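(* Let $\Sigma=\mathbb{R}^2/2\pi\mathbb{Z}^2$ be an oriented $2$-torus with a conformal structure and $g:\Sigma\to SU(2)$ a harmonic map, with energy $E$, which is not a holomorphic or antiholomorphic map to an equatorial $2$-sphere. Let $S$ be its spectral curve and $\mu_1,\mu_2$ the eigenvalue functions on $S\setminus\pi^{-1}\{0,\infty\}$ of the holonomies of the associated family of flat connections. Lift the arc $\{e^{i\theta}:0\le\theta\le\pi\}$ of the unit circle to $S$ and let $\log\mu_1,\log\mu_2$ be the continuous logarithms along this lift which vanish at $\theta=0$. Then the Wess-Zumino term of $g$ is, modulo $2\pi\mathbb{Z}$, $$\Gamma(g)=-\frac1\pi\int_0^\pi\log\mu_1\,(\log\mu_2)'\,d\theta-\frac1{32}E,$$ where $'$ denotes differentiation with respect to $\theta$.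
   Context: $B$ denotes the Killing form of $\mathfrak{su}(2)$, and $SU(2)=S^3$ has the bi-invariant metric defined by $-B$. The energy is $E=\frac12\int_\Sigma\|g^{-1}dg\|^2$ in this metric and the conformal structure on $\Sigma$; $g$ is harmonic if it is a critical point of $E$. Wess-Zumino term: let $\omega=g^{-1}dg$ be the Maurer-Cartan form on $SU(2)$ and $\Omega=cB(\omega,[\omega,\omega])$ with $c=-\frac1{96\pi}$ (where $d\omega+\frac12[\omega,\omega]=0$), a closed bi-invariant $3$-form whose class generates $H^3(SU(2),2\pi\mathbb{Z})$. If $M$ is a compact oriented $3$-manifold with boundary the oriented surface $\Sigma$ and $\tilde g:M\to SU(2)$ extends $g$, then $\Gamma(g)=\int_M\tilde g^*\Omega\in\mathbb{R}/2\pi\mathbb{Z}$, which is independent of the choice of extension. Associated family and spectral curve: put $\alpha=g^*\omega=\alpha^{1,0}+\alpha^{0,1}$, where $\ast\alpha^{1,0}=i\alpha^{1,0}$ and $\ast\alpha^{0,1}=-i\alpha^{0,1}$ for the Hodge star $\ast$ on $1$-forms. For $\zeta\in\mathbb{C}^*$, $d+A(\zeta)$ with $A(\zeta)=\frac12(1-\zeta)\alpha^{1,0}+\frac12(1-\zeta^{-1})\alpha^{0,1}$ is a flat $SL(2,\mathbb{C})$ connection on the torus, which is an $SU(2)$ connection when $|\zeta|=1$, with $A=0$ at $\zeta=1$ and $A=g^*\omega$ at $\zeta=-1$. Its holonomies along the two generators of $\pi_1(\Sigma)\cong\mathbb{Z}^2$ given by the standard coordinates $x_1,x_2$ of $\mathbb{R}^2/2\pi\mathbb{Z}^2$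 are commuting matrices $h_1(\zeta),h_2(\zeta)\in SL(2,\mathbb{C})$ with eigenvalues $(\mu_1,\mu_1^{-1})$, $(\mu_2,\mu_2^{-1})$, where $\mu_1,\mu_2$ correspond to a common eigenvector. For $g$ as in the claim, $\mu_1,\mu_2$ become single-valued holomorphic functions on $S\setminus\pi^{-1}\{0,\infty\}$, where the spectral curve $\pi:S\to\mathbb{CP}^1$ is a hyperelliptic curve $\eta^2=P(\zeta)$ of arithmetic genus $p$, with $P$ a section of $\mathcal{O}(2p+2)$ on $\mathbb{CP}^1$, real with respect to $\zeta\mapsto\bar\zeta^{-1}$, having no zeros on the unit circle and at most simple zeros at $\zeta=0,\infty$. The differentials $d\log\mu_1,d\log\mu_2$ extend to meromorphic differentials of the second kind on $S$, the involution $\sigma:\eta\mapsto-\eta$ satisfies $\mu_i\,\sigma^*\mu_i=1$, and $\mu_i=1$ at the points of $\pi^{-1}\{1,-1\}$. *)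

theory Defs
  imports "HOL-Complex_Analysis.Complex_Analysis"
    "HOL-Computational_Algebra.Polynomial"
begin

section \<open>Smooth maps\<close>

fun Ck_on :: "nat \<Rightarrow> 'a::real_normed_vector set \<Rightarrow> ('a \<Rightarrow> 'b::real_normed_vector) \<Rightarrow> bool" where
  "Ck_on 0 U f \<longleftrightarrow> continuous_on U f"
| "Ck_on (Suc k) U f \<longleftrightarrow> (\<forall>x\<in>U. f differentiable (at x)) \<and>
     (\<forall>v. Ck_on k U (\<lambda>x. frechet_derivative f (at x) v))"

text \<open>Meant for open \<open>U\<close> only.\<close>

definition smooth_on :: "'a::real_normed_vector set \<Rightarrow> ('a \<Rightarrow> 'b::real_normed_vector) \<Rightarrow> bool" where
  "smooth_on U f \<longleftrightarrow> (\<forall>k. Ck_on k U f)"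

text \<open>Smoothness on an arbitrary set, in the sense of local smooth extensions; this is the notion
  used up to the boundary of a half space.\<close>

definition locally_smooth_on :: "'a::real_normed_vector set \<Rightarrow> ('a \<Rightarrow> 'b::real_normed_vector) \<Rightarrow> bool" where
  "locally_smooth_on S f \<longleftrightarrow>
     (\<forall>y\<in>S. \<exists>W F. open W \<and> y \<in> W \<and> smooth_on W F \<and> (\<forall>z\<in>W \<inter> S. F z = f z))"


section \<open>The group \<open>SU(2)\<close>, its Killing form and the 3-form\<close>

definition conj_transpose :: "complex^2^2 \<Rightarrow> complex^2^2" where
  "conj_transpose X = (\<chi> i j. cnj (X $ j $ i))"

definition SU2 :: "(complex^2^2) set" where
  "SU2 = {q. q ** conj_transpose q = mat 1 \<and> det q = 1}"

definition commutator :: "complex^2^2 \<Rightarrow> complex^2^2 \<Rightarrow> complex^2^2" where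
  "commutator X Y = X ** Y - Y ** X"

definition su2_basis :: "(complex^2^2) set" where
  "su2_basis = {vector [vector [0, \<i>], vector [\<i>, 0]],
                vector [vector [0, 1], vector [-1, 0]],
                vector [vector [\<i>, 0], vector [0, -\<i>]]}"

text \<open>The trace of \<open>ad X \<circ> ad Y\<close> on the real Lie algebra \<open>su(2)\<close>, computed in the basis above, which
  is orthogonal for the Euclidean inner product.\<close>

definition killing :: "complex^2^2 \<Rightarrow> complex^2^2 \<Rightarrow> real" where
  "killing X Y = (\<Sum>e\<in>su2_basis. (commutator X (commutator Y e) \<bullet> e) / (e \<bullet> e))"

text \<open>The value of \<open>[\<omega>,\<omega>]\<close> on two tangent vectors on which \<open>\<omega>\<close> takes the values \<open>X\<close>, \<open>Y\<close>; the
  factor 2 is the convention for which \<open>d\<omega> + (1/2) [\<omega>,\<omega>] = 0\<close>.\<close>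

definition bracket_form :: "complex^2^2 \<Rightarrow> complex^2^2 \<Rightarrow> complex^2^2" where
  "bracket_form X Y = 2 *\<^sub>R commutator X Y"

text \<open>\<open>\<Omega> = c B(\<omega>,[\<omega>,\<omega>])\<close> at the point \<open>q\<close> on tangent vectors \<open>u\<close>, \<open>v\<close>, \<open>w\<close>. The product of a 1-form
  and a 2-form is the cyclic sum, without a factor 1/3; so \<open>\<Omega>\<close> has integral \<open>2\<pi>\<close>, up to sign.\<close>

definition Omega :: "complex^2^2 \<Rightarrow> complex^2^2 \<Rightarrow> complex^2^2 \<Rightarrow> complex^2^2 \<Rightarrow> real" where
  "Omega q u v w =
     (let X = matrix_inv q ** u; Y = matrix_inv q ** v; Z = matrix_inv q ** w in
      - (1 / (96 * pi)) *
        (killing X (bracket_form Y Z) + killing Y (bracket_form Z X) + killing Z (bracket_form X Y)))"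


section \<open>The torus, conformal structures and harmonic maps\<close>

text \<open>Functions on \<open>\<Sigma> = \<real>\<^sup>2/2\<pi>\<int>\<^sup>2\<close> are doubly periodic functions on the plane.\<close>

definition periodic :: "(real^2 \<Rightarrow> 'b) \<Rightarrow> bool" where
  "periodic f \<longleftrightarrow> (\<forall>x i. f (x + (2 * pi) *\<^sub>R axis i 1) = f x)"

text \<open>A conformal structure is given by a smooth Riemannian metric in its class. All that follows
  is unchanged when the metric is multiplied by a positive function.\<close>

definition torus_metric :: "(real^2 \<Rightarrow> real^2^2) \<Rightarrow> bool" where
  "torus_metric h \<longleftrightarrow> smooth_on UNIV h \<and> periodic h \<and>
     (\<forall>x. transpose (h x) = h x \<and> (\<forall>v. v \<noteq> 0 \<longrightarrow> v \<bullet> (h x *v v) > 0))"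

text \<open>\<open>\<Sigma>\<close> is oriented so that \<open>(\<partial>/\<partial>x\<^sub>2, \<partial>/\<partial>x\<^sub>1)\<close> is a positive frame: the formula for the
  Wess-Zumino term needs this order of the two generators. For the opposite orientation the sign
  of the integral of \<open>log \<mu>\<^sub>1 (log \<mu>\<^sub>2)'\<close> changes, as it does, modulo \<open>2\<pi>\<int>\<close>, on exchanging \<open>\<mu>\<^sub>1\<close>
  and \<open>\<mu>\<^sub>2\<close>. The next definition is the rotation by \<open>\<pi>/2\<close> in the tangent planes for this
  orientation. The Hodge star on 1-forms is composition with it, so that it is \<open>\<i>\<close> on forms of
  type (1,0); for the flat metric it maps \<open>dx\<^sub>1\<close> to \<open>dx\<^sub>2\<close>.\<close>

definition rotation :: "real^2^2 \<Rightarrow> real^2^2" where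
  "rotation H = (1 / sqrt (det H)) *\<^sub>R
     vector [vector [H $ 1 $ 2, H $ 2 $ 2], vector [- (H $ 1 $ 1), - (H $ 1 $ 2)]]"

definition hodge_star :: "real^2^2 \<Rightarrow> (real^2 \<Rightarrow> 'b) \<Rightarrow> (real^2 \<Rightarrow> 'b)" where
  "hodge_star H \<beta> = (\<lambda>v. \<beta> (rotation H *v v))"

definition torus_map :: "(real^2 \<Rightarrow> complex^2^2) \<Rightarrow> bool" where
  "torus_map g \<longleftrightarrow> smooth_on UNIV g \<and> periodic g \<and> range g \<subseteq> SU2"

text \<open>The form \<open>\<alpha> = g\<^sup>-\<^sup>1 dg\<close>.\<close>

definition mc_pullback :: "(real^2 \<Rightarrow> complex^2^2) \<Rightarrow> real^2 \<Rightarrow> real^2 \<Rightarrow> complex^2^2" where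
  "mc_pullback g x v = matrix_inv (g x) ** frechet_derivative g (at x) v"

definition energy :: "(real^2 \<Rightarrow> real^2^2) \<Rightarrow> (real^2 \<Rightarrow> complex^2^2) \<Rightarrow> real" where
  "energy h g = 1/2 * integral (cbox 0 (\<chi> i. 2 * pi)) (\<lambda>x. sqrt (det (h x)) *
     (\<Sum>i\<in>UNIV. \<Sum>j\<in>UNIV. matrix_inv (h x) $ i $ j *
        (- killing (mc_pullback g x (axis i 1)) (mc_pullback g x (axis j 1)))))"

definition harmonic_torus_map :: "(real^2 \<Rightarrow> real^2^2) \<Rightarrow> (real^2 \<Rightarrow> complex^2^2) \<Rightarrow> bool" where
  "harmonic_torus_map h g \<longleftrightarrow> torus_map g \<and>
     (\<forall>G :: real \<Rightarrow> real^2 \<Rightarrow> complex^2^2.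
        smooth_on UNIV (\<lambda>(t, x). G t x) \<and> (\<forall>t. torus_map (G t)) \<and> G 0 = g \<longrightarrow>
        ((\<lambda>t. energy h (G t)) has_real_derivative 0) (at 0))"

text \<open>The equatorial 2-sphere orthogonal to \<open>c \<in> SU(2)\<close>.\<close>

definition equator :: "complex^2^2 \<Rightarrow> (complex^2^2) set" where
  "equator c = {q \<in> SU2. q \<bullet> c = 0}"

text \<open>Left translation by \<open>c\<^sup>-\<^sup>1\<close> maps \<open>equator c\<close> to the sphere of imaginary unit quaternions, on
  which the rotation by \<open>\<pi>/2\<close> of the tangent plane at \<open>q\<close> is \<open>w \<mapsto> q w\<close>. Hence the complex
  structures on \<open>equator c\<close> are \<open>w \<mapsto> \<plusminus> q c\<^sup>-\<^sup>1 w\<close>.\<close>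

definition pm_holomorphic_to_equator ::
    "(real^2 \<Rightarrow> real^2^2) \<Rightarrow> (real^2 \<Rightarrow> complex^2^2) \<Rightarrow> complex^2^2 \<Rightarrow> bool" where
  "pm_holomorphic_to_equator h g c \<longleftrightarrow> range g \<subseteq> equator c \<and>
     (\<exists>s\<in>{1, -1::real}. \<forall>x v. frechet_derivative g (at x) (rotation (h x) *v v) =
        s *\<^sub>R (g x ** matrix_inv c ** frechet_derivative g (at x) v))"


section \<open>The associated family and the spectral curve\<close>

definition alpha10 :: "(real^2 \<Rightarrow> real^2^2) \<Rightarrow> (real^2 \<Rightarrow> complex^2^2) \<Rightarrow> real^2 \<Rightarrow> real^2 \<Rightarrow> complex^2^2" where
  "alpha10 h g x v = mat (1/2) ** (mc_pullback g x v - mat \<i> ** hodge_star (h x) (mc_pullback g x) v)"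

definition alpha01 :: "(real^2 \<Rightarrow> real^2^2) \<Rightarrow> (real^2 \<Rightarrow> complex^2^2) \<Rightarrow> real^2 \<Rightarrow> real^2 \<Rightarrow> complex^2^2" where
  "alpha01 h g x v = mat (1/2) ** (mc_pullback g x v + mat \<i> ** hodge_star (h x) (mc_pullback g x) v)"

definition assoc_family ::
    "(real^2 \<Rightarrow> real^2^2) \<Rightarrow> (real^2 \<Rightarrow> complex^2^2) \<Rightarrow> complex \<Rightarrow> real^2 \<Rightarrow> real^2 \<Rightarrow> complex^2^2" where
  "assoc_family h g \<zeta> x v =
     mat (1/2 * (1 - \<zeta>)) ** alpha10 h g x v + mat (1/2 * (1 - inverse \<zeta>)) ** alpha01 h g x v"

text \<open>\<open>H\<close> is the parallel transport of \<open>d + A\<close>, based at the origin, along the \<open>j\<close>-th coordinate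
  circle.\<close>

definition is_holonomy :: "(real^2 \<Rightarrow> real^2 \<Rightarrow> complex^2^2) \<Rightarrow> 2 \<Rightarrow> complex^2^2 \<Rightarrow> bool" where
  "is_holonomy A j H \<longleftrightarrow> (\<exists>F :: real \<Rightarrow> complex^2^2. F 0 = mat 1 \<and> F (2 * pi) = H \<and>
     (\<forall>t\<in>{0..2 * pi}. (F has_vector_derivative (- (A (t *\<^sub>R axis j 1) (axis j 1) ** F t)))
        (at t within {0..2 * pi})))"

text \<open>\<open>P\<close> as a section of \<open>O(2p+2)\<close> on the projective line, where \<open>n = p + 1\<close>: it is real for
  \<open>\<zeta> \<mapsto> 1/cnj \<zeta>\<close>, has at most simple zeros at \<open>0\<close> and \<open>\<infinity>\<close>, and none on the unit circle. The case
  \<open>n = 0\<close> occurs for maps to a geodesic, where the curve is a disjoint union of two lines.\<close>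

definition spectral_polynomial :: "nat \<Rightarrow> complex poly \<Rightarrow> bool" where
  "spectral_polynomial n P \<longleftrightarrow> P \<noteq> 0 \<and> degree P \<le> 2 * n \<and>
     (\<forall>k\<le>2 * n. coeff P (2 * n - k) = cnj (coeff P k)) \<and>
     order 0 P \<le> 1 \<and> 2 * n - degree P \<le> 1 \<and>
     (\<forall>\<zeta>. cmod \<zeta> = 1 \<longrightarrow> poly P \<zeta> \<noteq> 0)"

text \<open>The spectral curve \<open>\<eta>\<^sup>2 = P(\<zeta>)\<close> over the punctured plane is the curve of common eigenlines of
  the two holonomies. The eigenlines are those of a holomorphic family \<open>Q\<close> of nonzero trace-free
  matrices commuting with \<open>H\<^sub>1\<close>, \<open>H\<^sub>2\<close>, normalized by \<open>Q\<^sup>2 = P\<close>; the point \<open>(\<zeta>,\<eta>)\<close> corresponds to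
  the line \<open>ker (Q \<zeta> - \<eta>)\<close>. As \<open>Q\<close> has no zeros, the zeros of \<open>P\<close> are the points where the
  eigenlines, and not only the eigenvalues, come together, with multiplicity.\<close>

definition spectral_curve :: "(complex \<Rightarrow> complex^2^2) \<Rightarrow> (complex \<Rightarrow> complex^2^2) \<Rightarrow>
    complex poly \<Rightarrow> (complex \<Rightarrow> complex^2^2) \<Rightarrow> bool" where
  "spectral_curve H1 H2 P Q \<longleftrightarrow> (\<exists>n. spectral_polynomial n P) \<and>
     (\<forall>i j. (\<lambda>\<zeta>. Q \<zeta> $ i $ j) holomorphic_on (- {0})) \<and>
     (\<forall>\<zeta>. \<zeta> \<noteq> 0 \<longrightarrow> Q \<zeta> \<noteq> 0 \<and> trace (Q \<zeta>) = 0 \<and> Q \<zeta> ** Q \<zeta> = mat (poly P \<zeta>) \<and>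
        Q \<zeta> ** H1 \<zeta> = H1 \<zeta> ** Q \<zeta> \<and> Q \<zeta> ** H2 \<zeta> = H2 \<zeta> ** Q \<zeta>)"

definition curve_points :: "complex poly \<Rightarrow> (complex \<times> complex) set" where
  "curve_points P = {(\<zeta>, \<eta>). \<zeta> \<noteq> 0 \<and> \<eta>\<^sup>2 = poly P \<zeta>}"

text \<open>\<open>\<mu>\<close> is the eigenvalue of \<open>H\<close> on the eigenline that belongs to a point of the curve; using the
  same \<open>Q\<close> for both holonomies makes the eigenvector common.\<close>

definition eigenvalue_function :: "complex poly \<Rightarrow> (complex \<Rightarrow> complex^2^2) \<Rightarrow>
    (complex \<Rightarrow> complex^2^2) \<Rightarrow> (complex \<times> complex \<Rightarrow> complex) \<Rightarrow> bool" where
  "eigenvalue_function P Q H \<mu> \<longleftrightarrow> (\<forall>(\<zeta>, \<eta>)\<in>curve_points P. \<forall>v :: complex^2.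
     Q \<zeta> *v v = \<eta> *s v \<longrightarrow> H \<zeta> *v v = \<mu> (\<zeta>, \<eta>) *s v)"

text \<open>The continuous logarithm of \<open>\<mu>\<close> along the lift \<open>(e\<^sup>i\<^sup>\<theta>, \<eta> \<theta>)\<close> of the upper half circle,
  vanishing at \<open>\<theta> = 0\<close>.\<close>

definition log_along_lift :: "(complex \<times> complex \<Rightarrow> complex) \<Rightarrow> (real \<Rightarrow> complex) \<Rightarrow>
    (real \<Rightarrow> complex) \<Rightarrow> bool" where
  "log_along_lift \<mu> \<eta> l \<longleftrightarrow> continuous_on {0..pi} l \<and> l 0 = 0 \<and>
     (\<forall>\<theta>\<in>{0..pi}. exp (l \<theta>) = \<mu> (cis \<theta>, \<eta> \<theta>))"


section \<open>Oriented 3-manifolds with boundary and the Wess-Zumino integral\<close>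

text \<open>Charts take values in this half space, whose outward normal is the first basis vector. So
  the boundary orientation (outward normal first) is given by the second and third coordinates.\<close>

definition half_space :: "(real^3) set" where
  "half_space = {y. y $ 1 \<le> 0}"

type_synonym 'm chart = "'m set \<times> ('m \<Rightarrow> real^3)"

definition is_chart :: "'m::t2_space set \<Rightarrow> 'm chart \<Rightarrow> bool" where
  "is_chart M c \<longleftrightarrow> (case c of (U, \<phi>) \<Rightarrow>
     openin (top_of_set M) U \<and> openin (top_of_set half_space) (\<phi> ` U) \<and>
     homeomorphism U (\<phi> ` U) \<phi> (inv_into U \<phi>))"

text \<open>It suffices to test the sign of the Jacobian in the interior, since the transition maps are
  diffeomorphisms up to the boundary.\<close>

definition oriented_compatible :: "'m::t2_space chart \<Rightarrow> 'm chart \<Rightarrow> bool" where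
  "oriented_compatible c c' \<longleftrightarrow> (case (c, c') of ((U, \<phi>), (U', \<phi>')) \<Rightarrow>
     let T = \<phi>' \<circ> inv_into U \<phi>; D = \<phi> ` (U \<inter> U') in
     locally_smooth_on D T \<and>
     (\<forall>y\<in>D. y $ 1 < 0 \<longrightarrow> det (matrix (frechet_derivative T (at y))) > 0))"

text \<open>A compact manifold has a finite atlas.\<close>

definition compact_oriented_3manifold :: "'m::t2_space set \<Rightarrow> 'm chart list \<Rightarrow> bool" where
  "compact_oriented_3manifold M cs \<longleftrightarrow> compact M \<and> (\<Union>c\<in>set cs. fst c) = M \<and>
     (\<forall>c\<in>set cs. is_chart M c) \<and> (\<forall>c\<in>set cs. \<forall>c'\<in>set cs. oriented_compatible c c')"

definition manifold_boundary :: "'m::t2_space chart list \<Rightarrow> 'm set" where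
  "manifold_boundary cs = (\<Union>(U, \<phi>)\<in>set cs. {m\<in>U. \<phi> m $ 1 = 0})"

text \<open>\<open>\<iota>\<close> identifies \<open>\<Sigma>\<close> with the boundary of the manifold; the last condition says that it
  preserves orientation, \<open>\<Sigma>\<close> being oriented by the frame \<open>(\<partial>/\<partial>x\<^sub>2, \<partial>/\<partial>x\<^sub>1)\<close>.\<close>

definition boundary_torus :: "'m::t2_space chart list \<Rightarrow> (real^2 \<Rightarrow> 'm) \<Rightarrow> bool" where
  "boundary_torus cs \<iota> \<longleftrightarrow> continuous_on UNIV \<iota> \<and> range \<iota> = manifold_boundary cs \<and>
     (\<forall>x y. \<iota> x = \<iota> y \<longleftrightarrow> (\<forall>i. \<exists>k::int. x $ i - y $ i = 2 * pi * k)) \<and>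
     (\<forall>(U, \<phi>)\<in>set cs. smooth_on {x. \<iota> x \<in> U} (\<phi> \<circ> \<iota>) \<and>
        (\<forall>x. \<iota> x \<in> U \<longrightarrow>
           (let d1 = frechet_derivative (\<phi> \<circ> \<iota>) (at x) (axis 1 1);
                d2 = frechet_derivative (\<phi> \<circ> \<iota>) (at x) (axis 2 1)
            in d2 $ 2 * d1 $ 3 - d2 $ 3 * d1 $ 2 > 0)))"

definition smooth_extension :: "'m::t2_space set \<Rightarrow> 'm chart list \<Rightarrow> (real^2 \<Rightarrow> 'm) \<Rightarrow>
    (real^2 \<Rightarrow> complex^2^2) \<Rightarrow> ('m \<Rightarrow> complex^2^2) \<Rightarrow> bool" where
  "smooth_extension M cs \<iota> g gt \<longleftrightarrow> gt ` M \<subseteq> SU2 \<and>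
     (\<forall>(U, \<phi>)\<in>set cs. locally_smooth_on (\<phi> ` U) (gt \<circ> inv_into U \<phi>)) \<and>
     (\<forall>x. gt (\<iota> x) = g x)"

text \<open>The integral over the manifold of the pull-back of \<open>\<Omega>\<close>. The manifold is cut into the pieces
  that lie in the domain of one chart and not in that of an earlier one, and each piece is
  integrated in that chart.\<close>

definition wess_zumino_integral :: "'m::t2_space chart list \<Rightarrow> ('m \<Rightarrow> complex^2^2) \<Rightarrow> real" where
  "wess_zumino_integral cs gt = (\<Sum>i<length cs.
     (let U = fst (cs ! i); \<phi> = snd (cs ! i); F = gt \<circ> inv_into U \<phi> in
      integral (\<phi> ` (U - (\<Union>j<i. fst (cs ! j))))
        (\<lambda>y. Omega (F y) (frechet_derivative F (at y) (axis 1 1))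
               (frechet_derivative F (at y) (axis 2 1)) (frechet_derivative F (at y) (axis 3 1)))))"

end

theory Submission
 imports Defs
begin

text \<open>Parallel frames \<open>F(\<theta>, x)\<close> of the connections \<open>d + A(e\<^sup>i\<^sup>\<theta>)\<close> satisfy \<open>F = 1\<close> at \<open>\<theta> = 0\<close>
and \<open>F = g\<^sup>-\<^sup>1 g(0)\<close> at \<open>\<theta> = \<pi>\<close>; translation by a period multiplies them by the holonomies
\<open>exp(L\<^sub>j(\<theta>) n(\<theta>))\<close>, where \<open>log \<mu>\<^sub>j = i L\<^sub>j\<close> and the unit vector \<open>n\<close> in \<open>su(2)\<close> has the common
eigenlines of the holonomies. Undoing the holonomies by \<open>exp(- (L\<^sub>1 x\<^sub>1 + L\<^sub>2 x\<^sub>2) n / 2\<pi>)\<close>, up to integers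
that make the exponent vanish at \<open>\<theta> = \<pi>\<close>, gives a map \<open>G\<close> of \<open>[0,\<pi>] \<times> T\<^sup>2\<close> to \<open>SU(2)\<close> that is \<open>g\<close>
at one end and has values in a circle at the other. By flatness the integral of \<open>G\<^sup>*\<Omega>\<close> reduces
to the two terms \<open>\<integral> L\<^sub>1 dL\<^sub>2\<close> and \<open>E / 32\<close>.

To compare it with the integral over \<open>M\<close>, \<open>\<Omega>\<close> is written as \<open>\<plusminus>d\<beta>\<close> on \<open>SU(2) - {-1}\<close>.
For almost every translate of the map, \<open>-1\<close> is a regular value avoided on the boundary; cutting \<open>\<beta>\<close> off
near \<open>-1\<close> and applying Stokes leaves \<open>2\<pi>\<close> for every preimage of \<open>-1\<close>, counted with sign. So both
integrals are congruent to boundary integrals of \<open>\<beta>\<close>, which agree for a common translate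
because \<open>\<beta>\<close> vanishes on circles.\<close>

text \<open>\<open>Omega\<close> is closed but not exact, so boundary data determine either integral
  only modulo 2 pi. Gluing \<open>M\<close> to the cylinder would call for collars and a new atlas;
  instead each integral is brought separately to the same boundary expression. Forms are handled
  through functions: the 2-forms in use are sums of a db^dc, and the density of da^db^dc is the
  Jacobian \<open>jac a b c\<close>. Only the first factor is cut off or localized, and Stokes asks
  no more of it than C^1; hence the linear continuation of k below \<open>w0\<close> and bumps of
  class C^1 are good enough. Constants: \<open>Omega\<close> is 1/pi times the volume form of the
  unit 3-sphere, whose volume is 2 pi^2. The 1/32 is (pi/4)(1/4)/(2 pi): the primitive (sin theta -
  theta)/4 of the energy term is -pi/4 at theta = pi, \<open>energy\<close> is 4 times the integral
  of the density, and \<open>Omega\<close> is 1/(2 pi) times the triple product. The integers that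
  make the exponent vanish at theta = pi enter the result only through 2 pi times their
  product.\<close>

abbreviation fd :: "('a::real_normed_vector => 'b::real_normed_vector) => 'a => 'a => 'b" where
 "fd f x == frechet_derivative f (at x)"
abbreviation jdet :: "(real^'n => real^'n) => real^'n => real" where "jdet f x == det (matrix (fd f x))"
abbreviation smooth :: "('a::real_normed_vector => 'b::real_normed_vector) => bool" where "smooth == smooth_on UNIV"
abbreviation ct :: "complex^2^2 => complex^2^2" where "ct == conj_transpose"
abbreviation shift :: "'n => real^'n" where "shift i == (2 * pi) *\<^sub>R axis i 1"

section \<open>Functions of class \<open>C\<^sup>k\<close>\<close>

lemma Ck_on_cong:
 assumes "open U" "!!x. x : U ==> f x = g x"
 shows "Ck_on k U f \<longleftrightarrow> Ck_on k U g"
 using assms(2)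
proof (induction k arbitrary: f g)
 case 0
 thus ?case by (simp cong: continuous_on_cong)
next
 case (Suc k)
 have d: "f differentiable (at x) \<longleftrightarrow> g differentiable (at x)" if "x : U" for x
  using has_derivative_transform_within_open[OF _ assms(1) that] Suc.prems
  unfolding differentiable_def by metis
 have e: "fd f x v = fd g x v"
  if "x : U" "f differentiable (at x)" for x v
  using frechet_derivative_transform_within_open[OF that(2) assms(1) that(1)] Suc.prems by metis
 show ?case
  by (simp add: d cong: ball_cong)
   (metis (no_types, lifting) Suc.IH d e)
qed

lemma Ck_on_SucI:
 assumes "open U" "!!x. x : U ==> (f has_derivative f' x) (at x)"
  and "!!v. Ck_on k U (%x. f' x v)"
 shows "Ck_on (Suc k) U f"
proof -
 have "fd f x = f' x" if "x : U" for x
  using frechet_derivative_at[OF assms(2)[OF that]] by simp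
 hence "Ck_on k U (%x. fd f x v)" for v
  using assms(3)[of v] Ck_on_cong[OF assms(1), of "%x. fd f x v" "%x. f' x v"] by simp
 thus ?thesis using assms(2) by (auto simp: differentiable_def)
qed

lemma Ck_on_SucD:
 assumes "Ck_on (Suc k) U f"
 shows "x : U ==> (f has_derivative fd f x) (at x)"
  and "Ck_on k U (%x. fd f x v)"
 using assms by (auto simp: frechet_derivative_works)

lemma Ck_on_Suc_imp: "Ck_on (Suc k) U f ==> Ck_on k U f"
proof (induction k arbitrary: f)
 case 0
 thus ?case
  by (auto intro!: continuous_at_imp_continuous_on differentiable_imp_continuous_within)
next
 case (Suc k)
 thus ?case by (metis Ck_on.simps(2))
qed

lemma Ck_on_le: "m <= k ==> Ck_on k U f ==> Ck_on m U f"
 by (induction k) (auto simp: le_Suc_eq simp del: Ck_on.simps dest: Ck_on_Suc_imp)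

lemma Ck_on_continuous: "Ck_on k U f ==> continuous_on U f"
 using Ck_on_le[of 0 k U f] by simp

lemma Ck_on_subset: "Ck_on k U f ==> V <= U ==> Ck_on k V f"
 by (induction k arbitrary: f) (auto intro: continuous_on_subset)

lemma Ck_on_open_UN:
 assumes "!!x. x : U ==> EX W. open W & x : W & Ck_on k W f"
 shows "Ck_on k U f"
 using assms
proof (induction k arbitrary: f)
 case 0
 hence "isCont f x" if "x : U" for x
  using that by (metis Ck_on.simps(1) continuous_on_eq_continuous_at)
 thus ?case by (simp add: continuous_at_imp_continuous_on)
next
 case (Suc k)
 have "EX W. open W & x : W & Ck_on k W (%x. fd f x v)" if "x : U" for x v
  using Suc.prems[OF that] by auto
 hence "Ck_on k U (%x. fd f x v)" for v using Suc.IH by blast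
 moreover have "f differentiable (at x)" if "x : U" for x using Suc.prems[OF that] by auto
 ultimately show ?case by simp
qed

lemma Ck_on_const [intro]: "Ck_on k U (%x. c)"
proof (induction k arbitrary: c)
 case (Suc k)
 thus ?case by simp
qed simp

lemma Ck_on_linear: "open U ==> bounded_linear f ==> Ck_on k U f"
proof (cases k)
 case 0
 thus "bounded_linear f ==> Ck_on k U f" by (simp add: linear_continuous_on)
next
 case (Suc m)
 assume "open U" "bounded_linear f"
 thus ?thesis unfolding Suc
  by (intro Ck_on_SucI[where f' = "%x. f"]) (auto intro: bounded_linear_imp_has_derivative)
qed

lemma Ck_on_compose_linear:
 assumes "open U" "bounded_linear L" "Ck_on k U f"
 shows "Ck_on k U (%x. L (f x))"
 using assms(3)
proof (induction k arbitrary: f)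
 case 0
 thus ?case using linear_continuous_on_compose assms(2)
  by (simp add: bounded_linear.continuous_on)
next
 case (Suc k)
 show ?case
  by (rule Ck_on_SucI[OF assms(1), where f' = "%x v. L (fd f x v)"])
   (auto intro: Suc.IH Ck_on_SucD[OF Suc.prems] bounded_linear.has_derivative[OF assms(2)])
qed

lemma Ck_on_add:
 assumes "open U" "Ck_on k U f" "Ck_on k U g"
 shows "Ck_on k U (%x. f x + g x)"
 using assms(2,3)
proof (induction k arbitrary: f g)
 case 0
 thus ?case by (simp add: continuous_on_add)
next
 case (Suc k)
 show ?case
  by (rule Ck_on_SucI[OF assms(1), where
     f' = "%x v. fd f x v + fd g x v"])
   (auto intro!: Suc.IH Ck_on_SucD[OF Suc.prems(1)] Ck_on_SucD[OF Suc.prems(2)] has_derivative_add)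
qed

lemma Ck_on_bilinear:
 assumes "open U" "bounded_bilinear B" "Ck_on k U f" "Ck_on k U g"
 shows "Ck_on k U (%x. B (f x) (g x))"
 using assms(3,4)
proof (induction k arbitrary: f g)
 case 0
 thus ?case using bounded_bilinear.continuous_on[OF assms(2)] by simp
next
 case (Suc k)
 show ?case
  by (rule Ck_on_SucI[OF assms(1), where
     f' = "%x v. B (f x) (fd g x v) + B (fd f x v) (g x)"])
   (auto intro!: Suc.IH Ck_on_add assms(1) Ck_on_SucD[OF Suc.prems(1)] Ck_on_SucD[OF Suc.prems(2)]
     Ck_on_Suc_imp[OF Suc.prems(1)] Ck_on_Suc_imp[OF Suc.prems(2)] bounded_bilinear.FDERIV[OF assms(2)])
qed

lemma Ck_on_uminus: "open U ==> Ck_on k U f ==> Ck_on k U (%x. - f x)"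
 by (rule Ck_on_compose_linear[OF _ bounded_linear_minus[OF bounded_linear_ident]])

lemma Ck_on_diff: "open U ==> Ck_on k U f ==> Ck_on k U g ==> Ck_on k U (%x. f x - g x)"
 using Ck_on_add[OF _ _ Ck_on_uminus, of U k f g] by simp

lemma Ck_on_sum:
 assumes "open U" "!!i. i : I ==> Ck_on k U (f i)"
 shows "Ck_on k U (%x. SUM i:I. f i x)"
 using assms(2)
 by (induction I rule: infinite_finite_induct) (auto intro!: Ck_on_add assms(1))

lemma Ck_on_mult:
 fixes f g :: "_ => 'a::real_normed_algebra"
 shows "open U ==> Ck_on k U f ==> Ck_on k U g ==> Ck_on k U (%x. f x * g x)"
 by (rule Ck_on_bilinear[OF _ bounded_bilinear_mult])

lemma Ck_on_scaleR: "open U ==> Ck_on k U f ==> Ck_on k U g ==> Ck_on k U (%x. f x *\<^sub>R g x)"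
 by (rule Ck_on_bilinear[OF _ bounded_bilinear_scaleR])

lemma Ck_on_vec_nth: "open U ==> Ck_on k U f ==> Ck_on k U (%x. f x $ i)"
 by (rule Ck_on_compose_linear[OF _ bounded_linear_vec_nth])

lemma Ck_on_compose:
 fixes f :: "'a::real_normed_vector => 'b::euclidean_space" and g :: "'b => 'c::real_normed_vector"
 assumes "open U" "Ck_on k U f" "Ck_on k V g" "f ` U <= V"
 shows "Ck_on k U (%x. g (f x))"
 using assms(2-4)
proof (induction k arbitrary: f g)
 case 0
 thus ?case using continuous_on_compose2 by auto
next
 case (Suc k)
 let ?f' = "%x v. SUM b:Basis. (fd f x v \<bullet> b) *\<^sub>R fd g (f x) b"
 have eq: "?f' x v = fd g (f x) (fd f x v)" if "x : U" for x v
 proof -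
  have "bounded_linear (fd g (f x))"
   using has_derivative_bounded_linear[OF Ck_on_SucD(1)[OF Suc.prems(2)]] Suc.prems(3) that by blast
  hence "linear (fd g (f x))" by (rule bounded_linear.linear)
  hence "fd g (f x) (SUM b:Basis. (w \<bullet> b) *\<^sub>R b)
    = (SUM b:Basis. (w \<bullet> b) *\<^sub>R fd g (f x) b)" for w
   using linear_sum[of "fd g (f x)" "%b. (w \<bullet> b) *\<^sub>R b" Basis]
   by (simp add: linear_scale)
  from this[of "fd f x v"] show ?thesis
   unfolding euclidean_representation by (rule sym)
 qed
 show ?case
 proof (rule Ck_on_SucI[OF assms(1), where f' = ?f'])
  fix x assume "x : U"
  thus "((%x. g (f x)) has_derivative ?f' x) (at x)"
   using diff_chain_at[OF Ck_on_SucD(1)[OF Suc.prems(1)] Ck_on_SucD(1)[OF Suc.prems(2)]] Suc.prems(3)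
   unfolding eq[OF \<open>x : U\<close>] by (auto simp: o_def image_subset_iff)
 next
  fix v
  have "Ck_on k U (%x. fd g (f x) b)" for b
   by (rule Suc.IH[OF Ck_on_Suc_imp[OF Suc.prems(1)] Ck_on_SucD(2)[OF Suc.prems(2)] Suc.prems(3)])
  moreover have "Ck_on k U (%x. fd f x v \<bullet> b)" for b
   by (rule Ck_on_compose_linear[OF assms(1) _ Ck_on_SucD(2)[OF Suc.prems(1)]])
    (rule bounded_linear_inner_left)
  ultimately show "Ck_on k U (%x. ?f' x v)"
   by (intro Ck_on_sum Ck_on_scaleR assms(1)) auto
 qed
qed

lemma Ck_on_euclidean_componentwise:
 fixes f :: "'a::real_normed_vector => 'b::euclidean_space"
 assumes "open U" "!!b. b : Basis ==> Ck_on k U (%x. f x \<bullet> b)"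
 shows "Ck_on k U f"
proof -
 have "Ck_on k U (%x. SUM b:Basis. (f x \<bullet> b) *\<^sub>R b)"
  by (intro Ck_on_sum Ck_on_scaleR assms Ck_on_const)
 thus ?thesis by (simp add: euclidean_representation)
qed

lemma Ck_on_vec:
 fixes f :: "'a::real_normed_vector => ('b::euclidean_space)^'n"
 assumes "open U" "!!i. Ck_on k U (%x. f x $ i)"
 shows "Ck_on k U f"
proof (rule Ck_on_euclidean_componentwise[OF assms(1)])
 fix b :: "'b^'n" assume "b : Basis"
 then obtain i u where b: "b = axis i u" by (auto simp: Basis_vec_def)
 show "Ck_on k U (%x. f x \<bullet> b)" unfolding b inner_axis
  by (rule Ck_on_compose_linear[OF assms(1) bounded_linear_inner_left assms(2)])
qed

lemma Ck_on_field_derivI: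
 fixes f :: "'a::real_normed_field => 'a"
 assumes "open U" "!!x. x : U ==> (f has_field_derivative f' x) (at x)" "Ck_on k U f'"
 shows "Ck_on (Suc k) U f"
 by (rule Ck_on_SucI[OF assms(1), where f' = "%x v. f' x * v"])
  (use assms in \<open>auto simp: has_field_derivative_def intro!: Ck_on_mult\<close>)

lemma Ck_on_exp: "Ck_on k UNIV (exp :: 'a => 'a::{real_normed_field,banach})"
proof (induction k)
 case (Suc k)
 thus ?case by (intro Ck_on_field_derivI[where f' = exp] open_UNIV DERIV_exp)
qed (simp add: continuous_on_exp)

lemma Ck_on_sin_cos: "Ck_on k UNIV (sin :: real => real) & Ck_on k UNIV (cos :: real => real)"
proof (induction k)
 case 0
 thus ?case by (auto intro!: continuous_intros)
next
 case (Suc k)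
 thus ?case
  by (intro conjI Ck_on_field_derivI[where f' = cos] Ck_on_field_derivI[where f' = "%x. - sin x"] Ck_on_uminus
    open_UNIV DERIV_sin DERIV_cos) auto
qed

lemma Ck_on_powr: "Ck_on k {0<..} (%x::real. x powr a)"
proof (induction k arbitrary: a)
 case 0
 thus ?case by (auto intro!: continuous_intros)
next
 case (Suc k)
 have "Ck_on k {0<..} (%x. a * x powr (a - 1))" for a :: real
  by (intro Ck_on_mult open_greaterThan Ck_on_const Suc)
 thus ?case
  by (intro Ck_on_field_derivI[where f' = "%x. a * x powr (a - 1)"] open_greaterThan
    has_real_derivative_powr) auto
qed

lemma smooth_on_Ck: "smooth_on U f ==> Ck_on k U f"
 by (simp add: smooth_on_def)

text \<open>In finite dimension, continuity in every direction is continuity in the operator norm,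
  the form of C^1 that the inverse function theorem takes.\<close>

lemma Ck_on_blinfun_continuous:
 fixes f :: "'a::euclidean_space => 'b::real_normed_vector"
 assumes "Ck_on (Suc k) U f"
 shows "continuous_on U (%x. Blinfun (fd f x))"
proof (rule continuous_on_blinfun_componentwise)
 fix b :: 'a
 have "continuous_on U (%x. fd f x b)"
  using Ck_on_SucD(2)[OF assms] Ck_on_continuous by blast
 moreover have "blinfun_apply (Blinfun (fd f x)) = fd f x" if "x : U" for x
  using Ck_on_SucD(1)[OF assms that] has_derivative_bounded_linear bounded_linear_Blinfun_apply by blast
 ultimately show "continuous_on U (%x. blinfun_apply (Blinfun (fd f x)) b)"
  by (simp cong: continuous_on_cong)
qed

subsection \<open>Symmetry of second derivatives\<close>

lemma directional_derivative:
 assumes "(f has_derivative f') (at (x + t *\<^sub>R v))"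
 shows "((%t. f (x + t *\<^sub>R v)) has_vector_derivative f' v) (at t)"
proof -
 have "((%t. f (x + t *\<^sub>R v)) has_derivative (%s. f' (s *\<^sub>R v))) (at t)"
  using has_derivative_compose[of "%t. x + t *\<^sub>R v" "%s. s *\<^sub>R v" t UNIV f f'] assms
  by (force intro!: derivative_eq_intros)
 thus ?thesis
  using bounded_linear.linear[OF has_derivative_bounded_linear[OF assms]]
  by (simp add: has_vector_derivative_def linear_scale)
qed

text \<open>The mean value theorem twice: along \<open>v\<close> for the difference in
  \<open>w\<close>, then along \<open>w\<close> for the derivative in the direction
  \<open>v\<close>.\<close>

lemma second_difference_MVT:
 fixes f :: "'a::real_normed_vector => real"
 assumes "Ck_on 2 U f" "e > 0"
  and U: "!!s t. 0 <= s ==> s <= e ==> 0 <= t ==> t <= e ==> x + s *\<^sub>R v + t *\<^sub>R w : U"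
 obtains s t where "0 < s" "s < e" "0 < t" "t < e"
  "f (x + e *\<^sub>R v + e *\<^sub>R w) - f (x + e *\<^sub>R v) - f (x + e *\<^sub>R w) + f x =
   e\<^sup>2 * fd (%x. fd f x v) (x + s *\<^sub>R v + t *\<^sub>R w) w"
proof -
 have C: "Ck_on (Suc (Suc 0)) U f" using assms(1) by (simp add: numeral_2_eq_2)
 have d1: "((%s. f (y + s *\<^sub>R v)) has_vector_derivative fd f (y + s *\<^sub>R v) v) (at s)"
  if "y + s *\<^sub>R v : U" for y s
  by (rule directional_derivative[OF Ck_on_SucD(1)[OF C that]])
 have "EX s. 0 < s & s < e & (f (x + e *\<^sub>R v + e *\<^sub>R w) - f (x + e *\<^sub>R v)) - (f (x + 0 *\<^sub>R v + e *\<^sub>R w) - f (x + 0 *\<^sub>R v)) =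
   (e - 0) * (fd f (x + s *\<^sub>R v + e *\<^sub>R w) v - fd f (x + s *\<^sub>R v) v)"
  using d1[of "x + e *\<^sub>R w"] d1[of x] U[of _ e] U[of _ 0] \<open>e > 0\<close>
  by (intro MVT2[where f = "%s. f (x + s *\<^sub>R v + e *\<^sub>R w) - f (x + s *\<^sub>R v)"])
    (auto simp: has_real_derivative_iff_has_vector_derivative add_ac intro!: derivative_eq_intros)
 then obtain s where s: "0 < s" "s < e" "(f (x + e *\<^sub>R v + e *\<^sub>R w) - f (x + e *\<^sub>R v)) - (f (x + e *\<^sub>R w) - f x) =
   e * (fd f (x + s *\<^sub>R v + e *\<^sub>R w) v - fd f (x + s *\<^sub>R v) v)"
  by auto
 let ?g = "%x. fd f x v"
 have "EX t. 0 < t & t < e & ?g (x + s *\<^sub>R v + e *\<^sub>R w) - ?g (x + s *\<^sub>R v + 0 *\<^sub>R w) =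
   (e - 0) * fd ?g (x + s *\<^sub>R v + t *\<^sub>R w) w"
  using directional_derivative[OF Ck_on_SucD(1)[OF Ck_on_SucD(2)[OF C]], of "x + s *\<^sub>R v" _ w v] U[of s] s \<open>e > 0\<close>
  by (intro MVT2) (auto simp: has_real_derivative_iff_has_vector_derivative)
 then obtain t where "0 < t" "t < e" "?g (x + s *\<^sub>R v + e *\<^sub>R w) - ?g (x + s *\<^sub>R v) =
   e * fd ?g (x + s *\<^sub>R v + t *\<^sub>R w) w" by auto
 with s show ?thesis
  by (intro that[of s t]) (auto simp: power2_eq_square)
qed

text \<open>The second difference over a parallelogram is symmetric in its two sides, and it is e^2
  times either mixed derivative at some nearby point. If the two mixed derivatives differed at x,
  continuity would keep them apart near x.\<close>

lemma second_derivative_symmetric_real: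
 fixes f :: "'a::real_normed_vector => real"
 assumes "open U" "Ck_on 2 U f" "x : U"
 shows "fd (%x. fd f x v) x w =
     fd (%x. fd f x w) x v"
proof (rule ccontr)
 define p where "p v w y = fd (%x. fd f x v) y w" for v w y
 assume "~ ?thesis"
 hence ne: "p v w x ~= p w v x" by (simp add: p_def)
 have C: "Ck_on (Suc (Suc 0)) U f" using assms(2) by (simp add: numeral_2_eq_2)
 have "continuous_on U (p v w)" for v w
  using Ck_on_SucD(2)[OF Ck_on_SucD(2)[OF C]] unfolding p_def by (metis Ck_on.simps(1))
 hence cont: "isCont (p v w) x" for v w
  using assms by (simp add: continuous_on_eq_continuous_at)
 define r where "r = dist (p v w x) (p w v x) / 2"
 have "r > 0" using ne by (simp add: r_def)
 then obtain d1 where d1: "d1 > 0" "!!y. dist y x < d1 ==> dist (p v w y) (p v w x) < r"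
  using cont[of v w] unfolding continuous_at_eps_delta by (metis dist_norm)
 obtain d2 where d2: "d2 > 0" "!!y. dist y x < d2 ==> dist (p w v y) (p w v x) < r"
  using cont[of w v] \<open>r > 0\<close> unfolding continuous_at_eps_delta by (metis dist_norm)
 obtain d3 where d3: "d3 > 0" "ball x d3 <= U" using assms open_contains_ball by blast
 define d where "d = min d1 (min d2 d3)"
 define S where "S = norm v + norm w + 1"
 define e where "e = d / (2 * S)"
 have "d > 0" using d1 d2 d3 by (simp add: d_def)
 have nn: "S > 0" unfolding S_def by (smt (verit) norm_ge_zero)
 hence "e > 0" using \<open>d > 0\<close> by (simp add: e_def)
 have small: "dist (x + (s *\<^sub>R v + t *\<^sub>R w)) x < d" if "0 <= s" "s <= e" "0 <= t" "t <= e" for s t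
 proof -
  have "norm (s *\<^sub>R v + t *\<^sub>R w) <= s * norm v + t * norm w"
   using norm_triangle_ineq[of "s *\<^sub>R v" "t *\<^sub>R w"] that by simp
  also have "... <= e * norm v + e * norm w" using that by (intro add_mono mult_right_mono) auto
  also have "... <= e * S" using \<open>e > 0\<close> by (simp add: S_def algebra_simps)
  also have "... = d / 2" using nn by (simp add: e_def)
  finally show ?thesis using \<open>d > 0\<close> by (simp add: dist_norm)
 qed
 have inU: "x + s *\<^sub>R v + t *\<^sub>R w : U" if "0 <= s" "s <= e" "0 <= t" "t <= e" for s t
  using small[OF that] d3(2) by (auto simp: d_def dist_commute add.assoc)
 hence inU': "x + t *\<^sub>R w + s *\<^sub>R v : U" if "0 <= s" "s <= e" "0 <= t" "t <= e" for s t
  using that by (simp add: add_ac)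
 obtain s t where st: "0 < s" "s < e" "0 < t" "t < e"
  "f (x + e *\<^sub>R v + e *\<^sub>R w) - f (x + e *\<^sub>R v) - f (x + e *\<^sub>R w) + f x = e\<^sup>2 * p v w (x + s *\<^sub>R v + t *\<^sub>R w)"
  using second_difference_MVT[OF assms(2) \<open>e > 0\<close>, of x v w] inU unfolding p_def by metis
 obtain s' t' where st': "0 < s'" "s' < e" "0 < t'" "t' < e"
  "f (x + e *\<^sub>R w + e *\<^sub>R v) - f (x + e *\<^sub>R w) - f (x + e *\<^sub>R v) + f x = e\<^sup>2 * p w v (x + s' *\<^sub>R w + t' *\<^sub>R v)"
  using second_difference_MVT[OF assms(2) \<open>e > 0\<close>, of x w v] inU' unfolding p_def by metis
 have "f (x + e *\<^sub>R w + e *\<^sub>R v) = f (x + e *\<^sub>R v + e *\<^sub>R w)" by (simp add: add_ac)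
 hence "e\<^sup>2 * p v w (x + s *\<^sub>R v + t *\<^sub>R w) = e\<^sup>2 * p w v (x + s' *\<^sub>R w + t' *\<^sub>R v)"
  using st(5) st'(5) by linarith
 hence "p v w (x + s *\<^sub>R v + t *\<^sub>R w) = p w v (x + s' *\<^sub>R w + t' *\<^sub>R v)" using \<open>e > 0\<close> by simp
 moreover have "dist (p v w (x + s *\<^sub>R v + t *\<^sub>R w)) (p v w x) < r"
  using small[of s t] st by (intro d1) (auto simp: d_def add_ac)
 moreover have "dist (p w v (x + s' *\<^sub>R w + t' *\<^sub>R v)) (p w v x) < r"
  using small[of t' s'] st' by (intro d2) (auto simp: d_def add_ac)
 ultimately show False unfolding r_def by (smt (verit) dist_commute dist_triangle field_sum_of_halves)
qed

lemma second_derivative_symmetric: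
 fixes f :: "'a::real_normed_vector => 'b::euclidean_space"
 assumes "open U" "Ck_on 2 U f" "x : U"
 shows "fd (%x. fd f x v) x w =
     fd (%x. fd f x w) x v"
proof (rule euclidean_eqI)
 fix b :: 'b assume "b : Basis"
 have C: "Ck_on (Suc (Suc 0)) U f" using assms(2) by (simp add: numeral_2_eq_2)
 have bl: "bounded_linear (%y::'b. y \<bullet> b)" by (rule bounded_linear_inner_left)
 have 1: "fd (%x. f x \<bullet> b) y v = fd f y v \<bullet> b" if "y : U" for y v
  using frechet_derivative_at[OF bounded_linear.has_derivative[OF bl Ck_on_SucD(1)[OF C that]]] by metis
 have 2: "fd (%y. fd (%x. f x \<bullet> b) y v) x w
   = fd (%y. fd f y v) x w \<bullet> b" for v w
 proof -
  have "((%y. fd f y v \<bullet> b) has_derivative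
    (%w. fd (%y. fd f y v) x w \<bullet> b)) (at x)"
   by (rule bounded_linear.has_derivative[OF bl Ck_on_SucD(1)[OF Ck_on_SucD(2)[OF C] assms(3)]])
  hence "((%y. fd (%x. f x \<bullet> b) y v) has_derivative
    (%w. fd (%y. fd f y v) x w \<bullet> b)) (at x)"
   by (rule has_derivative_transform_within_open[OF _ assms(1,3)]) (simp add: 1)
  from fun_cong[OF frechet_derivative_at[OF this], of w] show ?thesis by (rule sym)
 qed
 have "Ck_on 2 U (%x. f x \<bullet> b)" by (rule Ck_on_compose_linear[OF assms(1) bl assms(2)])
 from second_derivative_symmetric_real[OF assms(1) this assms(3), of v w]
 show "fd (%x. fd f x v) x w \<bullet> b =
     fd (%x. fd f x w) x v \<bullet> b"
  by (simp add: 2)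
qed

no_notation fps_nth (infixl \<open>$\<close> 75)

section \<open>Quaternion coordinates\<close>

definition qw :: "complex^2^2 => real" where "qw q = Re (q $ 1 $ 1)"
definition qx :: "complex^2^2 => real" where "qx q = Re (q $ 1 $ 2)"
definition qy :: "complex^2^2 => real" where "qy q = Im (q $ 1 $ 2)"
definition qz :: "complex^2^2 => real" where "qz q = Im (q $ 1 $ 1)"

lemmas q_defs = qw_def qx_def qy_def qz_def

definition quat :: "real => real => real => real => complex^2^2" where
 "quat w x y z = vector [vector [Complex w z, Complex x y], vector [Complex (- x) y, Complex w (- z)]]"

lemma quat_coords [simp]:
 "qw (quat w x y z) = w" "qx (quat w x y z) = x" "qy (quat w x y z) = y" "qz (quat w x y z) = z"
 by (simp_all add: q_defs quat_def)

text \<open>The real span of SU(2), a copy of Hamilton's quaternions. Being linear, it also contains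
  the derivatives of maps into SU(2).\<close>

definition quats :: "(complex^2^2) set" where
 "quats = {q. q $ 2 $ 2 = cnj (q $ 1 $ 1) & q $ 2 $ 1 = - cnj (q $ 1 $ 2)}"

lemma vec2_eq_iff: "(X :: 'a^2^2) = Y \<longleftrightarrow> X $ 1 $ 1 = Y $ 1 $ 1 & X $ 1 $ 2 = Y $ 1 $ 2 &
  X $ 2 $ 1 = Y $ 2 $ 1 & X $ 2 $ 2 = Y $ 2 $ 2"
 by (auto simp: vec_eq_iff forall_2)

lemma mat2_mult_nth: "((X :: 'a::semiring_1^2^2) ** Y) $ i $ j = X $ i $ 1 * Y $ 1 $ j + X $ i $ 2 * Y $ 2 $ j"
 by (simp add: matrix_matrix_mult_def sum_2)

lemma mat2_nth: "(mat c :: 'a::zero^2^2) $ 1 $ 1 = c" "(mat c :: 'a^2^2) $ 1 $ 2 = 0"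
  "(mat c :: 'a^2^2) $ 2 $ 1 = 0" "(mat c :: 'a^2^2) $ 2 $ 2 = c"
 by (simp_all add: mat_def)

lemma quat_in_quats [simp]: "quat w x y z : quats"
 by (simp add: quats_def quat_def complex_eq_iff)

lemma quats_eq: "q : quats ==> q = quat (qw q) (qx q) (qy q) (qz q)"
 by (auto simp: vec2_eq_iff q_defs quat_def quats_def complex_eq_iff)

lemma quat_eq_iff: "p : quats ==> q : quats ==>
  p = q \<longleftrightarrow> qw p = qw q & qx p = qx q & qy p = qy q & qz p = qz q"
 using quats_eq by metis

lemma quat_mult: "quat w x y z ** quat w' x' y' z' =
  quat (w*w' - x*x' - y*y' - z*z') (w*x' + x*w' + y*z' - z*y') (w*y' + y*w' + z*x' - x*z')
    (w*z' + z*w' + x*y' - y*x')"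
 by (simp add: vec2_eq_iff mat2_mult_nth quat_def complex_eq_iff algebra_simps)

lemma conj_transpose_quat: "ct (quat w x y z) = quat w (-x) (-y) (-z)"
 by (simp add: vec2_eq_iff conj_transpose_def quat_def complex_eq_iff)

lemma quat_1: "mat 1 = quat 1 0 0 0"
 by (simp add: vec2_eq_iff mat2_nth quat_def complex_eq_iff)

lemma SU2_iff: "q : SU2 \<longleftrightarrow> q : quats & (qw q)\<^sup>2 + (qx q)\<^sup>2 + (qy q)\<^sup>2 + (qz q)\<^sup>2 = 1"
proof
 assume q: "q : SU2"
 define a b c d where "a = q $ 1 $ 1" and "b = q $ 1 $ 2" and "c = q $ 2 $ 1" and "d = q $ 2 $ 2"
 have 1: "a * cnj a + b * cnj b = 1" "a * cnj c + b * cnj d = 0" "c * cnj a + d * cnj b = 0"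
   "c * cnj c + d * cnj d = 1" "a * d - b * c = 1"
  using q by (auto simp: SU2_def vec2_eq_iff mat2_mult_nth mat2_nth conj_transpose_def det_2
    a_def b_def c_def d_def)
 \<comment> \<open>Both factors in parentheses are 1; after cancellation a multiple of an
   off-diagonal entry of q times its adjoint remains.\<close>
 have "d - cnj a = (a * cnj a + b * cnj b) * d - cnj a * (a * d - b * c)" using 1 by simp
 also have "... = b * (c * cnj a + d * cnj b)" by algebra
 finally have d: "d = cnj a" using 1 by simp
 have "c + cnj b = (a * cnj a + b * cnj b) * c + cnj b * (a * d - b * c)" using 1 by simp
 also have "... = a * (c * cnj a + d * cnj b)" by algebra
 finally have c: "c = - cnj b" using 1 by (simp add: eq_neg_iff_add_eq_0)
 have "(Re a)\<^sup>2 + (Im a)\<^sup>2 + (Re b)\<^sup>2 + (Im b)\<^sup>2 = Re (a * cnj a + b * cnj b)"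
  by (simp add: power2_eq_square)
 with c d 1 show "q : quats & (qw q)\<^sup>2 + (qx q)\<^sup>2 + (qy q)\<^sup>2 + (qz q)\<^sup>2 = 1"
  by (simp add: quats_def q_defs a_def b_def c_def d_def algebra_simps)
next
 assume q: "q : quats & (qw q)\<^sup>2 + (qx q)\<^sup>2 + (qy q)\<^sup>2 + (qz q)\<^sup>2 = 1"
 have "quat w x y z ** ct (quat w x y z) = quat (w\<^sup>2 + x\<^sup>2 + y\<^sup>2 + z\<^sup>2) 0 0 0" for w x y z
  by (simp add: conj_transpose_quat quat_mult power2_eq_square algebra_simps)
 hence "q ** ct q = mat 1"
  using q quats_eq quat_1 by metis
 moreover have "det q = 1" using q
  by (simp add: quats_def det_2 q_defs complex_eq_iff power2_eq_square)
 ultimately show "q : SU2" by (simp add: SU2_def)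
qed

lemma SU2_quats: "q : SU2 ==> q : quats" by (simp add: SU2_iff)

lemma quats_mult [intro]: "p : quats ==> q : quats ==> p ** q : quats"
 by (metis quat_in_quats quat_mult quats_eq)

lemma quats_conj [intro]: "p : quats ==> ct p : quats"
 by (metis quat_in_quats conj_transpose_quat quats_eq)

lemma q_mult:
 assumes "p : quats" "q : quats"
 shows "qw (p ** q) = qw p * qw q - qx p * qx q - qy p * qy q - qz p * qz q"
  "qx (p ** q) = qw p * qx q + qx p * qw q + qy p * qz q - qz p * qy q"
  "qy (p ** q) = qw p * qy q + qy p * qw q + qz p * qx q - qx p * qz q"
  "qz (p ** q) = qw p * qz q + qz p * qw q + qx p * qy q - qy p * qx q"
 using quat_mult quats_eq[OF assms(1)] quats_eq[OF assms(2)] quat_coords by metis+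

lemma q_conj: "qw (ct p) = qw p" "p : quats ==> qx (ct p) = - qx p"
  "p : quats ==> qy (ct p) = - qy p" "qz (ct p) = - qz p"
 by (auto simp: q_defs conj_transpose_def quats_def)

lemma conj_transpose_SU2: "q : SU2 ==> ct q ** q = mat 1" "q : SU2 ==> q ** ct q = mat 1"
 unfolding SU2_def using matrix_left_right_inverse by auto

lemma matrix_inv_unique:
 fixes A :: "'a::field^'n^'n"
 assumes "A ** B = mat 1" shows "matrix_inv A = B"
proof -
 have B: "B ** A = mat 1" using assms matrix_left_right_inverse by blast
 have "A ** matrix_inv A = mat 1 & matrix_inv A ** A = mat 1"
  unfolding matrix_inv_def by (rule someI[of _ B]) (use assms B in simp)
 hence "matrix_inv A ** A = mat 1" by simp
 hence "matrix_inv A ** (A ** B) = B" by (simp add: matrix_mul_assoc)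
 thus ?thesis using assms by simp
qed

lemma matrix_inv_SU2: "q : SU2 ==> matrix_inv q = ct q"
 by (rule matrix_inv_unique) (rule conj_transpose_SU2)

lemma SU2_mult: "p : SU2 ==> q : SU2 ==> p ** q : SU2"
 unfolding SU2_iff
 by (auto simp: q_mult power2_eq_square) algebra

lemma SU2_conj: "p : SU2 ==> ct p : SU2"
 unfolding SU2_iff by (auto simp: q_conj)

lemma SU2_1 [simp]: "mat 1 : SU2"
 unfolding SU2_iff by (simp add: quat_1)

subsection \<open>The 3-form\<close>

definition det3 :: "real => real => real => real => real => real => real => real => real => real" where
 "det3 a1 a2 a3 b1 b2 b3 c1 c2 c3 =
  a1 * (b2 * c3 - b3 * c2) + a2 * (b3 * c1 - b1 * c3) + a3 * (b1 * c2 - b2 * c1)"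

definition su2 :: "(complex^2^2) set" where "su2 = {X:quats. qw X = 0}"

lemma killing_su2:
 assumes "X : su2" "Y : su2"
 shows "killing X Y = - 8 * (qx X * qx Y + qy X * qy Y + qz X * qz Y)"
proof -
 let ?e1 = "vector [vector [0, \<i>], vector [\<i>, 0]] :: complex^2^2"
 let ?e2 = "vector [vector [0, 1], vector [-1, 0]] :: complex^2^2"
 let ?e3 = "vector [vector [\<i>, 0], vector [0, -\<i>]] :: complex^2^2"
 have e: "?e1 = quat 0 0 1 0" "?e2 = quat 0 1 0 0" "?e3 = quat 0 0 0 1"
  by (simp_all add: vec2_eq_iff quat_def complex_eq_iff)
 have "?e1 ~= ?e2" "?e1 ~= ?e3" "?e2 ~= ?e3" by (simp_all add: vec2_eq_iff)
 hence k: "killing X Y = (\<Sum>e\<leftarrow>[?e1, ?e2, ?e3]. (commutator X (commutator Y e) \<bullet> e) / (e \<bullet> e))"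
  unfolding killing_def su2_basis_def by simp
 have diff: "quat w x y z - quat w' x' y' z' = quat (w - w') (x - x') (y - y') (z - z')" for w x y z w' x' y' z'
  by (simp add: vec2_eq_iff quat_def complex_eq_iff)
 have inn: "quat w x y z \<bullet> quat w' x' y' z' = 2 * (w * w' + x * x' + y * y' + z * z')" for w x y z w' x' y' z'
  by (simp add: inner_vec_def sum_2 quat_def inner_complex_def)
 obtain x y z x' y' z' where X: "X = quat 0 x y z" "Y = quat 0 x' y' z'"
  using assms quats_eq unfolding su2_def by (metis (mono_tags, lifting) mem_Collect_eq)
 show ?thesis
  unfolding k e unfolding X by (simp add: commutator_def quat_mult diff inn) (simp add: field_simps)
qed

lemma su2_commutator:
 assumes "X : su2" "Y : su2"
 shows "bracket_form X Y : su2" "qx (bracket_form X Y) = 4 * (qy X * qz Y - qz X * qy Y)"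
  "qy (bracket_form X Y) = 4 * (qz X * qx Y - qx X * qz Y)"
  "qz (bracket_form X Y) = 4 * (qx X * qy Y - qy X * qx Y)"
proof -
 obtain x y z x' y' z' where X: "X = quat 0 x y z" "Y = quat 0 x' y' z'"
  using assms quats_eq unfolding su2_def by (metis (mono_tags, lifting) mem_Collect_eq)
 have diff: "quat w x y z - quat w' x' y' z' = quat (w - w') (x - x') (y - y') (z - z')" for w x y z w' x' y' z'
  by (simp add: vec2_eq_iff quat_def complex_eq_iff)
 have scal: "c *\<^sub>R quat w x y z = quat (c * w) (c * x) (c * y) (c * z)" for c w x y z
  by (simp add: vec2_eq_iff quat_def complex_eq_iff)
 have "bracket_form X Y = quat 0 (4 * (qy X * qz Y - qz X * qy Y)) (4 * (qz X * qx Y - qx X * qz Y)) (4 * (qx X * qy Y - qy X * qx Y))"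
  unfolding bracket_form_def commutator_def
  by (simp add: X quat_mult diff scal algebra_simps)
 thus "bracket_form X Y : su2" "qx (bracket_form X Y) = 4 * (qy X * qz Y - qz X * qy Y)"
  "qy (bracket_form X Y) = 4 * (qz X * qx Y - qx X * qz Y)"
  "qz (bracket_form X Y) = 4 * (qx X * qy Y - qy X * qx Y)"
  by (simp_all add: su2_def)
qed

text \<open>The constant 1/(96 pi) cancels against 8 from the Killing form, 4 from the bracket and 3
  from the cyclic sum, which leaves 1/pi times the volume form of the unit 3-sphere.\<close>

lemma Omega_su2:
 assumes "q : SU2" and su: "ct q ** u : su2" "ct q ** v : su2" "ct q ** w : su2"
 defines "X == ct q ** u" and "Y == ct q ** v" and "Z == ct q ** w"
 shows "Omega q u v w = det3 (qx X) (qx Y) (qx Z) (qy X) (qy Y) (qy Z) (qz X) (qz Y) (qz Z) / pi"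
 using su unfolding X_def[symmetric] Y_def[symmetric] Z_def[symmetric] Omega_def
 by (simp add: Let_def matrix_inv_SU2[OF assms(1)] X_def[symmetric] Y_def[symmetric] Z_def[symmetric]
   killing_su2 su2_commutator det3_def field_simps)

definition tangent :: "complex^2^2 => complex^2^2 => bool" where
 "tangent q u \<longleftrightarrow> u : quats & qw q * qw u + qx q * qx u + qy q * qy u + qz q * qz u = 0"

lemma tangent_iff_su2:
 assumes "q : SU2"
 shows "tangent q u \<longleftrightarrow> ct q ** u : su2"
proof -
 have "u : quats" if "ct q ** u : quats"
  using quats_mult[OF SU2_quats[OF assms] that] by (simp add: matrix_mul_assoc conj_transpose_SU2 assms)
 hence *: "u : quats \<longleftrightarrow> ct q ** u : quats"
  using assms quats_mult quats_conj SU2_quats by blast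
 have "qw (ct q ** u) = qw q * qw u + qx q * qx u + qy q * qy u + qz q * qz u" if "u : quats"
  using that SU2_quats[OF assms] by (simp add: q_mult q_conj quats_conj)
 with * show ?thesis by (auto simp: tangent_def su2_def)
qed

text \<open>The restrictions to the sphere of dx^dy^dz and of dw^(x dy^dz + y dz^dx + z dx^dy), as
  multiples of the volume form. They give d(k(w)(x dy^dz + y dz^dx + z dx^dy)) the coefficient 3 w k
  - (1 - w^2) k' and so are the source of the differential equation for \<open>kfun\<close>.\<close>

lemma Omega_tangent:
 assumes "q : SU2" "tangent q u" "tangent q v" "tangent q t"
 shows "det3 (qx u) (qx v) (qx t) (qy u) (qy v) (qy t) (qz u) (qz v) (qz t) = qw q * (pi * Omega q u v t)" (is ?A)
  and "qx q * det3 (qw u) (qw v) (qw t) (qy u) (qy v) (qy t) (qz u) (qz v) (qz t)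
    + qy q * det3 (qw u) (qw v) (qw t) (qz u) (qz v) (qz t) (qx u) (qx v) (qx t)
    + qz q * det3 (qw u) (qw v) (qw t) (qx u) (qx v) (qx t) (qy u) (qy v) (qy t)
    = - (1 - (qw q)\<^sup>2) * (pi * Omega q u v t)" (is ?B)
proof -
 define X Y Z where "X = ct q ** u" and "Y = ct q ** v" and "Z = ct q ** t"
 have su: "X : su2" "Y : su2" "Z : su2"
  using assms by (simp_all add: X_def Y_def Z_def tangent_iff_su2)
 have O: "pi * Omega q u v t = det3 (qx X) (qx Y) (qx Z) (qy X) (qy Y) (qy Z) (qz X) (qz Y) (qz Z)"
  using su unfolding X_def Y_def Z_def by (simp add: Omega_su2[OF assms(1)])
 have "u = q ** X" "v = q ** Y" "t = q ** Z"
  by (simp_all add: X_def Y_def Z_def matrix_mul_assoc conj_transpose_SU2 assms)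
 hence u: "qw u = - (qx q * qx X) - qy q * qy X - qz q * qz X" "qx u = qw q * qx X + qy q * qz X - qz q * qy X"
   "qy u = qw q * qy X + qz q * qx X - qx q * qz X" "qz u = qw q * qz X + qx q * qy X - qy q * qx X"
   "qw v = - (qx q * qx Y) - qy q * qy Y - qz q * qz Y" "qx v = qw q * qx Y + qy q * qz Y - qz q * qy Y"
   "qy v = qw q * qy Y + qz q * qx Y - qx q * qz Y" "qz v = qw q * qz Y + qx q * qy Y - qy q * qx Y"
   "qw t = - (qx q * qx Z) - qy q * qy Z - qz q * qz Z" "qx t = qw q * qx Z + qy q * qz Z - qz q * qy Z"
   "qy t = qw q * qy Z + qz q * qx Z - qx q * qz Z" "qz t = qw q * qz Z + qx q * qy Z - qy q * qx Z"
  using su SU2_quats[OF assms(1)] by (simp_all add: su2_def q_mult)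
 have n: "(qw q)\<^sup>2 + (qx q)\<^sup>2 + (qy q)\<^sup>2 + (qz q)\<^sup>2 = 1" using assms(1) SU2_iff by blast
 show ?A unfolding O u det3_def using n by algebra
 show ?B unfolding O u det3_def using n by algebra
qed

section \<open>A primitive of the volume form off a point\<close>

text \<open>The rotationally symmetric primitive \<open>k(w) (x dy\<and>dz + y dz\<and>dx + z dx\<and>dy)\<close> of the 3-form is
 regular away from \<open>w = -1\<close> when \<open>(1 - w\<^sup>2) k' = 3 w k - 1/\<pi>\<close>. The solution that is regular at
 \<open>w = 1\<close> is found as a power series in \<open>1 - w\<close>, of radius 2.\<close>

primrec kcoeff :: "nat => real" where
 "kcoeff 0 = 1 / (3 * pi)"
| "kcoeff (Suc n) = (real n + 3) / (2 * real n + 5) * kcoeff n"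

definition kfun :: "real => real" where "kfun w = (\<Sum>n. kcoeff n * (1 - w) ^ n)"
definition kfun' :: "real => real" where "kfun' w = - (\<Sum>n. diffs kcoeff n * (1 - w) ^ n)"

text \<open>After multiplication by 2^n consecutive ratios are (2n+6)/(2n+5), so growth is at most
  linear. The radius of convergence in 1 - w is therefore at least 2, which reaches down to the pole
  w = -1.\<close>

lemma kcoeff_bound: "0 <= kcoeff n & kcoeff n * 2 ^ n <= (real n + 1) / (3 * pi)"
proof (induction n)
 case (Suc n)
 let ?q = "(2 * real n + 6) / (2 * real n + 5)"
 have "kcoeff (Suc n) * 2 ^ Suc n = ?q * (kcoeff n * 2 ^ n)" by (simp add: field_simps)
 also have "... <= ?q * ((real n + 1) / (3 * pi))" using Suc by (intro mult_left_mono) auto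
 also have "... <= (real (Suc n) + 1) / (3 * pi)"
 proof -
  have "?q * (real n + 1) <= real (Suc n) + 1" by (simp add: field_simps)
  hence "?q * (real n + 1) / (3 * pi) <= (real (Suc n) + 1) / (3 * pi)"
   by (intro divide_right_mono) auto
  thus ?thesis by simp
 qed
 finally show ?case using Suc by simp
qed simp

lemma kcoeff_summable: assumes "\<bar>t\<bar> < 2" shows "summable (%n. kcoeff n * t ^ n)"
proof (rule summable_comparison_test')
 have "summable (%n. of_nat (Suc n) * (\<bar>t\<bar> / 2) ^ n :: real)"
  using geometric_deriv_sums[of "\<bar>t\<bar> / 2"] assms by (intro sums_summable) auto
 from summable_mult[OF this, of "1 / (3 * pi)"]
 show "summable (%n. 1 / (3 * pi) * (of_nat (Suc n) * (\<bar>t\<bar> / 2) ^ n))" .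
 fix n
 have "norm (kcoeff n * t ^ n) = kcoeff n * 2 ^ n * (\<bar>t\<bar> / 2) ^ n"
  using kcoeff_bound[of n] by (simp add: abs_mult power_abs power_divide)
 also have "... <= (real n + 1) / (3 * pi) * (\<bar>t\<bar> / 2) ^ n"
  using kcoeff_bound[of n] by (intro mult_right_mono) auto
 finally show "norm (kcoeff n * t ^ n) <= 1 / (3 * pi) * (of_nat (Suc n) * (\<bar>t\<bar> / 2) ^ n)"
  by (simp add: divide_simps) (simp add: algebra_simps)
qed

lemma between_abs: assumes "\<bar>t\<bar> < 2" obtains K :: real where "\<bar>t\<bar> < \<bar>K\<bar>" "\<bar>K\<bar> < 2"
proof
 show "\<bar>t\<bar> < \<bar>(\<bar>t\<bar> + 2) / 2\<bar>" "\<bar>(\<bar>t\<bar> + 2) / 2\<bar> < 2" using assms by auto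
qed

lemma kseries_DERIV:
 assumes "\<bar>t\<bar> < 2"
 shows "((%t. \<Sum>n. kcoeff n * t ^ n) has_real_derivative (\<Sum>n. diffs kcoeff n * t ^ n)) (at t)"
  and "((%t. \<Sum>n. diffs kcoeff n * t ^ n) has_real_derivative (\<Sum>n. diffs (diffs kcoeff) n * t ^ n)) (at t)"
  and "summable (%n. diffs kcoeff n * t ^ n)"
proof -
 have s: "summable (%n. diffs kcoeff n * t ^ n)" if "\<bar>t\<bar> < 2" for t
  using that by (rule_tac termdiff_converges[where K = 2]) (auto simp: kcoeff_summable)
 obtain K where K: "\<bar>t\<bar> < \<bar>K\<bar>" "\<bar>K\<bar> < 2" using between_abs[OF assms] .
 show "((%t. \<Sum>n. kcoeff n * t ^ n) has_real_derivative (\<Sum>n. diffs kcoeff n * t ^ n)) (at t)"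
  by (rule termdiffs_strong[OF kcoeff_summable[OF K(2)]]) (use K in simp)
 show "((%t. \<Sum>n. diffs kcoeff n * t ^ n) has_real_derivative (\<Sum>n. diffs (diffs kcoeff) n * t ^ n)) (at t)"
  by (rule termdiffs_strong[OF s[OF K(2)]]) (use K in simp)
 show "summable (%n. diffs kcoeff n * t ^ n)" by (rule s[OF assms])
qed

lemma kfun_DERIV:
 assumes "-1 < w" "w < 3"
 shows "(kfun has_real_derivative kfun' w) (at w)" "isCont kfun' w"
proof -
 have w: "\<bar>1 - w\<bar> < 2" using assms by auto
 have l: "((%w. 1 - w) has_real_derivative -1) (at w)" by (auto intro!: derivative_eq_intros)
 show "(kfun has_real_derivative kfun' w) (at w)"
  using DERIV_chain2[OF kseries_DERIV(1)[OF w] l] unfolding kfun_def kfun'_def by simp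
 show "isCont kfun' w"
  using DERIV_isCont[OF DERIV_minus[OF DERIV_chain2[OF kseries_DERIV(2)[OF w] l]]] unfolding kfun'_def .
qed

text \<open>In t = 1 - w the equation reads 2 t S' + 3 S - 1/pi = t (t S' + 3 S), with S' the
  derivative in t. Comparing powers of t gives the recursion of \<open>kcoeff\<close>.\<close>

lemma kfun_ode:
 assumes "-1 < w" "w < 3"
 shows "(1 - w\<^sup>2) * kfun' w = 3 * w * kfun w - 1 / pi"
proof -
 define t where "t = 1 - w"
 have t: "\<bar>t\<bar> < 2" using assms by (auto simp: t_def)
 define S where "S = (\<Sum>n. kcoeff n * t ^ n)"
 define S' where "S' = (\<Sum>n. diffs kcoeff n * t ^ n)"
 have 0: "(%n. kcoeff n * t ^ n) sums S" unfolding S_def by (rule summable_sums[OF kcoeff_summable[OF t]])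
 have 1: "(%n. diffs kcoeff n * t ^ n) sums S'" unfolding S'_def by (rule summable_sums[OF kseries_DERIV(3)[OF t]])
 have 2: "(%n. real n * kcoeff n * t ^ n) sums (t * S')"
 proof -
  have "(%n. real (Suc n) * kcoeff (Suc n) * t ^ Suc n) sums (t * S')"
   using sums_mult[OF 1, of t] by (simp add: diffs_def algebra_simps)
  thus ?thesis using sums_Suc_iff[of "%n. real n * kcoeff n * t ^ n" "t * S'"] by simp
 qed
 have 3: "(%n. (2 * real n + 3) * kcoeff n * t ^ n) sums (2 * (t * S') + 3 * S)"
  using sums_add[OF sums_mult[OF 2, of 2] sums_mult[OF 0, of 3]] by (simp add: algebra_simps)
 have "(%n. (2 * real (Suc n) + 3) * kcoeff (Suc n) * t ^ Suc n) sums (2 * (t * S') + 3 * S - 1 / pi)"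
  using sums_Suc_iff[of "%n. (2 * real n + 3) * kcoeff n * t ^ n"] 3 by simp
 moreover have "(2 * real (Suc n) + 3) * kcoeff (Suc n) * t ^ Suc n = t * ((real n + 3) * kcoeff n * t ^ n)" for n
 proof -
  have "(2 * real (Suc n) + 3) * kcoeff (Suc n) = (real n + 3) * kcoeff n"
   using of_nat_0_le_iff[of n, where 'a = real] by (simp add: field_simps add_nonneg_eq_0_iff)
  thus ?thesis by simp
 qed
 moreover have "(%n. t * ((real n + 3) * kcoeff n * t ^ n)) sums (t * (t * S' + 3 * S))"
  using sums_mult[OF sums_add[OF 2 sums_mult[OF 0, of 3]], of t] by (simp add: algebra_simps)
 ultimately have "2 * (t * S') + 3 * S - 1 / pi = t * (t * S' + 3 * S)"
  using sums_unique2 by simp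
 moreover have "kfun w = S" "kfun' w = - S'" by (simp_all add: S_def S'_def kfun_def kfun'_def t_def)
 moreover have "w = 1 - t" by (simp add: t_def)
 ultimately show ?thesis by (simp only:) (simp add: power2_eq_square algebra_simps)
qed

text \<open>The factor (1 - w^2)^(3/2) is integrating: it leaves the derivative - sqrt(1 - w^2) /
  pi, and both sides vanish at w = 1. Times 4 pi the left side is the integral of the primitive over
  the 2-sphere of latitude w; its limit 2 pi at w = -1 is the residue at the pole.\<close>

lemma kfun_closed_form:
 assumes "-1 < w" "w < 1"
 shows "(1 - w\<^sup>2) * sqrt (1 - w\<^sup>2) * kfun w = (arccos w - w * sqrt (1 - w\<^sup>2)) / (2 * pi)"
proof -
 let ?d = "%w. (1 - w\<^sup>2) * sqrt (1 - w\<^sup>2) * kfun w - (arccos w - w * sqrt (1 - w\<^sup>2)) / (2 * pi)"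
 have pos: "1 - v\<^sup>2 > 0" if "w <= v" "v < 1" for v
  using that assms by (simp add: power2_less_1_iff abs_square_less_1 abs_if)
 have "?d 1 = ?d w"
 proof (rule DERIV_isconst_end[where f = ?d])
  show "w < 1" by fact
  have "continuous_on {w..1} kfun"
   using DERIV_isCont[OF kfun_DERIV(1)] assms
   by (intro continuous_at_imp_continuous_on) auto
  moreover have "continuous_on {w..1} arccos"
   using continuous_on_arccos' assms by (auto intro: continuous_on_subset)
  ultimately show "continuous_on {w..1} ?d" using assms by (intro continuous_intros) auto
 next
  fix v assume v: "w < v" "v < 1"
  have p: "1 - v\<^sup>2 > 0" "v > -1" using pos[of v] v assms by auto
  define s where "s = sqrt (1 - v\<^sup>2)"
  have s: "s > 0" "s\<^sup>2 = 1 - v\<^sup>2" using p by (auto simp: s_def)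
  have ds: "((%v. sqrt (1 - v\<^sup>2)) has_real_derivative (- v / s)) (at v)"
   unfolding s_def using p by (auto intro!: derivative_eq_intros simp: field_simps)
  have d1: "((%v. 1 - v\<^sup>2) has_real_derivative -2 * v) (at v)"
   by (auto intro!: derivative_eq_intros)
  have da: "(arccos has_real_derivative - inverse s) (at v)"
   using DERIV_arccos[of v] p v by (simp add: s_def)
  have "(?d has_real_derivative ((-2 * v) * s + (1 - v\<^sup>2) * (- v / s)) * kfun v + (1 - v\<^sup>2) * s * kfun' v
    - (- inverse s - (s + v * (- v / s))) / (2 * pi)) (at v)"
   by (rule DERIV_cong[OF DERIV_diff[OF DERIV_mult[OF DERIV_mult[OF d1 ds] kfun_DERIV(1)]
     DERIV_cdivide[OF DERIV_diff[OF da DERIV_mult[OF DERIV_ident ds]], of "2 * pi"]]])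
    (use p v in \<open>simp_all add: s_def[symmetric] algebra_simps\<close>)
  also have "((-2 * v) * s + (1 - v\<^sup>2) * (- v / s)) * kfun v + (1 - v\<^sup>2) * s * kfun' v
    - (- inverse s - (s + v * (- v / s))) / (2 * pi) = 0"
  proof -
   have a: "(1 - v\<^sup>2) * s * kfun' v = s * (3 * v * kfun v - 1 / pi)" using kfun_ode[of v] p v by simp
   have b: "(1 - v\<^sup>2) * (- v / s) = - v * s"
    unfolding s(2)[symmetric] using s(1) by (simp add: power2_eq_square)
   have c: "- inverse s - (s + v * (- v / s)) = - 2 * s"
   proof -
    have "inverse s + s - v * v / s = (1 - v\<^sup>2 + s\<^sup>2) / s"
     using s(1) by (simp add: field_simps power2_eq_square)
    also have "... = 2 * s" unfolding s(2)[symmetric] using s(1) by (simp add: power2_eq_square)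
    finally show ?thesis by simp
   qed
   show ?thesis unfolding a b c by (simp add: algebra_simps)
  qed
  finally show "(?d has_real_derivative 0) (at v)" .
 qed
 thus ?thesis by simp
qed

subsection \<open>Cutting off near the pole\<close>

definition kcut :: "real => real => real" where
 "kcut w0 w = (if w <= w0 then kfun w0 + kfun' w0 * (w - w0) else kfun w)"
definition kcut' :: "real => real => real" where
 "kcut' w0 w = (if w <= w0 then kfun' w0 else kfun' w)"

text \<open>Linear continuation of \<open>k\<close> below \<open>w0\<close> makes the primitive regular at the pole; \<open>defect\<close> is
 the density by which its differential then differs from the 3-form.\<close>

definition defect :: "real => real => real" where
 "defect w0 w = (if w <= w0 then (1 / pi - 3 * w * kcut w0 w + (1 - w\<^sup>2) * kcut' w0 w) / w else 0)"

lemma DERIV_piecewise: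
 fixes f g :: "real => real"
 assumes "w <= c ==> (f has_real_derivative f' w) (at w)" "c <= w ==> (g has_real_derivative g' w) (at w)" "f c = g c" "f' c = g' c"
 shows "((%w. if w <= c then f w else g w) has_real_derivative (if w <= c then f' w else g' w)) (at w)"
proof -
 have "closure {..c} Int closure {c..} = {c}" "{..c} Un {c..} = UNIV" by auto
 then have [simp]: "{..c} Un closure {..c} Int closure {c..} = {..c}" "{c..} Un closure {..c} Int closure {c..} = {c..}" "{..c} Un {c..} = UNIV" by auto
 have "((%w. if w : {..c} then f w else g w) has_derivative (if w : {..c} then (*) (f' w) else (*) (g' w))) (at w within {..c} Un {c..})"
  by (rule has_derivative_If_within_closures)
   (use assms in \<open>auto simp: has_field_derivative_def intro: has_derivative_at_withinI\<close>)
 then show ?thesis by (cases "w <= c") (simp_all add: has_field_derivative_def)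
qed

lemma kcut_DERIV:
 assumes "-1 < w0" "w0 < 3" "w < 3"
 shows "(kcut w0 has_real_derivative kcut' w0 w) (at w)"
proof -
 have d: "((%w. kfun w0 + kfun' w0 * (w - w0)) has_real_derivative kfun' w0) (at w)" by (auto intro!: derivative_eq_intros)
 show ?thesis unfolding kcut_def[abs_def] kcut'_def
  by (rule DERIV_piecewise[where f' = "%_. kfun' w0" and g' = kfun', OF d]) (use assms kfun_DERIV(1)[of w] in auto)
qed

lemma kcut'_continuous:
 assumes "-1 < w0" "w0 < 3"
 shows "continuous_on {..<3} (kcut' w0)"
proof -
 have "kcut' w0 = (%w. kfun' (max w w0))" by (auto simp: kcut'_def max_def)
 moreover have "continuous_on {-1<..<3} kfun'"
  using kfun_DERIV(2) by (intro continuous_at_imp_continuous_on) auto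
 ultimately show ?thesis using assms
  by (auto intro!: continuous_on_compose2[of "{-1<..<3}" kfun' _ "%w. max w w0"] continuous_intros)
qed

lemma kcut_continuous:
 assumes "-1 < w0" "w0 < 3"
 shows "continuous_on {..<3} (kcut w0)"
 using kcut_DERIV assms by (intro continuous_at_imp_continuous_on) (auto intro!: DERIV_isCont)

text \<open>Above \<open>w0\<close> this is the differential equation of \<open>kfun\<close>; below
  \<open>w0\<close> it is solved for the defect, which is possible because w is negative
  there.\<close>

lemma defect_eq:
 assumes "-1 < w0" "w0 < 0" "w < 3"
 shows "1 / pi = 3 * w * kcut w0 w - (1 - w\<^sup>2) * kcut' w0 w + defect w0 w * w"
 using kfun_ode[of w] assms by (auto simp: kcut_def kcut'_def defect_def)

lemma defect_continuous:
 assumes "-1 < w0" "w0 < 0"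
 shows "continuous_on {..<0} (defect w0)"
proof -
 have "defect w0 w = (1 / pi - 3 * w * kcut w0 w + (1 - w\<^sup>2) * kcut' w0 w) / w" if "w < 0" for w
  using defect_eq[of w0 w] assms that by (simp add: field_simps)
 moreover have "continuous_on {..<0} (%w. (1 / pi - 3 * w * kcut w0 w + (1 - w\<^sup>2) * kcut' w0 w) / w)"
  using kcut_continuous[of w0] kcut'_continuous[of w0] assms
  by (auto intro!: continuous_intros elim!: continuous_on_subset)
 ultimately show ?thesis by (auto elim!: continuous_on_eq)
qed

text \<open>Polar coordinates for radial functions. Two measures on the line are compared on
  half-lines, where both give volumes of spherical shells.\<close>

lemma radial_distr:
 assumes "R >= 0"
 shows "distr (density lborel (%v. ennreal (indicator (cball (0::real^3) R) v))) borel norm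
   = density lborel (%s. ennreal (4 * pi * s\<^sup>2 * indicator {0..R} s))" (is "?M = ?N")
proof (rule measure_eqI_lessThan)
 have [measurable]: "cball (0::real^3) R : sets borel" by simp
 have M: "emeasure ?M {x<..} = ennreal (4 / 3 * pi * (R ^ 3 - (max 0 (min x R)) ^ 3))" for x
 proof -
  let ?y = "max 0 (min x R)"
  have c: "emeasure lborel (cball (0::real^3) r) = ennreal (4 / 3 * pi * r ^ 3)" if "r >= 0" for r
   using emeasure_cball[OF that, of "0::real^3"] by (simp add: unit_ball_vol_3)
  have "emeasure ?M {x<..} = emeasure lborel (cball (0::real^3) R Int {v. x < norm v})"
  proof -
   have "emeasure ?M {x<..} = emeasure (density lborel (%v. ennreal (indicator (cball (0::real^3) R) v))) {v. x < norm v}"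
    by (subst emeasure_distr) (auto intro!: arg_cong2[where f = emeasure])
   also have "... = (\<integral>\<^sup>+v. ennreal (indicator (cball (0::real^3) R) v) * indicator {v. x < norm v} v \<partial>lborel)"
    by (subst emeasure_density) auto
   also have "... = (\<integral>\<^sup>+v. indicator (cball (0::real^3) R Int {v. x < norm v}) v \<partial>lborel)"
    by (intro nn_integral_cong) (auto simp: indicator_def)
   finally show ?thesis by simp
  qed
  also have "... = emeasure lborel (if x < 0 then cball (0::real^3) R else cball 0 R - cball 0 ?y)"
   using assms by (intro arg_cong2[where f = emeasure]) (auto simp: max_def min_def not_le intro: less_le_trans[OF _ norm_ge_zero])
  also have "... = ennreal (4 / 3 * pi * (R ^ 3 - ?y ^ 3))"
  proof (cases "x < 0")
   case True
   thus ?thesis using c[OF assms] by (simp add: max_def min_def)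
  next
   case False
   hence "emeasure lborel (cball (0::real^3) R - cball 0 ?y) = ennreal (4 / 3 * pi * R ^ 3) - ennreal (4 / 3 * pi * ?y ^ 3)"
    using c[of R] c[of ?y] assms by (subst emeasure_Diff) (auto simp: subset_iff)
   also have "... = ennreal (4 / 3 * pi * (R ^ 3 - ?y ^ 3))"
    by (subst ennreal_minus) (auto simp: algebra_simps)
   finally show ?thesis using False by simp
  qed
  finally show ?thesis .
 qed
 show "emeasure ?M {x<..} < \<infinity>" for x unfolding M by simp
 show "emeasure ?M {x<..} = emeasure ?N {x<..}" for x
 proof -
  let ?y = "max 0 (min x R)"
  have y: "0 <= ?y" "?y <= R" using assms by auto
  have "emeasure ?N {x<..} = (\<integral>\<^sup>+s. ennreal (4 * pi * s\<^sup>2 * indicator {0..R} s) * indicator {x<..} s \<partial>lborel)"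
   by (subst emeasure_density) auto
  also have "... = (\<integral>\<^sup>+s. ennreal (4 * pi * s\<^sup>2) * indicator {?y..R} s \<partial>lborel)"
  proof (rule nn_integral_cong_AE)
   have "AE s in lborel. s ~= ?y" by (rule AE_lborel_singleton)
   thus "AE s in lborel. ennreal (4 * pi * s\<^sup>2 * indicator {0..R} s) * indicator {x<..} s
     = ennreal (4 * pi * s\<^sup>2) * indicator {?y..R} s"
    by eventually_elim (auto simp: indicator_def max_def min_def split: if_splits)
  qed
  also have "... = ennreal (4 / 3 * pi * R ^ 3 - 4 / 3 * pi * ?y ^ 3)"
   by (rule nn_integral_FTC_Icc[OF _ _ _ y(2)]) (auto intro!: derivative_eq_intros simp: power2_eq_square)
  finally show ?thesis unfolding M by (simp add: algebra_simps)
 qed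
qed auto

lemma radial_integral:
 fixes f :: "real => real"
 assumes "R >= 0" "continuous_on {0..R} f"
 shows "integrable lborel (%v::real^3. indicator (cball 0 R) v * f (norm v))"
  and "integral\<^sup>L lborel (%v::real^3. indicator (cball 0 R) v * f (norm v)) = integral {0..R} (%s. 4 * pi * s\<^sup>2 * f s)"
proof -
 have [measurable]: "cball (0::real^3) R : sets borel" by simp
 define g where "g s = indicator {0..R} s * f s" for s
 have gm: "g : borel_measurable borel"
  using borel_measurable_continuous_on_indicator[OF _ assms(2)] by (simp add: g_def[abs_def])
 have eq: "(%v::real^3. indicator (cball 0 R) v * f (norm v)) = (%v. indicator (cball 0 R) v *\<^sub>R g (norm v))"
  by (auto simp: g_def indicator_def)
 let ?D = "density lborel (%v. ennreal (indicator (cball (0::real^3) R) v))"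
 have c: "continuous_on {0..R} (%s. 4 * pi * s\<^sup>2 * f s)" using assms(2) by (intro continuous_intros)
 have si: "set_integrable lborel {0..R} (%s. 4 * pi * s\<^sup>2 * f s)"
  by (rule borel_integrable_atLeastAtMost') (rule c)
 have "integrable (density lborel (%s. ennreal (4 * pi * s\<^sup>2 * indicator {0..R} s))) g"
 proof (subst integrable_density)
  have "(%s. (4 * pi * s\<^sup>2 * indicator {0..R} s) *\<^sub>R g s) = (%s. indicator {0..R} s *\<^sub>R (4 * pi * s\<^sup>2 * f s))"
   by (auto simp: g_def indicator_def)
  thus "integrable lborel (%s. (4 * pi * s\<^sup>2 * indicator {0..R} s) *\<^sub>R g s)"
   using si unfolding set_integrable_def by simp
 qed (use gm in auto)
 hence "integrable (distr ?D borel norm) g" using radial_distr[OF assms(1)] by simp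
 hence "integrable ?D (%v. g (norm v))" by (subst (asm) integrable_distr_eq) (auto simp: gm)
 thus "integrable lborel (%v::real^3. indicator (cball 0 R) v * f (norm v))"
  unfolding eq using gm by (subst (asm) integrable_density) auto
 have "integral\<^sup>L lborel (%v::real^3. indicator (cball 0 R) v *\<^sub>R g (norm v)) = integral\<^sup>L ?D (%v. g (norm v))"
  using gm by (subst integral_density) auto
 also have "... = integral\<^sup>L (distr ?D borel norm) g" using gm by (subst integral_distr) auto
 also have "... = integral\<^sup>L (density lborel (%s. ennreal (4 * pi * s\<^sup>2 * indicator {0..R} s))) g"
  using radial_distr[OF assms(1)] by simp
 also have "... = (\<integral>s\<in>{0..R}. 4 * pi * s\<^sup>2 * f s \<partial>lborel)"
  unfolding set_lebesgue_integral_def using gm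
  by (subst integral_density) (auto simp: g_def indicator_def intro!: Bochner_Integration.integral_cong)
 also have "... = integral {0..R} (%s. 4 * pi * s\<^sup>2 * f s)"
  by (rule set_borel_integral_eq_integral(2)[OF si])
 finally show "integral\<^sup>L lborel (%v::real^3. indicator (cball 0 R) v * f (norm v)) = integral {0..R} (%s. 4 * pi * s\<^sup>2 * f s)"
  unfolding eq .
qed

text \<open>Over the hemisphere w < 0 the coordinates v = (x, y, z) determine w = - sqrt(1 - |v|^2),
  and \<open>norm v <= sqrt (1 - w0\<^sup>2)\<close> describes the cap w <= \<open>w0\<close>. So
  this is the density \<open>defect\<close> written in the coordinates v.\<close>

definition bump :: "real => real^3 => real" where
 "bump w0 v = (if norm v <= sqrt (1 - w0\<^sup>2) then defect w0 (- sqrt (1 - (norm v)\<^sup>2)) else 0)"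

text \<open>The cut-off primitive is regular on the whole sphere, so the defect has to account for
  the full integral 2 pi of the 3-form. The sign is negative because dx^dy^dz reverses the
  orientation where w < 0.\<close>

lemma bump_integral:
 assumes "-1 < w0" "w0 < 0"
 shows "integrable lborel (bump w0)" "integral\<^sup>L lborel (bump w0) = - 2 * pi"
proof -
 define R where "R = sqrt (1 - w0\<^sup>2)"
 have w0: "w0\<^sup>2 < 1" "0 < w0\<^sup>2" using assms by (auto simp: abs_square_less_1)
 have R: "0 < R" "R < 1" using w0 by (auto simp: R_def)
 have R2: "R\<^sup>2 = 1 - w0\<^sup>2" using w0 by (simp add: R_def)
 have wR: "- sqrt (1 - R\<^sup>2) = w0" using assms by (simp add: R2)
 have s1: "0 < 1 - s\<^sup>2" if "0 <= s" "s <= R" for s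
  using that R by (simp add: abs_square_less_1)
 define f where "f s = defect w0 (- sqrt (1 - s\<^sup>2))" for s
 have cf: "continuous_on {0..R} f" unfolding f_def
  using s1 by (intro continuous_on_compose2[OF defect_continuous[OF assms]] continuous_intros) auto
 have eq: "bump w0 = (%v. indicator (cball 0 R) v * f (norm v))"
  by (auto simp: bump_def f_def R_def indicator_def)
 show "integrable lborel (bump w0)" unfolding eq using radial_integral(1)[OF _ cf] R by simp
 \<comment> \<open>The term with \<open>kcut\<close> is the flux of the cut-off primitive through
   the sphere of radius s. The other one comes from the 3-form itself, whose density in the
   coordinates v is 1 / (pi sqrt(1 - s^2)) up to sign.\<close>
 define G where "G s = 4 * pi * (- (s ^ 3 * kcut w0 (- sqrt (1 - s\<^sup>2))) - (arcsin s - s * sqrt (1 - s\<^sup>2)) / (2 * pi))" for s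
 have "((%s. 4 * pi * s\<^sup>2 * f s) has_integral (G R - G 0)) {0..R}"
 proof (rule fundamental_theorem_of_calculus)
  fix s assume "s : {0..R}"
  hence s: "0 <= s" "s <= R" "s < 1" using R by auto
  define t where "t = sqrt (1 - s\<^sup>2)"
  have t: "t > 0" "t\<^sup>2 = 1 - s\<^sup>2" using s1[OF s(1,2)] by (auto simp: t_def)
  have tw: "- t <= w0"
  proof -
   have "\<bar>w0\<bar> <= t" using s R2 unfolding t_def
    by (intro real_le_rsqrt) (simp, metis R(1) abs_of_nonneg less_eq_real_def power_mono R2 diff_le_eq le_diff_eq add.commute)
   thus ?thesis by simp
  qed
  have dt: "((%s. - sqrt (1 - s\<^sup>2)) has_real_derivative (s / t)) (at s)"
   unfolding t_def using s1[OF s(1,2)] by (auto intro!: derivative_eq_intros simp: field_simps)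
  have dt': "((%s. sqrt (1 - s\<^sup>2)) has_real_derivative - (s / t)) (at s)"
   using DERIV_minus[OF dt] by simp
  have d3: "((%s. s ^ 3) has_real_derivative 3 * s\<^sup>2) (at s)"
   by (auto intro!: derivative_eq_intros)
  have dk: "((%s. kcut w0 (- sqrt (1 - s\<^sup>2))) has_real_derivative (kcut' w0 (- t) * (s / t))) (at s)"
   unfolding t_def
   by (rule DERIV_chain2[OF kcut_DERIV dt[unfolded t_def]]) (use assms t(1) in \<open>auto simp: t_def[symmetric]\<close>)
  have da: "(arcsin has_real_derivative inverse t) (at s)"
   using DERIV_arcsin[of s] s by (simp add: t_def)
  have "(G has_real_derivative 4 * pi * (- (3 * s\<^sup>2 * kcut w0 (- t) + s ^ 3 * (kcut' w0 (- t) * (s / t)))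
    - (inverse t - (t + s * - (s / t))) / (2 * pi))) (at s)"
   unfolding G_def
   using DERIV_cmult[OF DERIV_diff[OF DERIV_minus[OF DERIV_mult[OF d3 dk]]
     DERIV_cdivide[OF DERIV_diff[OF da DERIV_mult[OF DERIV_ident dt']], of "2 * pi"]], of "4 * pi"]
   by (simp add: t_def[symmetric] mult_ac)
  also have "4 * pi * (- (3 * s\<^sup>2 * kcut w0 (- t) + s ^ 3 * (kcut' w0 (- t) * (s / t)))
    - (inverse t - (t + s * - (s / t))) / (2 * pi)) = 4 * pi * s\<^sup>2 * f s"
  proof -
   have "f s * t = - (1 / pi + 3 * t * kcut w0 (- t) + s\<^sup>2 * kcut' w0 (- t))"
    using defect_eq[of w0 "-t"] assms t by (simp add: f_def t_def[symmetric])
   moreover have "inverse t - (t + s * - (s / t)) = 2 * s\<^sup>2 / t"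
    using t by (simp add: field_simps power2_eq_square)
   moreover define K K' where "K = kcut w0 (- t)" and "K' = kcut' w0 (- t)"
   ultimately have fe: "f s * t = - (1 / pi + 3 * t * K + s\<^sup>2 * K')"
    and ie: "inverse t - (t + s * - (s / t)) = 2 * s\<^sup>2 / t" by simp_all
   have "4 * pi * (- (3 * s\<^sup>2 * K + s ^ 3 * (K' * (s / t))) - 2 * s\<^sup>2 / t / (2 * pi))
     = (4 * pi * s\<^sup>2) * (- (1 / pi + 3 * t * K + s\<^sup>2 * K')) / t"
    using t(1) by (simp add: field_simps power2_eq_square power3_eq_cube)
   also have "... = 4 * pi * s\<^sup>2 * f s" unfolding fe[symmetric] using t(1) by simp
   finally show ?thesis unfolding ie K_def K'_def .
  qed
  finally show "(G has_vector_derivative 4 * pi * s\<^sup>2 * f s) (at s within {0..R})"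
   by (auto simp: has_real_derivative_iff_has_vector_derivative intro: has_vector_derivative_at_within)
 qed (use R in simp)
 moreover have "G R - G 0 = - 2 * pi"
 proof -
  have "R ^ 3 * kcut w0 w0 = (1 - w0\<^sup>2) * sqrt (1 - w0\<^sup>2) * kfun w0"
   using R2 by (simp add: kcut_def R_def power3_eq_cube power2_eq_square)
  also have "... = (arccos w0 - w0 * R) / (2 * pi)"
   using kfun_closed_form[of w0] assms by (simp add: R_def)
  finally have k: "R ^ 3 * kcut w0 w0 = (arccos w0 - w0 * R) / (2 * pi)" .
  \<comment> \<open>As \<open>w0\<close> is negative, arcsin yields the supplementary angle. Then
    all terms depending on \<open>w0\<close> cancel and only pi survives, whatever the
    cut-off.\<close>
  have ac: "arccos w0 = pi - arcsin R"
  proof -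
   have "arccos (- w0) = arcsin R"
   proof (rule arccos_unique)
    have "cos (arcsin R) = sqrt (1 - R\<^sup>2)" using R by (simp add: cos_arcsin)
    thus "cos (arcsin R) = - w0" using wR by linarith
    show "0 <= arcsin R" "arcsin R <= pi" using R arcsin_bounded[of R] arcsin_le_arcsin[of 0 R] by auto
   qed
   thus ?thesis using arccos_minus[of "-w0"] assms by simp
  qed
  have sq: "sqrt (1 - R\<^sup>2) = - w0" using wR by simp
  have "G R - G 0 = 4 * pi * (- (R ^ 3 * kcut w0 w0) - (arcsin R + R * w0) / (2 * pi))"
   by (simp add: G_def sq)
  also have "... = - 2 * pi" unfolding k ac by (simp add: field_simps)
  finally show ?thesis .
 qed
 ultimately have "integral {0..R} (%s. 4 * pi * s\<^sup>2 * f s) = - 2 * pi" by (metis integral_unique)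
 thus "integral\<^sup>L lborel (bump w0) = - 2 * pi"
  unfolding eq using radial_integral(2)[OF _ cf] R by simp
qed

section \<open>Integration over boxes\<close>

text \<open>Identifies Lebesgue measure on \<open>real^3\<close> with the one on a product of a line
  and a plane, so that Fubini is available with any coordinate singled out.\<close>

lemma lborel_permutation:
 fixes T :: "'a::euclidean_space => 'b::euclidean_space"
 assumes "linear T" "bij_betw T Basis Basis"
 shows "lborel = distr lborel borel T"
proof (rule lborel_eqI)
 have Tm [measurable]: "T : borel_measurable borel"
  using assms(1) by (intro borel_measurable_continuous_onI linear_continuous_on) (simp add: linear_conv_bounded_linear)
 have Tinner: "T x \<bullet> T b = x \<bullet> b" if "b : Basis" for x b
 proof -
  have "T x = T (SUM c:Basis. (x \<bullet> c) *\<^sub>R c)" by (simp add: euclidean_representation)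
  also have "... = (SUM c:Basis. (x \<bullet> c) *\<^sub>R T c)"
   using linear_sum[OF assms(1), of "%c. (x \<bullet> c) *\<^sub>R c" Basis] by (simp add: linear_scale[OF assms(1)])
  finally have "T x \<bullet> T b = (SUM c:Basis. (x \<bullet> c) * (T c \<bullet> T b))" by (simp add: inner_sum_left)
  also have "... = (SUM c:Basis. (x \<bullet> c) * (if c = b then 1 else 0))"
  proof (rule sum.cong[OF refl])
   fix c :: 'a assume "c : Basis"
   hence "T c : Basis" "T b : Basis" "T c = T b \<longleftrightarrow> c = b"
    using assms(2) that by (auto simp: bij_betw_def inj_on_def)
   thus "(x \<bullet> c) * (T c \<bullet> T b) = (x \<bullet> c) * (if c = b then 1 else 0)"
    by (auto simp: inner_not_same_Basis)
  qed
  also have "... = x \<bullet> b" using that by (simp add: if_distrib sum.delta cong: if_cong)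
  finally show ?thesis .
 qed
 fix l u :: 'b assume lu: "!!b. b : Basis ==> l \<bullet> b <= u \<bullet> b"
 define l' where "l' = (SUM b:Basis. (l \<bullet> T b) *\<^sub>R b)"
 define u' where "u' = (SUM b:Basis. (u \<bullet> T b) *\<^sub>R b)"
 have l'[simp]: "l' \<bullet> b = l \<bullet> T b" "u' \<bullet> b = u \<bullet> T b" if "b : Basis" for b
  using that by (simp_all add: l'_def u'_def inner_sum_left inner_Basis if_distrib cong: if_cong)
 have "T -` box l u = box l' u'"
 proof -
  have "T x : box l u \<longleftrightarrow> (ALL b:Basis. l \<bullet> T b < T x \<bullet> T b & T x \<bullet> T b < u \<bullet> T b)" for x
   unfolding mem_box using bij_betw_imp_surj_on[OF assms(2)] by (metis (no_types, opaque_lifting) image_iff)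
  thus ?thesis by (auto simp: mem_box Tinner)
 qed
 hence "emeasure (distr lborel borel T) (box l u) = emeasure lborel (box l' u')"
  by (subst emeasure_distr) auto
 also have "... = (\<Prod>b\<in>Basis. (u' - l') \<bullet> b)"
 proof (rule emeasure_lborel_box)
  fix b :: 'a assume b: "b : Basis"
  hence "T b : Basis" using assms(2) bij_betwE by blast
  thus "l' \<bullet> b <= u' \<bullet> b" using lu b by simp
 qed
 also have "... = (\<Prod>b\<in>Basis. (u - l) \<bullet> T b)"
  by (auto simp: inner_diff_left intro!: prod.cong)
 also have "(\<Prod>b\<in>Basis. (u - l) \<bullet> T b) = (\<Prod>b\<in>Basis. (u - l) \<bullet> b)"
  by (rule prod.reindex_bij_betw[OF assms(2)])
 finally show "emeasure (distr lborel borel T) (box l u) = (\<Prod>b\<in>Basis. (u - l) \<bullet> b)" .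
qed simp

text \<open>In a chart at the boundary, derivatives are controlled in the open box only; boundedness
  suffices there because the faces are null.\<close>

lemma integrable_on_box_bounded:
 fixes f :: "'a::euclidean_space => real"
 assumes "continuous_on (box l u) f" "bounded (f ` box l u)"
 shows "integrable lborel (%x. indicator (box l u) x * f x)"
  and "f absolutely_integrable_on cbox l u"
  and "integral (cbox l u) f = integral\<^sup>L lborel (%x. indicator (box l u) x * f x)"
proof -
 have m: "(%x. indicator (box l u) x *\<^sub>R f x) : borel_measurable borel"
  by (rule borel_measurable_continuous_on_indicator[OF _ assms(1)]) simp
 obtain B where B: "!!x. x : box l u ==> norm (f x) <= B"
  using assms(2) unfolding bounded_iff by auto
 show i: "integrable lborel (%x. indicator (box l u) x * f x)"
 proof (rule Bochner_Integration.integrable_bound)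
  show "integrable lborel (%x. B * indicator (box l u) x :: real)"
   using emeasure_lborel_box_finite[of l u] by (intro integrable_mult_right integrable_real_indicator) auto
  show "AE x in lborel. norm (indicator (box l u) x * f x) <= norm (B * indicator (box l u) x)"
   using B by (auto simp: indicator_def intro!: AE_I2) (meson abs_ge_self order_trans)
 qed (use m in simp)
 have "set_integrable lborel (box l u) f" using i by (simp add: set_integrable_def)
 thus "integral (cbox l u) f = integral\<^sup>L lborel (%x. indicator (box l u) x * f x)"
  using set_borel_integral_eq_integral(2)[of "box l u" f]
  by (simp add: set_lebesgue_integral_def integral_open_interval)
 have "f absolutely_integrable_on box l u"
  using integrable_completion[of "%x. indicator (box l u) x *\<^sub>R f x" lborel] m i
  by (auto simp: set_integrable_def)
 moreover have "negligible (cbox l u - box l u)"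
  by (rule negligible_frontier_interval)
 hence "negligible {x:box l u - cbox l u. f x ~= 0}" "negligible {x:cbox l u - box l u. f x ~= 0}"
  using box_subset_cbox[of l u] by (auto intro: negligible_subset)
 ultimately show "f absolutely_integrable_on cbox l u"
  using absolutely_integrable_spike_set_eq by blast
qed

text \<open>Fubini, followed by the fundamental theorem in the direction singled out by
  \<open>T\<close>. \<open>X\<close> is continuous up to the faces and differentiable inside only,
  as in a chart at the boundary.\<close>

lemma box_FTC:
 fixes T :: "real \<times> 'p::euclidean_space => 'b::euclidean_space"
 assumes T: "linear T" "bij_betw T Basis Basis"
  and lu: "!!t p. T (t, p) : box l u \<longleftrightarrow> a < t & t < b & p : box lp up" and "a <= b"
  and X: "continuous_on ({a..b} \<times> cbox lp up) (%(t, p). X (T (t, p)))"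
  and f: "continuous_on (box l u) f" "bounded (f ` box l u)"
  and d: "!!t p. a < t ==> t < b ==> p : box lp up ==>
    ((%t. X (T (t, p))) has_real_derivative f (T (t, p))) (at t)"
 shows "integral (cbox l u) f = integral (cbox lp up) (%p. X (T (b, p)) - X (T (a, p)))"
proof -
 have Tm [measurable]: "T : borel_measurable borel"
  using T(1) by (intro borel_measurable_continuous_onI linear_continuous_on) (simp add: linear_conv_bounded_linear)
 define g where "g = (%x. indicator (box l u) x * f x)"
 note ib = integrable_on_box_bounded[OF f, folded g_def]
 have gm [measurable]: "g : borel_measurable borel" using borel_measurable_integrable[OF ib(1)] by simp
 have "integrable (distr lborel borel T) g" using ib(1) lborel_permutation[OF T] by simp
 hence gT: "integrable lborel (%z. g (T z))" by (subst (asm) integrable_distr_eq) auto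
 have inner: "(LINT t|lborel. g (T (t, p))) = indicator (box lp up) p * (X (T (b, p)) - X (T (a, p)))" for p
 proof (cases "p : box lp up")
  case True
  have pc: "p : cbox lp up" using True box_subset_cbox by blast
  have Tc: "continuous_on {a<..<b} (%t. T (t, p))"
   using T(1) by (intro continuous_on_compose2[OF linear_continuous_on[of T UNIV]] continuous_intros)
    (auto simp: linear_conv_bounded_linear)
  have "continuous_on (box a b) (%t. f (T (t, p)))"
   by (rule continuous_on_compose2[OF f(1) Tc[folded box_real]]) (use True lu in auto)
  moreover have "bounded ((%t. f (T (t, p))) ` box a b)"
   by (rule bounded_subset[OF f(2)]) (use True lu in auto)
  ultimately have "integral (cbox a b) (%t. f (T (t, p))) = (LINT t|lborel. indicator (box a b) t * f (T (t, p)))"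
   by (rule integrable_on_box_bounded(3))
  also have "(%t. indicator (box a b) t * f (T (t, p))) = (%t. g (T (t, p)))"
   using True lu by (auto simp: g_def indicator_def)
  finally have 1: "integral {a..b} (%t. f (T (t, p))) = (LINT t|lborel. g (T (t, p)))" by simp
  have "((%t. f (T (t, p))) has_integral (X (T (b, p)) - X (T (a, p)))) {a..b}"
  proof (rule fundamental_theorem_of_calculus_interior[OF \<open>a <= b\<close>])
   show "continuous_on {a..b} (%t. X (T (t, p)))"
   proof -
    have "continuous_on {a..b} (%t. (t, p))" by (intro continuous_on_Pair continuous_on_const continuous_on_id)
    thus ?thesis using continuous_on_compose2[OF X, of "{a..b}" "%t. (t, p)"] pc by auto
   qed
   show "((%t. X (T (t, p))) has_vector_derivative f (T (t, p))) (at t)" if "t : {a<..<b}" for t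
    using d[of t p] that True by (simp add: has_real_derivative_iff_has_vector_derivative)
  qed
  thus ?thesis using 1 True by (simp add: integral_unique)
 next
  case False
  thus ?thesis using lu by (simp add: g_def indicator_def)
 qed
 have "integral (cbox l u) f = integral\<^sup>L lborel g" by (rule ib(3))
 also have "... = integral\<^sup>L (distr lborel borel T) g" using lborel_permutation[OF T] by simp
 also have "... = (LINT z|lborel. g (T z))" by (subst integral_distr) auto
 also have "... = (LINT z|(lborel \<Otimes>\<^sub>M lborel). (case z of (t, p) => g (T (t, p))))" by (simp add: lborel_prod)
 also have "... = (LINT p|lborel. (LINT t|lborel. g (T (t, p))))"
  by (subst lborel_pair.integral_snd) (use gT in \<open>auto simp: lborel_prod case_prod_unfold\<close>)
 also have "... = (LINT p|lborel. indicator (box lp up) p * (X (T (b, p)) - X (T (a, p))))"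
  by (simp add: inner)
 also have "... = integral (cbox lp up) (%p. X (T (b, p)) - X (T (a, p)))"
 proof (rule integrable_on_box_bounded(3)[symmetric])
  have "continuous_on (cbox lp up) (%p. X (T (t, p)))" if "t : {a..b}" for t
  proof -
   have "continuous_on (cbox lp up) (%p. (t, p))" by (intro continuous_on_Pair continuous_on_const continuous_on_id)
   thus ?thesis using continuous_on_compose2[OF X, of "cbox lp up" "%p. (t, p)"] that by (auto simp: image_subset_iff)
  qed
  hence c: "continuous_on (cbox lp up) (%p. X (T (b, p)) - X (T (a, p)))"
   using \<open>a <= b\<close> by (intro continuous_intros) auto
  thus "continuous_on (box lp up) (%p. X (T (b, p)) - X (T (a, p)))"
   by (rule continuous_on_subset) (rule box_subset_cbox)
  show "bounded ((%p. X (T (b, p)) - X (T (a, p))) ` box lp up)"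
   using compact_continuous_image[OF c compact_cbox] compact_imp_bounded bounded_subset image_mono[OF box_subset_cbox] by metis
 qed
 finally show ?thesis .
qed

subsection \<open>Coordinates in dimensions 2 and 3\<close>

definition ins1 :: "real \<times> (real^2) => real^3" where "ins1 = (%(t, p). vector [t, p $ 1, p $ 2])"
definition ins2 :: "real \<times> (real^2) => real^3" where "ins2 = (%(t, p). vector [p $ 1, t, p $ 2])"
definition ins3 :: "real \<times> (real^2) => real^3" where "ins3 = (%(t, p). vector [p $ 1, p $ 2, t])"

lemmas ins_defs = ins1_def ins2_def ins3_def

lemma ins_nth [simp]:
 "ins1 (t, p) $ 1 = t" "ins1 (t, p) $ 2 = p $ 1" "ins1 (t, p) $ 3 = p $ 2"
 "ins2 (t, p) $ 1 = p $ 1" "ins2 (t, p) $ 2 = t" "ins2 (t, p) $ 3 = p $ 2"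
 "ins3 (t, p) $ 1 = p $ 1" "ins3 (t, p) $ 2 = p $ 2" "ins3 (t, p) $ 3 = t"
 by (simp_all add: ins_defs)

lemma ins_linear: "linear ins1" "linear ins2" "linear ins3"
 by (auto intro!: linearI simp: vec_eq_iff forall_2 forall_3)

lemma ins_bij: "bij_betw ins1 Basis Basis" "bij_betw ins2 Basis Basis" "bij_betw ins3 Basis Basis"
proof -
 have main: "bij_betw T Basis Basis"
  if "inj T" "T ` Basis <= Basis" "DIM('x) = DIM('y)" for T :: "'x::euclidean_space => 'y::euclidean_space"
  using that card_subset_eq[of "Basis :: 'y set" "T ` Basis"]
  by (auto simp: bij_betw_def card_image inj_on_subset intro: inj_on_subset)
 have B: "axis i 1 : (Basis :: (real^'n) set)" for i :: "'n::finite" by (simp add: axis_in_Basis_iff)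
 have B2: "(Basis :: (real^2) set) = {axis 1 1, axis 2 1}" by (auto simp: Basis_vec_def exhaust_2 UNIV_2)
 have e: "ins1 (1, 0) = axis 1 1" "ins1 (0, axis 1 1) = axis 2 1" "ins1 (0, axis 2 1) = axis 3 1"
  "ins2 (1, 0) = axis 2 1" "ins2 (0, axis 1 1) = axis 1 1" "ins2 (0, axis 2 1) = axis 3 1"
  "ins3 (1, 0) = axis 3 1" "ins3 (0, axis 1 1) = axis 1 1" "ins3 (0, axis 2 1) = axis 2 1"
  by (simp_all add: vec_eq_iff forall_2 forall_3 axis_def)
 have i: "inj ins1" "inj ins2" "inj ins3"
  by (auto simp: inj_def vec_eq_iff forall_2 forall_3)
 show "bij_betw ins1 Basis Basis" "bij_betw ins2 Basis Basis" "bij_betw ins3 Basis Basis"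
  by (rule main[OF i(1)] main[OF i(2)] main[OF i(3)], force simp: Basis_prod_def B2 e B, simp)+
qed

lemma ins_box:
 "ins1 (t, p) : box l u \<longleftrightarrow> l $ 1 < t & t < u $ 1 & p : box (vector [l $ 2, l $ 3]) (vector [u $ 2, u $ 3])"
 "ins2 (t, p) : box l u \<longleftrightarrow> l $ 2 < t & t < u $ 2 & p : box (vector [l $ 1, l $ 3]) (vector [u $ 1, u $ 3])"
 "ins3 (t, p) : box l u \<longleftrightarrow> l $ 3 < t & t < u $ 3 & p : box (vector [l $ 1, l $ 2]) (vector [u $ 1, u $ 2])"
 by (auto simp: mem_box_cart forall_2 forall_3)

lemma ins_cbox:
 "ins1 (t, p) : cbox l u \<longleftrightarrow> l $ 1 <= t & t <= u $ 1 & p : cbox (vector [l $ 2, l $ 3]) (vector [u $ 2, u $ 3])"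
 "ins2 (t, p) : cbox l u \<longleftrightarrow> l $ 2 <= t & t <= u $ 2 & p : cbox (vector [l $ 1, l $ 3]) (vector [u $ 1, u $ 3])"
 "ins3 (t, p) : cbox l u \<longleftrightarrow> l $ 3 <= t & t <= u $ 3 & p : cbox (vector [l $ 1, l $ 2]) (vector [u $ 1, u $ 2])"
 by (auto simp: mem_box_cart forall_2 forall_3)

lemma ins_continuous: "continuous_on S ins1" "continuous_on S ins2" "continuous_on S ins3"
 by (simp_all add: linear_continuous_on linear_conv_bounded_linear[symmetric] ins_linear)

lemma ins_directional:
 assumes "(X has_derivative X') (at (T (t, p)))" "linear T" "T (1, 0) = e"
 shows "((%t. X (T (t, p))) has_vector_derivative X' e) (at t)"
proof -
 have eq: "T (s, p) = T (0, p) + s *\<^sub>R e" for s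
 proof -
  have "T (s, p) = T ((0, p) + s *\<^sub>R (1, 0))" by simp
  thus ?thesis using assms(3) by (simp only: linear_add[OF assms(2)] linear_scale[OF assms(2)])
 qed
 show ?thesis using directional_derivative[of X X' "T (0, p)" t e] assms(1) by (simp add: eq[symmetric])
qed

lemma ins_axis: "ins1 (1, 0) = axis 1 1" "ins2 (1, 0) = axis 2 1" "ins3 (1, 0) = axis 3 1"
 by (simp_all add: vec_eq_iff forall_2 forall_3 axis_def)

lemma box3_FTC:
 fixes X :: "real^3 => real"
 assumes "!!i. l $ i <= u $ i" "continuous_on (cbox l u) X"
  and "continuous_on (box l u) f" "bounded (f ` box l u)"
 shows "(!!y. y : box l u ==> EX X'. (X has_derivative X') (at y) & X' (axis 1 1) = f y) ==>
   integral (cbox l u) f = integral (cbox (vector [l $ 2, l $ 3]) (vector [u $ 2, u $ 3]))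
    (%p::real^2. X (vector [u $ 1, p $ 1, p $ 2]) - X (vector [l $ 1, p $ 1, p $ 2]))" (is "PROP ?h1 ==> ?c1")
  and "(!!y. y : box l u ==> EX X'. (X has_derivative X') (at y) & X' (axis 2 1) = f y) ==>
   integral (cbox l u) f = integral (cbox (vector [l $ 1, l $ 3]) (vector [u $ 1, u $ 3]))
    (%p::real^2. X (vector [p $ 1, u $ 2, p $ 2]) - X (vector [p $ 1, l $ 2, p $ 2]))" (is "PROP ?h2 ==> ?c2")
  and "(!!y. y : box l u ==> EX X'. (X has_derivative X') (at y) & X' (axis 3 1) = f y) ==>
   integral (cbox l u) f = integral (cbox (vector [l $ 1, l $ 2]) (vector [u $ 1, u $ 2]))
    (%p::real^2. X (vector [p $ 1, p $ 2, u $ 3]) - X (vector [p $ 1, p $ 2, l $ 3]))" (is "PROP ?h3 ==> ?c3")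
proof -
 have c: "continuous_on S (%(t, p). X (T (t, p)))" if "continuous_on S T" "T ` S <= cbox l u" for S T
  using continuous_on_compose2[OF assms(2) that] by (simp add: case_prod_unfold)
 have d: "((%t. X (T (t, p))) has_real_derivative f (T (t, p))) (at t)"
  if ex: "!!y. y : box l u ==> EX X'. (X has_derivative X') (at y) & X' e = f y"
   and "T (t, p) : box l u" and T: "linear T" "T (1, 0) = e"
  for T t p e
 proof -
  obtain X' where "(X has_derivative X') (at (T (t, p)))" "X' e = f (T (t, p))" using ex[OF \<open>T (t, p) : box l u\<close>] by blast
  thus ?thesis using ins_directional[OF _ T]
   by (metis has_real_derivative_iff_has_vector_derivative)
 qed
 show ?c1 if *: "PROP ?h1"
  unfolding ins1_def[THEN fun_cong, of "(_, _)", simplified prod.case, symmetric]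
  by (rule box_FTC[OF ins_linear(1) ins_bij(1) ins_box(1) assms(1) c[OF ins_continuous(1)] assms(3,4) d[OF * _ ins_linear(1) ins_axis(1)]])
   (auto simp: ins_cbox ins_box)
 show ?c2 if *: "PROP ?h2"
  unfolding ins2_def[THEN fun_cong, of "(_, _)", simplified prod.case, symmetric]
  by (rule box_FTC[OF ins_linear(2) ins_bij(2) ins_box(2) assms(1) c[OF ins_continuous(2)] assms(3,4) d[OF * _ ins_linear(2) ins_axis(2)]])
   (auto simp: ins_cbox ins_box)
 show ?c3 if *: "PROP ?h3"
  unfolding ins3_def[THEN fun_cong, of "(_, _)", simplified prod.case, symmetric]
  by (rule box_FTC[OF ins_linear(3) ins_bij(3) ins_box(3) assms(1) c[OF ins_continuous(3)] assms(3,4) d[OF * _ ins_linear(3) ins_axis(3)]])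
   (auto simp: ins_cbox ins_box)
qed

subsection \<open>Stokes' theorem for Jacobians\<close>

definition pd :: "(real^3 => real) => real^3 => 3 => real" where
 "pd f y i = fd f y (axis i 1)"

definition jac :: "(real^3 => real) => (real^3 => real) => (real^3 => real) => real^3 => real" where
 "jac a b c y = det3 (pd a y 1) (pd a y 2) (pd a y 3) (pd b y 1) (pd b y 2) (pd b y 3)
   (pd c y 1) (pd c y 2) (pd c y 3)"

abbreviation integral_2pi :: "(real^3) set => (real^3 => real) => bool" where
 "integral_2pi S f == EX k::int. f absolutely_integrable_on S & integral S f = 2 * pi * k"

abbreviation qjac :: "(real^3 => complex^2^2) => real^3 => real" where
 "qjac G == jac (%z. qx (G z)) (%z. qy (G z)) (%z. qz (G z))"

abbreviation near_pole :: "(real => bool) => bool" where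
 "near_pole P == EX w1>-1. ALL w0. -1 < w0 --> w0 < w1 --> P w0"

definition minor2 :: "(real^3 => real) => (real^3 => real) => 3 => 3 => real^3 => real" where
 "minor2 b c i j y = pd b y i * pd c y j - pd b y j * pd c y i"

lemma pd_eq: "(f has_derivative f') (at y) ==> pd f y i = f' (axis i 1)"
 using frechet_derivative_at[of f f' y] by (simp add: pd_def)

lemma pd_Ck:
 assumes "Ck_on (Suc k) W b" shows "Ck_on k W (%y. pd b y i)"
 unfolding pd_def by (rule Ck_on_SucD(2)[OF assms])

lemma minor2_Ck:
 assumes "open W" "Ck_on (Suc k) W b" "Ck_on (Suc k) W c" shows "Ck_on k W (minor2 b c i j)"
 unfolding minor2_def[abs_def] by (intro Ck_on_diff Ck_on_mult pd_Ck assms)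

text \<open>The form db^dc is closed: the second derivatives cancel in pairs by symmetry.\<close>

lemma minor2_divergence:
 assumes W: "open W" and b: "Ck_on 2 W b" and c: "Ck_on 2 W c" and y: "y : W"
 shows "pd (minor2 b c 2 3) y 1 + pd (minor2 b c 3 1) y 2 + pd (minor2 b c 1 2) y 3 = 0"
proof -
 have 2: "Ck_on (Suc (Suc 0)) W b" "Ck_on (Suc (Suc 0)) W c"
  using b c by (simp_all add: numeral_2_eq_2)
 define s where "s f i j = fd (%y. pd f y i) y (axis j 1)" for f i j
 have sym: "s b i j = s b j i" "s c i j = s c j i" for i j
  unfolding s_def pd_def using second_derivative_symmetric[OF W b y] second_derivative_symmetric[OF W c y] by auto
 have "pd (minor2 b c i j) y k = pd b y i * s c j k + s b i k * pd c y j - (pd b y j * s c i k + s b j k * pd c y i)" for i j k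
 proof -
  have d: "((%y. pd b y i) has_derivative fd (%y. pd b y i) y) (at y)"
    "((%y. pd c y i) has_derivative fd (%y. pd c y i) y) (at y)" for i
   using Ck_on_SucD(1)[OF pd_Ck y] 2 by blast+
  have "(minor2 b c i j has_derivative (%v. (pd b y i * fd (%y. pd c y j) y v
    + fd (%y. pd b y i) y v * pd c y j)
    - (pd b y j * fd (%y. pd c y i) y v
    + fd (%y. pd b y j) y v * pd c y i))) (at y)"
   unfolding minor2_def[abs_def] by (intro has_derivative_diff has_derivative_mult d)
  from pd_eq[OF this] show ?thesis by (simp add: s_def)
 qed
 thus ?thesis by (simp add: sym(1)[of 2 1] sym(1)[of 3 1] sym(1)[of 3 2] sym(2)[of 2 1] sym(2)[of 3 1] sym(2)[of 3 2])
qed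

lemma jac_divergence:
 assumes W: "open W" "y : W" and abc: "Ck_on (Suc 0) W a" "Ck_on 2 W b" "Ck_on 2 W c"
 shows "jac a b c y = pd (%y. a y * minor2 b c 2 3 y) y 1 + pd (%y. a y * minor2 b c 3 1 y) y 2 + pd (%y. a y * minor2 b c 1 2 y) y 3"
proof -
 have "Ck_on (Suc 0) W (minor2 b c i j)" for i j using minor2_Ck[OF W(1), of "Suc 0"] abc(2,3) by (simp add: numeral_2_eq_2)
 note d = has_derivative_mult[OF Ck_on_SucD(1)[OF abc(1) W(2)] Ck_on_SucD(1)[OF this W(2)]]
 have "a y * (pd (minor2 b c 2 3) y 1 + pd (minor2 b c 3 1) y 2 + pd (minor2 b c 1 2) y 3) = 0"
  using minor2_divergence[OF W(1) abc(2,3) W(2)] by simp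
 then show ?thesis unfolding pd_eq[OF d]
  by (simp add: jac_def det3_def minor2_def[of b c _ _ y] pd_def distrib_left)
qed

text \<open>Stokes for a db^dc, whose components are \<open>a\<close> times the minors. While
  \<open>b\<close> and \<open>c\<close> are controlled on \<open>W\<close> only, the products extend
  by 0 because \<open>a\<close> vanishes off the compact \<open>K\<close>.\<close>

lemma stokes_box:
 fixes a b c :: "real^3 => real" and l u :: "real^3"
 assumes lu: "!!i. l $ i <= u $ i" and W: "open W" "compact K" "K <= W"
  and bc: "Ck_on 2 W b" "Ck_on 2 W c"
  and a: "continuous_on (cbox l u) a" "!!y. y : cbox l u - K ==> a y = 0" "Ck_on 1 (box l u) a"
  and bd: "!!i. bounded ((%y. pd a y i) ` box l u)"
 defines "X == %i j y. a y * minor2 b c i j y"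
 shows "jac a b c absolutely_integrable_on cbox l u" (is ?ai)
  and "integral (cbox l u) (jac a b c) =
   integral (cbox (vector [l $ 2, l $ 3]) (vector [u $ 2, u $ 3]))
    (%p::real^2. X 2 3 (vector [u $ 1, p $ 1, p $ 2]) - X 2 3 (vector [l $ 1, p $ 1, p $ 2]))
  + integral (cbox (vector [l $ 1, l $ 3]) (vector [u $ 1, u $ 3]))
    (%p::real^2. X 3 1 (vector [p $ 1, u $ 2, p $ 2]) - X 3 1 (vector [p $ 1, l $ 2, p $ 2]))
  + integral (cbox (vector [l $ 1, l $ 2]) (vector [u $ 1, u $ 2]))
    (%p::real^2. X 1 2 (vector [p $ 1, p $ 2, u $ 3]) - X 1 2 (vector [p $ 1, p $ 2, l $ 3]))" (is ?eq)
proof -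
 have 2: "Ck_on (Suc (Suc 0)) W b" "Ck_on (Suc (Suc 0)) W c"
  using bc by (simp_all add: numeral_2_eq_2)
 have a1: "Ck_on (Suc 0) (box l u) a" using a(3) by simp
 have mC: "Ck_on (Suc 0) W (minor2 b c i j)" for i j
  by (rule minor2_Ck[OF W(1) 2])
 have mc: "continuous_on W (minor2 b c i j)" for i j by (rule Ck_on_continuous[OF mC])
 have bW: "open (box l u Int W)" "open (box l u - K)"
  using W compact_imp_closed by (auto intro: open_Int open_Diff)
 have cover: "box l u = (box l u Int W) Un (box l u - K)" using W(3) by auto
 have a0: "pd a y i = 0" if "y : box l u - K" for y i
 proof -
  have "(a has_derivative (%_. 0)) (at y)"
   by (rule has_derivative_transform_within_open[of "%_. 0", OF _ bW(2) that])
    (use a(2) box_subset_cbox in fastforce)+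
  from pd_eq[OF this] show ?thesis .
 qed
 \<comment> \<open>The partial derivatives of the components, continued by 0 off \<open>W\<close>.
   Since everything vanishes off \<open>K\<close>, continuity can be glued from the two open sets in
   \<open>cover\<close>.\<close>
 define G where "G i j k y = (if y : W then pd a y k * minor2 b c i j y + a y * pd (minor2 b c i j) y k else 0)" for i j k y
 have G0: "G i j k y = 0" if "y : box l u - K" for i j k y
  using a0[OF that] a(2)[of y] that box_subset_cbox[of l u] by (auto simp: G_def)
 have X0: "X i j y = 0" if "y : cbox l u - K" for i j y
  using a(2)[OF that] by (simp add: X_def)
 have Xc: "continuous_on (cbox l u) (X i j)" for i j
 proof -
  have "continuous_on ((cbox l u Int W) Un (cbox l u - K)) (X i j)"
  proof (rule continuous_on_Un_local_open)
   show "continuous_on (cbox l u Int W) (X i j)" unfolding X_def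
    by (intro continuous_on_mult continuous_on_subset[OF a(1)] continuous_on_subset[OF mc]) auto
   show "continuous_on (cbox l u - K) (X i j)"
    using X0 by (subst continuous_on_cong[where g = "%_. 0"]) auto
   have s: "cbox l u Int W Un (cbox l u - K) = cbox l u" using W(3) by auto
   show "openin (top_of_set (cbox l u Int W Un (cbox l u - K))) (cbox l u Int W)"
    unfolding s using W(1) by (rule openin_open_Int)
   have "cbox l u - K = cbox l u Int (- K)" by auto
   thus "openin (top_of_set (cbox l u Int W Un (cbox l u - K))) (cbox l u - K)"
    unfolding s using compact_imp_closed[OF W(2)] by (simp add: openin_open_Int open_Compl)
  qed
  moreover have "(cbox l u Int W) Un (cbox l u - K) = cbox l u" using W(3) by auto
  ultimately show ?thesis by simp
 qed
 have Gc: "continuous_on (box l u) (G i j k)" for i j k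
 proof -
  have pm: "continuous_on W (%y. pd (minor2 b c i j) y k)"
   using Ck_on_continuous[OF pd_Ck[OF mC]] .
  have pa: "continuous_on (box l u) (%y. pd a y k)"
   using Ck_on_continuous[OF pd_Ck[OF a1]] .
  have "continuous_on (box l u Int W) (%y. pd a y k * minor2 b c i j y + a y * pd (minor2 b c i j) y k)"
   using box_subset_cbox[of l u]
   by (intro continuous_on_add continuous_on_mult continuous_on_subset[OF pa] continuous_on_subset[OF pm]
     continuous_on_subset[OF mc] continuous_on_subset[OF a(1)]) auto
  hence "continuous_on (box l u Int W) (G i j k)"
   by (rule continuous_on_eq) (simp add: G_def)
  moreover have "continuous_on (box l u - K) (G i j k)"
   by (rule continuous_on_eq[OF continuous_on_const[of _ 0]]) (simp add: G0)
  ultimately show ?thesis using continuous_on_open_Un[OF bW] cover by simp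
 qed
 have Gb: "bounded (G i j k ` box l u)" for i j k
 proof -
  have bK: "bounded (f ` K)" if "continuous_on W f" for f :: "real^3 => real"
   using compact_continuous_image[OF continuous_on_subset[OF that W(3)] W(2)] compact_imp_bounded by blast
  obtain B1 where B1: "!!y. y : K ==> \<bar>minor2 b c i j y\<bar> <= B1"
   using bK[OF mc[of i j]] unfolding bounded_iff by auto
  obtain B2 where B2: "!!y. y : K ==> \<bar>pd (minor2 b c i j) y k\<bar> <= B2"
   using bK[OF Ck_on_continuous[OF pd_Ck[OF mC]], of i j k] unfolding bounded_iff by auto
  obtain B3 where B3: "!!y. y : box l u ==> \<bar>pd a y k\<bar> <= B3"
   using bd[of k] unfolding bounded_iff by auto
  obtain B4 where B4: "!!y. y : box l u ==> \<bar>a y\<bar> <= B4"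
   using compact_imp_bounded[OF compact_continuous_image[OF a(1) compact_cbox]] box_subset_cbox[of l u]
   unfolding bounded_iff by auto
  have "\<bar>G i j k y\<bar> <= max 0 (B3 * B1 + B4 * B2)" if "y : box l u" for y
  proof (cases "y : K")
   case True
   have "\<bar>G i j k y\<bar> <= \<bar>pd a y k\<bar> * \<bar>minor2 b c i j y\<bar> + \<bar>a y\<bar> * \<bar>pd (minor2 b c i j) y k\<bar>"
    unfolding G_def by (auto simp: abs_mult[symmetric] intro: abs_triangle_ineq)
   also have "... <= B3 * B1 + B4 * B2"
    using B1[OF True] B2[OF True] B3[OF that] B4[OF that] by (intro add_mono mult_mono) auto
   finally show ?thesis by simp
  qed (use G0 that in auto)
  thus ?thesis unfolding bounded_iff by auto
 qed
 have Xd: "EX X'. (X i j has_derivative X') (at y) & X' (axis k 1) = G i j k y" if y: "y : box l u" for i j k y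
 proof (cases "y : W")
  case True
  have "(X i j has_derivative (%v. a y * fd (minor2 b c i j) y v
    + fd a y v * minor2 b c i j y)) (at y)"
   unfolding X_def by (intro has_derivative_mult Ck_on_SucD(1)[OF mC True] Ck_on_SucD(1)[OF a1 y])
  moreover have "a y * fd (minor2 b c i j) y (axis k 1)
    + fd a y (axis k 1) * minor2 b c i j y = G i j k y"
   using True by (simp add: G_def pd_def)
  ultimately show ?thesis by blast
 next
  case False
  hence yK: "y : box l u - K" using y W(3) by auto
  have "(X i j has_derivative (%_. 0)) (at y)"
   by (rule has_derivative_transform_within_open[of "%_. 0", OF _ bW(2) yK])
    (use X0 box_subset_cbox in fastforce)+
  thus ?thesis using G0[OF yK] by auto
 qed
 have jac: "jac a b c y = G 2 3 1 y + G 3 1 2 y + G 1 2 3 y" if "y : box l u" for y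
 proof (cases "y : W")
  case True
  have "jac a b c y = pd a y 1 * minor2 b c 2 3 y + pd a y 2 * minor2 b c 3 1 y + pd a y 3 * minor2 b c 1 2 y"
   by (simp add: jac_def det3_def minor2_def)
  moreover have "a y * (pd (minor2 b c 2 3) y 1 + pd (minor2 b c 3 1) y 2 + pd (minor2 b c 1 2) y 3) = 0"
   using minor2_divergence[OF W(1) bc True] by simp
  ultimately show ?thesis using True by (simp add: G_def distrib_left)
 next
  case False
  hence "y : box l u - K" using that W(3) by auto
  thus ?thesis using a0 False by (simp add: jac_def det3_def G_def)
 qed
 have ai: "G i j k absolutely_integrable_on cbox l u" for i j k
  by (rule integrable_on_box_bounded(2)[OF Gc Gb])
 have sum_ai: "(%y. G 2 3 1 y + G 3 1 2 y + G 1 2 3 y) absolutely_integrable_on cbox l u"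
  by (intro set_integral_add(1) ai)
 have neg: "negligible (cbox l u - box l u)" by (rule negligible_frontier_interval)
 show ?ai
  by (rule absolutely_integrable_spike[OF sum_ai neg]) (use jac in auto)
 have gi: "G i j k integrable_on cbox l u" for i j k
  using ai set_lebesgue_integral_eq_integral(1) by blast
 have "integral (cbox l u) (jac a b c) = integral (cbox l u) (%y. G 2 3 1 y + G 3 1 2 y + G 1 2 3 y)"
  by (rule integral_spike[OF neg]) (use jac in auto)
 also have "... = integral (cbox l u) (G 2 3 1) + integral (cbox l u) (G 3 1 2) + integral (cbox l u) (G 1 2 3)"
  using gi by (simp add: integral_add integrable_add)
 also have "integral (cbox l u) (G 2 3 1) = integral (cbox (vector [l $ 2, l $ 3]) (vector [u $ 2, u $ 3]))
    (%p::real^2. X 2 3 (vector [u $ 1, p $ 1, p $ 2]) - X 2 3 (vector [l $ 1, p $ 1, p $ 2]))"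
  by (rule box3_FTC(1)[OF lu Xc Gc Gb Xd])
 also have "integral (cbox l u) (G 3 1 2) = integral (cbox (vector [l $ 1, l $ 3]) (vector [u $ 1, u $ 3]))
    (%p::real^2. X 3 1 (vector [p $ 1, u $ 2, p $ 2]) - X 3 1 (vector [p $ 1, l $ 2, p $ 2]))"
  by (rule box3_FTC(2)[OF lu Xc Gc Gb Xd])
 also have "integral (cbox l u) (G 1 2 3) = integral (cbox (vector [l $ 1, l $ 2]) (vector [u $ 1, u $ 2]))
    (%p::real^2. X 1 2 (vector [p $ 1, p $ 2, u $ 3]) - X 1 2 (vector [p $ 1, p $ 2, l $ 3]))"
  by (rule box3_FTC(3)[OF lu Xc Gc Gb Xd])
 finally show ?eq .
qed

section \<open>The local degree\<close>

lemma det_matrix_jac: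
 fixes a b c :: "real^3 => real"
 assumes "a differentiable (at y)" "b differentiable (at y)" "c differentiable (at y)"
 shows "((%y. vector [a y, b y, c y] :: real^3) has_derivative
   (%v. vector [frechet_derivative a (at y) v, fd b y v, fd c y v])) (at y)"
  and "jdet (%y. vector [a y, b y, c y] :: real^3) y = jac a b c y"
proof -
 have v: "vector [p, q, r] = p *\<^sub>R axis 1 1 + q *\<^sub>R axis 2 1 + r *\<^sub>R (axis 3 1 :: real^3)" for p q r
  by (simp add: vec_eq_iff forall_3 axis_def)
 show 1: "((%y. vector [a y, b y, c y] :: real^3) has_derivative
   (%v. vector [frechet_derivative a (at y) v, fd b y v, fd c y v])) (at y)"
  using assms unfolding v frechet_derivative_works
  by (intro has_derivative_add has_derivative_scaleR_left)
 show "jdet (%y. vector [a y, b y, c y] :: real^3) y = jac a b c y"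
  unfolding frechet_derivative_at[OF 1, symmetric]
  by (simp add: det_3 matrix_def jac_def det3_def pd_def algebra_simps)
qed

text \<open>The inverse function theorem, with the neighbourhood shrunk until the Jacobian keeps its
  sign. The last clause has the form in which a constant sign is pulled out of an integral.\<close>

lemma local_diffeo:
 fixes p :: "real^3 => real^3"
 assumes W: "open W" "m : W" and p: "Ck_on 1 W p" and reg: "jdet p m ~= 0"
 obtains U where "open U" "m : U" "U <= W" "inj_on p U" "!!U'. open U' ==> U' <= U ==> open (p ` U')"
  "!!y. y : U ==> jdet p y =
    sgn (jdet p m) * \<bar>jdet p y\<bar>"
proof -
 have p1: "Ck_on (Suc 0) W p" using p by simp
 define p' where "p' y = Blinfun (fd p y)" for y
 have d: "(p has_derivative fd p y) (at y)" if "y : W" for y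
  by (rule Ck_on_SucD(1)[OF p1 that])
 have p': "blinfun_apply (p' y) = fd p y" if "y : W" for y
  unfolding p'_def by (rule bounded_linear_Blinfun_apply[OF has_derivative_bounded_linear[OF d[OF that]]])
 have lin: "linear (fd p y)" if "y : W" for y
  using d[OF that] has_derivative_linear by blast
 have cont': "continuous_on W p'" unfolding p'_def by (rule Ck_on_blinfun_continuous[OF p1])
 have "inj (fd p m)"
  using reg det_nz_iff_inj[OF lin[OF W(2)]] by simp
 then obtain q where q: "linear q" "q o fd p m = id"
  using linear_injective_left_inverse[OF lin[OF W(2)]] by blast
 have blq: "bounded_linear q" using q(1) by (simp add: linear_conv_bounded_linear)
 have inv: "Blinfun q o\<^sub>L p' m = id_blinfun"
  by (rule blinfun_eqI) (use q(2) in \<open>simp add: bounded_linear_Blinfun_apply[OF blq] p'[OF W(2)] fun_eq_iff\<close>)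
 obtain U0 V g where U0: "open U0" "U0 <= W" "m : U0" "open V" "homeomorphism U0 V p g"
  using inverse_function_theorem[OF W(1) _ cont' W(2) inv, of p] d p' by metis
 define D where "D y = jdet p y" for y
 have "continuous_on W D"
 proof -
  have "continuous_on W (%y. fd p y v $ i)" for v i
   by (rule Ck_on_continuous[OF Ck_on_vec_nth[OF W(1) Ck_on_SucD(2)[OF p1]]])
  thus ?thesis unfolding D_def det_3 matrix_def
   by (simp, intro continuous_on_add continuous_on_diff continuous_on_mult)
 qed
 hence Dc: "continuous_on U0 D" by (rule continuous_on_subset[OF _ U0(2)])
 define U where "U = {y:U0. 0 < D y * D m}"
 have "open U" unfolding U_def
 proof -
  have "open (U0 Int (%y. D y * D m) -` {0<..})"
   by (rule continuous_open_preimage[OF continuous_on_mult[OF Dc continuous_on_const] U0(1) open_greaterThan])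
  moreover have "{y:U0. 0 < D y * D m} = U0 Int (%y. D y * D m) -` {0<..}" by auto
  ultimately show "open {y:U0. 0 < D y * D m}" by simp
 qed
 show ?thesis
 proof (rule that[OF \<open>open U\<close>])
  show "m : U" using U0(3) reg by (auto simp: U_def D_def zero_less_mult_iff linorder_neq_iff)
  show "U <= W" using U0(2) by (auto simp: U_def)
  show "inj_on p U" using homeomorphism_apply1[OF U0(5)] by (intro inj_on_inverseI[of _ g]) (auto simp: U_def)
  show "open (p ` U')" if "open U'" "U' <= U" for U'
  proof -
   have "openin (top_of_set U0) U'" using that by (auto simp: U_def openin_open_eq[OF U0(1)])
   hence "openin (top_of_set V) (p ` U')"
    by (rule homeomorphism_imp_open_map[OF U0(5)])
   thus ?thesis using openin_open_eq[OF U0(4)] by blast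
  qed
  show "jdet p y = sgn (jdet p m) * \<bar>jdet p y\<bar>" if "y : U" for y
  proof -
   have "D y = sgn (D m) * \<bar>D y\<bar>" using that by (auto simp: U_def zero_less_mult_iff)
   thus ?thesis by (simp only: D_def)
  qed
 qed
qed

text \<open>The scalar case of the change of variables for vector-valued functions, by passing
  through \<open>real^1\<close>.\<close>

lemma integral_change_of_variables_real:
 fixes f :: "real^'n::{finite,wellorder} => real" and g :: "real^'n::_ => real^'n::_"
 assumes S: "S : sets lebesgue" and der: "!!x. x : S ==> (g has_derivative g' x) (at x within S)" and inj: "inj_on g S"
 shows "((%x. \<bar>det (matrix (g' x))\<bar> * f (g x)) absolutely_integrable_on S &
     integral S (%x. \<bar>det (matrix (g' x))\<bar> * f (g x)) = b)
   \<longleftrightarrow> f absolutely_integrable_on (g ` S) & integral (g ` S) f = b"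
proof -
 have v: "(%x. vec (h x) :: real^1) absolutely_integrable_on T & integral T (%x. vec (h x) :: real^1) = vec b
   \<longleftrightarrow> h absolutely_integrable_on T & integral T h = b" for h T
 proof -
  have "(%x. vec (h x) :: real^1) absolutely_integrable_on T \<longleftrightarrow> h absolutely_integrable_on T"
   by (simp add: absolutely_integrable_on_1_iff)
  moreover have "integral T (%x. vec (h x) :: real^1) = vec (integral T h)"
   if "h absolutely_integrable_on T"
   using that by (simp add: integral_on_1_eq vec_eq_iff)
  ultimately show ?thesis by (auto simp: vec_eq_iff)
 qed
 have "(%x. \<bar>det (matrix (g' x))\<bar> *\<^sub>R (vec (f (g x)) :: real^1)) = (%x. vec (\<bar>det (matrix (g' x))\<bar> * f (g x)))"
  by (auto simp: vec_eq_iff)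
 thus ?thesis
  using has_absolute_integral_change_of_variables[OF S der inj, of "%x. vec (f x) :: real^1" "vec b"] v[of S] v[of "g ` S" f]
  by simp
qed

lemma bump_eq_defect:
 assumes "-1 < w0" "w0 < 0" "w < 0" "w\<^sup>2 + (norm v)\<^sup>2 = 1"
 shows "bump w0 v = defect w0 w"
proof -
 have w: "- sqrt (1 - (norm v)\<^sup>2) = w"
 proof -
  have "1 - (norm v)\<^sup>2 = w\<^sup>2" using assms(4) by linarith
  thus ?thesis using assms(3) by simp
 qed
 show ?thesis
 proof (cases "norm v <= sqrt (1 - w0\<^sup>2)")
  case True
  thus ?thesis using w by (simp add: bump_def)
 next
  case False
  have "w0\<^sup>2 < 1" using assms by (simp add: abs_square_less_1)
  hence "(sqrt (1 - w0\<^sup>2))\<^sup>2 < (norm v)\<^sup>2" using False by (intro power_strict_mono) auto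
  hence "w\<^sup>2 < w0\<^sup>2" using assms(4) \<open>w0\<^sup>2 < 1\<close> by simp
  hence "\<bar>w\<bar> < \<bar>w0\<bar>" by (simp add: abs_square_less_1 power2_less_imp_less power_mono_iff abs_le_square_iff not_le[symmetric])
  hence "w > w0" using assms(2,3) by simp
  thus ?thesis using False by (simp add: bump_def defect_def)
 qed
qed

lemma bump_zero: "norm v > sqrt (1 - w0\<^sup>2) ==> bump w0 v = 0"
 by (simp add: bump_def)

lemma bump_has_integral:
 assumes "-1 < w0" "w0 < 0" "cball 0 (sqrt (1 - w0\<^sup>2)) <= S"
 shows "bump w0 absolutely_integrable_on S & integral S (bump w0) = - 2 * pi"
proof -
 let ?r = "sqrt (1 - w0\<^sup>2)"
 have i: "integrable lborel (bump w0)" using bump_integral(1)[OF assms(1,2)] .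
 have "set_integrable lborel UNIV (bump w0)" using i by (simp add: set_integrable_def)
 hence "integral UNIV (bump w0) = - 2 * pi"
  using bump_integral(2)[OF assms(1,2)] set_borel_integral_eq_integral(2)[of UNIV "bump w0"] by (simp add: set_lebesgue_integral_def)
 moreover have "bump w0 absolutely_integrable_on UNIV"
  using integrable_completion[of "bump w0" lborel] i borel_measurable_integrable[OF i] by (simp add: set_integrable_def)
 ultimately have U: "bump w0 absolutely_integrable_on UNIV & integral UNIV (bump w0) = - 2 * pi" by simp
 have "(%x. if x : S then bump w0 x else 0) = bump w0"
  using assms(3) bump_zero[of w0] by (fastforce simp: fun_eq_iff not_le[symmetric])
 thus ?thesis using U
  by (metis absolutely_integrable_restrict_UNIV integral_restrict_UNIV)
qed

text \<open>The substitution z = p y turns the integral into that of \<open>bump\<close>, which is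
  supported in a ball inside the image. The constant sign \<open>s\<close> of the Jacobian is the
  local degree.\<close>

lemma local_degree_bump:
 fixes p :: "real^3 => real^3" and w :: "real^3 => real"
 assumes U: "open U" "inj_on p U" and p: "Ck_on 1 U p" and w0: "-1 < w0" "w0 < 0"
  and img: "cball 0 (sqrt (1 - w0\<^sup>2)) <= p ` U"
  and s: "!!y. y : U ==> jdet p y = s * \<bar>jdet p y\<bar>"
  and w: "!!y. y : U ==> w y < 0 & (w y)\<^sup>2 + (norm (p y))\<^sup>2 = 1"
 shows "(%y. defect w0 (w y) * jdet p y) absolutely_integrable_on U"
  and "integral U (%y. defect w0 (w y) * jdet p y) = - 2 * pi * s"
proof -
 let ?D = "%y. jdet p y"
 have p1: "Ck_on (Suc 0) U p" using p by simp
 have "(%y. \<bar>?D y\<bar> * bump w0 (p y)) absolutely_integrable_on U & integral U (%y. \<bar>?D y\<bar> * bump w0 (p y)) = - 2 * pi"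
 proof (subst integral_change_of_variables_real)
  show "U : sets lebesgue" using U(1) by (simp add: lebesgue_openin)
  show "(p has_derivative fd p x) (at x within U)" if "x : U" for x
   using Ck_on_SucD(1)[OF p1 that] by (rule has_derivative_at_withinI)
 qed (use U bump_has_integral[OF w0 img] in auto)
 hence 1: "(%y. s * (\<bar>?D y\<bar> * bump w0 (p y))) absolutely_integrable_on U"
   "integral U (%y. s * (\<bar>?D y\<bar> * bump w0 (p y))) = s * (- 2 * pi)"
  by (auto intro!: set_integrable_mult_right)
 have e: "s * (\<bar>?D y\<bar> * bump w0 (p y)) = defect w0 (w y) * ?D y" if "y : U" for y
 proof -
  have b: "bump w0 (p y) = defect w0 (w y)" using bump_eq_defect[OF w0, of "w y" "p y"] w[OF that] by simp
  have "s * (\<bar>?D y\<bar> * bump w0 (p y)) = defect w0 (w y) * (s * \<bar>?D y\<bar>)" unfolding b by (simp only: mult_ac)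
  also have "... = defect w0 (w y) * ?D y" by (simp only: s[OF that, symmetric])
  finally show ?thesis .
 qed
 show "(%y. defect w0 (w y) * ?D y) absolutely_integrable_on U"
  using 1(1) e by (subst set_integrable_cong[OF refl refl, where f' = "%y. s * (\<bar>?D y\<bar> * bump w0 (p y))"]) auto
 show "integral U (%y. defect w0 (w y) * ?D y) = - 2 * pi * s"
  using 1(2) e integral_cong[of U "%y. s * (\<bar>?D y\<bar> * bump w0 (p y))" "%y. defect w0 (w y) * ?D y"] by (simp add: mult_ac)
qed

lemma finite_disjoint_nbhds:
 fixes E :: "'m::t2_space set"
 assumes "finite E"
 shows "EX U. (ALL m:E. open (U m) & m : U m) & disjoint_family_on U E"
 using assms
proof (induction E)
 case (insert a E)
 then obtain U where U: "ALL m:E. open (U m) & m : U m" "disjoint_family_on U E" by blast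
 have "ALL m:E. EX A B. open A & open B & a : A & m : B & A Int B = {}"
  using hausdorff insert.hyps(2) by metis
 then obtain A B where AB: "ALL m:E. open (A m) & open (B m) & a : A m & m : B m & A m Int B m = {}"
  by metis
 define U' where "U' m = (if m = a then (\<Inter>m\<in>E. A m) else U m Int B m)" for m
 have "open (U' m) & m : U' m" if "m : insert a E" for m
  using that AB U insert.hyps by (auto simp: U'_def intro!: open_INT)
 moreover have "disjoint_family_on U' (insert a E)"
  using AB U(2) insert.hyps(2) unfolding disjoint_family_on_def U'_def by (simp, blast)
 ultimately show ?case by blast
qed (simp add: disjoint_family_on_def)

text \<open>\<open>\<Lambda> \<theta> a\<close> stands for \<open>a\<close> being the integral of \<open>\<theta> dx\<and>dy\<and>dz\<close>.\<close>

lemma degree_integrality: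
 fixes X :: "'m::t2_space set" and w :: "'m => real" and \<Lambda> :: "('m => real) => real => bool"
 assumes X: "compact X" and w: "continuous_on X w" "!!m. m : X ==> -1 <= w m"
  and zero: "\<Lambda> (%_. 0) 0"
  and add: "!!\<theta> \<theta>' a a'. \<Lambda> \<theta> a ==> \<Lambda> \<theta>' a' ==> \<Lambda> (%m. \<theta> m + \<theta>' m) (a + a')"
  and cong: "!!\<theta> \<theta>' a. \<Lambda> \<theta> a ==> (!!m. m : X ==> \<theta> m = \<theta>' m) ==> \<Lambda> \<theta>' a"
  and loc: "!!m. m : X ==> w m = -1 ==> EX N. open N & m : N & (ALL m':N Int X. w m' = -1 --> m' = m) &
    (ALL N'. open N' --> N' <= N --> m : N' -->
      (near_pole (%w0. EX k::int. \<Lambda> (%x. indicator N' x * defect w0 (w x)) (2 * pi * k))))"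
 shows "near_pole (%w0. EX k::int. \<Lambda> (%x. defect w0 (w x)) (2 * pi * k))"
proof -
 define E where "E = {m:X. w m = -1}"
 define P where "P m N \<longleftrightarrow> open N & m : N & (ALL m':N Int X. w m' = -1 --> m' = m) &
    (ALL N'. open N' --> N' <= N --> m : N' -->
      (near_pole (%w0. EX k::int. \<Lambda> (%x. indicator N' x * defect w0 (w x)) (2 * pi * k))))" for m N
 have "ALL m:E. EX N. P m N" using loc unfolding E_def P_def by simp
 then obtain N where "ALL m:E. P m (N m)" by metis
 hence N: "!!m. m : E ==> open (N m) & m : N m & (ALL m':N m Int X. w m' = -1 --> m' = m)"
  and Nl: "!!m N'. m : E ==> open N' ==> N' <= N m ==> m : N' ==>
      near_pole (%w0. EX k::int. \<Lambda> (%x. indicator N' x * defect w0 (w x)) (2 * pi * k))"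
  unfolding P_def by simp_all
 have Ec: "compact E"
  using closedin_compact[OF X] continuous_closedin_preimage[OF w(1), of "{-1}"]
  by (simp add: E_def vimage_def Int_def)
 \<comment> \<open>Each member of a finite subcover contains a single pole.\<close>
 have "finite E"
 proof -
  obtain C where C: "C <= N ` E" "finite C" "E <= \<Union>C"
   using compactE[OF Ec, of "N ` E"] N by (metis (no_types, lifting) UN_I imageE subsetI)
  obtain E' where E': "E' <= E" "finite E'" "C = N ` E'" using finite_subset_image[OF C(2,1)] by blast
  have "E <= E'"
  proof
   fix m assume m: "m : E"
   then obtain e where e: "e : E'" "m : N e" using C(3) E'(3) by auto
   hence "m = e" using N[of e] E'(1) m by (auto simp: E_def)
   thus "m : E'" using e by simp
  qed
  thus ?thesis using E'(2) finite_subset by blast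
 qed
 then obtain U where U: "ALL m:E. open (U m) & m : U m" "disjoint_family_on U E"
  using finite_disjoint_nbhds by blast
 define O' where "O' m = U m Int N m" for m
 have O': "open (O' m)" "m : O' m" "O' m <= N m" if "m : E" for m
  using U N that by (auto simp: O'_def)
 have disj: "O' m Int O' m' = {}" if "m : E" "m' : E" "m ~= m'" for m m'
  using U(2) that unfolding disjoint_family_on_def O'_def by blast
 obtain w1 where w1: "!!m. m : E ==> w1 m > -1"
   "!!m w0. m : E ==> -1 < w0 ==> w0 < w1 m ==> EX k::int. \<Lambda> (%x. indicator (O' m) x * defect w0 (w x)) (2 * pi * k)"
 proof -
  have "ALL m:E. near_pole (%w0. EX k::int. \<Lambda> (%x. indicator (O' m) x * defect w0 (w x)) (2 * pi * k))"
   using Nl[OF _ O'(1,3,2)] by blast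
  thus ?thesis using that by metis
 qed
 define wf where "wf = Min (insert 0 (w1 ` E))"
 have wf: "wf > -1" "!!m. m : E ==> wf <= w1 m"
  using w1(1) \<open>finite E\<close> by (auto simp: wf_def)
 have "compact (X - (UN m:E. O' m))" using X O'(1) by (intro compact_diff open_UN) auto
 moreover have "continuous_on (X - (UN m:E. O' m)) w" by (rule continuous_on_subset[OF w(1)]) auto
 moreover have "w m > -1" if "m : X - (UN m:E. O' m)" for m
  using w(2)[of m] O'(2)[of m] that by (force simp: E_def)
 \<comment> \<open>Off the chosen neighbourhoods \<open>w\<close> has a minimum above -1. For
   \<open>w0\<close> below that minimum the defect lives on the neighbourhoods alone.\<close>
 ultimately obtain wr where wr: "wr > -1" "!!m. m : X - (UN m:E. O' m) ==> wr <= w m"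
 proof (cases "X - (UN m:E. O' m) = {}")
  case True
  thus ?thesis using that[of 0] by auto
 next
  case False
  assume *: "compact (X - (UN m:E. O' m))" "continuous_on (X - (UN m:E. O' m)) w"
   "!!m. m : X - (UN m:E. O' m) ==> w m > -1"
  obtain x where "x : X - (UN m:E. O' m)" "ALL y:X - (UN m:E. O' m). w x <= w y"
   using continuous_attains_inf[OF *(1) False *(2)] by blast
  thus ?thesis using that[of "w x"] *(3) by blast
 qed
 have "EX k::int. \<Lambda> (%x. defect w0 (w x)) (2 * pi * k)" if w0: "-1 < w0" "w0 < min wf wr" for w0
 proof -
  have sum: "EX k::int. \<Lambda> (%x. SUM m:A. indicator (O' m) x * defect w0 (w x)) (2 * pi * k)" if "finite A" "A <= E" for A
   using that
  proof (induction A)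
   case empty
   thus ?case using zero by (auto intro!: exI[of _ 0])
  next
   case (insert a A)
   obtain k where k: "\<Lambda> (%x. SUM m:A. indicator (O' m) x * defect w0 (w x)) (2 * pi * real_of_int k)"
    using insert by auto
   obtain l where "\<Lambda> (%x. indicator (O' a) x * defect w0 (w x)) (2 * pi * real_of_int l)"
    using w1(2)[of a w0] w0 wf(2)[of a] insert.prems by force
   from add[OF this k] have "\<Lambda> (%x. SUM m:insert a A. indicator (O' m) x * defect w0 (w x)) (2 * pi * real_of_int l + 2 * pi * real_of_int k)"
    using insert.hyps by (simp only: sum.insert not_False_eq_True)
   thus ?case by (intro exI[of _ "l + k"]) (simp only: distrib_left of_int_add)
  qed
  obtain k where k: "\<Lambda> (%x. SUM m:E. indicator (O' m) x * defect w0 (w x)) (2 * pi * real_of_int k)"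
   using sum[OF \<open>finite E\<close>] by blast
  have "(SUM m:E. indicator (O' m) x * defect w0 (w x)) = defect w0 (w x)" if x: "x : X" for x
  proof (cases "x : (UN m:E. O' m)")
   case True
   then obtain m where m: "m : E" "x : O' m" by blast
   have "(SUM m':E. indicator (O' m') x * defect w0 (w x)) = (SUM m':E. if m' = m then defect w0 (w x) else 0)"
    using m disj[OF m(1)] by (intro sum.cong) (auto simp: indicator_def)
   thus ?thesis using m(1) \<open>finite E\<close> by simp
  next
   case False
   hence "w x > w0" using wr(2)[of x] x w0 by auto
   thus ?thesis by (simp add: defect_def)
  qed
  hence "\<Lambda> (%x. defect w0 (w x)) (2 * pi * real_of_int k)" by (intro cong[OF k])
  thus ?thesis by blast
 qed
 thus ?thesis using wf(1) wr(1) by (intro exI[of _ "min wf wr"]) auto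
qed

section \<open>Maps into \<open>SU(2)\<close>\<close>

lemma bounded_linear_q [intro]: "bounded_linear qw" "bounded_linear qx" "bounded_linear qy" "bounded_linear qz"
proof -
 have "bounded_linear (%q::complex^2^2. q $ 1 $ j)" for j
  by (rule bounded_linear_compose[OF bounded_linear_vec_nth bounded_linear_vec_nth])
 thus "bounded_linear qw" "bounded_linear qx" "bounded_linear qy" "bounded_linear qz"
  unfolding q_defs[abs_def]
  using bounded_linear_compose[OF bounded_linear_Re] bounded_linear_compose[OF bounded_linear_Im] by blast+
qed

lemma bounded_bilinear_mat: "bounded_bilinear ((**) :: complex^2^2 => complex^2^2 => complex^2^2)"
proof -
 have "bilinear ((**) :: complex^2^2 => complex^2^2 => complex^2^2)"
  unfolding bilinear_def by (auto intro!: linearI simp: vec2_eq_iff mat2_mult_nth algebra_simps scaleR_right_distrib)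
 thus ?thesis by (simp add: bilinear_conv_bounded_bilinear)
qed

lemmas continuous_on_mat = bounded_bilinear.continuous_on[OF bounded_bilinear_mat]

lemmas bounded_linear_mat_left = bounded_bilinear.bounded_linear_right[OF bounded_bilinear_mat]
lemmas has_derivative_mat = bounded_bilinear.FDERIV[OF bounded_bilinear_mat]
lemmas Ck_on_mat = Ck_on_bilinear[OF _ bounded_bilinear_mat]

lemma q_linear: "qw (X + Y) = qw X + qw Y" "qx (X + Y) = qx X + qx Y" "qy (X + Y) = qy X + qy Y" "qz (X + Y) = qz X + qz Y"
 "qw (- X) = - qw X" "qx (- X) = - qx X" "qy (- X) = - qy X" "qz (- X) = - qz X"
 "qw (X - Y) = qw X - qw Y" "qx (X - Y) = qx X - qx Y" "qy (X - Y) = qy X - qy Y" "qz (X - Y) = qz X - qz Y"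
 "qw (r *\<^sub>R X) = r * qw X" "qx (r *\<^sub>R X) = r * qx X" "qy (r *\<^sub>R X) = r * qy X" "qz (r *\<^sub>R X) = r * qz X"
 "qw 0 = 0" "qx 0 = 0" "qy 0 = 0" "qz 0 = 0"
 by (simp_all add: q_defs)

lemma quats_linear: "X : quats ==> Y : quats ==> X + Y : quats" "X : quats ==> Y : quats ==> X - Y : quats"
  "X : quats ==> - X : quats" "X : quats ==> r *\<^sub>R X : quats" "0 : quats"
 by (auto simp: quats_def)

lemma Ck_on_q:
 assumes "open U" "Ck_on k U F"
 shows "Ck_on k U (%y. qw (F y))" "Ck_on k U (%y. qx (F y))" "Ck_on k U (%y. qy (F y))" "Ck_on k U (%y. qz (F y))"
 by (intro Ck_on_compose_linear[OF assms(1) _ assms(2)] bounded_linear_q)+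

text \<open>The linear equations of \<open>quats\<close> and the equation |q| = 1 hold along
  \<open>F\<close>; differentiating them gives tangency.\<close>

lemma tangent_derivative:
 assumes "open S" "y : S" "F ` S <= SU2" "(F has_derivative F') (at y)"
 shows "tangent (F y) (F' v)"
proof -
 have SU: "F z : SU2" if "z : S" for z using assms(3) that by auto
 have d: "((%z. L (F z)) has_derivative (%v. L (F' v))) (at y)" if "bounded_linear L" for L
  by (rule bounded_linear.has_derivative[OF that assms(4)])
 have zero: "L (F' v) = 0" if "bounded_linear L" "!!q. q : SU2 ==> L q = 0" for L :: "complex^2^2 => complex"
 proof -
  have "((%z. L (F z)) has_derivative (%v. 0)) (at y)"
   by (rule has_derivative_transform_within_open[of "%_. 0", OF _ assms(1,2)]) (use SU that(2) in auto)
  from has_derivative_unique[OF this d[OF that(1)]] show ?thesis by metis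
 qed
 have ij: "bounded_linear (%q::complex^2^2. q $ i $ j)" for i j
  by (rule bounded_linear_compose[OF bounded_linear_vec_nth bounded_linear_vec_nth])
 have "bounded_linear (%q::complex^2^2. q $ 2 $ 2 - cnj (q $ 1 $ 1))" "bounded_linear (%q::complex^2^2. q $ 2 $ 1 + cnj (q $ 1 $ 2))"
  by (intro bounded_linear_sub bounded_linear_add ij bounded_linear_compose[OF bounded_linear_cnj])+
 from zero[OF this(1)] zero[OF this(2)] have "F' v : quats"
  using SU2_quats by (auto simp: quats_def eq_neg_iff_add_eq_0)
 moreover have "((%z. (qw (F z))\<^sup>2 + (qx (F z))\<^sup>2 + (qy (F z))\<^sup>2 + (qz (F z))\<^sup>2) has_derivative
   (%v. 2 * qw (F y) * qw (F' v) + 2 * qx (F y) * qx (F' v) + 2 * qy (F y) * qy (F' v) + 2 * qz (F y) * qz (F' v))) (at y)"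
  by (auto intro!: derivative_eq_intros d bounded_linear_q simp: algebra_simps)
 moreover have "((%z. (qw (F z))\<^sup>2 + (qx (F z))\<^sup>2 + (qy (F z))\<^sup>2 + (qz (F z))\<^sup>2) has_derivative (%v. 0)) (at y)"
  by (rule has_derivative_transform_within_open[of "%_. 1", OF _ assms(1,2)]) (use SU SU2_iff in auto)
 ultimately have "2 * qw (F y) * qw (F' v) + 2 * qx (F y) * qx (F' v) + 2 * qy (F y) * qy (F' v) + 2 * qz (F y) * qz (F' v) = 0"
  by (auto dest: has_derivative_unique[THEN fun_cong, of _ _ _ _ v])
 hence "qw (F y) * qw (F' v) + qx (F y) * qx (F' v) + qy (F y) * qy (F' v) + qz (F y) * qz (F' v) = 0" by linarith
 with \<open>F' v : quats\<close> show ?thesis by (simp add: tangent_def)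
qed

abbreviation D3 :: "(real^3 => complex^2^2) => real^3 => 3 => complex^2^2" where
 "D3 F y i == fd F y (axis i 1)"

abbreviation Omega3 :: "(real^3 => complex^2^2) => real^3 => real" where
 "Omega3 F y == Omega (F y) (D3 F y 1) (D3 F y 2) (D3 F y 3)"

lemma pd_q:
 assumes "F differentiable (at y)"
 shows "pd (%z. qw (F z)) y i = qw (D3 F y i)" "pd (%z. qx (F z)) y i = qx (D3 F y i)"
   "pd (%z. qy (F z)) y i = qy (D3 F y i)" "pd (%z. qz (F z)) y i = qz (D3 F y i)"
proof -
 have d: "(F has_derivative fd F y) (at y)" using assms by (simp add: frechet_derivative_works)
 note * = pd_eq[OF bounded_linear.has_derivative[OF _ d]]
 show "pd (%z. qw (F z)) y i = qw (D3 F y i)" "pd (%z. qx (F z)) y i = qx (D3 F y i)"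
   "pd (%z. qy (F z)) y i = qy (D3 F y i)" "pd (%z. qz (F z)) y i = qz (D3 F y i)"
  by (rule *[OF bounded_linear_q(1)] *[OF bounded_linear_q(2)] *[OF bounded_linear_q(3)] *[OF bounded_linear_q(4)])+
qed

text \<open>This is \<open>defect_eq\<close> multiplied by pi times the pulled-back 3-form.
  \<open>Omega_tangent\<close> turns its terms into Jacobians, and those with k and k' assemble to
  the differential of the cut-off primitive.\<close>

lemma Omega3_decomposition:
 assumes S: "open S" "y : S" "F ` S <= SU2" and F: "F differentiable (at y)" and w0: "-1 < w0" "w0 < 0"
 defines "w == %z. qw (F z)" and "x1 == %z. qx (F z)" and "x2 == %z. qy (F z)" and "x3 == %z. qz (F z)"
 shows "Omega3 F y = jac (%z. kcut w0 (w z) * x1 z) x2 x3 y + jac (%z. kcut w0 (w z) * x2 z) x3 x1 y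
   + jac (%z. kcut w0 (w z) * x3 z) x1 x2 y + defect w0 (w y) * jac x1 x2 x3 y"
proof -
 have SU: "F y : SU2" using S by auto
 have n: "(qw (F y))\<^sup>2 + (qx (F y))\<^sup>2 + (qy (F y))\<^sup>2 + (qz (F y))\<^sup>2 = 1" using SU SU2_iff by blast
 hence "(w y)\<^sup>2 <= 1" unfolding w_def by (smt (verit) zero_le_power2)
 hence "\<bar>w y\<bar> <= 1" by (simp add: abs_square_le_1)
 hence w1: "w y < 3" by linarith
 have d: "(F has_derivative fd F y) (at y)" using F by (simp add: frechet_derivative_works)
 have t: "tangent (F y) (D3 F y i)" for i by (rule tangent_derivative[OF S(1,2,3) d])
 have dq: "((%z. L (F z)) has_derivative (%v. L (fd F y v))) (at y)" if "bounded_linear L" for L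
  by (rule bounded_linear.has_derivative[OF that d])
 have kd: "((%z. kcut w0 (w z)) has_derivative (%v. kcut' w0 (w y) * qw (fd F y v))) (at y)"
  using has_derivative_compose[OF dq[OF bounded_linear_q(1)], of "kcut w0" "(*) (kcut' w0 (w y))"]
   kcut_DERIV[of w0 "w y"] w0 w1 by (simp add: has_field_derivative_def w_def)
 have pk: "pd (%z. kcut w0 (w z) * L (F z)) y i = kcut w0 (w y) * L (D3 F y i) + kcut' w0 (w y) * qw (D3 F y i) * L (F y)"
  if "bounded_linear L" for L i
  using pd_eq[OF has_derivative_mult[OF kd dq[OF that]]] by simp
 define U V T where "U = D3 F y 1" and "V = D3 F y 2" and "T = D3 F y 3"
 define Om where "Om = pi * Omega (F y) U V T"
 note OT = Omega_tangent[OF SU t t t, of 1 2 3, folded U_def V_def T_def Om_def]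
 define k k' r where "k = kcut w0 (w y)" and "k' = kcut' w0 (w y)" and "r = defect w0 (w y)"
 have de: "1 / pi = 3 * w y * k - (1 - (w y)\<^sup>2) * k' + r * w y"
  unfolding k_def k'_def r_def by (rule defect_eq[OF w0 w1])
 have "Omega (F y) U V T = (1 / pi) * Om" by (simp add: Om_def)
 also have "... = 3 * k * (w y * Om) + k' * (- (1 - (w y)\<^sup>2) * Om) + r * (w y * Om)"
  unfolding de by (simp add: algebra_simps)
 also have "... = 3 * k * det3 (qx U) (qx V) (qx T) (qy U) (qy V) (qy T) (qz U) (qz V) (qz T)
   + k' * (qx (F y) * det3 (qw U) (qw V) (qw T) (qy U) (qy V) (qy T) (qz U) (qz V) (qz T)
    + qy (F y) * det3 (qw U) (qw V) (qw T) (qz U) (qz V) (qz T) (qx U) (qx V) (qx T)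
    + qz (F y) * det3 (qw U) (qw V) (qw T) (qx U) (qx V) (qx T) (qy U) (qy V) (qy T))
   + r * det3 (qx U) (qx V) (qx T) (qy U) (qy V) (qy T) (qz U) (qz V) (qz T)"
  unfolding OT w_def by (simp add: Om_def)
 finally have main: "Omega (F y) U V T = ..." .
 show ?thesis
  unfolding jac_def x1_def x2_def x3_def pk[OF bounded_linear_q(2)] pk[OF bounded_linear_q(3)] pk[OF bounded_linear_q(4)]
   pd_q[OF F] U_def[symmetric] V_def[symmetric] T_def[symmetric] k_def[symmetric] k'_def[symmetric] r_def[symmetric] main det3_def
  by (simp add: algebra_simps)
qed

section \<open>Translates for which the pole is a regular value\<close>

definition p3 :: "complex^2^2 => real^3" where "p3 q = vector [qx q, qy q, qz q]"

lemma p3_nth [simp]: "p3 q $ 1 = qx q" "p3 q $ 2 = qy q" "p3 q $ 3 = qz q"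
 by (simp_all add: p3_def)

lemma p3_norm: "(norm (p3 q))\<^sup>2 = (qx q)\<^sup>2 + (qy q)\<^sup>2 + (qz q)\<^sup>2"
 by (simp add: norm_vec_def L2_set_def sum_3)

lemma bounded_linear_p3: "bounded_linear p3"
proof -
 have "linear p3" by (rule linearI) (simp_all add: vec_eq_iff forall_3 q_linear)
 thus ?thesis by (simp add: linear_conv_bounded_linear)
qed

text \<open>Left translation by \<open>cen v\<close> moves the point of the hemisphere \<open>w < 0\<close> above \<open>v\<close> to the pole \<open>-1\<close>.\<close>

definition qpt :: "real^3 => complex^2^2" where
 "qpt v = quat (- sqrt (1 - (norm v)\<^sup>2)) (v $ 1) (v $ 2) (v $ 3)"

definition cen :: "real^3 => complex^2^2" where "cen v = - ct (qpt v)"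

lemma qpt_SU2: assumes "norm v <= 1" shows "qpt v : SU2"
proof -
 have "(norm v)\<^sup>2 <= 1" using assms by (simp add: power_le_one)
 moreover have "(norm v)\<^sup>2 = (v $ 1)\<^sup>2 + (v $ 2)\<^sup>2 + (v $ 3)\<^sup>2"
  by (simp add: norm_vec_def L2_set_def sum_3)
 ultimately show ?thesis by (simp add: SU2_iff qpt_def)
qed

lemma SU2_minus: "q : SU2 ==> - q : SU2"
 by (simp add: SU2_iff q_linear quats_linear)

lemma cen_SU2: "norm v <= 1 ==> cen v : SU2"
 unfolding cen_def by (intro SU2_minus SU2_conj qpt_SU2)

lemma mat_minus: "(- X :: complex^2^2) ** Y = - (X ** Y)" "X ** (- Y :: complex^2^2) = - (X ** Y)"
 by (simp_all add: vec2_eq_iff mat2_mult_nth)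

lemma SU2_minus_one: assumes "q : SU2" "qw q = -1" shows "q = - mat 1"
proof -
 have "(qx q)\<^sup>2 + (qy q)\<^sup>2 + (qz q)\<^sup>2 = 0" using assms by (simp add: SU2_iff)
 hence "qx q = 0 & qy q = 0 & qz q = 0" by (smt (verit) power2_eq_iff zero_le_power2 zero_eq_power2)
 thus ?thesis using assms SU2_quats[OF assms(1)]
  by (subst quat_eq_iff) (auto simp: quats_linear q_linear SU2_quats quat_1)
qed

text \<open>All poles of a translate lie over the one point v of R^3. So the translates to be
  avoided are described by a null set in R^3, with no measure on SU(2) involved.\<close>

lemma cen_pole:
 assumes "norm v <= 1" "q : SU2" "qw (cen v ** q) = -1"
 shows "p3 q = v"
proof -
 have "cen v ** q = - mat 1" by (rule SU2_minus_one[OF SU2_mult[OF cen_SU2[OF assms(1)] assms(2)] assms(3)])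
 hence "ct (qpt v) ** q = mat 1" by (simp add: cen_def mat_minus)
 hence "qpt v ** (ct (qpt v) ** q) = qpt v" by simp
 hence "q = qpt v" using conj_transpose_SU2(2)[OF qpt_SU2[OF assms(1)]] by (simp add: matrix_mul_assoc)
 show ?thesis unfolding \<open>q = qpt v\<close> by (simp add: vec_eq_iff forall_3 qpt_def)
qed

lemma Omega_left_mult: "c : SU2 ==> q : SU2 ==> Omega (c ** q) (c ** u) (c ** v) (c ** t) = Omega q u v t"
proof -
 assume c: "c : SU2" and q: "q : SU2"
 have "matrix_inv (c ** q) ** (c ** u) = matrix_inv q ** u" for u :: "complex^2^2"
 proof -
  have "ct q ** u = ct q ** (ct c ** c) ** u"
   using conj_transpose_SU2(1)[OF c] by simp
  moreover have "ct (c ** q) = ct q ** ct c"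
   by (simp add: vec2_eq_iff mat2_mult_nth conj_transpose_def mult.commute)
  ultimately show ?thesis using c q SU2_mult by (simp add: matrix_inv_SU2 matrix_mul_assoc)
 qed
 thus ?thesis unfolding Omega_def by (simp only:)
qed

lemma D3_left_mult:
 fixes F :: "real^3 => complex^2^2" and c :: "complex^2^2"
 assumes "F differentiable (at y)"
 shows "fd (%z. c ** F z) y v = c ** fd F y v"
  and "(%z. c ** F z) differentiable (at y)"
proof -
 have d: "((%z. c ** F z) has_derivative (%v. c ** fd F y v)) (at y)"
  using bounded_linear.has_derivative[OF bounded_linear_mat_left assms[unfolded frechet_derivative_works]] .
 thus "fd (%z. c ** F z) y v = c ** fd F y v"
  using fun_cong[OF frechet_derivative_at[OF d], of v] by simp
 show "(%z. c ** F z) differentiable (at y)" using d differentiable_def by blast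
qed

lemma p3_frechet:
 assumes "F differentiable (at y)"
 shows "((%z. p3 (F z)) has_derivative (%v. p3 (fd F y v))) (at y)"
 by (rule bounded_linear.has_derivative[OF bounded_linear_p3]) (use assms in \<open>simp add: frechet_derivative_works\<close>)

lemma p3_jac:
 assumes "F differentiable (at y)"
 shows "jdet (%z. p3 (F z)) y = qjac F y"
proof -
 have "(%z. L (F z)) differentiable (at y)" if "bounded_linear L" for L :: "complex^2^2 => real"
  using bounded_linear.has_derivative[OF that] assms unfolding differentiable_def by blast
 thus ?thesis unfolding p3_def by (intro det_matrix_jac(2)) (simp_all add: bounded_linear_q)
qed

text \<open>A nonzero Jacobian of \<open>p3\<close> after \<open>F\<close> makes the derivative of
  \<open>F\<close> injective, which survives left multiplication. At the pole the tangent space is w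
  = 0, and there \<open>p3\<close> loses no information.\<close>

lemma regular_left_mult:
 assumes S: "open S" "y : S" "F ` S <= SU2" and F: "F differentiable (at y)" and c: "c : SU2"
  and pole: "c ** F y = - mat 1" and reg: "jdet (%z. p3 (F z)) y ~= 0"
 shows "jdet (%z. p3 (c ** F z)) y ~= 0"
proof -
 let ?F' = "fd F y"
 have 1: "fd (%z. p3 (F z)) y = (%v. p3 (?F' v))"
  using frechet_derivative_at[OF p3_frechet[OF F]] by simp
 have 2: "fd (%z. p3 (c ** F z)) y = (%v. p3 (c ** ?F' v))"
  using frechet_derivative_at[OF p3_frechet[OF D3_left_mult(2)[OF F, of c]]] D3_left_mult(1)[OF F, of c] by simp
 have lin1: "linear (%v. p3 (?F' v))" using has_derivative_linear[OF p3_frechet[OF F]] .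
 have lin2: "linear (%v. p3 (c ** ?F' v))"
  using has_derivative_linear[OF p3_frechet[OF D3_left_mult(2)[OF F, of c]]] D3_left_mult(1)[OF F, of c] by simp
 have inj1: "inj (%v. p3 (?F' v))" using reg det_nz_iff_inj[OF lin1] by (simp add: 1)
 have "v = 0" if v: "p3 (c ** ?F' v) = 0" for v
 proof -
  have "(%z. c ** F z) ` S <= SU2" using S(3) SU2_mult[OF c] by auto
  hence "tangent (c ** F y) (c ** ?F' v)"
   using tangent_derivative[OF S(1,2), of "%z. c ** F z"] D3_left_mult[OF F, of c] frechet_derivative_works by metis
  hence t: "c ** ?F' v : quats" "qw (c ** ?F' v) = 0"
   unfolding pole tangent_def by (simp_all add: q_linear quat_1)
  have "c ** ?F' v = 0"
   using v t by (subst quat_eq_iff) (auto simp: quats_linear q_linear vec_eq_iff forall_3)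
  hence "ct c ** (c ** ?F' v) = 0" by (simp add: vec2_eq_iff mat2_mult_nth)
  hence "?F' v = 0" using conj_transpose_SU2(1)[OF c] by (simp add: matrix_mul_assoc)
  hence "p3 (?F' v) = p3 (?F' 0)" using linear_0[OF has_derivative_linear] F
   unfolding frechet_derivative_works by metis
  thus ?thesis using inj1 by (simp add: inj_def)
 qed
 hence "inj (%v. p3 (c ** ?F' v))" using linear_injective_0[OF lin2] by blast
 thus ?thesis unfolding 2 using det_nz_iff_inj[OF lin2] by simp
qed

text \<open>Sard's theorem between spaces of equal dimension: where the determinant vanishes, the
  rank is below 3.\<close>

lemma negligible_critical_values:
 assumes "!!y. y : S ==> F differentiable (at y)"
 shows "negligible {p3 (F y) | y. y : S & jdet (%z. p3 (F z)) y = 0}"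
proof -
 let ?C = "{y:S. jdet (%z. p3 (F z)) y = 0}"
 have "negligible ((%z. p3 (F z)) ` ?C)"
 proof (rule baby_Sard[where f' = "%y. fd (%z. p3 (F z)) y"])
  fix y assume y: "y : ?C"
  have d: "((%z. p3 (F z)) has_derivative fd (%z. p3 (F z)) y) (at y)"
   using p3_frechet[OF assms] y differentiable_def frechet_derivative_works by blast
  thus "((%z. p3 (F z)) has_derivative fd (%z. p3 (F z)) y) (at y within ?C)"
   by (rule has_derivative_at_withinI)
  show "rank (matrix (fd (%z. p3 (F z)) y)) < CARD(3)"
   using y det_eq_0_rank by blast
 qed simp
 moreover have "(%z. p3 (F z)) ` ?C = {p3 (F y) | y. y : S & jdet (%z. p3 (F z)) y = 0}" by auto
 ultimately show ?thesis by simp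
qed

text \<open>One regular pole contributes 2 pi or -2 pi, on every smaller neighbourhood too, with a
  threshold for \<open>w0\<close> depending on it. The freedom to shrink is needed when the
  neighbourhoods of several poles are made disjoint.\<close>

lemma SU2_local_degree:
 fixes G :: "real^3 => complex^2^2"
 assumes W: "open W" "m : W" "G ` W <= SU2" and G: "Ck_on 1 W G" and pole: "qw (G m) = -1"
  and reg: "jdet (%z. p3 (G z)) m ~= 0"
 obtains U where "open U" "m : U" "U <= W" "!!y. y : U ==> qw (G y) = -1 ==> y = m"
  "!!U'. open U' ==> U' <= U ==> m : U' ==> near_pole (%w0. integral_2pi U' (%y. defect w0 (qw (G y)) * qjac G y))"
proof -
 have G1: "Ck_on (Suc 0) W G" using G by simp
 have diff: "G differentiable (at y)" if "y : W" for y
  using Ck_on_SucD(1)[OF G1 that] differentiable_def by blast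
 define W' where "W' = {y:W. qw (G y) < 0}"
 have "open (W Int (%y. qw (G y)) -` {..<0})"
  by (rule continuous_open_preimage[OF Ck_on_continuous[OF Ck_on_q(1)[OF W(1) G]] W(1) open_lessThan])
 moreover have "W' = W Int (%y. qw (G y)) -` {..<0}" by (auto simp: W'_def)
 ultimately have W': "open W'" "m : W'" "W' <= W" using W pole by (auto simp: W'_def)
 have pC: "Ck_on 1 W' (%z. p3 (G z))"
  by (rule Ck_on_compose_linear[OF W'(1) bounded_linear_p3 Ck_on_subset[OF G W'(3)]])
 obtain U where U: "open U" "m : U" "U <= W'" "inj_on (%z. p3 (G z)) U"
  "!!U'. open U' ==> U' <= U ==> open ((%z. p3 (G z)) ` U')"
  "!!y. y : U ==> jdet (%z. p3 (G z)) y =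
    sgn (jdet (%z. p3 (G z)) m) * \<bar>jdet (%z. p3 (G z)) y\<bar>"
  using local_diffeo[OF W'(1,2) pC reg] by blast
 let ?s = "sgn (jdet (%z. p3 (G z)) m)"
 have n: "qw (G y) < 0 & (qw (G y))\<^sup>2 + (norm (p3 (G y)))\<^sup>2 = 1" if "y : U" for y
 proof -
  have "G y : SU2" using that U(3) W'(3) W(3) by auto
  thus ?thesis using that U(3) by (auto simp: SU2_iff p3_norm W'_def)
 qed
 have p0: "p3 (G y) = 0" if "y : U" "qw (G y) = -1" for y
  using n[OF that(1)] that(2) by simp
 show ?thesis
 proof (rule that[OF U(1,2)])
  show "U <= W" using U(3) W'(3) by blast
  show "y = m" if "y : U" "qw (G y) = -1" for y
   using p0[OF that] p0[OF U(2) pole] inj_onD[OF U(4) _ that(1) U(2)] by simp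
  fix U' assume U': "open U'" "U' <= U" "m : U'"
  have "0 : (%z. p3 (G z)) ` U'" using p0[OF U(2) pole] U'(3) by (metis imageI)
  then obtain e0 where e0: "e0 > 0" "ball 0 e0 <= (%z. p3 (G z)) ` U'"
   using U(5)[OF U'(1,2)] open_contains_ball by metis
  define e where "e = min e0 (1/2)"
  have e: "0 < e" "e < 1" "ball 0 e <= (%z. p3 (G z)) ` U'" using e0 by (auto simp: e_def)
  have e2: "0 < 1 - e\<^sup>2" "0 < e\<^sup>2" using e(1,2) by (auto simp: abs_square_less_1)
  show "near_pole (%w0. integral_2pi U' (%y. defect w0 (qw (G y)) * qjac G y))"
  \<comment> \<open>For \<open>w0\<close> below this value the cap w <= \<open>w0\<close> projects
    into the ball of radius e, which the image of U' covers.\<close>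
  proof (intro exI[of _ "- sqrt (1 - e\<^sup>2)"] conjI allI impI)
   show "-1 < - sqrt (1 - e\<^sup>2)" using e2 by simp
   fix w0 :: real assume w0: "-1 < w0" "w0 < - sqrt (1 - e\<^sup>2)"
   have "w0 < 0" using w0(2) e2 by (smt (verit) real_sqrt_gt_zero)
   have "(sqrt (1 - e\<^sup>2))\<^sup>2 < (- w0)\<^sup>2" using w0(2) e2 by (intro power_strict_mono) auto
   hence "1 - w0\<^sup>2 < e\<^sup>2" using e2 by simp
   hence "sqrt (1 - w0\<^sup>2) < e" using e(1) by (intro real_less_lsqrt) auto
   hence img: "cball 0 (sqrt (1 - w0\<^sup>2)) <= (%z. p3 (G z)) ` U'" using e(3) by fastforce
   have pC': "Ck_on 1 U' (%z. p3 (G z))" by (rule Ck_on_subset[OF pC]) (use U' U in blast)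
   have inj': "inj_on (%z. p3 (G z)) U'" by (rule inj_on_subset[OF U(4) U'(2)])
   have eq: "defect w0 (qw (G y)) * jdet (%z. p3 (G z)) y
     = defect w0 (qw (G y)) * qjac G y" if "y : U'" for y
    using p3_jac[OF diff, of y] that U'(2) U(3) W'(3) by (simp add: subset_iff)
   have s': "jdet (%z. p3 (G z)) y = ?s * \<bar>jdet (%z. p3 (G z)) y\<bar>"
    if "y : U'" for y using U(6)[of y] that U'(2) by blast
   have n': "qw (G y) < 0 & (qw (G y))\<^sup>2 + (norm (p3 (G y)))\<^sup>2 = 1" if "y : U'" for y
    using n[of y] that U'(2) by blast
   note L = local_degree_bump[OF U'(1) inj' pC' w0(1) \<open>w0 < 0\<close> img s' n']
   have "(%y. defect w0 (qw (G y)) * qjac G y) absolutely_integrable_on U'"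
    using L(1) set_integrable_cong[of lebesgue lebesgue U', OF refl refl eq] by simp
   moreover have "integral U' (%y. defect w0 (qw (G y)) * qjac G y) = - 2 * pi * ?s"
   proof -
    have "integral U' (%y. defect w0 (qw (G y)) * qjac G y)
     = integral U' (%y. defect w0 (qw (G y)) * jdet (%z. p3 (G z)) y)"
     by (rule integral_cong) (simp only: eq)
    thus ?thesis using L(2) by simp
   qed
   moreover define k :: int where "k = (if ?s = 1 then -1 else 1)"
   moreover have "- 2 * pi * ?s = 2 * pi * real_of_int k"
    using reg by (auto simp: sgn_if k_def)
   ultimately show "integral_2pi U' (%y. defect w0 (qw (G y)) * qjac G y)"
    by (intro exI[of _ k]) simp
  qed
 qed
qed

section \<open>The integral over a cylinder\<close>

abbreviation square :: "(real^2) set" where "square == cbox 0 (vector [2 * pi, 2 * pi])"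

text \<open>The 2-form k(w) (x dy^dz + y dz^dx + z dx^dy), the primitive of the 3-form without
  cut-off; meaningful off the pole.\<close>

definition beta :: "complex^2^2 => complex^2^2 => complex^2^2 => real" where
 "beta q u v = kfun (qw q) * (qx q * (qy u * qz v - qy v * qz u) + qy q * (qz u * qx v - qz v * qx u)
   + qz q * (qx u * qy v - qx v * qy u))"

lemma kcut_Ck:
 assumes "-1 < w0" "w0 < 3" shows "Ck_on 1 {..<3} (kcut w0)"
 using Ck_on_field_derivI[of "{..<3}" "kcut w0" "kcut' w0" 0] kcut_DERIV[OF assms] kcut'_continuous[OF assms] by simp

lemma SU2_qw_bounds: assumes "q : SU2" shows "-1 <= qw q" "qw q <= 1"
proof -
 have "(qw q)\<^sup>2 <= 1" using assms unfolding SU2_iff by (smt (verit) zero_le_power2)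
 hence "\<bar>qw q\<bar> <= 1" by (simp add: abs_square_le_1)
 thus "-1 <= qw q" "qw q <= 1" by linarith+
qed

lemma kcut_compose_Ck:
 assumes U: "open U" "Ck_on 1 U F" "!!y. y : U ==> qw (F y) < 3" and w0: "-1 < w0" "w0 < 3"
  and L: "bounded_linear (L :: complex^2^2 => real)"
 shows "Ck_on 1 U (%y. kcut w0 (qw (F y)) * L (F y))"
 by (intro Ck_on_mult Ck_on_compose[OF U(1) _ kcut_Ck[OF w0]] Ck_on_q Ck_on_compose_linear[OF U(1) L] U) (use U(3) in auto)

lemma minimum_above:
 assumes "compact S" "continuous_on S f" "!!y. y : S ==> c < (f y :: real)"
 obtains d where "c < d" "!!y. y : S ==> d <= f y"
proof (cases "S = {}")
 case True
 thus ?thesis using that[of "c + 1"] by simp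
next
 case False
 then obtain y where "y : S" "ALL z:S. f y <= f z" using continuous_attains_inf[OF assms(1) _ assms(2)] by blast
 thus ?thesis using that[of "f y"] assms(3) by blast
qed

lemma pd_periodic:
 assumes "!!y. f (y + c) = f y" "f differentiable (at y)"
 shows "pd f (y + c) i = pd f y i"
proof -
 have "((%z. f (z - c)) has_derivative fd f y) (at (y + c))"
 proof -
  have "((%z. z - c) has_derivative (%v. v)) (at (y + c))" by (auto intro!: derivative_eq_intros)
  thus ?thesis
   using has_derivative_compose[of "%z. z - c" "%v. v" "y + c" UNIV f "fd f y"] assms(2)
   by (simp add: frechet_derivative_works)
 qed
 moreover have "f (z - c) = f z" for z using assms(1)[of "z - c"] by simp
 ultimately have "(f has_derivative fd f y) (at (y + c))" by simp
 from pd_eq[OF this] show ?thesis by (simp add: pd_def)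
qed

lemma negligible_face:
 fixes T :: "real \<times> (real^2) => real^3"
 assumes "Ck_on 1 UNIV (F :: real^3 => complex^2^2)" "linear T"
 shows "negligible (range (%p::real^2. p3 (F (T (t, p)))))"
proof (rule negligible_differentiable_image_lowdim)
 have F1: "Ck_on (Suc 0) UNIV F" using assms(1) by simp
 have "(%p::real^2. T (t, p)) differentiable (at p)" for p
 proof -
  have "((%p::real^2. T (t, p)) has_derivative (%v. T (0, v))) (at p)"
   by (rule bounded_linear.has_derivative[OF _ has_derivative_Pair[OF has_derivative_const has_derivative_ident]])
    (use assms(2) in \<open>simp add: linear_conv_bounded_linear\<close>)
  thus ?thesis unfolding differentiable_def by blast
 qed
 moreover have "(%y. p3 (F y)) differentiable (at y)" for y
  using p3_frechet[of F y] Ck_on_SucD(1)[OF F1, of y] unfolding differentiable_def by blast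
 ultimately have "(%p::real^2. p3 (F (T (t, p)))) differentiable (at p)" for p
  using differentiable_chain_at[of "%p::real^2. T (t, p)" p "%y. p3 (F y)"] by (simp add: o_def)
 thus "(%p::real^2. p3 (F (T (t, p)))) differentiable_on UNIV"
  by (simp add: differentiable_on_def differentiable_at_withinI)
qed simp

text \<open>Stokes on the box for the cut-off primitive of a translate. The lateral faces cancel by
  periodicity, on the two ends the cut-off is invisible once \<open>w0\<close> is below the values
  of w there, and the defect counts the poles inside.\<close>

theorem cylinder_integrality:
 fixes F :: "real^3 => complex^2^2"
 assumes F: "Ck_on 2 UNIV F" "range F <= SU2"
  and per: "!!y. F (y + shift 2) = F y" "!!y. F (y + shift 3) = F y"
 defines "bt == %v y. beta (cen v ** F y) (cen v ** D3 F y 2) (cen v ** D3 F y 3)"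
 obtains N where "negligible N" "!!v. v ~: N ==> norm v < 1 ==> EX k::int.
   integral (cbox 0 (vector [pi, 2 * pi, 2 * pi])) (Omega3 F) =
   integral (square) (%p::real^2. bt v (vector [pi, p $ 1, p $ 2]) - bt v (vector [0, p $ 1, p $ 2]))
   + 2 * pi * k"
proof -
 define u :: "real^3" where "u = vector [pi, 2 * pi, 2 * pi]"
 have u: "u $ 1 = pi" "u $ 2 = 2 * pi" "u $ 3 = 2 * pi" by (simp_all add: u_def)
 have lu: "(0::real^3) $ i <= u $ i" for i using exhaust_3[of i] u by auto
 have F1: "Ck_on 1 UNIV F" and F2: "Ck_on (Suc 1) UNIV F"
  using F(1) Ck_on_le[of 1 2 UNIV F] by (simp_all add: numeral_2_eq_2)
 have Fd: "F differentiable (at y)" for y using Ck_on_SucD(1)[OF F2, of y] unfolding differentiable_def by blast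
 define crit where "crit = {p3 (F y) | y. y : UNIV & jdet (%z. p3 (F z)) y = 0}"
 \<comment> \<open>Besides the critical values, the images of the faces are excluded, so that every
   pole of the translate in the closed box is an interior point.\<close>
 define N where "N = crit Un (UN t:{0, pi, 2 * pi}. range (%p::real^2. p3 (F (ins1 (t, p)))) \<union>
   range (%p::real^2. p3 (F (ins2 (t, p)))) Un range (%p::real^2. p3 (F (ins3 (t, p)))))"
 have "negligible N" unfolding N_def crit_def
  by (intro negligible_Un negligible_critical_values Fd negligible_Union)
   (auto intro!: negligible_Un negligible_face[OF F1] ins_linear)
 thus ?thesis
 proof (rule that)
  fix v :: "real^3" assume vN: "v ~: N" and v: "norm v < 1"
  define G where "G y = cen v ** F y" for y
  have cS: "cen v : SU2" using cen_SU2 v by simp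
  have GS: "G y : SU2" for y using SU2_mult[OF cS] F(2) by (auto simp: G_def)
  have G2: "Ck_on 2 UNIV G" unfolding G_def[abs_def]
   by (rule Ck_on_compose_linear[OF open_UNIV bounded_linear_mat_left F(1)])
  hence G1: "Ck_on 1 UNIV G" using Ck_on_le[of 1 2 UNIV G] by simp
  have G2': "Ck_on (Suc 1) UNIV G" using G2 by (simp add: numeral_2_eq_2)
  have Gd: "G differentiable (at y)" for y using Ck_on_SucD(1)[OF G2', of y] unfolding differentiable_def by blast
  have DG: "D3 G y i = cen v ** D3 F y i" for y i unfolding G_def[abs_def] by (rule D3_left_mult(1)[OF Fd])
  have Om: "Omega3 G y = Omega3 F y" for y
   using Omega_left_mult[OF cS] F(2) by (simp add: DG) (simp add: G_def image_subset_iff)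
  define w x1 x2 x3 where "w y = qw (G y)" and "x1 y = qx (G y)" and "x2 y = qy (G y)" and "x3 y = qz (G y)" for y
  have wx: "w = (%y. qw (G y))" "x1 = (%y. qx (G y))" "x2 = (%y. qy (G y))" "x3 = (%y. qz (G y))"
   by (auto simp: w_def x1_def x2_def x3_def)
  have xC: "Ck_on 2 UNIV w" "Ck_on 2 UNIV x1" "Ck_on 2 UNIV x2" "Ck_on 2 UNIV x3"
   unfolding wx by (rule Ck_on_q[OF open_UNIV G2])+
  have x1C: "Ck_on 1 UNIV x1" "Ck_on 1 UNIV x2" "Ck_on 1 UNIV x3"
   using xC Ck_on_le[of 1 2] by auto
  have wc: "continuous_on S w" for S using Ck_on_continuous[OF xC(1)] continuous_on_subset by blast
  have wb: "-1 <= w y" "w y < 3" for y using SU2_qw_bounds[OF GS[of y]] by (auto simp: w_def)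
  have pole: "p3 (F y) = v" if "w y = -1" for y
   using cen_pole[of v "F y"] v F(2) that by (auto simp: w_def G_def)
  have face: "w (ins1 (t, p)) ~= -1" "w (ins2 (t, p)) ~= -1" "w (ins3 (t, p)) ~= -1" if "t : {0, pi, 2 * pi}" for t p
   using pole vN that unfolding N_def by blast+
  have inner: "y : box 0 u" if "y : cbox 0 u" "w y = -1" for y
  proof -
   have e: "y = ins1 (y $ 1, vector [y $ 2, y $ 3])" "y = ins2 (y $ 2, vector [y $ 1, y $ 3])"
    "y = ins3 (y $ 3, vector [y $ 1, y $ 2])" by (simp_all add: vec_eq_iff forall_3)
   have "y $ i ~: {0, pi, 2 * pi} | (i ~= 1 & y $ i = pi)" for i
    using face[of "y $ i"] that(2) e exhaust_3[of i] by metis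
   hence "y $ i ~= 0 & y $ i ~= u $ i" for i using exhaust_3[of i] u by force
   thus ?thesis using that(1) by (auto simp: mem_box_cart order_less_le)
  qed
  define J where "J = jac x1 x2 x3"
  define \<Lambda> where "\<Lambda> \<theta> a \<longleftrightarrow> ((%y. \<theta> y * J y) has_integral a) (cbox 0 u)" for \<theta> a
  have "near_pole (%w0. EX k::int. \<Lambda> (%x. defect w0 (w x)) (2 * pi * k))"
  proof (rule degree_integrality[OF compact_cbox wc wb(1)])
   show "\<Lambda> (%_. 0) 0" by (simp add: \<Lambda>_def)
   show "\<Lambda> (%m. \<theta> m + \<theta>' m) (a + a')" if "\<Lambda> \<theta> a" "\<Lambda> \<theta>' a'" for \<theta> \<theta>' a a'
    using has_integral_add that unfolding \<Lambda>_def by (simp add: distrib_right)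
   show "\<Lambda> \<theta>' a" if "\<Lambda> \<theta> a" "!!m. m : cbox 0 u ==> \<theta> m = \<theta>' m" for \<theta> \<theta>' a
    using that unfolding \<Lambda>_def by (metis (no_types, lifting) has_integral_eq)
   fix m assume m: "m : cbox 0 u" "w m = -1"
   have mb: "m : box 0 u" by (rule inner[OF m])
   have "jdet (%z. p3 (F z)) m ~= 0"
    using vN pole[OF m(2)] unfolding N_def crit_def by blast
   moreover have "cen v ** F m = - mat 1" using SU2_minus_one[OF GS[of m]] m(2) by (simp add: w_def G_def)
   ultimately have reg: "jdet (%z. p3 (G z)) m ~= 0"
    unfolding G_def using regular_left_mult[OF open_UNIV UNIV_I F(2) Fd cS] by blast
   have Gb: "G ` box 0 u <= SU2" "Ck_on 1 (box 0 u) G" using GS Ck_on_subset[OF G1] by auto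
   obtain U where U: "open U" "m : U" "U <= box 0 u" "!!y. y : U ==> qw (G y) = -1 ==> y = m"
    "!!U'. open U' ==> U' <= U ==> m : U' ==> near_pole (%w0. integral_2pi U' (%y. defect w0 (qw (G y)) * qjac G y))"
    using SU2_local_degree[OF open_box mb Gb m(2)[unfolded w_def] reg] by blast
   show "EX N. open N & m : N & (ALL m':N Int cbox 0 u. w m' = -1 --> m' = m) &
    (ALL N'. open N' --> N' <= N --> m : N' -->
      (near_pole (%w0. EX k::int. \<Lambda> (%x. indicator N' x * defect w0 (w x)) (2 * pi * k))))"
   proof (intro exI[of _ U] conjI U(1,2) allI impI ballI)
    show "m' = m" if "m' : U Int cbox 0 u" "w m' = -1" for m' using U(4) that by (simp add: w_def)
    fix N' assume N': "open N'" "N' <= U" "m : N'"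
    obtain w1 where w1: "w1 > -1" "!!w0. -1 < w0 ==> w0 < w1 ==>
     (integral_2pi N' (%y. defect w0 (w y) * J y))"
     using U(5)[OF N'] unfolding J_def wx by blast
    have "EX k::int. \<Lambda> (%x. indicator N' x * defect w0 (w x)) (2 * pi * k)" if "-1 < w0" "w0 < w1" for w0
    proof -
     obtain k :: int where k: "(%y. defect w0 (w y) * J y) absolutely_integrable_on N'" "integral N' (%y. defect w0 (w y) * J y) = 2 * pi * k"
      using w1(2)[OF \<open>-1 < w0\<close> \<open>w0 < w1\<close>] by blast
     hence "((%y. defect w0 (w y) * J y) has_integral 2 * pi * k) N'"
      by (metis integrable_integral set_lebesgue_integral_eq_integral(1))
     moreover have "N' <= cbox 0 u" using N'(2) U(3) box_subset_cbox by blast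
     ultimately have "((%y. if y : N' then defect w0 (w y) * J y else 0) has_integral 2 * pi * k) (cbox 0 u)"
      by (simp add: has_integral_restrict)
     moreover have "(%y. if y : N' then defect w0 (w y) * J y else 0) = (%y. indicator N' y * defect w0 (w y) * J y)"
      by (auto simp: indicator_def)
     ultimately show ?thesis unfolding \<Lambda>_def by (intro exI[of _ k]) simp
    qed
    thus "near_pole (%w0. EX k::int. \<Lambda> (%x. indicator N' x * defect w0 (w x)) (2 * pi * k))"
     using w1(1) by blast
   qed
  qed
  then obtain w1 where w1: "w1 > -1" "!!w0. -1 < w0 ==> w0 < w1 ==> EX k::int. \<Lambda> (%x. defect w0 (w x)) (2 * pi * k)"
   by blast
  have wface: "EX d>-1. ALL p:square. d <= w (ins1 (t, p))" if "t : {0, pi, 2 * pi}" for t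
  proof -
   have "continuous_on (square) (%p. w (ins1 (t, p)))"
   proof (rule continuous_on_compose2[OF wc[of UNIV]])
    have "continuous_on (square) (%p::real^2. (t, p))"
     by (intro continuous_on_Pair continuous_on_const continuous_on_id)
    thus "continuous_on (square) (%p::real^2. ins1 (t, p))"
     using continuous_on_compose2[OF ins_continuous(1)[of UNIV]] by blast
   qed simp
   moreover have "-1 < w (ins1 (t, p))" for p using face(1)[OF that, of p] wb(1)[of "ins1 (t, p)"] by linarith
   ultimately show ?thesis using minimum_above[OF compact_cbox, of 0 "vector [2 * pi, 2 * pi]" "%p. w (ins1 (t, p))" "-1"] by metis
  qed
  obtain d0 where d0: "d0 > -1" "!!p. p : square ==> d0 <= w (ins1 (0, p))" using wface[of 0] by auto
  obtain d1 where d1: "d1 > -1" "!!p. p : square ==> d1 <= w (ins1 (pi, p))" using wface[of pi] by auto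
  \<comment> \<open>Halfway between -1 and the smallest threshold; \<open>d0\<close> and
    \<open>d1\<close> bound w from below on the two ends.\<close>
  define w0 where "w0 = (-1 + min 0 (min w1 (min d0 d1))) / 2"
  have w0: "-1 < w0" "w0 < 0" "w0 < w1" "w0 < d0" "w0 < d1" "w0 < 3"
   using w1(1) d0(1) d1(1) by (auto simp: w0_def)
  obtain k :: int where k: "((%y. defect w0 (w y) * J y) has_integral (2 * pi * k)) (cbox 0 u)"
   using w1(2)[OF w0(1,3)] unfolding \<Lambda>_def by blast
  define A where "A = (%L y. kcut w0 (qw (G y)) * L (G y) :: real)"
  define X where "X i j y = A qx y * minor2 x2 x3 i j y + A qy y * minor2 x3 x1 i j y + A qz y * minor2 x1 x2 i j y" for i j y
  note L = bounded_linear_q(2,3,4)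
  have AC: "Ck_on (Suc 0) UNIV (A L)" if "bounded_linear L" for L unfolding A_def
   using kcut_compose_Ck[OF open_UNIV G1 _ w0(1,6) that] wb(2) by (simp add: w_def)
  have mC: "Ck_on (Suc 0) UNIV (minor2 b c i j)" if "Ck_on 2 UNIV b" "Ck_on 2 UNIV c" for b c i j
   using minor2_Ck[of UNIV "Suc 0" b c] that by (simp add: numeral_2_eq_2)
  have AmC: "Ck_on (Suc 0) UNIV (%y. A L y * minor2 b c i j y)" if "bounded_linear L" "Ck_on 2 UNIV b" "Ck_on 2 UNIV c" for L b c i j
   by (rule Ck_on_mult[OF open_UNIV AC[OF that(1)] mC[OF that(2,3)]])
  note X3 = AmC[OF L(1) xC(3,4)] AmC[OF L(2) xC(4,2)] AmC[OF L(3) xC(2,3)]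
  have XC: "Ck_on (Suc 0) UNIV (X i j)" for i j unfolding X_def[abs_def] by (intro Ck_on_add open_UNIV X3)
  have Xd: "pd (X i j) y k = pd (%y. A qx y * minor2 x2 x3 i j y) y k + pd (%y. A qy y * minor2 x3 x1 i j y) y k
    + pd (%y. A qz y * minor2 x1 x2 i j y) y k" for i j y k
   unfolding X_def[abs_def]
   using pd_eq[OF has_derivative_add[OF has_derivative_add[OF Ck_on_SucD(1)[OF X3(1) UNIV_I] Ck_on_SucD(1)[OF X3(2) UNIV_I]] Ck_on_SucD(1)[OF X3(3) UNIV_I]]]
   by (simp add: pd_def)
  have dec: "Omega3 F y = pd (X 2 3) y 1 + pd (X 3 1) y 2 + pd (X 1 2) y 3 + defect w0 (w y) * J y" for y
   using Omega3_decomposition[OF open_UNIV UNIV_I image_subsetI[OF GS] Gd w0(1,2), of y] Om[of y] jac_divergence[OF open_UNIV UNIV_I AC[OF L(1)] xC(3,4), of y]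
    jac_divergence[OF open_UNIV UNIV_I AC[OF L(2)] xC(4,2), of y] jac_divergence[OF open_UNIV UNIV_I AC[OF L(3)] xC(2,3), of y]
   unfolding Xd A_def wx J_def by linarith
  have pdc: "continuous_on S (%y. pd (X i j) y k)" for S i j k
   using Ck_on_continuous[OF pd_Ck[OF XC]] continuous_on_subset by blast
  have bd: "bounded ((%y. pd (X i j) y k) ` box 0 u)" for i j k
   using compact_imp_bounded[OF compact_continuous_image[OF pdc compact_cbox]] bounded_subset image_mono[OF box_subset_cbox] by metis
  have Xper: "X i j (y + shift l) = X i j y" if l: "l = 2 | l = 3" for i j l y
  proof -
   have G: "G (y + shift l) = G y" for y using l per by (auto simp: G_def)
   have "pd f (y + shift l) k = pd f y k" if "Ck_on 2 UNIV f" "f = (%y. L (G y))" for f L k y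
    using pd_periodic[of f "shift l" y k] Ck_on_SucD(1)[of 1 UNIV f y] that G unfolding differentiable_def by (auto simp: numeral_2_eq_2)
   from this[OF xC(2) wx(2)] this[OF xC(3) wx(3)] this[OF xC(4) wx(4)] show ?thesis
    unfolding X_def A_def minor2_def by (simp add: G)
  qed
  have e: "vector [r, 2 * pi, s] = vector [r, 0, s] + (shift 2 :: real^3)" "vector [r, s, 2 * pi] = vector [r, s, 0] + (shift 3 :: real^3)" for r s
   by (simp_all add: vec_eq_iff forall_3 axis_def)
  have z: "(vector [0, 0] :: real^2) = 0" by (simp add: vec_eq_iff forall_2)
  have Xc: "continuous_on S (X i j)" for S i j using Ck_on_continuous[OF XC] continuous_on_subset by blast
  have d: "EX f'. (X i j has_derivative f') (at y) & f' (axis k 1) = pd (X i j) y k" for i j k y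
   using Ck_on_SucD(1)[OF XC UNIV_I] by (auto simp: pd_def)
  note I = box3_FTC(1)[OF lu Xc pdc bd d, of 2 3] box3_FTC(2)[OF lu Xc pdc bd d, of 3 1] box3_FTC(3)[OF lu Xc pdc bd d, of 1 2]
  have i: "(%y. pd (X i j) y k) integrable_on cbox 0 u" for i j k by (rule integrable_continuous[OF pdc])
  have "(Omega3 F has_integral (integral (cbox 0 u) (%y. pd (X 2 3) y 1) + integral (cbox 0 u) (%y. pd (X 3 1) y 2)
    + integral (cbox 0 u) (%y. pd (X 1 2) y 3) + 2 * pi * k)) (cbox 0 u)"
   unfolding dec[abs_def] by (intro has_integral_add integrable_integral i k)
  then have "integral (cbox 0 u) (Omega3 F) =
   integral (square) (%p::real^2. X 2 3 (vector [pi, p $ 1, p $ 2]) - X 2 3 (vector [0, p $ 1, p $ 2])) + 2 * pi * k"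
   using I by (simp add: integral_unique u z e Xper)
  also have "integral (square) (%p::real^2. X 2 3 (vector [pi, p $ 1, p $ 2]) - X 2 3 (vector [0, p $ 1, p $ 2]))
   = integral (square) (%p::real^2. bt v (vector [pi, p $ 1, p $ 2]) - bt v (vector [0, p $ 1, p $ 2]))"
  proof (rule integral_cong)
   fix p :: "real^2" assume p: "p : square"
   have "w0 < w (vector [pi, p $ 1, p $ 2])" "w0 < w (vector [0, p $ 1, p $ 2])"
    using d0(2)[OF p] d1(2)[OF p] w0(4,5) unfolding ins1_def by simp_all
   moreover have "X 2 3 y = bt v y" if "w0 < w y" for y
    using that unfolding X_def A_def minor2_def wx pd_q[OF Gd] bt_def beta_def DG[symmetric]
    by (simp add: kcut_def G_def algebra_simps)
   ultimately show "X 2 3 (vector [pi, p $ 1, p $ 2]) - X 2 3 (vector [0, p $ 1, p $ 2]) = bt v (vector [pi, p $ 1, p $ 2]) - bt v (vector [0, p $ 1, p $ 2])"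
    by simp
  qed
  finally show "EX k::int. integral (cbox 0 (vector [pi, 2 * pi, 2 * pi])) (Omega3 F) =
   integral (square) (%p::real^2. bt v (vector [pi, p $ 1, p $ 2]) - bt v (vector [0, p $ 1, p $ 2]))
   + 2 * pi * k" unfolding u_def by blast
 qed
qed

section \<open>Compact oriented 3-manifolds with boundary\<close>

subsection \<open>Functions with local extensions of class \<open>C\<^sup>k\<close>\<close>

text \<open>The version of \<open>locally_smooth_on\<close> for a fixed finite order: the cut-off
  factors are of class C^1 only.\<close>

definition locCk :: "nat => 'a::real_normed_vector set => ('a => 'b::real_normed_vector) => bool" where
 "locCk k S f \<longleftrightarrow> (ALL y:S. EX W F. open W & y : W & Ck_on k W F & (ALL z:W Int S. F z = f z))"

lemma locCkI:
 "(!!y. y : S ==> EX W F. open W & y : W & Ck_on k W F & (ALL z:W Int S. F z = f z)) ==> locCk k S f"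
 by (simp add: locCk_def)

lemma locCkE:
 assumes "locCk k S f" "y : S"
 obtains W F where "open W" "y : W" "Ck_on k W F" "ALL z:W Int S. F z = f z"
proof -
 from assms have "EX W F. open W & y : W & Ck_on k W F & (ALL z:W Int S. F z = f z)"
  unfolding locCk_def by (rule bspec)
 thus thesis by (elim exE conjE) (rule that)
qed

lemma locally_smooth_locCk: assumes "locally_smooth_on S f" shows "locCk k S f"
proof (rule locCkI)
 fix y assume "y : S"
 hence "EX W F. open W & y : W & smooth_on W F & (ALL z:W Int S. F z = f z)"
  using assms unfolding locally_smooth_on_def by simp
 thus "EX W F. open W & y : W & Ck_on k W F & (ALL z:W Int S. F z = f z)"
  by (elim exE conjE) (intro exI conjI smooth_on_Ck, assumption+)
qed

lemma locCk_le: assumes "m <= k" "locCk k S f" shows "locCk m S f"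
proof (rule locCkI)
 fix y assume "y : S"
 then obtain W F where "open W" "y : W" "Ck_on k W F" "ALL z:W Int S. F z = f z" by (rule locCkE[OF assms(2)])
 thus "EX W F. open W & y : W & Ck_on m W F & (ALL z:W Int S. F z = f z)"
  by (intro exI[of _ W] exI[of _ F] conjI Ck_on_le[OF assms(1)])
qed

lemma locCk_continuous: assumes "locCk k S f" shows "continuous_on S f"
proof (rule continuous_on_eq_continuous_within[THEN iffD2], rule ballI)
 fix y assume y: "y : S"
 then obtain W F where W: "open W" "y : W" "Ck_on k W F" "ALL z:W Int S. F z = f z"
  by (rule locCkE[OF assms(1)])
 have "continuous (at y within W Int S) F"
  using continuous_on_subset[OF Ck_on_continuous[OF W(3)], of "W Int S"] W(2) y
  by (simp add: continuous_on_eq_continuous_within)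
 hence "continuous (at y within W Int S) f"
  using W(4) y W(2) by (intro continuous_transform_within[of y "W Int S" F 1 f]) auto
 thus "continuous (at y within S) f"
  using at_within_nhd[OF W(2,1), of S "W Int S"] unfolding continuous_within by (simp add: Int_ac)
qed

text \<open>At a point of an open subset the local extension coincides with \<open>f\<close> on a
  full neighbourhood.\<close>

lemma locCk_open:
 assumes "open U" "U <= S" "locCk k S f" shows "Ck_on k U f"
proof (rule Ck_on_open_UN)
 fix y assume y: "y : U"
 then obtain W F where W: "open W" "y : W" "Ck_on k W F" "ALL z:W Int S. F z = f z"
  using assms(2) by (elim locCkE[OF assms(3) subsetD])
 have "Ck_on k (W Int U) f"
  using Ck_on_cong[of "W Int U" F f k] W Ck_on_subset[OF W(3), of "W Int U"] assms(1,2) by (auto simp: open_Int)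
 thus "EX W. open W & y : W & Ck_on k W f" using W assms(1) y by (intro exI[of _ "W Int U"]) (simp add: open_Int)
qed

lemma locCk_const: "locCk k S (%_. c)"
 unfolding locCk_def by (intro ballI exI[of _ UNIV] exI[of _ "%_. c"]) auto

lemma locCk_compose:
 fixes f :: "'a::real_normed_vector => 'b::euclidean_space"
 assumes "locCk k S f" "open V" "Ck_on k V g" "f ` S <= V"
 shows "locCk k S (%y. g (f y))"
 unfolding locCk_def
proof
 fix y assume y: "y : S"
 then obtain W F where W: "open W" "y : W" "Ck_on k W F" "ALL z:W Int S. F z = f z"
  by (rule locCkE[OF assms(1)])
 have o: "open (W Int F -` V)" by (rule continuous_open_preimage[OF Ck_on_continuous[OF W(3)] W(1) assms(2)])
 have "Ck_on k (W Int F -` V) (%z. g (F z))"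
  by (rule Ck_on_compose[OF o Ck_on_subset[OF W(3)] assms(3)]) auto
 moreover have "y : W Int F -` V" using W y assms(4) by auto
 ultimately show "EX W F. open W & y : W & Ck_on k W F & (ALL z:W Int S. F z = g (f z))"
  using o W(4) by (intro exI[of _ "W Int F -` V"] exI[of _ "%z. g (F z)"]) auto
qed

lemma locCk_linear: "bounded_linear L ==> locCk k S f ==> locCk k S (%y. L (f y))"
 unfolding locCk_def
proof
 fix y assume L: "bounded_linear L" and y: "y : S" and "ALL y:S. EX W F. open W & y : W & Ck_on k W F & (ALL z:W Int S. F z = f z)"
 then obtain W F where "open W" "y : W" "Ck_on k W F" "ALL z:W Int S. F z = f z" by meson
 thus "EX W F. open W & y : W & Ck_on k W F & (ALL z:W Int S. F z = L (f z))"
  using Ck_on_compose_linear[OF _ L] by (intro exI[of _ W] exI[of _ "%z. L (F z)"]) auto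
qed

lemma locCk_map2:
 fixes f :: "'a::real_normed_vector => 'b::real_normed_vector" and g :: "'a => 'c::real_normed_vector"
 assumes "locCk k S f" "locCk k S g"
  and "!!W (F :: 'a => 'b) (G :: 'a => 'c). open W ==> Ck_on k W F ==> Ck_on k W G ==> Ck_on k W (%y. h (F y) (G y))"
 shows "locCk k S (%y. h (f y) (g y))"
 unfolding locCk_def
proof
 fix y assume y: "y : S"
 then obtain W F where W: "open W" "y : W" "Ck_on k W F" "ALL z:W Int S. F z = f z"
  by (rule locCkE[OF assms(1)])
 obtain W' G where W': "open W'" "y : W'" "Ck_on k W' G" "ALL z:W' Int S. G z = g z"
  by (rule locCkE[OF assms(2) y])
 have "Ck_on k (W Int W') (%y. h (F y) (G y))"
  by (rule assms(3)[OF open_Int[OF W(1) W'(1)] Ck_on_subset[OF W(3)] Ck_on_subset[OF W'(3)]]) auto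
 thus "EX W F. open W & y : W & Ck_on k W F & (ALL z:W Int S. F z = h (f z) (g z))"
  using W W' by (intro exI[of _ "W Int W'"] exI[of _ "%y. h (F y) (G y)"]) (auto simp: open_Int)
qed

lemma locCk_mult: "locCk k S f ==> locCk k S g ==> locCk k S (%y. f y * (g y :: real))"
 by (rule locCk_map2) (auto intro: Ck_on_mult)

lemma locCk_add: "locCk k S f ==> locCk k S g ==> locCk k S (%y. f y + g y)"
 by (rule locCk_map2) (auto intro: Ck_on_add)

lemma locCk_sum: "(!!i. i : I ==> locCk k S (f i)) ==> locCk k S (%y. SUM i:I. f i y)"
 by (induction I rule: infinite_finite_induct) (auto intro: locCk_const locCk_add)

lemma locCk_inverse:
 assumes "locCk k S f" "!!y. y : S ==> 0 < f y" shows "locCk k S (%y. 1 / (f y :: real))"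
proof -
 have "locCk k S (%y. f y powr -1)"
  by (rule locCk_compose[OF assms(1) open_greaterThan Ck_on_powr]) (use assms(2) in auto)
 moreover have "f y powr -1 = 1 / f y" if "y : S" for y using assms(2)[OF that] by (simp add: powr_minus_divide)
 ultimately show ?thesis unfolding locCk_def by simp
qed

lemma locCk_openin:
 assumes "!!y. y : S ==> EX A. openin (top_of_set S) A & y : A & locCk k A f"
 shows "locCk k S f"
 unfolding locCk_def
proof
 fix y assume "y : S"
 then obtain A where A: "openin (top_of_set S) A" "y : A" "locCk k A f" using assms by blast
 then obtain W F where W: "open W" "y : W" "Ck_on k W F" "ALL z:W Int A. F z = f z" unfolding locCk_def by meson
 obtain O' where O': "open O'" "A = S Int O'" using A(1) by (auto simp: openin_open)
 show "EX W F. open W & y : W & Ck_on k W F & (ALL z:W Int S. F z = f z)"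
  using W O' A(2) Ck_on_subset[OF W(3), of "W Int O'"]
  by (intro exI[of _ "W Int O'"] exI[of _ F]) (auto simp: open_Int)
qed

lemma locCk_cong: "locCk k S f ==> (!!y. y : S ==> f y = g y) ==> locCk k S g"
 by (simp add: locCk_def)

subsection \<open>Charts and transition maps\<close>

lemma negligible_boundary_plane: "negligible {y::real^3. y $ 1 = 0}"
 using negligible_standard_hyperplane[of "axis 1 1 :: real^3" 0] by (simp add: axis_in_Basis_iff inner_axis)

lemma closed_boundary_plane: "closed {y::real^3. y $ 1 = 0}"
 by (intro closed_Collect_eq continuous_intros)

lemma half_space_closed: "closed half_space"
 unfolding half_space_def by (rule closed_halfspace_component_le_cart)

lemma openin_half_space_borel: "openin (top_of_set half_space) A ==> A : sets borel"
 using half_space_closed by (auto simp: openin_open)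

lemma openin_half_space_interior:
 assumes "openin (top_of_set half_space) A" shows "open {y:A. y $ 1 < 0}"
proof -
 obtain O' where O': "open O'" "A = half_space Int O'" using assms by (auto simp: openin_open)
 hence "{y:A. y $ 1 < 0} = O' Int {y. y $ 1 < 0}" by (auto simp: half_space_def)
 thus ?thesis using O'(1) by (simp add: open_Int open_halfspace_component_lt_cart)
qed

locale mfd =
 fixes M :: "'m::t2_space set" and cs :: "'m chart list"
 assumes mfd: "compact_oriented_3manifold M cs"
begin

abbreviation "n == length cs"
abbreviation "U i == fst (cs ! i)"
abbreviation "\<phi> i == snd (cs ! i)"
abbreviation "\<psi> i == inv_into (U i) (\<phi> i)"
abbreviation "V i == \<phi> i ` U i"
definition "piece i = U i - (\<Union>j<i. U j)"
abbreviation "T i j == \<phi> j o \<psi> i"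

lemma chart:
 assumes "i < n"
 shows "openin (top_of_set M) (U i)" "openin (top_of_set half_space) (V i)" "homeomorphism (U i) (V i) (\<phi> i) (\<psi> i)"
proof -
 have "is_chart M (cs ! i)" using mfd nth_mem[OF assms] by (simp add: compact_oriented_3manifold_def)
 thus "openin (top_of_set M) (U i)" "openin (top_of_set half_space) (V i)" "homeomorphism (U i) (V i) (\<phi> i) (\<psi> i)"
  by (simp_all add: is_chart_def case_prod_unfold)
qed

lemma compact_M: "compact M" using mfd by (simp add: compact_oriented_3manifold_def)

lemma cover: "M = (\<Union>i<n. U i)"
proof -
 have "M = (UN c:set cs. fst c)" using mfd by (simp add: compact_oriented_3manifold_def)
 moreover have "set cs = (%i. cs ! i) ` {..<n}" unfolding set_conv_nth by blast
 ultimately show ?thesis by simp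
qed

lemma U_sub: assumes "i < n" shows "U i <= M"
 using UN_upper[of i "{..<n}" U] assms unfolding cover[symmetric] by simp

lemma psi_phi [simp]: "i < n ==> m : U i ==> \<psi> i (\<phi> i m) = m"
 by (rule homeomorphism_apply1[OF chart(3)])

lemma phi_psi [simp]: "i < n ==> y : V i ==> \<phi> i (\<psi> i y) = y"
 by (rule homeomorphism_apply2[OF chart(3)])

lemma psi_in: "y : V i ==> \<psi> i y : U i"
 by (rule inv_into_into)

lemma phi_inj: "i < n ==> inj_on (\<phi> i) (U i)"
 by (rule inj_on_inverseI[of _ "\<psi> i"]) simp

lemma V_half: assumes "i < n" "y : V i" shows "y $ 1 <= 0"
 using subsetD[OF openin_imp_subset[OF chart(2)[OF assms(1)]] assms(2)] by (simp add: half_space_def)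

lemma compat:
 assumes "i < n" "j < n"
 shows "locally_smooth_on (\<phi> i ` (U i Int U j)) (T i j)"
  "!!y. y : \<phi> i ` (U i Int U j) ==> y $ 1 < 0 ==> jdet (T i j) y > 0"
proof -
 have "oriented_compatible (cs ! i) (cs ! j)"
  using mfd nth_mem[OF assms(1)] nth_mem[OF assms(2)] by (simp add: compact_oriented_3manifold_def)
 thus "locally_smooth_on (\<phi> i ` (U i Int U j)) (T i j)"
  "!!y. y : \<phi> i ` (U i Int U j) ==> y $ 1 < 0 ==> jdet (T i j) y > 0"
  unfolding oriented_compatible_def by (auto simp: case_prod_unfold Let_def)
qed

lemma phi_openin_V:
 assumes "i < n" "openin (top_of_set M) A" "A <= U i" shows "openin (top_of_set half_space) (\<phi> i ` A)"
proof -
 have "openin (top_of_set (U i)) A" using assms by (simp add: openin_subset_trans U_sub)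
 hence "openin (top_of_set (V i)) (\<phi> i ` A)" using homeomorphism_imp_open_map[OF chart(3)[OF assms(1)]] by blast
 thus ?thesis using chart(2)[OF assms(1)] openin_trans by blast
qed

lemma overlap_openin: "i < n ==> j < n ==> openin (top_of_set half_space) (\<phi> i ` (U i Int U j))"
 by (intro phi_openin_V openin_Int chart) auto

lemma overlap_open: "i < n ==> j < n ==> open {y:\<phi> i ` (U i Int U j). y $ 1 < 0}"
 by (rule openin_half_space_interior[OF overlap_openin])

lemma V_open: "i < n ==> open {y:V i. y $ 1 < 0}"
 by (rule openin_half_space_interior[OF chart(2)])

lemma phi_image_diff: "i < n ==> A <= U i ==> B <= U i ==> \<phi> i ` (A - B) = \<phi> i ` A - \<phi> i ` B"
 by (rule inj_on_image_set_diff[OF phi_inj]) auto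

lemma phi_piece_borel:
 assumes "i < n" "k < n" shows "\<phi> k ` (U k Int piece i) : sets borel"
proof -
 have "\<phi> k ` (U k Int piece i) = \<phi> k ` (U k Int U i) - (\<Union>j<i. \<phi> k ` (U k Int U j))"
 proof -
  have "U k Int piece i = (U k Int U i) - (U k Int (\<Union>j<i. U j))" by (auto simp: piece_def)
  moreover have "\<phi> k ` (U k Int (\<Union>j<i. U j)) = (\<Union>j<i. \<phi> k ` (U k Int U j))" by auto
  ultimately show ?thesis using phi_image_diff[OF assms(2), of "U k Int U i" "U k Int (\<Union>j<i. U j)"] by simp
 qed
 moreover have "\<phi> k ` (U k Int U j) : sets borel" if "j < n" for j
  by (rule openin_half_space_borel[OF overlap_openin[OF assms(2) that]])
 ultimately show ?thesis using assms by (auto intro!: sets.Diff sets.finite_UN)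
qed

lemma T_deriv:
 assumes "i < n" "j < n" "y : \<phi> i ` (U i Int U j)" "y $ 1 < 0"
 shows "(T i j has_derivative fd (T i j) y) (at y)"
proof -
 have "Ck_on (Suc 0) {y:\<phi> i ` (U i Int U j). y $ 1 < 0} (T i j)"
  by (rule locCk_open[OF overlap_open[OF assms(1,2)] _ locally_smooth_locCk[OF compat(1)[OF assms(1,2)]]]) auto
 from Ck_on_SucD(1)[OF this] show ?thesis using assms(3,4) by blast
qed

text \<open>An interior point cannot be mapped to the boundary: there the first component of the
 transition map would have a maximum, so that its derivative would be singular.\<close>

lemma T_interior:
 assumes "i < n" "j < n" "y : \<phi> i ` (U i Int U j)" "y $ 1 < 0"
 shows "T i j y $ 1 < 0"
proof (rule ccontr)
 assume "~ T i j y $ 1 < 0"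
 moreover have le: "T i j z $ 1 <= 0" if "z : \<phi> i ` (U i Int U j)" for z
  using that V_half[OF assms(2), of "T i j z"] assms(1) by auto
 ultimately have 0: "T i j y $ 1 = 0" using assms(3) by force
 have d: "((%z. T i j z $ 1) has_derivative (%v. fd (T i j) y v $ 1)) (at y)"
  by (rule bounded_linear.has_derivative[OF bounded_linear_vec_nth T_deriv[OF assms]])
 have "(%v. fd (T i j) y v $ 1) = (%v. 0)"
  by (rule differential_zero_maxmin[OF _ overlap_open[OF assms(1,2)] d]) (use assms le 0 in auto)
 hence "fd (T i j) y v $ 1 = 0" for v by metis
 hence "jdet (T i j) y = 0" by (simp add: det_3 matrix_def)
 thus False using compat(2)[OF assms] by simp
qed

subsection \<open>Integration of 3-forms\<close>

text \<open>A 3-form is given by its densities in the charts.\<close>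

definition form3 :: "(nat => real^3 => real) => bool" where
 "form3 d \<longleftrightarrow> (ALL i<n. ALL j<n. ALL y:\<phi> i ` (U i Int U j). y $ 1 < 0 -->
   d i y = jdet (T i j) y * d j (T i j y))"

definition has_int :: "(nat => real^3 => real) => real => bool" where
 "has_int d c \<longleftrightarrow> (ALL i<n. d i absolutely_integrable_on \<phi> i ` piece i) & c = (\<Sum>i<n. integral (\<phi> i ` piece i) (d i))"

lemma has_int_add:
 assumes "has_int d c" "has_int e c'" shows "has_int (%i y. d i y + e i y) (c + c')"
proof -
 have "integral (\<phi> i ` piece i) (%y. d i y + e i y) = integral (\<phi> i ` piece i) (d i) + integral (\<phi> i ` piece i) (e i)" if "i < n" for i
  using assms that unfolding has_int_def by (intro integral_add set_lebesgue_integral_eq_integral(1)) simp_all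
 moreover have "(%y. d i y + e i y) absolutely_integrable_on \<phi> i ` piece i" if "i < n" for i
  using assms that unfolding has_int_def by (intro set_integral_add(1)) simp_all
 ultimately show ?thesis using assms unfolding has_int_def by (simp add: sum.distrib)
qed

lemma has_int_0: "has_int (%i y. 0) 0"
 by (simp add: has_int_def)

text \<open>The boundary plane is null, so two forms need only agree at interior points, where the
  charts have open image and derivatives make sense.\<close>

lemma has_int_cong:
 assumes "has_int d c" "!!i m. i < n ==> m : U i ==> \<phi> i m $ 1 < 0 ==> d i (\<phi> i m) = e i (\<phi> i m)"
 shows "has_int e c"
proof -
 have e: "e i y = d i y" if "i < n" "y : \<phi> i ` piece i - {y. y $ 1 = 0}" for i y
 proof -
  have "y : \<phi> i ` piece i" using that by simp
  then obtain m where m: "m : U i" "y = \<phi> i m" unfolding piece_def by blast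
  have "y $ 1 ~= 0" "y $ 1 <= 0" using that(2) V_half[OF that(1)] m by auto
  thus ?thesis using assms(2)[OF that(1) m(1)] m(2) by simp
 qed
 have "e i absolutely_integrable_on \<phi> i ` piece i" if "i < n" for i
  by (rule absolutely_integrable_spike[OF _ negligible_boundary_plane e[OF that]])
   (use assms(1) that in \<open>simp_all add: has_int_def\<close>)
 moreover have "integral (\<phi> i ` piece i) (d i) = integral (\<phi> i ` piece i) (e i)" if "i < n" for i
  by (rule integral_spike[OF negligible_boundary_plane]) (use e[OF that] in auto)
 ultimately show ?thesis using assms(1) unfolding has_int_def by simp
qed

lemma form3D:
 "form3 d ==> i < n ==> j < n ==> y : \<phi> i ` (U i Int U j) ==> y $ 1 < 0 ==>
   d i y = jdet (T i j) y * d j (T i j y)"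
 unfolding form3_def by blast

text \<open>A form vanishing off one chart may be integrated in that chart alone. The pieces
  prescribed by the order of the atlas are carried over by the transition maps, whose Jacobians are
  positive; what is lost lies in the boundary plane.\<close>

lemma has_int_chart:
 assumes d: "form3 d" and k: "k < n"
  and supp: "!!i m. i < n ==> m : U i - U k ==> d i (\<phi> i m) = 0"
  and int: "d k absolutely_integrable_on V k"
 shows "has_int d (integral (V k) (d k))"
proof -
 define A where "A i = {m:U k Int piece i. \<phi> k m $ 1 < 0}" for i
 have Ai: "\<phi> i m $ 1 < 0" if "m : A i" "i < n" for i m
  using T_interior[OF k that(2), of "\<phi> k m"] that k by (auto simp: A_def piece_def)
 have kA: "\<phi> k ` A i = \<phi> k ` (U k Int piece i) - {y. y $ 1 = 0}" if "i < n" for i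
  using V_half[OF k] by (fastforce simp: A_def)
 have kAb: "\<phi> k ` A i : sets borel" if "i < n" for i
  unfolding kA[OF that] using phi_piece_borel[OF that k]
  using closed_boundary_plane by (intro sets.Diff) (auto intro!: borel_closed)
 have kp: "d k absolutely_integrable_on \<phi> k ` A i" if "i < n" for i
  by (rule set_integrable_subset[OF int]) (use kAb[OF that] in \<open>auto simp: A_def\<close>)
 have TA: "T k i ` \<phi> k ` A i = \<phi> i ` A i" for i
  using k by (auto simp: A_def image_image cong: image_cong_simp)
 have iA: "d i absolutely_integrable_on \<phi> i ` A i & integral (\<phi> i ` A i) (d i) = integral (\<phi> k ` A i) (d k)" if i: "i < n" for i
 proof -
  have yA: "y : \<phi> k ` (U k Int U i)" "y $ 1 < 0" if "y : \<phi> k ` A i" for y using that by (auto simp: A_def piece_def)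
  have "d i absolutely_integrable_on (T k i ` \<phi> k ` A i) & integral (T k i ` \<phi> k ` A i) (d i) = integral (\<phi> k ` A i) (d k)"
  proof (subst integral_change_of_variables_real[symmetric])
   show "\<phi> k ` A i : sets lebesgue" using kAb[OF i] by simp
   show "(T k i has_derivative fd (T k i) y) (at y within \<phi> k ` A i)" if "y : \<phi> k ` A i" for y
    using T_deriv[OF k i yA[OF that]] by (rule has_derivative_at_withinI)
   show "inj_on (T k i) (\<phi> k ` A i)"
    using phi_inj[OF i] k by (auto simp: inj_on_def A_def piece_def)
   have e: "\<bar>jdet (T k i) y\<bar> * d i (T k i y) = d k y" if "y : \<phi> k ` A i" for y
    using form3D[OF d k i yA[OF that]] compat(2)[OF k i yA[OF that]] by simp
   show "(%y. \<bar>jdet (T k i) y\<bar> * d i (T k i y)) absolutely_integrable_on \<phi> k ` A i &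
    integral (\<phi> k ` A i) (%y. \<bar>jdet (T k i) y\<bar> * d i (T k i y)) = integral (\<phi> k ` A i) (d k)"
    by (rule conjI, rule set_integrable_cong[OF refl refl e, THEN iffD2, OF _ kp[OF i]], assumption, rule integral_cong, rule e)
  qed
  thus ?thesis unfolding TA .
 qed
 have spike: "negligible {y:\<phi> i ` A i - \<phi> i ` piece i. d i y ~= 0}" "negligible {y:\<phi> i ` piece i - \<phi> i ` A i. d i y ~= 0}" if i: "i < n" for i
 proof -
  have "A i <= piece i" by (auto simp: A_def)
  hence "{y:\<phi> i ` A i - \<phi> i ` piece i. d i y ~= 0} = {}" by auto
  thus "negligible {y:\<phi> i ` A i - \<phi> i ` piece i. d i y ~= 0}" by (simp only: negligible_empty)
  have "y $ 1 = 0" if y: "y : \<phi> i ` piece i - \<phi> i ` A i" "d i y ~= 0" for y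
  proof (rule ccontr)
   assume ne: "y $ 1 ~= 0"
   obtain m where m: "m : piece i" "y = \<phi> i m" using y by auto
   hence mU: "m : U i" by (simp add: piece_def)
   hence "y $ 1 < 0" using V_half[OF i, of y] m ne by force
   moreover have "m : U k" using supp[OF i, of m] mU m(2) y(2) by blast
   ultimately have "\<phi> k m $ 1 < 0" using T_interior[OF i k, of y] mU m(2) i by auto
   hence "m : A i" using \<open>m : U k\<close> m(1) by (simp add: A_def)
   thus False using y(1) m(2) by blast
  qed
  thus "negligible {y:\<phi> i ` piece i - \<phi> i ` A i. d i y ~= 0}"
   by (intro negligible_subset[OF negligible_boundary_plane]) auto
 qed
 have 1: "d i absolutely_integrable_on \<phi> i ` piece i" "integral (\<phi> i ` piece i) (d i) = integral (\<phi> k ` A i) (d k)" if i: "i < n" for i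
  using iA[OF i] absolutely_integrable_spike_set_eq[OF spike[OF i]] integral_spike_set[OF spike[OF i]] by simp_all
 have "(d k has_integral (\<Sum>i<n. integral (\<phi> k ` A i) (d k))) (\<Union>i<n. \<phi> k ` A i)"
 proof (rule has_integral_UN)
  show "(d k has_integral integral (\<phi> k ` A i) (d k)) (\<phi> k ` A i)" if "i : {..<n}" for i
   using kp[of i] that set_lebesgue_integral_eq_integral(1) by blast
  have "\<phi> k ` A i Int \<phi> k ` A j = {}" if "i ~= j" for i j
  proof -
   have "piece i Int piece j = {}" using that by (cases "i < j") (auto simp: piece_def)
   hence "A i Int A j = {}" by (auto simp: A_def)
   moreover have "\<phi> k ` A i Int \<phi> k ` A j = \<phi> k ` (A i Int A j)"
    using inj_on_image_Int[OF phi_inj[OF k], of "A i" "A j"] by (auto simp: A_def)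
   ultimately show ?thesis by simp
  qed
  thus "pairwise (%i j. negligible (\<phi> k ` A i Int \<phi> k ` A j)) {..<n}" by (simp add: pairwise_def)
 qed simp
 hence "integral (\<Union>i<n. \<phi> k ` A i) (d k) = (\<Sum>i<n. integral (\<phi> k ` A i) (d k))" by (rule integral_unique)
 moreover have "integral (\<Union>i<n. \<phi> k ` A i) (d k) = integral (V k) (d k)"
 proof (rule integral_spike_set)
  have sub: "(\<Union>i<n. \<phi> k ` A i) <= V k" by (auto simp: A_def)
  hence "{y:(\<Union>i<n. \<phi> k ` A i) - V k. d k y ~= 0} = {}" by auto
  thus "negligible {y:(\<Union>i<n. \<phi> k ` A i) - V k. d k y ~= 0}" by (simp only: negligible_empty)
  have "y $ 1 = 0" if y: "y : V k - (\<Union>i<n. \<phi> k ` A i)" for y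
  proof (rule ccontr)
   assume "y $ 1 ~= 0"
   moreover obtain m where m: "m : U k" "y = \<phi> k m" using y by auto
   ultimately have "\<phi> k m $ 1 < 0" using V_half[OF k, of y] by force
   \<comment> \<open>A point belongs to the piece of the first chart containing it.\<close>
   define i where "i = (LEAST i. m : U i)"
   have "m : U i" "i <= k" unfolding i_def using m(1) by (auto intro: LeastI Least_le)
   moreover have "m ~: U j" if "j < i" for j using that not_less_Least unfolding i_def by blast
   ultimately have "m : A i" using m(1) \<open>\<phi> k m $ 1 < 0\<close> by (simp add: A_def piece_def)
   hence "y : \<phi> k ` A i" using m(2) by blast
   moreover have "i < n" using \<open>i <= k\<close> k by simp
   ultimately show False using y by blast
  qed
  thus "negligible {y:V k - (\<Union>i<n. \<phi> k ` A i). d k y ~= 0}"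
   by (intro negligible_subset[OF negligible_boundary_plane]) auto
 qed
 ultimately show ?thesis unfolding has_int_def using 1 by simp
qed

text \<open>By the chain rule the determinant of the derivative of (a, b, c) picks up exactly the
  Jacobian of the transition map.\<close>

lemma form3_jac:
 assumes a: "!!i. i < n ==> locCk 1 (V i) (a o \<psi> i)" and b: "!!i. i < n ==> locCk 1 (V i) (b o \<psi> i)"
  and c: "!!i. i < n ==> locCk 1 (V i) (c o \<psi> i)"
 shows "form3 (%i y. \<theta> (\<psi> i y) * jac (a o \<psi> i) (b o \<psi> i) (c o \<psi> i) y)"
 unfolding form3_def
proof (intro allI impI ballI)
 fix i j y assume i: "i < n" and j: "j < n" and y: "y : \<phi> i ` (U i Int U j)" and y1: "y $ 1 < 0"
 have \<psi>: "\<psi> j (T i j z) = \<psi> i z" if "z : \<phi> i ` (U i Int U j)" for z using that i j by auto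
 have Ty: "T i j y : {y:V j. y $ 1 < 0}" using T_interior[OF i j y y1] y i by auto
 have diff: "(f o \<psi> k) differentiable (at z)" if "k < n" "locCk 1 (V k) (f o \<psi> k)" "z : {y:V k. y $ 1 < 0}" for f :: "'m => real" and k z
  using Ck_on_SucD(1)[of 0 _ "f o \<psi> k" z] locCk_open[OF V_open[OF that(1)] _ that(2)] that(3)
  unfolding differentiable_def by (metis (no_types, lifting) One_nat_def mem_Collect_eq subsetI)
 have yi: "y : {y:V i. y $ 1 < 0}" using y y1 by auto
 let ?P = "%k z. vector [(a o \<psi> k) z, (b o \<psi> k) z, (c o \<psi> k) z] :: real^3"
 note J = det_matrix_jac[OF diff[OF i a[OF i] yi] diff[OF i b[OF i] yi] diff[OF i c[OF i] yi]]
 note J' = det_matrix_jac[OF diff[OF j a[OF j] Ty] diff[OF j b[OF j] Ty] diff[OF j c[OF j] Ty]]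
 have dj: "(?P j has_derivative fd (?P j) (T i j y)) (at (T i j y))"
  using J'(1) frechet_derivative_works differentiable_def by blast
 have "((%z. ?P j (T i j z)) has_derivative (%v. fd (?P j) (T i j y) (fd (T i j) y v))) (at y)"
  by (rule has_derivative_compose[OF T_deriv[OF i j y y1] dj])
 hence "(?P i has_derivative (%v. fd (?P j) (T i j y) (fd (T i j) y v))) (at y)"
  by (rule has_derivative_transform_within_open[OF _ overlap_open[OF i j]]) (use y y1 \<psi> in auto)
 from frechet_derivative_at[OF this]
 have "fd (?P i) y = fd (?P j) (T i j y) o fd (T i j) y"
  by (simp only: comp_def)
 moreover have "linear (fd (?P j) (T i j y))" "linear (fd (T i j) y)"
  using has_derivative_linear[OF dj] has_derivative_linear[OF T_deriv[OF i j y y1]] by auto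
 ultimately have "jdet (?P i) y
   = jdet (?P j) (T i j y) * jdet (T i j) y"
  by (simp add: matrix_compose det_mul)
 hence "jac (a o \<psi> i) (b o \<psi> i) (c o \<psi> i) y = jac (a o \<psi> j) (b o \<psi> j) (c o \<psi> j) (T i j y) * jdet (T i j) y"
  using J(2) J'(2) by simp
 thus "\<theta> (\<psi> i y) * jac (a o \<psi> i) (b o \<psi> i) (c o \<psi> i) y = jdet (T i j) y *
   (\<theta> (\<psi> j (T i j y)) * jac (a o \<psi> j) (b o \<psi> j) (c o \<psi> j) (T i j y))"
  using \<psi>[OF y] by simp
qed

end

subsection \<open>Stokes' theorem\<close>

lemma jac_cong:
 assumes "open O'" "y : O'" "!!z. z : O' ==> a z = a' z" "!!z. z : O' ==> b z = b' z" "!!z. z : O' ==> c z = c' z"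
 shows "jac a b c y = jac a' b' c' y"
proof -
 have *: "pd f y i = pd f' y i" if e: "!!z. z : O' ==> f z = f' z" for f f' i
 proof -
  have "(f has_derivative D) (at y) \<longleftrightarrow> (f' has_derivative D) (at y)" for D
  proof
   show "(f has_derivative D) (at y) ==> (f' has_derivative D) (at y)"
    by (rule has_derivative_transform_within_open[OF _ assms(1,2) e])
   show "(f' has_derivative D) (at y) ==> (f has_derivative D) (at y)"
    by (rule has_derivative_transform_within_open[OF _ assms(1,2) e[symmetric]])
  qed
  thus ?thesis unfolding pd_def frechet_derivative_def by simp
 qed
 show ?thesis unfolding jac_def by (simp add: *[OF assms(3)] *[OF assms(4)] *[OF assms(5)])
qed

lemma jac_zero:
 assumes "open O'" "y : O'" "!!z. z : O' ==> a z = 0" shows "jac a b c y = 0"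
proof -
 have "jac a b c y = jac (%_. 0) b c y" by (rule jac_cong[OF assms(1,2)]) (simp_all add: assms(3))
 thus ?thesis by (simp add: jac_def pd_def det3_def)
qed

text \<open>Near each point of \<open>K\<close>, boundary points included, \<open>f\<close> agrees
  on \<open>S\<close> with a C^1 function on an open set, and compactness makes the local bounds
  uniform. The set \<open>O'\<close> singles out the points where the derivative of \<open>f\<close>
  itself makes sense.\<close>

lemma locCk_pd_bounded:
 fixes f :: "real^3 => real"
 assumes "locCk 1 S f" "compact K" "K <= S"
 obtains B where "!!y O'. y : K ==> open O' ==> y : O' ==> O' <= S ==> \<bar>pd f y j\<bar> <= B"
proof -
 define P where "P A B \<longleftrightarrow> (ALL y O'. y : A Int K --> open O' --> y : O' --> O' <= S --> \<bar>pd f y j\<bar> <= B)" for A B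
 have "ALL z:K. EX A B. open A & z : A & P A B"
 proof
  fix z assume z: "z : K"
  obtain W F where W: "open W" "z : W" "Ck_on 1 W F" "ALL x:W Int S. F x = f x"
   using locCkE[OF assms(1) subsetD[OF assms(3) z]] .
  have W1: "Ck_on (Suc 0) W F" using W(3) by simp
  define A where "A = W Int (%y. \<bar>pd F y j\<bar>) -` {..<\<bar>pd F z j\<bar> + 1}"
  have "open A" unfolding A_def
   by (rule continuous_open_preimage[OF _ W(1) open_lessThan])
    (intro continuous_intros Ck_on_continuous[OF pd_Ck[OF W1]])
  moreover have "z : A" using W(2) by (simp add: A_def)
  moreover have "P A (\<bar>pd F z j\<bar> + 1)" unfolding P_def
  proof (intro allI impI)
   fix y O' assume y: "y : A Int K" "open O'" "y : O'" "O' <= S"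
   have yW: "y : W" using y(1) by (simp add: A_def)
   have "(f has_derivative fd F y) (at y)"
    by (rule has_derivative_transform_within_open[OF Ck_on_SucD(1)[OF W1 yW] open_Int[OF W(1) y(2)]])
     (use yW y(3,4) W(4) in auto)
   hence "pd f y j = pd F y j" by (simp add: pd_eq pd_def[of F])
   thus "\<bar>pd f y j\<bar> <= \<bar>pd F z j\<bar> + 1" using y(1) by (simp add: A_def)
  qed
  ultimately show "EX A B. open A & z : A & P A B" by blast
 qed
 then obtain A B where AB: "ALL z:K. open (A z) & z : A z & P (A z) (B z)" by metis
 obtain E where E: "E <= K" "finite E" "K <= (UN z:E. A z)"
  using compactE_image[OF assms(2), of K A] AB by (metis (no_types, lifting) UN_I subsetI)
 show thesis
 proof (rule that[of "SUM z:E. \<bar>B z\<bar>"])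
  fix y O' assume y: "y : K" "open O'" "y : O'" "O' <= S"
  obtain z where z: "z : E" "y : A z" using E(3) y(1) by blast
  hence "P (A z) (B z)" using AB E(1) by blast
  hence "\<bar>pd f y j\<bar> <= B z" using y z unfolding P_def by blast
  also have "... <= \<bar>B z\<bar>" by simp
  also have "... <= (SUM z:E. \<bar>B z\<bar>)" by (rule member_le_sum[OF z(1) _ E(2)]) simp
  finally show "\<bar>pd f y j\<bar> <= (SUM z:E. \<bar>B z\<bar>)" .
 qed
qed

lemma norm_component_gt: "r < \<bar>y $ i - y0 $ i\<bar> ==> y ~: cball y0 (r::real)" for y :: "real^'n"
 using component_le_norm_cart[of "y - y0" i] by (auto simp: dist_norm norm_minus_commute)

context mfd
begin

definition ext0 :: "nat => ('m => real) => real^3 => real" where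
 "ext0 i a y = (if y : V i then a (\<psi> i y) else 0)"

text \<open>Stokes in one chart for a form supported in a ball. Among the faces of the box only the
  one in the boundary plane can meet the support; its outward normal is the first basis vector, so
  it enters with sign +.\<close>

lemma chart_stokes:
 assumes i: "i < n" and y0: "y0 $ 1 <= 0" and r: "0 < r" and W: "open W" "cball y0 r <= W" "cball y0 r Int half_space <= V i"
  and a: "locCk 1 (V i) (a o \<psi> i)" "!!y. y : V i - cball y0 r ==> a (\<psi> i y) = 0"
  and BC: "Ck_on 2 W B" "Ck_on 2 W C" "!!y. y : W Int V i ==> B y = b (\<psi> i y)" "!!y. y : W Int V i ==> C y = c (\<psi> i y)"
 shows "jac (a o \<psi> i) (b o \<psi> i) (c o \<psi> i) absolutely_integrable_on V i"
  and "integral (V i) (jac (a o \<psi> i) (b o \<psi> i) (c o \<psi> i)) =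
   integral (cbox (vector [y0 $ 2 - (r + 1), y0 $ 3 - (r + 1)]) (vector [y0 $ 2 + (r + 1), y0 $ 3 + (r + 1)]))
    (%p::real^2. ext0 i a (ins1 (0, p)) * minor2 B C 2 3 (ins1 (0, p)))"
proof -
 \<comment> \<open>The box exceeds the ball by one unit, so that five faces miss it; the sixth is
   put into the boundary plane.\<close>
 define l :: "real^3" where "l = (\<chi> j. y0 $ j - (r + 1))"
 define u :: "real^3" where "u = (\<chi> j. if j = 1 then 0 else y0 $ j + (r + 1))"
 have lu: "l $ j <= u $ j" for j using y0 r by (simp add: l_def u_def)
 define a' where "a' = ext0 i a"
 have V0: "a' y = 0" if "y ~: cball y0 r" for y using a(2)[of y] that by (simp add: a'_def ext0_def)
 have V1: "a' y = (a o \<psi> i) y" if "y : V i" for y using that by (simp add: a'_def ext0_def)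
 have Vo: "open {y:V i. y $ 1 < 0}" by (rule V_open[OF i])
 have u1: "u $ 1 = 0" by (simp add: u_def)
 have "y $ 1 <= u $ 1" if "y : cbox l u" for y using that unfolding mem_box_cart by blast
 hence half: "cbox l u <= half_space" by (auto simp: half_space_def u1)
 have "y $ 1 < u $ 1" if "y : box l u" for y using that unfolding mem_box_cart by blast
 hence bneg: "y $ 1 < 0" if "y : box l u" for y using that by (simp add: u1)
 have cov: "cbox l u = (cbox l u Int V i) Un (cbox l u - cball y0 r)" using W(3) half by blast
 have ac: "continuous_on (cbox l u) a'"
 proof -
  have "continuous_on ((cbox l u Int V i) Un (cbox l u - cball y0 r)) a'"
  proof (rule continuous_on_Un_local_open)
   show "continuous_on (cbox l u Int V i) a'"
    by (rule continuous_on_eq[OF continuous_on_subset[OF locCk_continuous[OF a(1)]]]) (simp_all add: V1)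
   show "continuous_on (cbox l u - cball y0 r) a'"
    by (rule continuous_on_eq[OF continuous_on_const[of _ 0]]) (simp add: V0)
   obtain O' where O': "open O'" "V i = half_space Int O'" using chart(2)[OF i] by (auto simp: openin_open)
   hence "cbox l u Int V i = cbox l u Int O'" using half by auto
   thus "openin (top_of_set ((cbox l u Int V i) Un (cbox l u - cball y0 r))) (cbox l u Int V i)"
    unfolding cov[symmetric] using O'(1) by (simp add: openin_open_Int)
   have "cbox l u - cball y0 r = cbox l u Int (- cball y0 r)" by auto
   thus "openin (top_of_set ((cbox l u Int V i) Un (cbox l u - cball y0 r))) (cbox l u - cball y0 r)"
    unfolding cov[symmetric] by (simp add: openin_open_Int open_Compl)
  qed
  thus ?thesis unfolding cov[symmetric] .
 qed
 have a1: "Ck_on 1 {y:V i. y $ 1 < 0} (a o \<psi> i)" by (rule locCk_open[OF Vo _ a(1)]) auto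
 have aC: "Ck_on 1 (box l u) a'"
 proof (rule Ck_on_open_UN)
  fix y assume y: "y : box l u"
  have yh: "y : half_space" "y $ 1 < 0" using bneg[OF y] by (auto simp: half_space_def)
  show "EX W. open W & y : W & Ck_on 1 W a'"
  proof (cases "y : V i")
   case True
   have "Ck_on 1 {y:V i. y $ 1 < 0} a'"
    by (rule Ck_on_cong[OF Vo, THEN iffD1, OF _ a1]) (simp add: V1)
   thus ?thesis using Vo True yh(2) by blast
  next
   case False
   hence "y : - cball y0 r" using W(3) yh(1) by blast
   moreover have "Ck_on 1 (- cball y0 r) a'"
    by (rule Ck_on_cong[THEN iffD1, OF _ _ Ck_on_const[of _ _ 0]]) (simp_all add: V0 open_Compl)
   ultimately show ?thesis by (meson closed_cball open_Compl)
  qed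
 qed
 have pd_eq': "pd a' y j = pd (a o \<psi> i) y j" if "y : V i" "y $ 1 < 0" for y j
 proof -
  have y: "y : {y:V i. y $ 1 < 0}" using that by simp
  have "((a o \<psi> i) has_derivative fd (a o \<psi> i) y) (at y)"
   using Ck_on_SucD(1)[of 0, OF _ y] a1 by simp
  hence "(a' has_derivative fd (a o \<psi> i) y) (at y)"
   by (rule has_derivative_transform_within_open[OF _ Vo y]) (simp add: V1)
  from pd_eq[OF this] show ?thesis by (simp add: pd_def[of "a o \<psi> i"])
 qed
 have pd0: "pd a' y j = 0" if "y ~: cball y0 r" for y j
 proof -
  have "(a' has_derivative (%_. 0)) (at y)"
   by (rule has_derivative_transform_within_open[of "%_. 0", OF _ open_Compl[OF closed_cball]]) (use that V0 in auto)
  from pd_eq[OF this] show ?thesis .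
 qed
 have bd: "bounded ((%y. pd a' y j) ` box l u)" for j
 proof -
  have "compact (cball y0 r Int half_space)" by (rule compact_Int_closed[OF compact_cball half_space_closed])
  then obtain B where B: "!!y O'. y : cball y0 r Int half_space ==> open O' ==> y : O' ==> O' <= V i ==> \<bar>pd (a o \<psi> i) y j\<bar> <= B"
   using locCk_pd_bounded[OF a(1) _ W(3)] by blast
  have "\<bar>pd a' y j\<bar> <= max B 0" if y: "y : box l u" for y
  proof (cases "y : cball y0 r")
   case True
   hence yh: "y : cball y0 r Int half_space" using bneg[OF y] by (simp add: half_space_def)
   hence yV: "y : V i" using W(3) by blast
   have "\<bar>pd (a o \<psi> i) y j\<bar> <= B" by (rule B[OF yh Vo]) (use yV bneg[OF y] in auto)
   thus ?thesis using pd_eq'[OF yV bneg[OF y]] by simp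
  qed (simp add: pd0)
  thus ?thesis unfolding bounded_iff by auto
 qed
 have K0: "a' y = 0" if "y : cbox l u - cball y0 r" for y using V0 that by simp
 note S = stokes_box[OF lu W(1) compact_cball W(2) BC(1,2) ac K0 aC bd]
 have neg: "negligible ({y::real^3. y $ 1 = 0} Un (cbox l u - box l u))"
  by (intro negligible_Un negligible_boundary_plane negligible_frontier_interval)
 let ?J = "jac (a o \<psi> i) (b o \<psi> i) (c o \<psi> i)"
 have eq: "(if y : V i then ?J y else 0) = (if y : cbox l u then jac a' B C y else 0)"
  if "y ~: {y::real^3. y $ 1 = 0} Un (cbox l u - box l u)" for y
 proof (cases "y : cball y0 r")
  case False
  have "jac a' B C y = 0" by (rule jac_zero[OF open_Compl[OF closed_cball]]) (use False V0 in auto)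
  moreover have "?J y = 0" if yV: "y : V i"
  proof -
   have "y $ 1 < 0" using V_half[OF i yV] \<open>y ~: {y. y $ 1 = 0} Un (cbox l u - box l u)\<close> by simp
   show ?thesis
   proof (rule jac_zero[OF open_Int[OF Vo open_Compl[OF closed_cball]]])
    show "y : {y:V i. y $ 1 < 0} Int - cball y0 r" using yV \<open>y $ 1 < 0\<close> False by simp
   qed (use a(2) in auto)
  qed
  ultimately show ?thesis by simp
 next
  case True
  have sm: "\<bar>y $ j - y0 $ j\<bar> <= r" for j using norm_component_gt[of r y j y0] True by force
  hence "y0 $ j - (r + 1) <= y $ j & y $ j <= y0 $ j + (r + 1)" for j using sm[of j] unfolding abs_le_iff by linarith
  hence box: "y : cbox l u \<longleftrightarrow> y $ 1 <= 0" by (auto simp: mem_box_cart l_def u_def)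
  show ?thesis
  proof (cases "y $ 1 < 0")
   case True
   hence yV: "y : V i" using W(3) \<open>y : cball y0 r\<close> by (auto simp: half_space_def)
   have "?J y = jac a' B C y"
    by (rule jac_cong[OF open_Int[OF W(1) Vo]]) (use yV True W(2) \<open>y : cball y0 r\<close> V1 BC(3,4) in auto)
   thus ?thesis using yV box True by simp
  next
   case False
   hence "y $ 1 > 0" using that by simp
   thus ?thesis using box V_half[OF i, of y] by auto
  qed
 qed
 have "(%y. if y : cbox l u then jac a' B C y else 0) absolutely_integrable_on UNIV"
  using S(1) by (simp add: absolutely_integrable_restrict_UNIV)
 hence "(%y. if y : V i then ?J y else 0) absolutely_integrable_on UNIV"
  by (rule absolutely_integrable_spike[OF _ neg]) (use eq in auto)
 thus "?J absolutely_integrable_on V i" by (simp add: absolutely_integrable_restrict_UNIV)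
 have "integral (V i) ?J = integral UNIV (%y. if y : V i then ?J y else 0)" by (simp add: integral_restrict_UNIV)
 also have "... = integral UNIV (%y. if y : cbox l u then jac a' B C y else 0)"
  by (rule integral_spike[OF neg]) (use eq in auto)
 also have "... = integral (cbox l u) (jac a' B C)" by (simp add: integral_restrict_UNIV)
 also have "... = integral (cbox (vector [y0 $ 2 - (r + 1), y0 $ 3 - (r + 1)]) (vector [y0 $ 2 + (r + 1), y0 $ 3 + (r + 1)]))
    (%p::real^2. ext0 i a (ins1 (0, p)) * minor2 B C 2 3 (ins1 (0, p)))"
 proof -
  have z1: "a' (vector [l $ 1, p $ 1, p $ 2]) = 0" for p :: "real^2" by (rule V0, rule norm_component_gt[of _ _ 1]) (use r in \<open>simp add: l_def\<close>)
  have z2: "a' (vector [p $ 1, u $ 2, p $ 2]) = 0" "a' (vector [p $ 1, l $ 2, p $ 2]) = 0" for p :: "real^2"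
   by (rule V0, rule norm_component_gt[of _ _ 2], use r in \<open>simp add: l_def u_def\<close>)+
  have z3: "a' (vector [p $ 1, p $ 2, u $ 3]) = 0" "a' (vector [p $ 1, p $ 2, l $ 3]) = 0" for p :: "real^2"
   by (rule V0, rule norm_component_gt[of _ _ 3], use r in \<open>simp add: l_def u_def\<close>)+
  have lu23: "l $ 2 = y0 $ 2 - (r + 1)" "l $ 3 = y0 $ 3 - (r + 1)" "u $ 2 = y0 $ 2 + (r + 1)" "u $ 3 = y0 $ 3 + (r + 1)" "u $ 1 = 0"
   by (simp_all add: l_def u_def)
  have "integral (cbox l u) (jac a' B C) = integral (cbox (vector [l $ 2, l $ 3]) (vector [u $ 2, u $ 3]))
    (%p::real^2. a' (vector [u $ 1, p $ 1, p $ 2]) * minor2 B C 2 3 (vector [u $ 1, p $ 1, p $ 2]))"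
   by (subst S(2)) (simp_all add: z1 z2 z3)
  thus ?thesis unfolding lu23 by (simp add: a'_def ins1_def)
 qed
 finally show "integral (V i) ?J = ..." .
qed

end

text \<open>The value of df^dg on the frame (d/dx2, d/dx1), which is positive for the orientation
  chosen on the torus.\<close>

definition tm :: "(real^2 => real) => (real^2 => real) => real^2 => real" where
 "tm f g x = fd f x (axis 2 1) * fd g x (axis 1 1)
   - fd f x (axis 1 1) * fd g x (axis 2 1)"

text \<open>A fundamental domain of the period lattice, half-open so that \<open>\<iota>\<close> is
  injective on it.\<close>

definition hsquare :: "(real^2) set" where "hsquare = {x. 0 <= x $ 1 & x $ 1 < 2 * pi & 0 <= x $ 2 & x $ 2 < 2 * pi}"

lemma hsquare_borel: "hsquare : sets borel"
proof -
 have eq: "hsquare = ({x. x $ 1 >= 0} Int {x. x $ 1 < 2 * pi}) Int ({x. x $ 2 >= 0} Int {x. x $ 2 < 2 * pi})"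
  by (auto simp: hsquare_def)
 show ?thesis unfolding eq
  by (intro sets.Int borel_closed[OF closed_halfspace_component_ge_cart] borel_open[OF open_halfspace_component_lt_cart])
qed

lemma hsquare_square: "hsquare <= square" "negligible (square - hsquare)"
proof -
 show "hsquare <= square" by (auto simp: hsquare_def mem_box_cart forall_2)
 have "square - hsquare <= square - box 0 (vector [2 * pi, 2 * pi])"
  by (auto simp: hsquare_def mem_box_cart forall_2)
 thus "negligible (square - hsquare)" by (rule negligible_subset[OF negligible_frontier_interval])
qed

lemma hsquare_representative:
 obtains x' where "x' : hsquare" "!!i. EX k::int. x $ i - x' $ i = 2 * pi * k"
proof -
 define x' :: "real^2" where "x' = (\<chi> i. x $ i - 2 * pi * of_int \<lfloor>x $ i / (2 * pi)\<rfloor>)"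
 have "0 <= x' $ i & x' $ i < 2 * pi" for i
 proof -
  define t where "t = x $ i / (2 * pi)"
  have "2 * pi * of_int \<lfloor>t\<rfloor> <= 2 * pi * t" "2 * pi * t < 2 * pi * (of_int \<lfloor>t\<rfloor> + 1)"
   by (intro mult_left_mono mult_strict_left_mono; simp; linarith)+
  moreover have "x $ i = 2 * pi * t" by (simp add: t_def)
  ultimately show ?thesis by (simp add: x'_def t_def[symmetric] distrib_left)
 qed
 hence "x' : hsquare" by (simp add: hsquare_def)
 moreover have "x $ i - x' $ i = 2 * pi * of_int \<lfloor>x $ i / (2 * pi)\<rfloor>" for i by (simp add: x'_def)
 ultimately show ?thesis using that by blast
qed

lemma tm_continuous:
 assumes "Ck_on 1 UNIV f" "Ck_on 1 UNIV g" shows "continuous_on S (tm f g)"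
proof -
 have "continuous_on S (%x. fd f x v)" if "Ck_on 1 UNIV f" for f :: "real^2 => real" and v
  using Ck_on_SucD(2)[of 0 UNIV f v] that continuous_on_subset[OF _ subset_UNIV] by auto
 thus ?thesis unfolding tm_def[abs_def] using assms by (intro continuous_on_diff continuous_on_mult) auto
qed

section \<open>The boundary torus in the charts\<close>

locale mfd_boundary = mfd +
 fixes \<iota> :: "real^2 => 'a"
 assumes bdry: "boundary_torus cs \<iota>"
begin

lemma iota_continuous: "continuous_on UNIV \<iota>" and iota_range: "range \<iota> = manifold_boundary cs"
 and iota_inj: "\<iota> x = \<iota> y \<longleftrightarrow> (ALL i. EX k::int. x $ i - y $ i = 2 * pi * k)"
 using bdry unfolding boundary_torus_def by auto

lemma iota_chart:
 assumes "i < n"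
 shows "smooth_on {x. \<iota> x : U i} (\<phi> i o \<iota>)"
  and "!!x. \<iota> x : U i ==> fd (\<phi> i o \<iota>) x (axis 2 1) $ 2 * fd (\<phi> i o \<iota>) x (axis 1 1) $ 3
    - fd (\<phi> i o \<iota>) x (axis 2 1) $ 3 * fd (\<phi> i o \<iota>) x (axis 1 1) $ 2 > 0"
 using bdry nth_mem[OF assms] unfolding boundary_torus_def by (auto simp: case_prod_unfold Let_def)

lemma boundary_iff: "m : manifold_boundary cs \<longleftrightarrow> (EX j<n. m : U j & \<phi> j m $ 1 = 0)"
proof -
 have "set cs = (%i. cs ! i) ` {..<n}" unfolding set_conv_nth by blast
 thus ?thesis unfolding manifold_boundary_def by (simp add: case_prod_unfold) blast
qed

lemma boundary_chart:
 assumes "i < n" "m : U i" shows "m : range \<iota> \<longleftrightarrow> \<phi> i m $ 1 = 0"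
proof
 assume "m : range \<iota>"
 then obtain j where j: "j < n" "m : U j" "\<phi> j m $ 1 = 0" unfolding iota_range boundary_iff by blast
 show "\<phi> i m $ 1 = 0"
 proof (rule ccontr)
  assume "\<phi> i m $ 1 ~= 0"
  hence "\<phi> i m $ 1 < 0" using V_half[OF assms(1), of "\<phi> i m"] assms(2) by force
  thus False using T_interior[OF assms(1) j(1), of "\<phi> i m"] assms j by auto
 qed
next
 assume "\<phi> i m $ 1 = 0"
 thus "m : range \<iota>" unfolding iota_range boundary_iff using assms by blast
qed

lemma iota_in_M: "\<iota> x : M"
proof -
 obtain j where "j < n" "\<iota> x : U j" using iota_range boundary_iff by blast
 thus ?thesis using U_sub by blast
qed

lemma iota_open: assumes "i < n" shows "open {x. \<iota> x : U i}"
proof -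
 obtain O' where O': "open O'" "U i = M Int O'" using chart(1)[OF assms] by (auto simp: openin_open)
 hence "{x. \<iota> x : U i} = \<iota> -` O'" using iota_in_M by auto
 thus ?thesis using open_vimage[OF O'(1) iota_continuous] by simp
qed

text \<open>On the torus the first chart coordinate is constantly 0, so only the partial derivatives
  of B and C along the boundary plane enter. The other two coordinates change variables from the
  torus to the face.\<close>

lemma chart_boundary:
 assumes i: "i < n" and W: "open W" "cball y0 r <= W"
  and a: "!!y. y : V i - cball y0 r ==> a (\<psi> i y) = 0" "!!m. m : M - U i ==> a m = 0" "continuous_on M a"
  and BC: "Ck_on 2 W B" "Ck_on 2 W C" "!!y. y : W Int V i ==> B y = b (\<psi> i y)" "!!y. y : W Int V i ==> C y = c (\<psi> i y)"
  and bc: "Ck_on 1 UNIV (b o \<iota>)" "Ck_on 1 UNIV (c o \<iota>)"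
 shows "integral (cbox (vector [y0 $ 2 - (r + 1), y0 $ 3 - (r + 1)]) (vector [y0 $ 2 + (r + 1), y0 $ 3 + (r + 1)]))
    (%p::real^2. ext0 i a (ins1 (0, p)) * minor2 B C 2 3 (ins1 (0, p)))
   = integral square (%x. a (\<iota> x) * tm (b o \<iota>) (c o \<iota>) x)"
proof -
 let ?face = "cbox (vector [y0 $ 2 - (r + 1), y0 $ 3 - (r + 1)]) (vector [y0 $ 2 + (r + 1), y0 $ 3 + (r + 1)]) :: (real^2) set"
 define f where "f p = ext0 i a (ins1 (0, p)) * minor2 B C 2 3 (ins1 (0, p))" for p
 define h where "h x = a (\<iota> x) * tm (b o \<iota>) (c o \<iota>) x" for x
 define S where "S = {x. \<iota> x : U i} Int hsquare"
 have Sb: "S : sets borel" unfolding S_def by (rule sets.Int[OF borel_open[OF iota_open[OF i]] hsquare_borel])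
 define k where "k = \<phi> i o \<iota>"
 define k' where "k' x = fd k x" for x
 have kd: "(k has_derivative k' x) (at x)" if "\<iota> x : U i" for x
  using Ck_on_SucD(1)[of 0, OF smooth_on_Ck[OF iota_chart(1)[OF i]]] that by (simp add: k_def k'_def)
 have k1: "k x $ 1 = 0" if "\<iota> x : U i" for x using boundary_chart[OF i that] by (simp add: k_def)
 have k'1: "k' x v $ 1 = 0" if "\<iota> x : U i" for x v
 proof -
  have "((%z. k z $ 1) has_derivative (%v. k' x v $ 1)) (at x)"
   by (rule bounded_linear.has_derivative[OF bounded_linear_vec_nth kd[OF that]])
  moreover have "((%z. k z $ 1) has_derivative (%v. 0)) (at x)"
   by (rule has_derivative_transform_within_open[of "%_. 0", OF _ iota_open[OF i]]) (use that k1 in auto)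
  ultimately show ?thesis by (rule has_derivative_unique[THEN fun_cong])
 qed
 define \<tau> where "\<tau> x = (vector [k x $ 2, k x $ 3] :: real^2)" for x
 define \<tau>' where "\<tau>' x = (%v. vector [k' x v $ 2, k' x v $ 3] :: real^2)" for x
 have ik: "ins1 (0, \<tau> x) = k x" if "\<iota> x : U i" for x
  using k1[OF that] by (simp add: vec_eq_iff forall_3 \<tau>_def)
 have v2: "vector [s, t] = s *\<^sub>R axis 1 1 + t *\<^sub>R (axis 2 1 :: real^2)" for s t :: real
  by (simp add: vec_eq_iff forall_2 axis_def)
 have \<tau>d: "(\<tau> has_derivative \<tau>' x) (at x)" if "\<iota> x : U i" for x
  unfolding \<tau>_def[abs_def] \<tau>'_def v2
  by (intro has_derivative_add has_derivative_scaleR_left bounded_linear.has_derivative[OF bounded_linear_vec_nth kd[OF that]])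
 \<comment> \<open>The determinant itself is negative in the order (x1, x2), since the positive
   frame is the reversed one.\<close>
 have det: "\<bar>det (matrix (\<tau>' x))\<bar> = k' x (axis 2 1) $ 2 * k' x (axis 1 1) $ 3 - k' x (axis 2 1) $ 3 * k' x (axis 1 1) $ 2"
  if "\<iota> x : U i" for x
  using iota_chart(2)[OF i that] unfolding det_2 matrix_def \<tau>'_def k'_def[symmetric] k_def[symmetric]
  by (simp add: algebra_simps)
 have BCd: "fd (g o \<iota>) x v = pd G (k x) 2 * k' x v $ 2 + pd G (k x) 3 * k' x v $ 3"
  if x: "\<iota> x : U i" "k x : W" and G: "Ck_on 2 W G" "ALL y:W Int V i. G y = g (\<psi> i y)" for g G x v
 proof -
  have Gd: "(G has_derivative fd G (k x)) (at (k x))"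
   using Ck_on_SucD(1)[of 1 W G, OF _ x(2)] G(1) by (simp add: numeral_2_eq_2)
  have o: "open ({x. \<iota> x : U i} Int k -` W)"
   by (rule continuous_open_preimage[OF _ iota_open[OF i] W(1)])
    (use Ck_on_continuous[OF smooth_on_Ck[OF iota_chart(1)[OF i]]] in \<open>simp add: k_def\<close>)
  have "((%z. G (k z)) has_derivative (%v. fd G (k x) (k' x v))) (at x)"
   by (rule has_derivative_compose[OF kd[OF x(1)] Gd])
  hence "((g o \<iota>) has_derivative (%v. fd G (k x) (k' x v))) (at x)"
   by (rule has_derivative_transform_within_open[OF _ o]) (use x G(2) i in \<open>auto simp: k_def\<close>)
  hence 1: "fd (g o \<iota>) x v = fd G (k x) (k' x v)"
   by (rule frechet_derivative_at[THEN fun_cong, symmetric])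
  have "k' x v = k' x v $ 2 *\<^sub>R axis 2 1 + k' x v $ 3 *\<^sub>R axis 3 1"
   using k'1[OF x(1)] by (simp add: vec_eq_iff forall_3 axis_def)
  hence "fd G (k x) (k' x v) = fd G (k x) (k' x v $ 2 *\<^sub>R axis 2 1 + k' x v $ 3 *\<^sub>R axis 3 1)"
   by simp
  also have "... = pd G (k x) 2 * k' x v $ 2 + pd G (k x) 3 * k' x v $ 3"
   using has_derivative_linear[OF Gd] by (simp add: linear_add linear_scale pd_def)
  finally show ?thesis using 1 by simp
 qed
 have main: "\<bar>det (matrix (\<tau>' x))\<bar> * f (\<tau> x) = h x" if x: "x : S" for x
 proof -
  have xU: "\<iota> x : U i" using x by (simp add: S_def)
  have kV: "k x : V i" using xU by (simp add: k_def)
  have ak: "ext0 i a (k x) = a (\<iota> x)" using kV i xU by (simp add: ext0_def k_def)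
  show ?thesis
  proof (cases "k x : cball y0 r")
   case True
   hence kW: "k x : W" using W(2) by blast
   have ball: "ALL y:W Int V i. B y = b (\<psi> i y)" and ball': "ALL y:W Int V i. C y = c (\<psi> i y)"
    using BC(3,4) by auto
   have "tm (b o \<iota>) (c o \<iota>) x = minor2 B C 2 3 (k x) *
     (k' x (axis 2 1) $ 2 * k' x (axis 1 1) $ 3 - k' x (axis 2 1) $ 3 * k' x (axis 1 1) $ 2)"
    unfolding tm_def BCd[where g = b, OF xU kW BC(1) ball] BCd[where g = c, OF xU kW BC(2) ball'] minor2_def by (simp add: algebra_simps)
   thus ?thesis unfolding f_def h_def ik[OF xU] ak det[OF xU] by simp
  next
   case False
   hence "a (\<iota> x) = 0" using a(1)[of "k x"] kV i xU by (simp add: k_def)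
   thus ?thesis unfolding f_def h_def ik[OF xU] ak by simp
  qed
 qed
 have inj: "inj_on \<tau> S"
 proof (rule inj_onI)
  fix x x' assume x: "x : S" "x' : S" "\<tau> x = \<tau> x'"
  have xU: "\<iota> x : U i" "\<iota> x' : U i" using x by (auto simp: S_def)
  have "k x = k x'" using ik[OF xU(1)] ik[OF xU(2)] x(3) by metis
  hence "\<iota> x = \<iota> x'" using phi_inj[OF i] xU by (auto simp: k_def inj_on_def)
  hence "EX k::int. x $ j - x' $ j = 2 * pi * k" for j using iota_inj by blast
  moreover have "\<bar>x $ j - x' $ j\<bar> < 2 * pi" for j
   using x(1,2) exhaust_2[of j] by (auto simp: S_def hsquare_def abs_less_iff)
  ultimately have "x $ j = x' $ j" for j
  proof -
   obtain q :: int where q: "x $ j - x' $ j = 2 * pi * q" using \<open>!!j. EX k::int. x $ j - x' $ j = 2 * pi * k\<close> by blast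
   have "2 * pi * \<bar>real_of_int q\<bar> < 2 * pi * 1" using \<open>!!j. \<bar>x $ j - x' $ j\<bar> < 2 * pi\<close>[of j] q by (simp add: abs_mult)
   hence "\<bar>real_of_int q\<bar> < 1" using mult_less_cancel_left_pos[of "2 * pi"] pi_gt_zero by (metis mult_pos_pos zero_less_numeral)
   hence "q = 0" by linarith
   thus ?thesis using q by simp
  qed
  thus "x = x'" by (simp add: vec_eq_iff)
 qed
 have hc: "continuous_on square h"
 proof -
  have "continuous_on square (%x. a (\<iota> x))"
   by (rule continuous_on_compose2[OF a(3) continuous_on_subset[OF iota_continuous]]) (use iota_in_M in auto)
  thus ?thesis unfolding h_def using tm_continuous[OF bc] by (intro continuous_on_mult)
 qed
 have hS: "h absolutely_integrable_on S"
  by (rule set_integrable_subset[OF absolutely_integrable_continuous[OF hc]])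
   (use Sb hsquare_square(1) in \<open>auto simp: S_def\<close>)
 have "(%x. \<bar>det (matrix (\<tau>' x))\<bar> * f (\<tau> x)) absolutely_integrable_on S &
   integral S (%x. \<bar>det (matrix (\<tau>' x))\<bar> * f (\<tau> x)) = integral S h"
  by (rule conjI, rule set_integrable_cong[OF refl refl main, THEN iffD2, OF _ hS], assumption, rule integral_cong, rule main)
 hence cv: "integral (\<tau> ` S) f = integral S h"
  using integral_change_of_variables_real[of S \<tau> \<tau>' f "integral S h"] Sb \<tau>d inj
  by (auto simp: S_def intro: has_derivative_at_withinI)
 have fz: "p : \<tau> ` S & p : ?face" if "f p ~= 0" for p
 proof -
  let ?y = "ins1 (0, p)"
  have yV: "?y : V i" and ya: "a (\<psi> i ?y) ~= 0" using that by (auto simp: f_def ext0_def split: if_splits)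
  hence yc: "?y : cball y0 r" using a(1) by blast
  have m: "\<psi> i ?y : U i" "\<phi> i (\<psi> i ?y) = ?y" using psi_in[OF yV] phi_psi[OF i yV] .
  hence "\<psi> i ?y : range \<iota>" using boundary_chart[OF i m(1)] by simp
  then obtain x where x: "\<iota> x = \<psi> i ?y" by (metis imageE)
  obtain x' where x': "x' : hsquare" "!!j. EX k::int. x $ j - x' $ j = 2 * pi * k" using hsquare_representative by blast
  have "\<iota> x' = \<psi> i ?y" using iota_inj[of x x'] x'(2) x by simp
  hence "x' : S" "k x' = ?y" using x'(1) m by (auto simp: S_def k_def)
  hence "\<tau> x' = p" by (simp add: \<tau>_def vec_eq_iff forall_2)
  moreover have "p : ?face"
  proof -
   have "\<bar>?y $ j - y0 $ j\<bar> <= r" for j using norm_component_gt[of r ?y j y0] yc by force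
   from this[of 2] this[of 3] show ?thesis by (simp add: mem_box_cart forall_2 abs_le_iff)
  qed
  ultimately show ?thesis using \<open>x' : S\<close> by blast
 qed
 have "integral ?face f = integral UNIV f"
  by (subst integral_restrict_UNIV[symmetric]) (intro arg_cong[of _ _ "integral UNIV"] ext, use fz in auto)
 also have "... = integral (\<tau> ` S) f"
  by (subst (2) integral_restrict_UNIV[symmetric]) (intro arg_cong[of _ _ "integral UNIV"] ext, use fz in auto)
 also have "... = integral S h" by (rule cv)
 also have "... = integral hsquare h"
 proof -
  have "h x = 0" if "x : hsquare - S" for x using that a(2)[of "\<iota> x"] iota_in_M by (auto simp: S_def h_def)
  hence "(%x. if x : S then h x else 0) = (%x. if x : hsquare then h x else 0)" by (auto simp: S_def)
  thus ?thesis unfolding integral_restrict_UNIV[symmetric, of S] integral_restrict_UNIV[symmetric, of hsquare] by simp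
 qed
 also have "... = integral square h"
 proof (rule integral_spike_set)
  have "{x:hsquare - square. h x ~= 0} = {}" using hsquare_square(1) by blast
  thus "negligible {x:hsquare - square. h x ~= 0}" by (simp only: negligible_empty)
  show "negligible {x:square - hsquare. h x ~= 0}"
   by (rule negligible_subset[OF hsquare_square(2)]) blast
 qed
 finally show ?thesis unfolding f_def h_def .
qed

end

section \<open>Partition of unity and the global Stokes theorem\<close>

lemma jac_sum:
 assumes "finite E" "!!e. e : E ==> (f e) differentiable (at y)"
 shows "jac (%z. SUM e:E. f e z) b c y = (SUM e:E. jac (f e) b c y)"
proof -
 have "((%z. SUM e:E. f e z) has_derivative (%v. SUM e:E. fd (f e) y v)) (at y)"
  using assms(2) by (intro has_derivative_sum) (simp add: frechet_derivative_works)
 hence "pd (%z. SUM e:E. f e z) y i = (SUM e:E. pd (f e) y i)" for i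
  using pd_eq by (simp add: pd_def)
 thus ?thesis unfolding jac_def det3_def
  by (simp add: sum_distrib_right sum_distrib_left sum.distrib sum_subtractf algebra_simps)
qed

text \<open>The square of the positive part is C^1. No more is asked of the partition of unity,
  which multiplies only the first factor of a db^dc.\<close>

definition bump_fun :: "real^3 => real => real^3 => real" where
 "bump_fun y0 r z = (max 0 (r\<^sup>2 - (norm (z - y0))\<^sup>2))\<^sup>2"

lemma bump_fun_Ck: "Ck_on 1 UNIV (bump_fun y0 r)"
proof -
 have "((%t::real. if t <= 0 then 0 else t\<^sup>2) has_field_derivative (if t <= 0 then 0 else 2 * t)) (at t)" for t :: real
  by (rule DERIV_piecewise[where f = "%_. 0" and g = "%t. t\<^sup>2" and f' = "%_. 0" and g' = "%t. 2 * t"]) (auto intro!: derivative_eq_intros)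
 moreover have "(%t::real. if t <= 0 then 0 else t\<^sup>2) = (%t. (max 0 t)\<^sup>2)" "(if t <= 0 then 0 else 2 * t) = 2 * max 0 t" for t :: real
  by (auto simp: max_def)
 ultimately have "((%t. (max 0 t)\<^sup>2) has_field_derivative 2 * max 0 t) (at t)" for t :: real by (simp only:)
 then have "Ck_on (Suc 0) UNIV (%t::real. (max 0 t)\<^sup>2)"
  by (intro Ck_on_field_derivI[where f' = "%t. 2 * max 0 t"]) (auto intro!: continuous_intros)
 moreover have "Ck_on 1 UNIV (%z::real^3. r\<^sup>2 - (norm (z - y0))\<^sup>2)"
 proof -
  have z: "Ck_on 1 UNIV (%z::real^3. z - y0)"
   by (rule Ck_on_diff[OF open_UNIV Ck_on_linear[OF open_UNIV bounded_linear_ident] Ck_on_const])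
  have "Ck_on 1 UNIV (%z::real^3. r\<^sup>2 - (z - y0) \<bullet> (z - y0))"
   by (rule Ck_on_diff[OF open_UNIV Ck_on_const Ck_on_bilinear[OF open_UNIV bounded_bilinear_inner z z]])
  thus ?thesis unfolding power2_norm_eq_inner .
 qed
 ultimately show ?thesis unfolding bump_fun_def[abs_def]
  using Ck_on_compose[of UNIV 1 "%z::real^3. r\<^sup>2 - (norm (z - y0))\<^sup>2" UNIV "%t. (max 0 t)\<^sup>2"]
  by (simp del: Ck_on.simps)
qed

lemma bump_fun_pos: "0 < r ==> bump_fun y0 r y0 > 0" and bump_fun_nonneg: "bump_fun y0 r z >= 0"
 and bump_fun_zero: "0 < r ==> z ~: ball y0 r ==> bump_fun y0 r z = 0"
proof -
 show "0 < r ==> bump_fun y0 r y0 > 0" "bump_fun y0 r z >= 0" by (simp_all add: bump_fun_def)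
 assume "0 < r" "z ~: ball y0 r"
 hence "r\<^sup>2 <= (norm (z - y0))\<^sup>2" by (intro power_mono) (auto simp: dist_norm norm_minus_commute)
 thus "bump_fun y0 r z = 0" by (simp add: bump_fun_def)
qed

context mfd
begin

lemma continuous_on_M:
 fixes f :: "'m => 'b::topological_space"
 assumes "!!i. i < n ==> continuous_on (V i) (f o \<psi> i)" shows "continuous_on M f"
 unfolding continuous_on_eq_continuous_within
proof
 fix m assume "m : M"
 then obtain i where i: "i < n" "m : U i" using cover by auto
 obtain O' where O': "open O'" "U i = M Int O'" using chart(1)[OF i(1)] by (auto simp: openin_open)
 have "continuous_on (U i) ((f o \<psi> i) o \<phi> i)"
  by (rule continuous_on_compose[OF homeomorphism_cont1[OF chart(3)[OF i(1)]] assms[OF i(1)]])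
 hence "continuous_on (U i) f"
  by (rule continuous_on_eq) (use i(1) in simp)
 hence "continuous (at m within U i) f" using i(2) by (simp add: continuous_on_eq_continuous_within)
 moreover have "at m within M = at m within U i"
  by (rule at_within_nhd[of m O']) (use O' i(2) in auto)
 ultimately show "continuous (at m within M) f" by simp
qed

lemma V_preimage_open:
 assumes "i < n" "closed K" shows "open {y:V i. y $ 1 < 0 & \<psi> i y ~: K}"
proof -
 have "open ({y:V i. y $ 1 < 0} Int \<psi> i -` (- K))"
  by (rule continuous_open_preimage[OF continuous_on_subset[OF homeomorphism_cont2[OF chart(3)[OF assms(1)]]] V_open[OF assms(1)] open_Compl[OF assms(2)]]) auto
 moreover have "{y:V i. y $ 1 < 0} Int \<psi> i -` (- K) = {y:V i. y $ 1 < 0 & \<psi> i y ~: K}" by auto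
 ultimately show ?thesis by simp
qed

definition bump_on :: "nat => real^3 => real => 'm => real" where
 "bump_on k y0 r m = (if m : U k then bump_fun y0 r (\<phi> k m) else 0)"

lemma chart_ball_closed:
 assumes "k < n" "cball y0 r Int half_space <= V k" shows "closed (\<psi> k ` (cball y0 r Int half_space))"
 by (intro compact_imp_closed compact_continuous_image compact_Int_closed[OF compact_cball half_space_closed]
  continuous_on_subset[OF homeomorphism_cont2[OF chart(3)[OF assms(1)]] assms(2)])

lemma bump_on_support:
 assumes "k < n" "0 < r" "bump_on k y0 r m ~= 0" shows "m : U k" "\<phi> k m : cball y0 r" "m : \<psi> k ` (cball y0 r Int half_space)"
proof -
 show 1: "m : U k" using assms(3) by (auto simp: bump_on_def split: if_splits)
 hence "bump_fun y0 r (\<phi> k m) ~= 0" using assms(3) by (simp add: bump_on_def)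
 thus 2: "\<phi> k m : cball y0 r" using bump_fun_zero[OF assms(2)] by (meson ball_subset_cball subsetD)
 have "\<phi> k m : half_space" using V_half[OF assms(1), of "\<phi> k m"] 1 by (simp add: half_space_def)
 thus "m : \<psi> k ` (cball y0 r Int half_space)" using 1 2 assms(1) by (intro image_eqI[of _ _ "\<phi> k m"]) auto
qed

text \<open>The bump vanishes off the image of a compact set, which is closed because the space is
  Hausdorff. Off this image it is 0 in every chart; on the domain of chart \<open>k\<close> the
  transition maps carry it over.\<close>

lemma bump_on_locCk:
 assumes k: "k < n" and r: "0 < r" "cball y0 r Int half_space <= V k" and i: "i < n"
 shows "locCk 1 (V i) (bump_on k y0 r o \<psi> i)"
proof (rule locCk_openin)
 fix y assume y: "y : V i"
 let ?K = "\<psi> k ` (cball y0 r Int half_space)"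
 show "EX A. openin (top_of_set (V i)) A & y : A & locCk 1 A (bump_on k y0 r o \<psi> i)"
 proof (cases "\<psi> i y : U k")
  case True
  let ?A = "\<phi> i ` (U i Int U k)"
  have "openin (top_of_set (V i)) ?A"
   by (rule openin_subset_trans[OF overlap_openin[OF i k] _ openin_imp_subset[OF chart(2)[OF i]]]) auto
  moreover have "y : ?A" using y True psi_in[OF y] i by (intro image_eqI[of _ _ "\<psi> i y"]) auto
  moreover have "locCk 1 ?A (bump_on k y0 r o \<psi> i)"
  proof (rule locCk_cong)
   show "locCk 1 ?A (%y. bump_fun y0 r (T i k y))"
    by (rule locCk_compose[OF locally_smooth_locCk[OF compat(1)[OF i k]] open_UNIV bump_fun_Ck]) simp
   show "bump_fun y0 r (T i k y) = (bump_on k y0 r o \<psi> i) y" if "y : ?A" for y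
    using that i by (auto simp: bump_on_def)
  qed
  ultimately show ?thesis by blast
 next
  case False
  let ?A = "V i Int \<psi> i -` (- ?K)"
  have "openin (top_of_set (V i)) ?A"
   by (rule continuous_openin_preimage_gen[OF homeomorphism_cont2[OF chart(3)[OF i]] open_Compl[OF chart_ball_closed[OF k r(2)]]])
  moreover have "y : ?A"
  proof -
   have "?K <= U k" using r(2) psi_in by blast
   thus ?thesis using y False by blast
  qed
  moreover have "locCk 1 ?A (bump_on k y0 r o \<psi> i)"
   by (rule locCk_cong[OF locCk_const[of _ _ 0]]) (use bump_on_support(3)[OF k r(1)] in fastforce)
  ultimately show ?thesis by blast
 qed
qed

end

context mfd_boundary
begin

lemma stokes_local:
 assumes k: "k < n" and y0: "y0 $ 1 <= 0" and r: "0 < r" and W: "open W" "cball y0 r <= W" "cball y0 r Int half_space <= V k"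
  and a: "!!i. i < n ==> locCk 1 (V i) (a o \<psi> i)" "!!m. m ~: \<psi> k ` (cball y0 r Int half_space) ==> a m = 0"
  and b: "!!i. i < n ==> locCk 1 (V i) (b o \<psi> i)" and c: "!!i. i < n ==> locCk 1 (V i) (c o \<psi> i)"
  and BC: "Ck_on 2 W B" "Ck_on 2 W C" "!!y. y : W Int V k ==> B y = b (\<psi> k y)" "!!y. y : W Int V k ==> C y = c (\<psi> k y)"
  and bc: "Ck_on 1 UNIV (b o \<iota>)" "Ck_on 1 UNIV (c o \<iota>)"
 shows "has_int (%i. jac (a o \<psi> i) (b o \<psi> i) (c o \<psi> i)) (integral square (%x. a (\<iota> x) * tm (b o \<iota>) (c o \<iota>) x))"
proof -
 let ?K = "\<psi> k ` (cball y0 r Int half_space)"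
 let ?J = "%i. jac (a o \<psi> i) (b o \<psi> i) (c o \<psi> i)"
 \<comment> \<open>The indicator forces the value 0 off \<open>U k\<close> at every point. The bare
   Jacobian vanishes at interior points only, as \<open>fd\<close> carries no information on the
   boundary plane.\<close>
 let ?d = "%i y. indicator (U k) (\<psi> i y) * ?J i y"
 have KU: "?K <= U k" using W(3) psi_in by blast
 have a1: "a (\<psi> k y) = 0" if "y : V k - cball y0 r" for y
 proof (rule a(2))
  show "\<psi> k y ~: ?K"
  proof
   assume "\<psi> k y : ?K"
   then obtain z where z: "z : cball y0 r Int half_space" "\<psi> k y = \<psi> k z" by blast
   hence "y = z" using phi_psi[OF k, of y] phi_psi[OF k, of z] that W(3) by auto
   thus False using z that by simp
  qed
 qed
 note S = chart_stokes[OF k y0 r W a(1)[OF k] a1 BC]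
 have dk: "?d k y = ?J k y" if "y : V k" for y using psi_in[OF that] by simp
 have "?d k absolutely_integrable_on V k"
  by (rule set_integrable_cong[OF refl refl dk, THEN iffD2, OF _ S(1)]) assumption
 moreover have "form3 ?d" by (rule form3_jac[OF a(1) b c])
 ultimately have "has_int ?d (integral (V k) (?d k))"
  by (intro has_int_chart[OF _ k]) auto
 also have "integral (V k) (?d k) = integral (V k) (?J k)" by (rule integral_cong) (rule dk)
 also have "... = integral square (%x. a (\<iota> x) * tm (b o \<iota>) (c o \<iota>) x)"
 proof -
  have a2: "a m = 0" if "m : M - U k" for m using a(2)[of m] KU that by blast
  show ?thesis
   by (rule trans[OF S(2) chart_boundary[OF k W(1,2) a1 a2 continuous_on_M[OF locCk_continuous[OF a(1)]] BC bc]]) auto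
 qed
 finally show ?thesis
 proof (rule has_int_cong)
  fix i m assume im: "i < n" "m : U i" "\<phi> i m $ 1 < 0"
  show "?d i (\<phi> i m) = ?J i (\<phi> i m)"
  proof (cases "m : U k")
   case False
   have "?J i (\<phi> i m) = 0"
    by (rule jac_zero[OF V_preimage_open[OF im(1) chart_ball_closed[OF k W(3)]]]) (use im False KU a(2) in auto)
   thus ?thesis by simp
  qed (use im in simp)
 qed
qed

text \<open>A partition of unity by bumps on balls in charts, multiplied into \<open>a\<close>,
  leaves \<open>b\<close> and \<open>c\<close> untouched. The balls are so small that
  \<open>b\<close> and \<open>c\<close> have C^2 extensions across the boundary plane near
  them.\<close>

theorem stokes:
 assumes a: "!!i. i < n ==> locCk 1 (V i) (a o \<psi> i)"
  and b: "!!i. i < n ==> locCk 2 (V i) (b o \<psi> i)" and c: "!!i. i < n ==> locCk 2 (V i) (c o \<psi> i)"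
  and bc: "Ck_on 1 UNIV (b o \<iota>)" "Ck_on 1 UNIV (c o \<iota>)"
 shows "has_int (%i. jac (a o \<psi> i) (b o \<psi> i) (c o \<psi> i)) (integral square (%x. a (\<iota> x) * tm (b o \<iota>) (c o \<iota>) x))"
proof -
 have b1: "locCk 1 (V i) (b o \<psi> i)" and c1: "locCk 1 (V i) (c o \<psi> i)" if "i < n" for i
  by (rule locCk_le[OF _ b[OF that]], simp) (rule locCk_le[OF _ c[OF that]], simp)
 define I where "I a = integral square (%x. a (\<iota> x) * tm (b o \<iota>) (c o \<iota>) x)" for a
 define P where "P k y0 r \<longleftrightarrow> k < n & y0 : V k & 0 < r & cball y0 r Int half_space <= V k &
  (EX W B C. open W & cball y0 r <= W & Ck_on 2 W B & Ck_on 2 W C &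
    (ALL y:W Int V k. B y = b (\<psi> k y) & C y = c (\<psi> k y)))" for k y0 r
 have "EX k r. P k (\<phi> k m) r & m : U k" if m: "m : M" for m
 proof -
  obtain k where k: "k < n" "m : U k" using m cover by auto
  let ?y = "\<phi> k m"
  have yV: "?y : V k" using k by blast
  obtain W B where B: "open W" "?y : W" "Ck_on 2 W B" "ALL z:W Int V k. B z = (b o \<psi> k) z" by (rule locCkE[OF b[OF k(1)] yV])
  obtain W' C where C: "open W'" "?y : W'" "Ck_on 2 W' C" "ALL z:W' Int V k. C z = (c o \<psi> k) z" by (rule locCkE[OF c[OF k(1)] yV])
  obtain O' where O': "open O'" "V k = half_space Int O'" using chart(2)[OF k(1)] by (auto simp: openin_open)
  have "open (W Int W' Int O')" "?y : W Int W' Int O'" using B C O' yV by auto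
  then obtain r where r: "0 < r" "cball ?y r <= W Int W' Int O'" using open_contains_cball by meson
  have "Ck_on 2 (W Int W') B" "Ck_on 2 (W Int W') C"
   by (rule Ck_on_subset[OF B(3)], simp) (rule Ck_on_subset[OF C(3)], simp)
  hence "EX W B C. open W & cball ?y r <= W & Ck_on 2 W B & Ck_on 2 W C & (ALL y:W Int V k. B y = b (\<psi> k y) & C y = c (\<psi> k y))"
   by (rule_tac exI[of _ "W Int W'"], rule_tac exI[of _ B], rule_tac exI[of _ C]) (use B(1,4) C(1,4) r(2) in auto)
  moreover have "cball ?y r Int half_space <= V k" using r(2) O'(2) by blast
  ultimately have "P k ?y r" unfolding P_def using k(1) yV r(1) by blast
  thus ?thesis using k(2) by blast
 qed
 then obtain k r where kr: "!!m. m : M ==> P (k m) (\<phi> (k m) m) (r m) & m : U (k m)" by metis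
 define \<beta> where "\<beta> e = bump_on (k e) (\<phi> (k e) e) (r e)" for e
 have Pe: "k e < n" "\<phi> (k e) e : V (k e)" "0 < r e" "cball (\<phi> (k e) e) (r e) Int half_space <= V (k e)" if "e : M" for e
  using kr[OF that] unfolding P_def by blast+
 have \<beta>C: "locCk 1 (V i) (\<beta> e o \<psi> i)" if "e : M" "i < n" for e i
  unfolding \<beta>_def by (rule bump_on_locCk[OF Pe(1,3,4)[OF that(1)] that(2)])
 have \<beta>c: "continuous_on M (\<beta> e)" if "e : M" for e
  by (rule continuous_on_M[OF locCk_continuous[OF \<beta>C[OF that]]])
 have \<beta>0: "\<beta> e m >= 0" for e m by (simp add: \<beta>_def bump_on_def bump_fun_nonneg)
 have \<beta>p: "\<beta> e e > 0" if "e : M" for e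
  using kr[OF that] bump_fun_pos[OF Pe(3)[OF that]] by (simp add: \<beta>_def bump_on_def)
 have "EX A. open A & {m:M. 0 < \<beta> e m} = M Int A" if "e : M" for e
 proof -
  have "openin (top_of_set M) (M Int \<beta> e -` {0<..})" by (rule continuous_openin_preimage_gen[OF \<beta>c[OF that] open_greaterThan])
  then obtain A where "open A" "M Int \<beta> e -` {0<..} = M Int A" by (auto simp: openin_open)
  thus ?thesis by (intro exI[of _ A]) auto
 qed
 then obtain A where A: "!!e. e : M ==> open (A e) & {m:M. 0 < \<beta> e m} = M Int A e" by metis
 have "M <= (UN e:M. A e)" using A \<beta>p by blast
 then obtain E where E: "E <= M" "finite E" "M <= (UN e:E. A e)"
  using compactE_image[OF compact_M, of M A] A by (metis (no_types, lifting))
 define S where "S m = (SUM e:E. \<beta> e m)" for m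
 have Sp: "0 < S m" if "m : M" for m
 proof -
  have "m : (UN e:E. A e)" using E(3) that by (rule subsetD)
  then obtain e where "e : E" "m : A e" by (rule UN_E)
  hence "e : E" "0 < \<beta> e m" using A[of e] E(1) that by auto
  thus ?thesis unfolding S_def using \<beta>0 by (intro sum_pos2[OF E(2)]) auto
 qed
 define \<alpha> where "\<alpha> e m = a m * (\<beta> e m * (1 / S m))" for e m
 have \<alpha>C: "locCk 1 (V i) (\<alpha> e o \<psi> i)" if "e : E" "i < n" for e i
 proof -
  have "locCk 1 (V i) (%y. 1 / (SUM e:E. (\<beta> e o \<psi> i) y))"
  proof (rule locCk_inverse[OF locCk_sum])
   show "locCk 1 (V i) (\<beta> e' o \<psi> i)" if "e' : E" for e' by (rule \<beta>C[OF subsetD[OF E(1) that] \<open>i < n\<close>])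
   show "0 < (SUM e:E. (\<beta> e o \<psi> i) y)" if "y : V i" for y
    using Sp[OF subsetD[OF U_sub[OF \<open>i < n\<close>] psi_in[OF that]]] by (simp add: S_def)
  qed
  hence "locCk 1 (V i) (%y. (a o \<psi> i) y * ((\<beta> e o \<psi> i) y * (1 / (SUM e:E. (\<beta> e o \<psi> i) y))))"
   by (rule locCk_mult[OF a[OF that(2)] locCk_mult[OF \<beta>C[OF subsetD[OF E(1) that(1)] that(2)]]])
  thus ?thesis by (simp add: \<alpha>_def S_def comp_def)
 qed
 have \<alpha>S: "(SUM e:E. \<alpha> e m) = a m" if "m : M" for m
 proof -
  have "(SUM e:E. \<alpha> e m) = a m * (S m * (1 / S m))"
   unfolding \<alpha>_def S_def by (simp only: sum_distrib_left[symmetric] sum_distrib_right[symmetric])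
  thus ?thesis using Sp[OF that] by simp
 qed
 let ?J = "%a i. jac (a o \<psi> i) (b o \<psi> i) (c o \<psi> i)"
 have loc: "has_int (?J (\<alpha> e)) (I (\<alpha> e))" if e: "e : E" for e
 proof -
  have eM: "e : M" using e E(1) by blast
  obtain W B C where W: "open W" "cball (\<phi> (k e) e) (r e) <= W" "Ck_on 2 W B" "Ck_on 2 W C"
    "ALL y:W Int V (k e). B y = b (\<psi> (k e) y) & C y = c (\<psi> (k e) y)"
   using kr[OF eM] unfolding P_def by blast
  show ?thesis unfolding I_def
  proof (rule stokes_local[OF Pe(1)[OF eM] V_half[OF Pe(1)[OF eM] Pe(2)[OF eM]] Pe(3)[OF eM] W(1,2) Pe(4)[OF eM] \<alpha>C[OF e] _ _ _ W(3,4) _ _ bc])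
   show "\<alpha> e m = 0" if "m ~: \<psi> (k e) ` (cball (\<phi> (k e) e) (r e) Int half_space)" for m
   proof -
    have "\<beta> e m = 0" using bump_on_support(3)[OF Pe(1)[OF eM] Pe(3)[OF eM]] that unfolding \<beta>_def by blast
    thus ?thesis by (simp add: \<alpha>_def)
   qed
  qed (use W(5) b1 c1 in auto)
 qed
 have "has_int (%i y. SUM e:F. ?J (\<alpha> e) i y) (SUM e:F. I (\<alpha> e))" if "F <= E" for F
  using finite_subset[OF that E(2)] that
 proof (induction F rule: finite_induct)
  case (insert e F)
  hence F: "F <= E" "e : E" by auto
  from has_int_add[OF loc[OF F(2)] insert.IH[OF F(1)]] show ?case unfolding sum.insert[OF insert(1,2)] .
 qed (simp add: has_int_0)
 hence "has_int (%i y. SUM e:E. ?J (\<alpha> e) i y) (SUM e:E. I (\<alpha> e))" by simp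
 moreover have "(SUM e:E. I (\<alpha> e)) = I a"
 proof -
  have "(%x. \<alpha> e (\<iota> x) * tm (b o \<iota>) (c o \<iota>) x) integrable_on square" if "e : E" for e
  proof (rule integrable_continuous, rule continuous_on_mult[OF _ tm_continuous[OF bc]])
   show "continuous_on square (%x. \<alpha> e (\<iota> x))"
    by (rule continuous_on_compose2[OF continuous_on_M[OF locCk_continuous[OF \<alpha>C[OF that]]] continuous_on_subset[OF iota_continuous]])
     (use iota_in_M in auto)
  qed
  hence "(SUM e:E. I (\<alpha> e)) = integral square (%x. SUM e:E. \<alpha> e (\<iota> x) * tm (b o \<iota>) (c o \<iota>) x)"
   unfolding I_def by (intro integral_sum[symmetric] E(2))
  thus ?thesis unfolding I_def by (simp add: sum_distrib_right[symmetric] \<alpha>S iota_in_M)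
 qed
 ultimately have "has_int (%i y. SUM e:E. ?J (\<alpha> e) i y) (I a)" by simp
 thus ?thesis unfolding I_def
 proof (rule has_int_cong)
  fix i m assume im: "i < n" "m : U i" "\<phi> i m $ 1 < 0"
  have y: "\<phi> i m : {y:V i. y $ 1 < 0}" using im by blast
  have d: "(\<alpha> e o \<psi> i) differentiable (at (\<phi> i m))" if "e : E" for e
   using Ck_on_SucD(1)[OF _ y, of 0 "\<alpha> e o \<psi> i"] locCk_open[OF V_open[OF im(1)] _ \<alpha>C[OF that im(1)]]
   unfolding differentiable_def by auto
  have "(SUM e:E. ?J (\<alpha> e) i (\<phi> i m)) = jac (%z. SUM e:E. (\<alpha> e o \<psi> i) z) (b o \<psi> i) (c o \<psi> i) (\<phi> i m)"
   by (rule jac_sum[OF E(2) d, symmetric])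
  also have "... = ?J a i (\<phi> i m)"
   by (rule jac_cong[OF V_open[OF im(1)] y]) (use \<alpha>S U_sub[OF im(1)] psi_in im(1) in auto)
  finally show "(SUM e:E. ?J (\<alpha> e) i (\<phi> i m)) = ?J a i (\<phi> i m)" .
 qed
qed

abbreviation D2 :: "(real^2 => complex^2^2) => real^2 => 2 => complex^2^2" where
 "D2 g x i == fd g x (axis i 1)"

text \<open>Stokes for the three summands of the cut-off primitive of a translate. The minus sign
  compares the frame (d/dx1, d/dx2) used in \<open>beta\<close> with the positive one. Excluded are
  the translates belonging to critical values in the interior of a chart or to the image of the
  boundary torus.\<close>

theorem wess_zumino_boundary:
 assumes ext: "smooth_extension M cs \<iota> g gt" and g: "smooth g"
 obtains N where "negligible N" "!!v. v ~: N ==> norm v < 1 ==> EX k::int. wess_zumino_integral cs gt =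
   - integral square (%x. beta (cen v ** g x) (cen v ** D2 g x 1) (cen v ** D2 g x 2)) + 2 * pi * k"
proof -
 have gtS: "gt m : SU2" if "m : M" for m using ext that unfolding smooth_extension_def by blast
 have gti: "gt (\<iota> x) = g x" for x using ext unfolding smooth_extension_def by blast
 have gtC: "locCk k (V i) (gt o \<psi> i)" if "i < n" for i k
 proof (rule locally_smooth_locCk)
  show "locally_smooth_on (V i) (gt o \<psi> i)"
   using ext nth_mem[OF that] unfolding smooth_extension_def by (auto simp: case_prod_unfold)
 qed
 have gtS': "gt (\<psi> i y) : SU2" if "i < n" "y : V i" for i y
  by (rule gtS[OF subsetD[OF U_sub[OF that(1)] psi_in[OF that(2)]]])
 have gd: "(g has_derivative fd g x) (at x)" for x
  by (rule Ck_on_SucD(1)[OF smooth_on_Ck[OF g] UNIV_I])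
 have gtd: "(gt o \<psi> i) differentiable (at y)" if "i < n" "y : {y:V i. y $ 1 < 0}" for i y
 proof -
  have "Ck_on (Suc 0) {y:V i. y $ 1 < 0} (gt o \<psi> i)" by (rule locCk_open[OF V_open[OF that(1)] _ gtC[OF that(1)]]) auto
  from Ck_on_SucD(1)[OF this that(2)] show ?thesis unfolding differentiable_def by blast
 qed
 define crit where "crit i = {p3 ((gt o \<psi> i) y) | y. y : {y:V i. y $ 1 < 0} &
   jdet (%z. p3 ((gt o \<psi> i) z)) y = 0}" for i
 define N where "N = (UN i:{..<n}. crit i) Un range (%x. p3 (g x))"
 have "negligible (range (%x. p3 (g x)))"
 proof (rule negligible_differentiable_image_lowdim)
  show "(%x. p3 (g x)) differentiable_on UNIV"
   using bounded_linear.has_derivative[OF bounded_linear_p3 gd] unfolding differentiable_on_def differentiable_def by blast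
 qed simp
 moreover have "negligible (crit i)" if "i < n" for i
  unfolding crit_def by (rule negligible_critical_values[OF gtd[OF that]])
 ultimately have "negligible N" unfolding N_def
  by (intro negligible_Un negligible_Union) auto
 thus ?thesis
 proof (rule that)
  fix v :: "real^3" assume vN: "v ~: N" and v: "norm v < 1"
  define q where "q m = cen v ** gt m" for m
  have cS: "cen v : SU2" using cen_SU2 v by simp
  have qS: "q m : SU2" if "m : M" for m unfolding q_def by (rule SU2_mult[OF cS gtS[OF that]])
  have qC: "locCk k (V i) (%y. q (\<psi> i y))" if "i < n" for i k
   using locCk_linear[OF bounded_linear_mat_left gtC[OF that]] by (simp add: q_def)
  have LC: "locCk k (V i) ((%m. L (q m)) o \<psi> i)" if "bounded_linear L" "i < n" for L :: "complex^2^2 => real" and i k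
   using locCk_linear[OF that(1) qC[OF that(2)]] by (simp add: comp_def)
  define w x1 x2 x3 where "w m = qw (q m)" and "x1 m = qx (q m)" and "x2 m = qy (q m)" and "x3 m = qz (q m)" for m
  have wx: "w = (%m. qw (q m))" "x1 = (%m. qx (q m))" "x2 = (%m. qy (q m))" "x3 = (%m. qz (q m))"
   by (auto simp: w_def x1_def x2_def x3_def)
  have xC: "locCk k (V i) (w o \<psi> i)" "locCk k (V i) (x1 o \<psi> i)" "locCk k (V i) (x2 o \<psi> i)" "locCk k (V i) (x3 o \<psi> i)" if "i < n" for i k
   unfolding wx by (rule LC[OF _ that], rule bounded_linear_q)+
  have wb: "-1 <= w m" "w m < 3" if "m : M" for m using SU2_qw_bounds[OF qS[OF that]] by (auto simp: w_def)
  have wc: "continuous_on M w" by (rule continuous_on_M[OF locCk_continuous[OF xC(1)]])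
  have pole: "p3 (gt m) = v" if "m : M" "w m = -1" for m
   by (rule cen_pole) (use v gtS[OF that(1)] that(2) in \<open>auto simp: w_def q_def\<close>)
  have bnd: "w (\<iota> x) ~= -1" for x
   using pole[OF iota_in_M[of x]] vN gti[of x] unfolding N_def by auto
  define J where "J i = jac (x1 o \<psi> i) (x2 o \<psi> i) (x3 o \<psi> i)" for i
  define \<Lambda> where "\<Lambda> \<theta> a \<longleftrightarrow> has_int (%i y. \<theta> (\<psi> i y) * J i y) a" for \<theta> a
  have form: "form3 (%i y. \<theta> (\<psi> i y) * J i y)" for \<theta>
   unfolding J_def by (rule form3_jac[OF xC(2,3,4)])
  have "near_pole (%w0. EX k::int. \<Lambda> (%x. defect w0 (w x)) (2 * pi * k))"
  proof (rule degree_integrality[OF compact_M wc wb(1)])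
   show "\<Lambda> (%_. 0) 0" using has_int_0 by (simp add: \<Lambda>_def)
   show "\<Lambda> (%m. \<theta> m + \<theta>' m) (a + a')" if "\<Lambda> \<theta> a" "\<Lambda> \<theta>' a'" for \<theta> \<theta>' a a'
    using has_int_add that unfolding \<Lambda>_def by (simp add: distrib_right)
   show "\<Lambda> \<theta>' a" if "\<Lambda> \<theta> a" "!!m. m : M ==> \<theta> m = \<theta>' m" for \<theta> \<theta>' a
    using that(1) unfolding \<Lambda>_def by (rule has_int_cong) (use that(2) U_sub in auto)
   fix m assume m: "m : M" "w m = -1"
   obtain k where k: "k < n" "m : U k" using m(1) cover by auto
   let ?W = "{y:V k. y $ 1 < 0}" and ?y = "\<phi> k m" and ?G = "%y. cen v ** (gt o \<psi> k) y"
   \<comment> \<open>The image of the boundary torus is excluded, so a pole is an interior point and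
     the chart is open around it.\<close>
   have "m ~: range \<iota>" using bnd m(2) by blast
   hence "?y $ 1 ~= 0" using boundary_chart[OF k] by blast
   hence yW: "?y : ?W" using V_half[OF k(1), of ?y] k(2) by simp
   have wy: "w (\<psi> k y) = qw (?G y)" for y by (simp add: w_def q_def)
   have pole': "qw (?G ?y) = -1" using m(2) k by (simp add: w_def q_def)
   have "p3 ((gt o \<psi> k) ?y) = v" using pole[OF m] k by simp
   hence "jdet (%z. p3 ((gt o \<psi> k) z)) ?y ~= 0"
    using vN yW k(1) unfolding N_def crit_def by blast
   moreover have "?G ?y = - mat 1" using SU2_minus_one[OF qS[OF m(1)]] m(2) k by (simp add: w_def q_def)
   moreover have "(gt o \<psi> k) ` ?W <= SU2" using gtS'[OF k(1)] by auto
   ultimately have reg: "jdet (%z. p3 (?G z)) ?y ~= 0"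
    by (intro regular_left_mult[OF V_open[OF k(1)] yW _ gtd[OF k(1) yW] cS])
   have GW: "?G ` ?W <= SU2" using gtS'[OF k(1)] SU2_mult[OF cS] by auto
   have GC: "Ck_on 1 ?W ?G"
    by (rule locCk_open[OF V_open[OF k(1)] _ locCk_linear[OF bounded_linear_mat_left gtC[OF k(1)]]]) auto
   obtain O' where O': "open O'" "?y : O'" "O' <= ?W" "!!y. y : O' ==> qw (?G y) = -1 ==> y = ?y"
    "!!U'. open U' ==> U' <= O' ==> ?y : U' ==> near_pole (%w0. integral_2pi U' (%y. defect w0 (qw (?G y)) * qjac ?G y))"
    using SU2_local_degree[OF V_open[OF k(1)] yW GW GC pole' reg] by blast
   have Jk: "J k = qjac ?G"
    by (simp add: J_def wx q_def comp_def)
   have "openin (top_of_set (V k)) O'" using O'(1,3) by (intro open_subset) auto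
   hence "openin (top_of_set (U k)) (\<psi> k ` O')"
    using homeomorphism_imp_open_map[OF homeomorphism_symD[OF chart(3)[OF k(1)]]] by blast
   hence "openin (top_of_set M) (\<psi> k ` O')" using chart(1)[OF k(1)] openin_trans by blast
   then obtain N where N: "open N" "\<psi> k ` O' = M Int N" by (auto simp: openin_open)
   have inO: "y : O'" if "y : V k" "\<psi> k y : N" for y
   proof -
    have "\<psi> k y : \<psi> k ` O'" using N(2) that U_sub[OF k(1)] psi_in by blast
    then obtain z where z: "z : O'" "\<psi> k y = \<psi> k z" by blast
    hence "y = z" using phi_psi[OF k(1), of y] phi_psi[OF k(1), of z] that(1) O'(3) by auto
    thus ?thesis using z(1) by simp
   qed
   show "EX N. open N & m : N & (ALL m':N Int M. w m' = -1 --> m' = m) &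
    (ALL N'. open N' --> N' <= N --> m : N' -->
      (near_pole (%w0. EX k::int. \<Lambda> (%x. indicator N' x * defect w0 (w x)) (2 * pi * k))))"
   proof (rule exI[of _ N], intro conjI allI impI ballI N(1))
    have "\<psi> k ?y : \<psi> k ` O'" using O'(2) by (rule imageI)
    thus "m : N" using N(2) k by simp
    show "m' = m" if m': "m' : N Int M" "w m' = -1" for m'
    proof -
     have "m' : \<psi> k ` O'" using m'(1) unfolding N(2) by simp
     then obtain z where z: "z : O'" "m' = \<psi> k z" by auto
     hence "z = ?y" using O'(4)[of z] m'(2) wy by simp
     thus ?thesis using z k by simp
    qed
    fix N' assume N': "open N'" "N' <= N" "m : N'"
    define U' where "U' = O' Int \<psi> k -` N'"
    have U': "open U'" "U' <= O'" "?y : U'"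
    proof -
     have "O' <= V k" using O'(3) by blast
     thus "open U'" unfolding U'_def
      by (intro continuous_open_preimage[OF continuous_on_subset[OF homeomorphism_cont2[OF chart(3)[OF k(1)]]] O'(1) N'(1)])
    qed (use O'(2) k N'(3) in \<open>auto simp: U'_def\<close>)
    obtain w1 where w1: "w1 > -1" "!!w0. -1 < w0 ==> w0 < w1 ==>
     (integral_2pi U' (%y. defect w0 (w (\<psi> k y)) * J k y))"
     using O'(5)[OF U'] unfolding Jk wy by blast
    have "EX k'::int. \<Lambda> (%x. indicator N' x * defect w0 (w x)) (2 * pi * k')" if w0: "-1 < w0" "w0 < w1" for w0
    proof -
     obtain k' :: int where k': "(%y. defect w0 (w (\<psi> k y)) * J k y) absolutely_integrable_on U'" "integral U' (%y. defect w0 (w (\<psi> k y)) * J k y) = 2 * pi * k'"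
      using w1(2)[OF w0] by blast
     let ?d = "%i y. (indicator N' (\<psi> i y) * defect w0 (w (\<psi> i y))) * J i y"
     have UV: "y : U' \<longleftrightarrow> y : V k & \<psi> k y : N'" for y
      using inO[of y] N'(2) O'(3) by (auto simp: U'_def)
     have eq: "(%y. if y : V k then ?d k y else 0) = (%y. if y : U' then defect w0 (w (\<psi> k y)) * J k y else 0)"
      by (auto simp: fun_eq_iff UV indicator_def)
     have "?d k absolutely_integrable_on V k"
      unfolding absolutely_integrable_restrict_UNIV[symmetric, of "V k"] eq
      using k'(1) by (simp only: absolutely_integrable_restrict_UNIV)
     moreover have "?d i (\<phi> i m') = 0" if "i < n" "m' : U i - U k" for i m'
     proof -
      have "m' : M" using that U_sub by blast
      moreover have "M Int N <= U k" unfolding N(2)[symmetric] using O'(3) psi_in by blast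
      ultimately have "m' ~: N'" using N'(2) that by blast
      thus ?thesis using that by simp
     qed
     ultimately have "has_int ?d (integral (V k) (?d k))"
      by (intro has_int_chart[OF form k(1)])
     moreover have "integral (V k) (?d k) = integral U' (%y. defect w0 (w (\<psi> k y)) * J k y)"
      unfolding integral_restrict_UNIV[symmetric, of "V k"] eq by (simp only: integral_restrict_UNIV)
     ultimately show ?thesis unfolding \<Lambda>_def k'(2) by auto
    qed
    thus "near_pole (%w0. EX k::int. \<Lambda> (%x. indicator N' x * defect w0 (w x)) (2 * pi * k))"
     using w1(1) by blast
   qed
  qed
  then obtain w1 where w1: "w1 > -1" "!!w0. -1 < w0 ==> w0 < w1 ==> EX k::int. \<Lambda> (%x. defect w0 (w x)) (2 * pi * k)"
   by blast
  have "continuous_on square (%x. w (\<iota> x))"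
   by (rule continuous_on_compose2[OF wc continuous_on_subset[OF iota_continuous]]) (use iota_in_M in auto)
  moreover have "-1 < w (\<iota> x)" for x using bnd[of x] wb(1)[OF iota_in_M[of x]] by linarith
  ultimately obtain d0 where d0: "d0 > -1" "!!x. x : square ==> d0 <= w (\<iota> x)"
   using minimum_above[OF compact_cbox, of 0 "vector [2 * pi, 2 * pi]" "%x. w (\<iota> x)" "-1"] by metis
  define w0 where "w0 = (-1 + min 0 (min w1 d0)) / 2"
  have w0: "-1 < w0" "w0 < 0" "w0 < w1" "w0 < d0" "w0 < 3" using w1(1) d0(1) by (auto simp: w0_def)
  obtain k :: int where k: "has_int (%i y. defect w0 (w (\<psi> i y)) * J i y) (2 * pi * k)"
   using w1(2)[OF w0(1,3)] unfolding \<Lambda>_def by blast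
  define A where "A L m = kcut w0 (w m) * L (q m)" for L :: "complex^2^2 => real" and m
  have AC: "locCk 1 (V i) (A L o \<psi> i)" if "bounded_linear L" "i < n" for L i
  proof -
   have "locCk 1 (V i) (%y. kcut w0 ((w o \<psi> i) y))"
    by (rule locCk_compose[OF xC(1)[OF that(2)] open_lessThan kcut_Ck[OF w0(1,5)]])
     (use wb(2) U_sub[OF that(2)] that(2) in auto)
   from locCk_mult[OF this LC[OF that]] show ?thesis by (simp add: A_def comp_def)
  qed
  have qd: "((%x. L (q (\<iota> x))) has_derivative (%u. L (cen v ** fd g x u))) (at x)" if "bounded_linear L" for L :: "complex^2^2 => real" and x
   using bounded_linear.has_derivative[OF that bounded_linear.has_derivative[OF bounded_linear_mat_left gd]] by (simp add: q_def gti)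
  have xi: "Ck_on 1 UNIV (x1 o \<iota>)" "Ck_on 1 UNIV (x2 o \<iota>)" "Ck_on 1 UNIV (x3 o \<iota>)"
   unfolding wx comp_def q_def gti
   by (intro Ck_on_q Ck_on_compose_linear[OF open_UNIV bounded_linear_mat_left] open_UNIV smooth_on_Ck[OF g])+
  note L = bounded_linear_q(2,3,4)
  note S = stokes[OF AC[OF L(1)] xC(3,4) xi(2,3)] stokes[OF AC[OF L(2)] xC(4,2) xi(3,1)] stokes[OF AC[OF L(3)] xC(2,3) xi(1,2)]
  define I where "I L b c = integral square (%x. A L (\<iota> x) * tm (b o \<iota>) (c o \<iota>) x)" for L b c
  note tot = has_int_add[OF has_int_add[OF has_int_add[OF S(1) S(2)] S(3)] k, folded I_def]
  have "has_int (%i. Omega3 (gt o \<psi> i)) (I qx x2 x3 + I qy x3 x1 + I qz x1 x2 + 2 * pi * k)"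
   using tot
  proof (rule has_int_cong)
   fix i m assume im: "i < n" "m : U i" "\<phi> i m $ 1 < 0"
   let ?y = "\<phi> i m" and ?W = "{y:V i. y $ 1 < 0}" and ?G = "%y. cen v ** (gt o \<psi> i) y"
   have y: "?y : ?W" using im by blast
   have GW: "?G ` ?W <= SU2" using gtS'[OF im(1)] SU2_mult[OF cS] by auto
   have "Omega3 ?G ?y = Omega3 (gt o \<psi> i) ?y"
    unfolding D3_left_mult(1)[OF gtd[OF im(1) y]] using Omega_left_mult[OF cS gtS'[OF im(1), of ?y]] y by simp
   with Omega3_decomposition[OF V_open[OF im(1)] y GW D3_left_mult(2)[OF gtd[OF im(1) y]] w0(1,2)]
   show "jac (A qx o \<psi> i) (x2 o \<psi> i) (x3 o \<psi> i) ?y + jac (A qy o \<psi> i) (x3 o \<psi> i) (x1 o \<psi> i) ?y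
     + jac (A qz o \<psi> i) (x1 o \<psi> i) (x2 o \<psi> i) ?y + defect w0 (w (\<psi> i ?y)) * J i ?y = Omega3 (gt o \<psi> i) ?y"
    unfolding J_def by (simp add: wx A_def q_def comp_def)
  qed
  hence "wess_zumino_integral cs gt = I qx x2 x3 + I qy x3 x1 + I qz x1 x2 + 2 * pi * k"
   unfolding has_int_def wess_zumino_integral_def Let_def piece_def by simp
  also have "I qx x2 x3 + I qy x3 x1 + I qz x1 x2 =
    - integral square (%x. beta (cen v ** g x) (cen v ** D2 g x 1) (cen v ** D2 g x 2))"
  proof -
   have i: "(%x. A L (\<iota> x) * tm (b o \<iota>) (c o \<iota>) x) integrable_on square" if "bounded_linear L" "Ck_on 1 UNIV (b o \<iota>)" "Ck_on 1 UNIV (c o \<iota>)" for L b c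
   proof (rule integrable_continuous, rule continuous_on_mult[OF _ tm_continuous[OF that(2,3)]])
    show "continuous_on square (%x. A L (\<iota> x))"
     by (rule continuous_on_compose2[OF continuous_on_M[OF locCk_continuous[OF AC[OF that(1)]]] continuous_on_subset[OF iota_continuous]])
      (use iota_in_M in auto)
   qed
   note i' = i[OF L(1) xi(2,3)] i[OF L(2) xi(3,1)] i[OF L(3) xi(1,2)]
   have "I qx x2 x3 + I qy x3 x1 + I qz x1 x2 = integral square (%x. A qx (\<iota> x) * tm (x2 o \<iota>) (x3 o \<iota>) x
     + A qy (\<iota> x) * tm (x3 o \<iota>) (x1 o \<iota>) x + A qz (\<iota> x) * tm (x1 o \<iota>) (x2 o \<iota>) x)"
    unfolding I_def by (simp add: integral_add integrable_add i')
   also have "... = integral square (%x. - beta (cen v ** g x) (cen v ** D2 g x 1) (cen v ** D2 g x 2))"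
   proof (rule integral_cong)
    fix x assume x: "x : square"
    have D: "fd ((%m. L (q m)) o \<iota>) x u = L (cen v ** fd g x u)" if "bounded_linear L" for L :: "complex^2^2 => real" and u
     using frechet_derivative_at[OF qd[OF that], of x] by (simp add: comp_def fun_eq_iff)
    have "w0 < w (\<iota> x)" using d0(2)[OF x] w0(4) by linarith
    hence A: "A L (\<iota> x) = kfun (w (\<iota> x)) * L (q (\<iota> x))" for L by (simp add: A_def kcut_def)
    show "A qx (\<iota> x) * tm (x2 o \<iota>) (x3 o \<iota>) x + A qy (\<iota> x) * tm (x3 o \<iota>) (x1 o \<iota>) x + A qz (\<iota> x) * tm (x1 o \<iota>) (x2 o \<iota>) x
     = - beta (cen v ** g x) (cen v ** D2 g x 1) (cen v ** D2 g x 2)"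
     unfolding A tm_def wx D[OF L(1)] D[OF L(2)] D[OF L(3)] unfolding beta_def q_def gti by (simp add: algebra_simps)
   qed
   finally show ?thesis by simp
  qed
  finally show "EX k::int. wess_zumino_integral cs gt =
   - integral square (%x. beta (cen v ** g x) (cen v ** D2 g x 1) (cen v ** D2 g x 2)) + 2 * pi * k" by blast
 qed
qed

end

section \<open>Linear differential equations with parameters\<close>

text \<open>Hadamard's criterion: it suffices to write the increment with coefficients that are
  continuous at y. Differentiability of integrals and of solutions of differential equations is
  obtained from such exact formulas, without Gronwall estimates.\<close>

lemma hadamard_derivative:
 fixes f :: "real^3 => 'b::real_normed_vector"
 assumes f: "!!y'. f y' - f y = (SUM j:UNIV. (y' - y) $ j *\<^sub>R \<Psi> j y')" and c: "!!j. isCont (\<Psi> j) y"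
 shows "(f has_derivative (%v. SUM j:UNIV. v $ j *\<^sub>R \<Psi> j y)) (at y)"
 unfolding has_derivative_at
proof (intro conjI)
 show "bounded_linear (%v::real^3. SUM j:UNIV. v $ j *\<^sub>R \<Psi> j y)"
  by (intro bounded_linear_sum bounded_linear_scaleR_left[THEN bounded_linear_compose] bounded_linear_vec_nth)
 have b: "norm (f (y + h) - f y - (SUM j:UNIV. h $ j *\<^sub>R \<Psi> j y)) / norm h <= (SUM j:UNIV. norm (\<Psi> j (y + h) - \<Psi> j y))" for h
 proof (cases "h = 0")
  case False
  have "norm (f (y + h) - f y - (SUM j:UNIV. h $ j *\<^sub>R \<Psi> j y)) = norm (SUM j:UNIV. h $ j *\<^sub>R (\<Psi> j (y + h) - \<Psi> j y))"
   using f[of "y + h"] by (simp add: sum_subtractf scaleR_diff_right)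
  also have "... <= (SUM j:UNIV. norm h * norm (\<Psi> j (y + h) - \<Psi> j y))"
   by (intro order_trans[OF norm_sum] sum_mono) (simp add: component_le_norm_cart mult_right_mono)
  finally show ?thesis using False by (simp add: sum_distrib_left[symmetric] field_simps)
 qed (simp add: sum_nonneg)
 have "(%h. SUM j:UNIV. norm (\<Psi> j (y + h) - \<Psi> j y)) \<midarrow>0\<rightarrow> (SUM j:(UNIV :: 3 set). norm (\<Psi> j y - \<Psi> j y))"
  using c by (intro tendsto_intros) (simp add: isCont_iff)
 hence "(%h. SUM j:UNIV. norm (\<Psi> j (y + h) - \<Psi> j y)) \<midarrow>0\<rightarrow> 0" by simp
 thus "(%h. norm (f (y + h) - f y - (SUM j:UNIV. h $ j *\<^sub>R \<Psi> j y)) / norm h) \<midarrow>0\<rightarrow> 0"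
  by (rule Lim_null_comparison[rotated]) (use b in \<open>simp add: always_eventually\<close>)
qed

definition pdm :: "(real^3 => 'b::real_normed_vector) => 3 => real^3 => 'b" where
 "pdm f j y = fd f y (axis j 1)"

lemma pdm_sum:
 assumes "(f has_derivative f') (at y)" shows "f' v = (SUM j:UNIV. v $ j *\<^sub>R pdm f j y)"
proof -
 have e: "pdm f j y = f' (axis j 1)" for j
  using frechet_derivative_at[OF assms] by (simp add: pdm_def)
 have "v = (SUM j:UNIV. v $ j *\<^sub>R axis j 1)" for v :: "real^3"
  using basis_expansion[of v] by (simp add: scalar_mult_eq_scaleR)
 hence "f' v = f' (SUM j:UNIV. v $ j *\<^sub>R axis j 1)" by simp
 also have "... = (SUM j:UNIV. v $ j *\<^sub>R pdm f j y)"
  using has_derivative_linear[OF assms] by (simp add: linear_sum linear_scale e)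
 finally show ?thesis .
qed

lemma pdm_Ck: "Ck_on (Suc k) U f ==> Ck_on k U (pdm f j)"
 unfolding pdm_def[abs_def] by (rule Ck_on_SucD(2))

lemma pdm_has: "Ck_on (Suc k) UNIV f ==> (f has_derivative (%v. SUM j:UNIV. v $ j *\<^sub>R pdm f j y)) (at y)"
proof -
 assume "Ck_on (Suc k) UNIV f"
 hence d: "(f has_derivative fd f y) (at y)" by (rule Ck_on_SucD(1)) simp
 have "fd f y = (%v. SUM j:UNIV. v $ j *\<^sub>R pdm f j y)" using pdm_sum[OF d] by auto
 thus ?thesis using d by simp
qed

lemma pdm_eqI: "(f has_derivative f') (at y) ==> pdm f j y = f' (axis j 1)"
 using frechet_derivative_at[of f f' y] by (simp add: pdm_def)

section \<open>Difference quotients and segment integrals with parameters\<close>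

lemma integral_param_continuous:
 fixes f :: "'a::topological_space => real => 'b::banach"
 assumes "continuous_on (UNIV \<times> {0..1}) (%(y, s). f y s)" shows "continuous_on UNIV (%y. integral {0..1} (f y))"
 using integral_continuous_on_param[of UNIV 0 1 f] assms by simp

text \<open>The mean of a partial derivative over the segment from y to y', which is the coefficient
  in Hadamard's formula for the increment.\<close>

definition had :: "(real^3 => 'b::banach) => 3 => real^3 => real^3 => 'b" where
 "had f j y y' = integral {0..1} (%r. pdm f j (y + r *\<^sub>R (y' - y)))"

lemma had_diag: "had f j y y = pdm f j y"
 by (simp add: had_def)

lemma had_continuous:
 assumes "Ck_on (Suc 0) UNIV f" shows "continuous_on UNIV (%(y, y'). had f j y y')"
proof -
 have "continuous_on (UNIV \<times> {0..1}) (%(p, r). pdm f j (fst p + r *\<^sub>R (snd p - fst p)))"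
  unfolding case_prod_unfold
  by (rule continuous_on_compose2[OF Ck_on_continuous[OF pdm_Ck[OF assms]]]) (auto intro!: continuous_intros)
 from integral_param_continuous[OF this] show ?thesis by (simp add: had_def case_prod_unfold)
qed

lemma had_diff:
 assumes "Ck_on (Suc 0) UNIV f" shows "f y' - f y = (SUM j:UNIV. (y' - y) $ j *\<^sub>R had f j y y')"
proof -
 have "((%r. f (y + r *\<^sub>R (y' - y))) has_vector_derivative (SUM j:UNIV. (y' - y) $ j *\<^sub>R pdm f j (y + r *\<^sub>R (y' - y)))) (at r within {0..1})" for r
  by (rule has_vector_derivative_at_within[OF directional_derivative[OF pdm_has[OF assms]]])
 hence "((%r. SUM j:UNIV. (y' - y) $ j *\<^sub>R pdm f j (y + r *\<^sub>R (y' - y))) has_integral f (y + 1 *\<^sub>R (y' - y)) - f (y + 0 *\<^sub>R (y' - y))) {0..1}"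
  by (intro fundamental_theorem_of_calculus) auto
 moreover have "(%r. pdm f j (y + r *\<^sub>R (y' - y))) integrable_on {0..1}" for j
  by (intro integrable_continuous_interval continuous_on_compose2[OF Ck_on_continuous[OF pdm_Ck[OF assms]]])
   (auto intro!: continuous_intros)
 hence "((%r. SUM j:UNIV. (y' - y) $ j *\<^sub>R pdm f j (y + r *\<^sub>R (y' - y))) has_integral (SUM j:UNIV. (y' - y) $ j *\<^sub>R had f j y y')) {0..1}"
  unfolding had_def by (intro has_integral_sum has_integral_cmul integrable_integral) auto
 ultimately show ?thesis by (simp add: has_integral_unique)
qed

definition sc :: "3 => real => real^3 => real^3" where "sc i s y = (\<chi> j. if j = i then s * y $ j else y $ j)"

lemma sc_simps [simp]: "sc i s y $ j = (if j = i then s * y $ j else y $ j)" "sc i 1 y = y" "sc i s (sc i t y) = sc i (s * t) y"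
 by (simp_all add: sc_def vec_eq_iff)

lemma sc_continuous: "continuous_on S f ==> continuous_on S g ==> continuous_on S (%x. sc i (f x) (g x))"
 unfolding sc_def
proof (intro continuous_on_vec_lambda)
 fix j assume "continuous_on S f" "continuous_on S g"
 thus "continuous_on S (%x. if j = i then f x * g x $ j else g x $ j)"
  by (cases "j = i") (auto intro!: continuous_intros)
qed

text \<open>y_i times \<open>I01 i 0 h y\<close> is the integral of h in the i-th coordinate from 0
  to y_i. Rescaling to [0,1] removes the variable endpoint; the weight s^m records the powers of s
  produced by derivatives in the direction i.\<close>

definition I01 :: "3 => nat => (real^3 => 'b::banach) => real^3 => 'b" where
 "I01 i m h y = integral {0..1} (%s. s ^ m *\<^sub>R h (sc i s y))"

lemma sc_integrable:
 fixes h :: "real^3 => 'b::banach"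
 assumes "continuous_on UNIV h" shows "(%s. s ^ m *\<^sub>R h (sc i s y)) integrable_on {0..1}"
 by (intro integrable_continuous_interval continuous_on_scaleR continuous_on_compose2[OF assms] sc_continuous continuous_intros) auto

lemma I01_continuous:
 assumes "continuous_on UNIV h" shows "continuous_on UNIV (I01 i m h)"
proof -
 have "continuous_on (UNIV \<times> {0..1}) (%(y, s). s ^ m *\<^sub>R h (sc i s y))"
  unfolding case_prod_unfold
  by (intro continuous_on_scaleR continuous_on_compose2[OF assms] sc_continuous continuous_intros) auto
 from integral_param_continuous[OF this] show ?thesis by (simp add: I01_def[abs_def])
qed

text \<open>The increment of h is put into Hadamard's form under the integral. Scaling multiplies
  the i-th component of y' - y by s, which raises the weight exactly when j = i.\<close>

lemma I01_derivative:
 assumes h: "Ck_on (Suc 0) UNIV h"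
 shows "(I01 i m h has_derivative (%v. SUM j:UNIV. v $ j *\<^sub>R I01 i (m + of_bool (j = i)) (pdm h j) y)) (at y)"
proof -
 define \<Psi> where "\<Psi> j y' = integral {0..1} (%s. s ^ (m + of_bool (j = i)) *\<^sub>R had h j (sc i s y) (sc i s y'))" for j y'
 have hc: "continuous_on UNIV h" by (rule Ck_on_continuous[OF h])
 have c: "continuous_on (UNIV \<times> {0..1}) (%(y', s). s ^ k *\<^sub>R had h j (sc i s y) (sc i s y'))" for j k
 proof -
  have "continuous_on (UNIV \<times> {0..1}) (%p. (%(a, b). had h j a b) (sc i (snd p) y, sc i (snd p) (fst p)))"
   by (rule continuous_on_compose2[OF had_continuous[OF h]]) (auto intro!: continuous_intros sc_continuous)
  thus ?thesis unfolding case_prod_unfold by (intro continuous_on_scaleR continuous_intros) auto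
 qed
 have "isCont (\<Psi> j) y" for j
  using integral_param_continuous[OF c] unfolding \<Psi>_def[abs_def] by (simp add: continuous_on_eq_continuous_at)
 moreover have "I01 i m h y' - I01 i m h y = (SUM j:UNIV. (y' - y) $ j *\<^sub>R \<Psi> j y')" for y'
 proof -
  have "I01 i m h y' - I01 i m h y = integral {0..1} (%s. s ^ m *\<^sub>R h (sc i s y') - s ^ m *\<^sub>R h (sc i s y))"
   unfolding I01_def by (rule integral_diff[OF sc_integrable[OF hc] sc_integrable[OF hc], symmetric])
  also have "... = integral {0..1} (%s. SUM j:UNIV. (y' - y) $ j *\<^sub>R (s ^ (m + of_bool (j = i)) *\<^sub>R had h j (sc i s y) (sc i s y')))"
  proof (rule integral_cong)
   fix s :: real
   have "s ^ m *\<^sub>R h (sc i s y') - s ^ m *\<^sub>R h (sc i s y) = s ^ m *\<^sub>R (SUM j:UNIV. (sc i s y' - sc i s y) $ j *\<^sub>R had h j (sc i s y) (sc i s y'))"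
    unfolding had_diff[OF h, symmetric] by (simp add: scaleR_diff_right)
   also have "... = (SUM j:UNIV. (y' - y) $ j *\<^sub>R (s ^ (m + of_bool (j = i)) *\<^sub>R had h j (sc i s y) (sc i s y')))"
    by (simp add: scaleR_sum_right algebra_simps) (intro sum.cong, auto simp: algebra_simps)
   finally show "s ^ m *\<^sub>R h (sc i s y') - s ^ m *\<^sub>R h (sc i s y) = ..." .
  qed
  also have "... = (SUM j:UNIV. (y' - y) $ j *\<^sub>R \<Psi> j y')"
  proof -
   have "(%s. s ^ k *\<^sub>R had h j (sc i s y) (sc i s y')) integrable_on {0..1}" for j k
   proof (rule integrable_continuous_interval)
    have "continuous_on {0..1} (%s. (y', s))" by (intro continuous_intros)
    from continuous_on_compose2[OF c[of k j] this]
    show "continuous_on {0..1} (%s. s ^ k *\<^sub>R had h j (sc i s y) (sc i s y'))" by auto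
   qed
   hence "((%s. SUM j:UNIV. (y' - y) $ j *\<^sub>R (s ^ (m + of_bool (j = i)) *\<^sub>R had h j (sc i s y) (sc i s y'))) has_integral
     (SUM j:UNIV. (y' - y) $ j *\<^sub>R \<Psi> j y')) {0..1}"
    unfolding \<Psi>_def by (intro has_integral_sum has_integral_cmul integrable_integral) simp_all
   thus ?thesis by (rule integral_unique)
  qed
  finally show ?thesis .
 qed
 ultimately have "(I01 i m h has_derivative (%v. SUM j:UNIV. v $ j *\<^sub>R \<Psi> j y)) (at y)" by (rule hadamard_derivative[rotated])
 thus ?thesis by (simp add: \<Psi>_def I01_def had_diag)
qed

lemma I01_Ck: "Ck_on k UNIV h ==> Ck_on k UNIV (I01 i m h)"
proof (induction k arbitrary: m h)
 case 0
 thus ?case using I01_continuous by simp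
next
 case (Suc k)
 show ?case
 proof (rule Ck_on_SucI[OF open_UNIV I01_derivative])
  show "Ck_on (Suc 0) UNIV h" using Ck_on_le[OF _ Suc.prems, of "Suc 0"] by simp
  show "Ck_on k UNIV (%y. SUM j:UNIV. v $ j *\<^sub>R I01 i (m + of_bool (j = i)) (pdm h j) y)" for v
   by (intro Ck_on_sum Ck_on_scaleR Ck_on_const open_UNIV Suc.IH pdm_Ck[OF Suc.prems])
 qed
qed

text \<open>By substitution this is an antiderivative of k, written with a fixed interval of
  integration.\<close>

lemma integral_scale:
 fixes k :: "real => 'b::banach"
 assumes k: "continuous_on UNIV k"
 shows "((%s. s *\<^sub>R integral {0..1} (%r. k (s * r))) has_vector_derivative k s) (at s)"
proof -
 define c where "c = \<bar>s\<bar> + 1"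
 obtain g where g: "!!x. x : {-c..c} ==> (g has_vector_derivative k x) (at x within {-c..c})"
  using antiderivative_continuous[OF continuous_on_subset[OF k subset_UNIV]] by blast
 have eq: "s *\<^sub>R integral {0..1} (%r. k (s * r)) = g s - g 0" if s: "s : {-c<..<c}" for s
 proof -
  have sub: "s * r : {-c..c}" if r: "r : {0..1}" for r
  proof -
   have "\<bar>s * r\<bar> <= \<bar>s\<bar> * 1" unfolding abs_mult using r by (intro mult_left_mono) auto
   thus ?thesis using s by auto
  qed
  have "((%r. g (s * r)) has_vector_derivative s *\<^sub>R k (s * r)) (at r within {0..1})" if "r : {0..1}" for r
  proof -
   have "((%r. s * r) has_vector_derivative s) (at r within {0..1})"
    by (auto intro!: derivative_eq_intros simp: has_real_derivative_iff_has_vector_derivative[symmetric])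
   moreover have "(g has_vector_derivative k (s * r)) (at (s * r) within (*) s ` {0..1})"
    by (rule has_vector_derivative_within_subset[OF g[OF sub[OF that]]]) (use sub in blast)
   ultimately show ?thesis using vector_diff_chain_within[of "%r. s * r" s r "{0..1}" g "k (s * r)"] by (simp add: comp_def)
  qed
  hence "((%r. s *\<^sub>R k (s * r)) has_integral g (s * 1) - g (s * 0)) {0..1}"
   by (intro fundamental_theorem_of_calculus) auto
  from integral_unique[OF this] show ?thesis by simp
 qed
 have s: "s : {-c<..<c}" by (auto simp: c_def)
 have "at s within {-c..c} = at s" by (rule at_within_interior) (use s in auto)
 hence "(g has_vector_derivative k s) (at s)" using g[of s] s by simp
 hence "((%s. g s - g 0) has_vector_derivative k s) (at s)" by (auto intro!: derivative_eq_intros)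
 thus ?thesis
  by (rule has_vector_derivative_transform_within_open[OF _ open_greaterThanLessThan s]) (simp add: eq)
qed

section \<open>Existence of parallel transport by the Dyson series\<close>

lemma mat_norm_bound: obtains K where "0 < K" "!!(X :: complex^2^2) (Y :: complex^2^2). norm (X ** Y) <= norm X * norm Y * K"
 using bounded_bilinear.pos_bounded[OF bounded_bilinear_mat] by blast

text \<open>The terms of the Picard iteration for dY/dy_i = B Y with Y = 1 on y_i = 0; the other
  coordinates are parameters.\<close>

fun dyson :: "3 => (real^3 => complex^2^2) => nat => real^3 => complex^2^2" where
 "dyson i B 0 y = mat 1"
| "dyson i B (Suc n) y = y $ i *\<^sub>R I01 i 0 (%z. B z ** dyson i B n z) y"

lemma dyson_continuous:
 assumes "continuous_on UNIV B" shows "continuous_on UNIV (dyson i B n)"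
proof (induction n)
 case (Suc n)
 show ?case unfolding dyson.simps
  by (intro continuous_on_scaleR I01_continuous continuous_on_mat Suc assms continuous_intros)
qed simp

text \<open>As \<open>K\<close> is stable under shrinking the i-th coordinate, the induction stays
  inside it; each integration of s^n supplies a factor of the factorial.\<close>

lemma dyson_bound:
 assumes B: "continuous_on UNIV B" and K: "!!z s. z : K ==> s : {0..1} ==> sc i s z : K"
  and C: "0 <= C" "!!z X :: complex^2^2. z : K ==> norm (B z ** X) <= C * norm X" and y: "y : K"
 shows "norm (dyson i B n y) <= norm (mat 1 :: complex^2^2) * ((C * \<bar>y $ i\<bar>) ^ n / fact n)"
 using y
proof (induction n arbitrary: y)
 case (Suc n)
 let ?D = "norm (mat 1 :: complex^2^2)" and ?t = "C * \<bar>y $ i\<bar>"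
 let ?h = "%z. B z ** dyson i B n z"
 have hc: "continuous_on UNIV ?h"
  by (intro continuous_on_mat B dyson_continuous)
 have "((%s::real. s ^ Suc n / Suc n) has_real_derivative (real (Suc n) * s ^ (Suc n - Suc 0)) / Suc n) (at s within {0..1})" for s
  by (rule DERIV_cdivide[OF has_field_derivative_at_within[OF DERIV_pow]])
 hence "((%s::real. s ^ Suc n / Suc n) has_vector_derivative s ^ n) (at s within {0..1})" for s
  unfolding has_real_derivative_iff_has_vector_derivative by simp
 hence pow: "((%s::real. s ^ n) has_integral 1 / Suc n) {0..1}"
  using fundamental_theorem_of_calculus[of 0 1 "%s::real. s ^ Suc n / Suc n" "%s. s ^ n"] by simp
 have "norm (I01 i 0 ?h y) <= integral {0..1} (%s. (C * ?D * ?t ^ n / fact n) * s ^ n)"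
  unfolding I01_def
 proof (rule integral_norm_bound_integral[OF sc_integrable[OF hc]])
  show "(%s. C * ?D * ?t ^ n / fact n * s ^ n) integrable_on {0..1}" using pow by (intro integrable_on_mult_right) blast
  fix s :: real assume s: "s : {0..1}"
  have z: "sc i s y : K" by (rule K[OF Suc.prems s])
  have "norm (?h (sc i s y)) <= C * (?D * ((C * \<bar>sc i s y $ i\<bar>) ^ n / fact n))"
   by (rule order_trans[OF C(2)[OF z] mult_left_mono[OF Suc.IH[OF z] C(1)]])
  also have "... = C * ?D * ?t ^ n / fact n * s ^ n" using s by (simp add: abs_mult power_mult_distrib)
  finally show "norm (s ^ 0 *\<^sub>R ?h (sc i s y)) <= C * ?D * ?t ^ n / fact n * s ^ n" by simp
 qed
 also have "... = (C * ?D * ?t ^ n / fact n) * (1 / Suc n)"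
  by (rule integral_unique[OF has_integral_mult_right[OF pow]])
 finally have "\<bar>y $ i\<bar> * norm (I01 i 0 ?h y) <= \<bar>y $ i\<bar> * ((C * ?D * ?t ^ n / fact n) * (1 / Suc n))"
  by (rule mult_left_mono) simp
 thus ?case by (simp add: field_simps)
qed simp

text \<open>On every cube the series converges uniformly by comparison with exp, so the integral
  equation is obtained term by term. In the parameters only continuity comes out at this
  stage.\<close>

lemma transport_exists:
 assumes B: "continuous_on UNIV (B :: real^3 => complex^2^2)"
 obtains Y where "continuous_on UNIV Y" "!!y. Y y = mat 1 + y $ i *\<^sub>R I01 i 0 (%z. B z ** Y z) y"
proof -
 define K where "K r = {y::real^3. ALL j. \<bar>y $ j\<bar> <= r}" for r
 have Kc: "compact (K r)" for r
 proof -
  have "\<bar>t\<bar> <= r \<longleftrightarrow> - r <= t & t <= r" for t :: real by linarith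
  hence "K r = cbox (\<chi> j. - r) (\<chi> j. r)" by (simp add: K_def set_eq_iff mem_box_cart)
  thus ?thesis by simp
 qed
 have Ks: "sc i s z : K r" if "z : K r" "s : {0..1}" for z s r
 proof -
  have "\<bar>s * z $ j\<bar> <= r" for j
   using mult_mono[of s 1 "\<bar>z $ j\<bar>" r] that by (auto simp: K_def abs_mult)
  thus ?thesis using that(1) by (auto simp: K_def)
 qed
 have K_ex: "EX r>=0. y : ball 0 r & ball 0 r <= K r" for y :: "real^3"
 proof (rule exI[of _ "norm y + 1"], intro conjI subsetI)
  fix z :: "real^3" assume "z : ball 0 (norm y + 1)"
  hence "norm z <= norm y + 1" by simp
  thus "z : K (norm y + 1)" unfolding K_def using order_trans[OF component_le_norm_cart] by blast
 qed auto
 obtain \<kappa> where \<kappa>: "0 < \<kappa>" "!!(X :: complex^2^2) (Y :: complex^2^2). norm (X ** Y) <= norm X * norm Y * \<kappa>" using mat_norm_bound by blast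
 have C_ex: "EX C>=0. ALL z:K r. ALL X :: complex^2^2. norm (B z ** X) <= C * norm X" for r
 proof -
  obtain b where b: "!!z. z : K r ==> norm (B z) <= b"
   using compact_imp_bounded[OF compact_continuous_image[OF continuous_on_subset[OF B subset_UNIV] Kc]] unfolding bounded_iff by blast
  have "norm (B z ** X) <= (\<bar>b\<bar> * \<kappa>) * norm X" if "z : K r" for z and X :: "complex^2^2"
  proof -
   have "norm (B z) <= \<bar>b\<bar>" using b[OF that] by linarith
   hence "norm (B z) * norm X * \<kappa> <= \<bar>b\<bar> * norm X * \<kappa>" using \<kappa>(1) by (intro mult_right_mono) auto
   thus ?thesis using \<kappa>(2)[of "B z" X] by (simp add: mult_ac)
  qed
  thus ?thesis using \<kappa>(1) by (intro exI[of _ "\<bar>b\<bar> * \<kappa>"]) auto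
 qed
 let ?D = "norm (mat 1 :: complex^2^2)"
 define Y where "Y y = (\<Sum>n. dyson i B n y)" for y
 have bound: "EX C>=0. (ALL z:K r. ALL X :: complex^2^2. norm (B z ** X) <= C * norm X) &
   (ALL z:K r. ALL n. norm (dyson i B n z) <= ?D * ((C * r) ^ n / fact n))" if "0 <= r" for r
 proof -
  obtain C where C: "0 <= C" "!!z X :: complex^2^2. z : K r ==> norm (B z ** X) <= C * norm X" using C_ex[of r] by blast
  have "norm (dyson i B n z) <= ?D * ((C * r) ^ n / fact n)" if z: "z : K r" for z n
  proof -
   have "(C * \<bar>z $ i\<bar>) ^ n <= (C * r) ^ n"
    using z C(1) by (intro power_mono mult_left_mono) (auto simp: K_def)
   hence "?D * ((C * \<bar>z $ i\<bar>) ^ n / fact n) <= ?D * ((C * r) ^ n / fact n)"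
    by (intro mult_left_mono divide_right_mono) auto
   thus ?thesis using dyson_bound[OF B Ks C z, of n] by linarith
  qed
  thus ?thesis using C by blast
 qed
 have exps: "summable (%n. a * (x ^ n / fact n))" for a x :: real
  using summable_mult[OF summable_exp[of x]] by (simp add: field_simps)
 have Ylim: "uniform_limit (K r) (%n y. \<Sum>k<n. dyson i B k y) Y sequentially"
  and sY: "z : K r ==> summable (%n. dyson i B n z)" if r: "0 <= r" for r z
 proof -
  obtain C where C: "ALL z:K r. ALL n. norm (dyson i B n z) <= ?D * ((C * r) ^ n / fact n)" using bound[OF r] by blast
  show "uniform_limit (K r) (%n y. \<Sum>k<n. dyson i B k y) Y sequentially"
   unfolding Y_def by (rule Weierstrass_m_test[OF _ exps]) (use C in blast)
  show "z : K r ==> summable (%n. dyson i B n z)"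
   by (rule summable_comparison_test'[OF exps]) (use C in blast)
 qed
 have Yc: "continuous_on UNIV Y"
  unfolding continuous_on_eq_continuous_at[OF open_UNIV]
 proof
  fix y :: "real^3"
  obtain r where r: "r >= 0" "y : ball 0 r" "ball 0 r <= K r" using K_ex by blast
  have "continuous_on (K r) Y"
   by (rule uniform_limit_theorem[OF _ Ylim[OF r(1)]])
    (auto intro!: always_eventually continuous_on_sum continuous_on_subset[OF dyson_continuous[OF B]])
  thus "isCont Y y" using continuous_on_subset[OF _ r(3)] r(2) continuous_on_eq_continuous_at[OF open_ball] by blast
 qed
 moreover have "Y y = mat 1 + y $ i *\<^sub>R I01 i 0 (%z. B z ** Y z) y" for y
 proof -
  obtain r where r: "r >= 0" "y : ball 0 r" "ball 0 r <= K r" using K_ex by blast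
  have yK: "y : K r" using r by blast
  obtain C where C: "0 <= C" "ALL z:K r. ALL X :: complex^2^2. norm (B z ** X) <= C * norm X" "ALL z:K r. ALL n. norm (dyson i B n z) <= ?D * ((C * r) ^ n / fact n)"
   using bound[OF r(1)] by blast
  define f where "f k s = B (sc i s y) ** dyson i B k (sc i s y)" for k s
  have fc: "continuous_on {0..1} (f k)" for k
   unfolding f_def by (intro continuous_on_mat continuous_on_compose2[OF B]
    continuous_on_compose2[OF dyson_continuous[OF B]] sc_continuous continuous_intros) auto
  have u0: "uniform_limit {0..1} (%n s. \<Sum>k<n. f k s) (%s. \<Sum>k. f k s) sequentially"
  proof (rule Weierstrass_m_test[OF _ exps])
   fix n and s :: real assume "s : {0..1}"
   hence z: "sc i s y : K r" by (rule Ks[OF yK])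
   show "norm (f n s) <= (C * ?D) * ((C * r) ^ n / fact n)"
    unfolding f_def using order_trans[OF C(2)[rule_format, OF z] mult_left_mono[OF C(3)[rule_format, OF z] C(1)]]
    by (simp add: mult.assoc)
  qed
  have e: "(\<Sum>k. f k s) = B (sc i s y) ** Y (sc i s y)" if s: "s : {0..1}" for s
   unfolding f_def Y_def
   by (rule bounded_linear.suminf[OF bounded_linear_mat_left sY[OF r(1) Ks[OF yK s]], symmetric])
  have u: "uniform_limit {0..1} (%n s. \<Sum>k<n. f k s) (%s. B (sc i s y) ** Y (sc i s y)) sequentially"
   by (rule uniform_limit_cong'[THEN iffD1, OF refl e u0])
  obtain J I where J: "!!n. ((%s. \<Sum>k<n. f k s) has_integral J n) {0..1}" "((%s. B (sc i s y) ** Y (sc i s y)) has_integral I) {0..1}" "J \<longlonglongrightarrow> I"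
   by (rule uniform_limit_integral[OF u]) (auto intro!: continuous_on_sum fc)
  have I: "I = I01 i 0 (%z. B z ** Y z) y" using integral_unique[OF J(2)] by (simp add: I01_def)
  have "J n = (\<Sum>k<n. I01 i 0 (%z. B z ** dyson i B k z) y)" for n
  proof -
   have "((%s. \<Sum>k<n. f k s) has_integral (\<Sum>k<n. integral {0..1} (f k))) {0..1}"
    by (intro has_integral_sum integrable_integral integrable_continuous_interval fc) simp
   from has_integral_unique[OF J(1) this] show ?thesis by (simp add: I01_def f_def[abs_def])
  qed
  hence "mat 1 + y $ i *\<^sub>R J n = (\<Sum>k<Suc n. dyson i B k y)" for n
   by (simp only: sum.lessThan_Suc_shift dyson.simps scaleR_sum_right)
  moreover have "(%n. mat 1 + y $ i *\<^sub>R J n) \<longlonglongrightarrow> mat 1 + y $ i *\<^sub>R I" by (intro tendsto_intros J(3))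
  moreover have "(%n. \<Sum>k<Suc n. dyson i B k y) \<longlonglongrightarrow> Y y"
   by (rule LIMSEQ_Suc, rule tendsto_uniform_limitI[OF Ylim[OF r(1)] yK])
  ultimately show ?thesis using I LIMSEQ_unique by simp
 qed
 ultimately show ?thesis by (rule that)
qed

lemma bounded_linear_conj_transpose: "bounded_linear conj_transpose"
proof (rule bounded_linearI')
 show "ct (X + Y) = ct X + ct Y" for X Y
  by (simp add: vec_eq_iff conj_transpose_def)
 show "ct (c *\<^sub>R X) = c *\<^sub>R ct X" for c X
  by (simp add: vec_eq_iff conj_transpose_def)
qed

lemma conj_transpose_mult: "ct (X ** Y) = ct Y ** ct X"
 by (simp add: vec2_eq_iff mat2_mult_nth conj_transpose_def algebra_simps)

lemma conj_transpose_simps [simp]: "ct (ct X) = X" "ct (mat 1) = mat 1"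
  "ct (- X) = - ct X" "ct (c *\<^sub>R X) = c *\<^sub>R ct X"
 by (simp_all add: vec2_eq_iff mat2_nth conj_transpose_def)

lemma su2_conj: "X : su2 ==> ct X = - X"
 by (auto simp: su2_def quats_def qw_def vec2_eq_iff conj_transpose_def complex_eq_iff)

lemma mat_algebra:
 fixes X Y Z :: "complex^2^2"
 shows "X ** (Y + Z) = X ** Y + X ** Z" "(X + Y) ** Z = X ** Z + Y ** Z" "X ** (Y - Z) = X ** Y - X ** Z"
  "(X - Y) ** Z = X ** Z - Y ** Z" "(c *\<^sub>R X) ** Y = c *\<^sub>R (X ** Y)" "X ** (c *\<^sub>R Y) = c *\<^sub>R (X ** Y)"
  "X ** 0 = 0" "0 ** X = 0"
 by (simp_all add: vec2_eq_iff mat2_mult_nth algebra_simps)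

lemmas has_vector_derivative_mat = bounded_bilinear.has_vector_derivative[OF bounded_bilinear_mat]

lemma interval_constant:
 fixes f :: "real => 'b::real_normed_vector"
 assumes "!!s. s : {0..1} ==> (f has_vector_derivative 0) (at s within {0..1})" shows "f 1 = f 0"
 using has_vector_derivative_zero_constant[of "{0..1}" f] assms by (metis atLeastAtMost_iff convex_real_interval(5) order_refl zero_le_one)

section \<open>Smooth dependence of the transport on all coordinates\<close>

locale transport =
 fixes i :: 3 and B Y :: "real^3 => complex^2^2"
 assumes B: "smooth B" "!!y. B y : su2"
  and Y: "continuous_on UNIV Y" "!!y. Y y = mat 1 + y $ i *\<^sub>R I01 i 0 (%z. B z ** Y z) y"
begin

lemma Bc: "continuous_on UNIV B" by (rule Ck_on_continuous[OF smooth_on_Ck[OF B(1)]])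

lemma Y_0: "y $ i = 0 ==> Y y = mat 1"
 using Y(2)[of y] by simp

lemma seg:
 "((%s. Y (sc i s y)) has_vector_derivative y $ i *\<^sub>R (B (sc i s y) ** Y (sc i s y))) (at s within {0..1})"
proof -
 have "continuous_on UNIV (%s. B (sc i s y) ** Y (sc i s y))"
  by (intro continuous_on_mat continuous_on_compose2[OF Bc]
    continuous_on_compose2[OF Y(1)] sc_continuous continuous_intros) auto
 from has_vector_derivative_add[OF has_vector_derivative_const[of "mat 1"]
   bounded_linear.has_vector_derivative[OF bounded_linear_scaleR_right integral_scale[OF this, of s], of "y $ i"]]
 have "((%s. mat 1 + y $ i *\<^sub>R (s *\<^sub>R integral {0..1} (%r. B (sc i (s * r) y) ** Y (sc i (s * r) y))))
   has_vector_derivative y $ i *\<^sub>R (B (sc i s y) ** Y (sc i s y))) (at s)" by simp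
 moreover have e: "Y (sc i s y) = mat 1 + y $ i *\<^sub>R (s *\<^sub>R integral {0..1} (%r. B (sc i (s * r) y) ** Y (sc i (s * r) y)))" for s
  by (subst Y(2)) (simp add: I01_def mult.commute)
 ultimately show ?thesis by (subst e) (rule has_vector_derivative_at_within)
qed

text \<open>Along the segment both det Y and the adjoint of Y times Y are constant, because B is
  trace-free and skew.\<close>

lemma Y_SU2: "Y y : SU2"
proof -
 let ?b = "%s. y $ i *\<^sub>R (B (sc i s y) ** Y (sc i s y))" and ?W = "%s. Y (sc i s y)"
 have Bs: "ct (B z) = - B z" "B z $ 2 $ 2 = - B z $ 1 $ 1" for z
  using su2_conj[OF B(2)] B(2)[of z] by (auto simp: su2_def quats_def qw_def complex_eq_iff)
 have "((%s. ct (?W s) ** ?W s) has_vector_derivative 0) (at s within {0..1})" if s: "s : {0..1}" for s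
  using has_vector_derivative_mat[OF bounded_linear.has_vector_derivative[OF bounded_linear_conj_transpose seg] seg, of y y]
  by (simp add: conj_transpose_mult Bs mat_algebra mat_minus matrix_mul_assoc)
 from interval_constant[OF this] have 1: "ct (Y y) ** Y y = mat 1" by (simp add: Y_0)
 have "((%s. det (?W s)) has_vector_derivative 0) (at s within {0..1})" if s: "s : {0..1}" for s
 proof -
  have e: "((%s. ?W s $ j $ k) has_vector_derivative ?b s $ j $ k) (at s within {0..1})" for j k
   by (rule bounded_linear.has_vector_derivative[OF bounded_linear_compose[OF bounded_linear_vec_nth bounded_linear_vec_nth] seg])
  have "((%s. ?W s $ 1 $ 1 * ?W s $ 2 $ 2 - ?W s $ 1 $ 2 * ?W s $ 2 $ 1) has_vector_derivative
    (?W s $ 1 $ 1 * ?b s $ 2 $ 2 + ?b s $ 1 $ 1 * ?W s $ 2 $ 2) - (?W s $ 1 $ 2 * ?b s $ 2 $ 1 + ?b s $ 1 $ 2 * ?W s $ 2 $ 1)) (at s within {0..1})"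
   by (intro has_vector_derivative_diff has_vector_derivative_mult e)
  moreover have "(?W s $ 1 $ 1 * ?b s $ 2 $ 2 + ?b s $ 1 $ 1 * ?W s $ 2 $ 2) - (?W s $ 1 $ 2 * ?b s $ 2 $ 1 + ?b s $ 1 $ 2 * ?W s $ 2 $ 1) = 0"
   by (simp add: mat2_mult_nth Bs) (simp add: scaleR_conv_of_real algebra_simps)
  ultimately show ?thesis by (simp add: det_2)
 qed
 from interval_constant[OF this] have 2: "det (Y y) = 1" by (simp add: Y_0)
 show ?thesis using 1 2 matrix_left_right_inverse by (auto simp: SU2_def)
qed

abbreviation "Z y == ct (Y y)"

text \<open>Variation of constants: the inverse of Y on the segment to y, times Y on the segment to
  y', has a derivative linear in y' - y by \<open>had\<close>. Integrating it puts the increment of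
  Y into Hadamard's form. The resulting formula contains Y but no derivative of Y.\<close>

lemma Y_derivative:
 "(Y has_derivative (%v. SUM j:UNIV. v $ j *\<^sub>R (Y y ** (of_bool (j = i) *\<^sub>R I01 i 0 (%z. Z z ** B z ** Y z) y
   + y $ i *\<^sub>R I01 i (of_bool (j = i)) (%z. Z z ** pdm B j z ** Y z) y)))) (at y)"
proof -
 have B1: "Ck_on (Suc 0) UNIV B" by (rule smooth_on_Ck[OF B(1)])
 define \<beta> where "\<beta> j s y' = of_bool (j = i) *\<^sub>R B (sc i s y') + (y $ i * s ^ of_bool (j = i)) *\<^sub>R had B j (sc i s y) (sc i s y')" for j s y'
 define \<gamma> where "\<gamma> j s y' = Z (sc i s y) ** \<beta> j s y' ** Y (sc i s y')" for j s y'
 define \<Psi> where "\<Psi> j y' = Y y ** integral {0..1} (%s. \<gamma> j s y')" for j y'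
 have \<gamma>c: "continuous_on (UNIV \<times> {0..1}) (%(y', s). \<gamma> j s y')" for j
 proof -
  have "continuous_on (UNIV \<times> {0..1}) (%p. (%(a, b). had B j a b) (sc i (snd p) y, sc i (snd p) (fst p)))"
   by (rule continuous_on_compose2[OF had_continuous[OF B1]]) (auto intro!: continuous_intros sc_continuous)
  thus ?thesis unfolding \<gamma>_def \<beta>_def case_prod_unfold
   by (intro continuous_on_mat continuous_on_add continuous_on_scaleR
    bounded_linear.continuous_on[OF bounded_linear_conj_transpose] continuous_on_compose2[OF Bc]
    continuous_on_compose2[OF Y(1)] sc_continuous continuous_intros) auto
 qed
 have "isCont (\<Psi> j) y" for j
 proof -
  have "continuous_on UNIV (\<Psi> j)" unfolding \<Psi>_def[abs_def]
   by (intro continuous_on_mat continuous_on_const integral_param_continuous \<gamma>c)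
  thus ?thesis by (simp add: continuous_on_eq_continuous_at)
 qed
 moreover have "Y y' - Y y = (SUM j:UNIV. (y' - y) $ j *\<^sub>R \<Psi> j y')" for y'
 proof -
  have "((%s. SUM j:UNIV. (y' - y) $ j *\<^sub>R \<gamma> j s y') has_integral Z (sc i 1 y) ** Y (sc i 1 y') - Z (sc i 0 y) ** Y (sc i 0 y')) {0..1}"
  proof (rule fundamental_theorem_of_calculus)
   fix s :: real assume s: "s : {0..1}"
   have "((%s. Z (sc i s y) ** Y (sc i s y')) has_vector_derivative
     Z (sc i s y) ** (y' $ i *\<^sub>R B (sc i s y') - y $ i *\<^sub>R B (sc i s y)) ** Y (sc i s y')) (at s within {0..1})"
    using has_vector_derivative_mat[OF bounded_linear.has_vector_derivative[OF bounded_linear_conj_transpose seg] seg, of y y']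
    by (simp add: conj_transpose_mult su2_conj[OF B(2)] mat_algebra mat_minus matrix_mul_assoc)
   moreover have "y' $ i *\<^sub>R B (sc i s y') - y $ i *\<^sub>R B (sc i s y) = (SUM j:UNIV. (y' - y) $ j *\<^sub>R \<beta> j s y')"
   proof -
    have "(SUM j:UNIV. (y' - y) $ j *\<^sub>R \<beta> j s y') = (SUM j:UNIV. (if j = i then (y' - y) $ j *\<^sub>R B (sc i s y') else 0)
      + y $ i *\<^sub>R ((sc i s y' - sc i s y) $ j *\<^sub>R had B j (sc i s y) (sc i s y')))"
     by (rule sum.cong) (auto simp: \<beta>_def algebra_simps)
    also have "... = (y' $ i - y $ i) *\<^sub>R B (sc i s y') + y $ i *\<^sub>R (B (sc i s y') - B (sc i s y))"
     unfolding had_diff[OF B1] by (simp add: sum.distrib scaleR_sum_right)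
    finally show ?thesis by (simp add: algebra_simps)
   qed
   moreover have "Z (sc i s y) ** (SUM j:UNIV. (y' - y) $ j *\<^sub>R \<beta> j s y') ** Y (sc i s y') = (SUM j:UNIV. (y' - y) $ j *\<^sub>R \<gamma> j s y')"
    by (simp add: sum_3 \<gamma>_def mat_algebra)
   ultimately show "((%s. Z (sc i s y) ** Y (sc i s y')) has_vector_derivative (SUM j:UNIV. (y' - y) $ j *\<^sub>R \<gamma> j s y')) (at s within {0..1})"
    by simp
  qed simp
  moreover have "((%s. SUM j:UNIV. (y' - y) $ j *\<^sub>R \<gamma> j s y') has_integral (SUM j:UNIV. (y' - y) $ j *\<^sub>R integral {0..1} (%s. \<gamma> j s y'))) {0..1}"
  proof (intro has_integral_sum has_integral_cmul integrable_integral integrable_continuous_interval)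
   fix j
   have "continuous_on {0..1} (%s::real. (y', s))" by (intro continuous_intros)
   from continuous_on_compose2[OF \<gamma>c this] show "continuous_on {0..1} (%s. \<gamma> j s y')" by auto
  qed simp
  ultimately have "Z y ** Y y' - mat 1 = (SUM j:UNIV. (y' - y) $ j *\<^sub>R integral {0..1} (%s. \<gamma> j s y'))"
   by (simp add: has_integral_unique Y_0)
  hence "Y y ** (Z y ** Y y' - mat 1) = (SUM j:UNIV. (y' - y) $ j *\<^sub>R \<Psi> j y')"
   by (simp add: sum_3 \<Psi>_def mat_algebra)
  thus ?thesis by (simp add: mat_algebra matrix_mul_assoc conj_transpose_SU2[OF Y_SU2])
 qed
 ultimately have "(Y has_derivative (%v. SUM j:UNIV. v $ j *\<^sub>R \<Psi> j y)) (at y)" by (rule hadamard_derivative[rotated])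
 moreover have "\<Psi> j y = Y y ** (of_bool (j = i) *\<^sub>R I01 i 0 (%z. Z z ** B z ** Y z) y
   + y $ i *\<^sub>R I01 i (of_bool (j = i)) (%z. Z z ** pdm B j z ** Y z) y)" for j
 proof -
  have c: "continuous_on UNIV (%z. Z z ** C z ** Y z)" if "continuous_on UNIV C" for C
   by (intro continuous_on_mat bounded_linear.continuous_on[OF bounded_linear_conj_transpose] Y(1) that)
  have "(%s. \<gamma> j s y) = (%s. of_bool (j = i) *\<^sub>R (s ^ 0 *\<^sub>R (Z (sc i s y) ** B (sc i s y) ** Y (sc i s y)))
    + y $ i *\<^sub>R (s ^ of_bool (j = i) *\<^sub>R (Z (sc i s y) ** pdm B j (sc i s y) ** Y (sc i s y))))"
   by (simp add: \<gamma>_def \<beta>_def had_diag mat_algebra fun_eq_iff)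
  moreover have "integral {0..1} ... = of_bool (j = i) *\<^sub>R I01 i 0 (%z. Z z ** B z ** Y z) y
   + y $ i *\<^sub>R I01 i (of_bool (j = i)) (%z. Z z ** pdm B j z ** Y z) y"
   unfolding I01_def
   by (intro integral_unique has_integral_add has_integral_cmul integrable_integral sc_integrable c Bc
    Ck_on_continuous[OF pdm_Ck[OF B1]])
  ultimately show ?thesis by (simp add: \<Psi>_def)
 qed
 ultimately show ?thesis by simp
qed

text \<open>Bootstrapping: the first derivatives are expressed through Y itself, so C^k gives
  C^(k+1).\<close>

lemma Y_smooth: "smooth Y"
 unfolding smooth_on_def
proof
 fix k show "Ck_on k UNIV Y"
 proof (induction k)
  case 0
  thus ?case using Y(1) by simp
 next
  case (Suc k)
  have C: "Ck_on k UNIV (%z. Z z ** C z ** Y z)" if "Ck_on k UNIV C" for C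
   by (intro Ck_on_mat open_UNIV Ck_on_compose_linear[OF _ bounded_linear_conj_transpose] Suc that)
  show ?case
  proof (rule Ck_on_SucI[OF open_UNIV Y_derivative])
   fix v :: "real^3"
   have "Ck_on k UNIV (%y::real^3. y $ i)" by (rule Ck_on_linear[OF open_UNIV bounded_linear_vec_nth])
   thus "Ck_on k UNIV (%y. SUM j:UNIV. v $ j *\<^sub>R (Y y ** (of_bool (j = i) *\<^sub>R I01 i 0 (%z. Z z ** B z ** Y z) y
    + y $ i *\<^sub>R I01 i (of_bool (j = i)) (%z. Z z ** pdm B j z ** Y z) y)))"
    by (intro Ck_on_sum Ck_on_scaleR Ck_on_const open_UNIV Ck_on_mat Suc Ck_on_add I01_Ck C smooth_on_Ck[OF B(1)]
     pdm_Ck[OF smooth_on_Ck[OF B(1)]])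
  qed
 qed
qed

lemma Y_ode: "pdm Y i y = B y ** Y y"
proof -
 define l where "l s = sc i 0 y + s *\<^sub>R axis i 1" for s
 have l: "l (y $ i) = y" "sc i r (l s) = l (s * r)" "l s $ i = s" for r s by (simp_all add: vec_eq_iff axis_def l_def)
 have "continuous_on UNIV (%s. B (l s) ** Y (l s))" unfolding l_def
  by (intro continuous_on_mat continuous_on_compose2[OF Bc] continuous_on_compose2[OF Y(1)] continuous_intros) auto
 from has_vector_derivative_add[OF has_vector_derivative_const integral_scale[OF this]]
 have "((%s. mat 1 + s *\<^sub>R integral {0..1} (%r. B (l (s * r)) ** Y (l (s * r)))) has_vector_derivative B (l s) ** Y (l s)) (at s)" for s by simp
 moreover have "(%s. Y (l s)) = (%s. mat 1 + s *\<^sub>R integral {0..1} (%r. B (l (s * r)) ** Y (l (s * r))))"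
  by (rule ext, subst Y(2)) (simp add: I01_def l)
 ultimately have "((%s. Y (l s)) has_vector_derivative B (l s) ** Y (l s)) (at s)" for s by (simp only:)
 moreover have "((%s. Y (l s)) has_vector_derivative pdm Y i (l s)) (at s)" for s
  unfolding l_def pdm_def by (rule directional_derivative[OF Ck_on_SucD(1)[OF smooth_on_Ck[OF Y_smooth] UNIV_I]])
 ultimately have "B (l s) ** Y (l s) = pdm Y i (l s)" for s by (rule vector_derivative_unique_at)
 from this[of "y $ i"] show ?thesis by (simp add: l)
qed

end

theorem transport_smooth:
 assumes "smooth B" "!!y. B y : su2"
 obtains Y where "smooth Y" "!!y. Y y : SU2" "!!y. y $ i = 0 ==> Y y = mat 1" "!!y. pdm Y i y = B y ** Y y"
proof (rule transport_exists[where i = i, OF Ck_on_continuous[OF smooth_on_Ck[OF assms(1)]]])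
 fix Y assume "continuous_on UNIV Y" "!!y. Y y = mat 1 + y $ i *\<^sub>R I01 i 0 (%z. B z ** Y z) y"
 then interpret transport i B Y using assms by unfold_locales
 show ?thesis by (rule that[OF Y_smooth Y_SU2 Y_0 Y_ode])
qed

subsection \<open>Flat frames\<close>

lemma smooth_mat: "smooth X ==> smooth Y ==> smooth (%y. (X y :: complex^2^2) ** (Y y :: complex^2^2))"
 and smooth_add: "smooth f ==> smooth g ==> smooth (%y. f y + g y)"
 and smooth_diff: "smooth f ==> smooth g ==> smooth (%y. f y - g y)"
 and smooth_linear: "bounded_linear L ==> smooth f ==> smooth (%y. L (f y))"
 and smooth_scaleR: "smooth c ==> smooth f ==> smooth (%y. c y *\<^sub>R f y)"
 unfolding smooth_on_def by (auto intro: Ck_on_mat Ck_on_add Ck_on_diff Ck_on_compose_linear Ck_on_scaleR)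

lemma smooth_id: "bounded_linear L ==> smooth L" and smooth_const: "smooth (%_. c)"
 unfolding smooth_on_def by (auto intro: Ck_on_linear)

lemma smooth_compose:
 fixes f :: "'a::real_normed_vector => 'b::euclidean_space"
 shows "smooth f ==> smooth_on V g ==> range f <= V ==> smooth (%y. g (f y))"
 unfolding smooth_on_def by (blast intro: Ck_on_compose open_UNIV)

lemma smooth_frechet: "smooth f ==> smooth (%y. fd f y v)"
 unfolding smooth_on_def using Ck_on_SucD(2) by blast

lemma smooth_pdm: "smooth f ==> smooth (pdm f j)"
 unfolding pdm_def[abs_def] by (rule smooth_frechet)

lemma smooth_derivative: "smooth f ==> (f has_derivative fd f y) (at y)"
 by (rule Ck_on_SucD(1)[OF smooth_on_Ck[of UNIV f "Suc 0"] UNIV_I])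

lemmas smooth_conj = smooth_linear[OF bounded_linear_conj_transpose]
lemmas smooth_uminus = smooth_linear[OF bounded_linear_minus[OF bounded_linear_ident]]

lemma pdm_mat:
 assumes "smooth X" "smooth Y"
 shows "pdm (%y. (X y :: complex^2^2) ** (Y y :: complex^2^2)) j y = X y ** pdm Y j y + pdm X j y ** Y y"
 using pdm_eqI[OF has_derivative_mat[OF smooth_derivative[OF assms(1)] smooth_derivative[OF assms(2)]]] by (simp add: pdm_def)

lemma pdm_linear: "bounded_linear L ==> smooth X ==> pdm (%y. L (X y)) j y = L (pdm X j y)"
 using pdm_eqI[OF bounded_linear.has_derivative[OF _ smooth_derivative]] by (simp add: pdm_def)

lemma pdm_add: "smooth X ==> smooth Y ==> pdm (%y. X y + Y y) j y = pdm X j y + pdm Y j y"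
 and pdm_diff: "smooth X ==> smooth Y ==> pdm (%y. X y - Y y) j y = pdm X j y - pdm Y j y"
 using pdm_eqI[OF has_derivative_add[OF smooth_derivative smooth_derivative]]
  pdm_eqI[OF has_derivative_diff[OF smooth_derivative smooth_derivative]] by (simp_all add: pdm_def)

lemma pdm_scaleR:
 assumes "smooth c" "smooth X"
 shows "pdm (%y. c y *\<^sub>R X y) j y = c y *\<^sub>R pdm X j y + pdm c j y *\<^sub>R X y"
 using pdm_eqI[OF has_derivative_scaleR[OF smooth_derivative[OF assms(1)] smooth_derivative[OF assms(2)]]] by (simp add: pdm_def)

lemma pdm_const: "pdm (%_. c) j y = 0"
 by (rule pdm_eqI[OF has_derivative_const])

lemmas pdm_conj = pdm_linear[OF bounded_linear_conj_transpose]
lemmas pdm_uminus = pdm_linear[OF bounded_linear_minus[OF bounded_linear_ident]]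

lemma pdm_commute:
 fixes f :: "real^3 => 'b::euclidean_space"
 assumes "smooth f" shows "pdm (pdm f i) j y = pdm (pdm f j) i y"
 unfolding pdm_def[abs_def] by (rule second_derivative_symmetric[OF open_UNIV smooth_on_Ck[OF assms] UNIV_I])

lemma sc_line: "sc i s y = sc i 0 y + s *\<^sub>R (y $ i *\<^sub>R axis i 1)"
 by (simp add: vec_eq_iff axis_def)

lemma line_derivative:
 assumes "smooth f"
 shows "((%s. f (sc i s y)) has_vector_derivative y $ i *\<^sub>R pdm f i (sc i s y)) (at s)"
proof -
 have "((%s. f (sc i 0 y + s *\<^sub>R (y $ i *\<^sub>R axis i 1))) has_vector_derivative
   fd f (sc i 0 y + s *\<^sub>R (y $ i *\<^sub>R axis i 1)) (y $ i *\<^sub>R axis i 1)) (at s)"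
  by (rule directional_derivative[OF smooth_derivative[OF assms]])
 thus ?thesis unfolding sc_line[symmetric]
  using linear_scale[OF has_derivative_linear[OF smooth_derivative[OF assms]]] by (simp add: pdm_def)
qed

lemma pdm_zero_constant:
 assumes "smooth f" "!!y. pdm f i y = 0" shows "f y = f (sc i 0 y)"
proof -
 have "((%s. f (sc i s y)) has_vector_derivative 0) (at s within {0..1})" for s
  using has_vector_derivative_at_within[OF line_derivative[OF assms(1), of i y s]] assms(2) by simp
 from interval_constant[OF this] show ?thesis by simp
qed

lemma bounded_linear_sc: "bounded_linear (sc i s)"
 by (rule bounded_linearI') (auto simp: vec_eq_iff algebra_simps)

lemma pdm_sc:
 assumes "smooth f"
 shows "pdm (%y. f (sc i 0 y)) j y = (if j = i then 0 else pdm f j (sc i 0 y))"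
proof -
 have d: "((%y. f (sc i 0 y)) has_derivative (%v. fd f (sc i 0 y) (sc i 0 v))) (at y)"
  by (rule has_derivative_compose[OF bounded_linear_imp_has_derivative[OF bounded_linear_sc] smooth_derivative[OF assms]])
 have "sc i 0 (axis j 1) = (if j = i then 0 else axis j 1)" by (auto simp: vec_eq_iff axis_def)
 thus ?thesis unfolding pdm_eqI[OF d]
  using linear_0[OF has_derivative_linear[OF smooth_derivative[OF assms]]] by (simp add: pdm_def)
qed

text \<open>The inverse of the invertible solution \<open>X\<close> times \<open>R\<close> does not
  depend on the i-th coordinate.\<close>

lemma ode_unique:
 fixes R :: "real^3 => complex^2^2"
 assumes X: "smooth X" "!!y. X y : SU2" "!!y. pdm X i y = B y ** X y" and B: "!!y. B y : su2"
  and R: "smooth R" "!!y. pdm R i y = B y ** R y" "!!y. y $ i = 0 ==> R y = 0"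
 shows "R y = 0"
proof -
 have "pdm (%y. ct (X y) ** R y) i z = 0" for z
  by (simp add: pdm_mat smooth_conj X(1) R(1) pdm_conj X(3) R(2) conj_transpose_mult su2_conj[OF B] mat_minus mat_algebra matrix_mul_assoc)
 hence "ct (X y) ** R y = ct (X (sc i 0 y)) ** R (sc i 0 y)"
  by (rule pdm_zero_constant[OF smooth_mat[OF smooth_conj[OF X(1)] R(1)]])
 also have "... = 0" using R(3) by (simp add: mat_algebra)
 finally have "X y ** (ct (X y) ** R y) = 0" by (simp add: mat_algebra)
 thus ?thesis by (simp add: matrix_mul_assoc conj_transpose_SU2[OF X(2)])
qed

lemma su2_uminus: "X : su2 ==> - X : su2"
 by (auto simp: su2_def quats_def qw_def)

text \<open>Transport along the second coordinate in the plane y3 = 0, then along the third. By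
  flatness the failure R of the equation in direction 2 satisfies the linear equation in direction
  3, and it vanishes for y3 = 0. The first coordinate stays a parameter.\<close>

theorem flat_frame:
 assumes A: "smooth A1" "smooth A2" and su: "!!y. A1 y : su2" "!!y. A2 y : su2"
  and flat: "!!y. pdm A2 2 y - pdm A1 3 y + (A1 y ** A2 y - A2 y ** A1 y) = 0"
 obtains F where "smooth F" "!!y. F y : SU2" "!!y. y $ 2 = 0 ==> y $ 3 = 0 ==> F y = mat 1"
  "!!y. pdm F 2 y = - (A1 y ** F y)" "!!y. pdm F 3 y = - (A2 y ** F y)"
proof -
 note scs = smooth_id[OF bounded_linear_sc]
 have B1: "smooth (%y. - A1 (sc 3 0 y))" by (intro smooth_uminus smooth_compose[OF scs A(1)]) simp
 obtain Y1 where Y1: "smooth Y1" "!!y. Y1 y : SU2" "!!y. y $ 2 = 0 ==> Y1 y = mat 1" "!!y. pdm Y1 2 y = - A1 (sc 3 0 y) ** Y1 y"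
  using transport_smooth[OF B1 su2_uminus[OF su(1)], where i = 2] by metis
 obtain Y2 where Y2: "smooth Y2" "!!y. Y2 y : SU2" "!!y. y $ 3 = 0 ==> Y2 y = mat 1" "!!y. pdm Y2 3 y = - A2 y ** Y2 y"
  using transport_smooth[OF smooth_uminus[OF A(2)] su2_uminus[OF su(2)], where i = 3] by metis
 define F where "F y = Y2 y ** Y1 (sc 3 0 y)" for y
 have Y1s: "smooth (%y. Y1 (sc 3 0 y))" by (rule smooth_compose[OF scs Y1(1)]) simp
 have Fs: "smooth F" unfolding F_def[abs_def] by (rule smooth_mat[OF Y2(1) Y1s])
 have FSU: "F y : SU2" for y unfolding F_def by (rule SU2_mult[OF Y2(2) Y1(2)])
 have F3: "pdm F 3 y = - A2 y ** F y" for y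
  unfolding F_def[abs_def] by (simp add: pdm_mat Y2(1) Y1s pdm_sc[OF Y1(1)] Y2(4) mat_algebra matrix_mul_assoc)
 define R where "R y = pdm F 2 y + A1 y ** F y" for y
 have Rs: "smooth R" unfolding R_def[abs_def] by (intro smooth_add smooth_pdm smooth_mat Fs A)
 have "R y = 0" for y
 proof (rule ode_unique[OF Fs FSU F3 su2_uminus[OF su(2)] Rs])
  fix y
  have "pdm R 3 y = pdm (pdm F 3) 2 y + pdm (%y. A1 y ** F y) 3 y"
   unfolding R_def[abs_def] by (simp add: pdm_add smooth_pdm smooth_mat Fs A pdm_commute[OF Fs, of 2])
  also have "pdm (pdm F 3) 2 y = pdm (%y. - A2 y ** F y) 2 y"
   by (simp add: F3[abs_def])
  also have "... = - A2 y ** pdm F 2 y - pdm A2 2 y ** F y"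
   by (subst pdm_mat[OF smooth_uminus[OF A(2)] Fs]) (simp add: pdm_uminus[OF A(2)] mat_minus)
  also have "pdm (%y. A1 y ** F y) 3 y = A1 y ** (- A2 y ** F y) + pdm A1 3 y ** F y"
   by (simp add: pdm_mat A Fs F3)
  also have "pdm A1 3 y = pdm A2 2 y + (A1 y ** A2 y - A2 y ** A1 y)"
   using flat[of y] by (simp add: algebra_simps)
  finally show "pdm R 3 y = - A2 y ** R y"
   by (simp add: R_def[of y] mat_algebra mat_minus matrix_mul_assoc)
  assume y3: "y $ 3 = 0"
  hence y: "sc 3 0 y = y" by (simp add: vec_eq_iff)
  \<comment> \<open>\<open>Y2\<close> is constantly 1 on the plane y3 = 0, which contains the second
    direction.\<close>
  have "pdm Y2 2 y = 0"
  proof -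
   have "((%t. Y2 (y + t *\<^sub>R axis 2 1)) has_vector_derivative pdm Y2 2 y) (at 0)"
    unfolding pdm_def by (rule directional_derivative) (simp add: smooth_derivative[OF Y2(1)])
   moreover have "Y2 (y + t *\<^sub>R axis 2 1) = mat 1" for t using y3 by (intro Y2(3)) (simp add: axis_def)
   ultimately show ?thesis using vector_derivative_unique_at[OF _ has_vector_derivative_const] by simp
  qed
  hence "pdm F 2 y = - A1 y ** Y1 y"
   unfolding F_def[abs_def] by (simp add: pdm_mat Y2(1) Y1s pdm_sc[OF Y1(1)] Y1(4) Y2(3)[OF y3] y mat_algebra)
  thus "R y = 0" by (simp add: R_def F_def Y2(3)[OF y3] y mat_minus)
 qed
 hence F2: "pdm F 2 y = - (A1 y ** F y)" for y unfolding R_def by (simp add: eq_neg_iff_add_eq_0)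
 show ?thesis
 proof (rule that[OF Fs FSU _ F2])
  show "F y = mat 1" if "y $ 2 = 0" "y $ 3 = 0" for y
   using that by (simp add: F_def Y2(3) Y1(3))
  show "pdm F 3 y = - (A2 y ** F y)" for y using F3 by (simp add: mat_minus)
 qed
qed

definition P2 :: "real^3 => real^2" where "P2 y = vector [y $ 2, y $ 3]"

lemma P2_nth [simp]: "P2 y $ 1 = y $ 2" "P2 y $ 2 = y $ 3"
 by (simp_all add: P2_def)

lemma bounded_linear_P2: "bounded_linear P2"
 by (rule bounded_linearI') (auto simp: vec_eq_iff forall_2)

lemma smooth_P2: "smooth f ==> smooth (%y. f (P2 y))"
 by (rule smooth_compose[OF smooth_id[OF bounded_linear_P2]]) auto

lemma pdm_P2:
 assumes "smooth f"
 shows "pdm (%y. f (P2 y)) 1 y = 0" "pdm (%y. f (P2 y)) 2 y = fd f (P2 y) (axis 1 1)"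
  "pdm (%y. f (P2 y)) 3 y = fd f (P2 y) (axis 2 1)"
proof -
 have d: "((%y. f (P2 y)) has_derivative (%v. fd f (P2 y) (P2 v))) (at y)"
  by (rule has_derivative_compose[OF bounded_linear_imp_has_derivative[OF bounded_linear_P2] smooth_derivative[OF assms]])
 have a: "P2 (axis 1 1) = 0" "P2 (axis 2 1) = axis 1 1" "P2 (axis 3 1) = axis 2 1" by (auto simp: vec_eq_iff forall_2 axis_def)
 show "pdm (%y. f (P2 y)) 1 y = 0"
  using linear_0[OF has_derivative_linear[OF smooth_derivative[OF assms]]] by (simp add: pdm_eqI[OF d] a)
 show "pdm (%y. f (P2 y)) 2 y = fd f (P2 y) (axis 1 1)"
  "pdm (%y. f (P2 y)) 3 y = fd f (P2 y) (axis 2 1)"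
  by (simp_all add: pdm_eqI[OF d] a)
qed

section \<open>Harmonic maps and flatness\<close>

abbreviation pd2 :: "(real^2 => 'b::real_normed_vector) => 2 => real^2 => 'b" where
 "pd2 f j x == fd f x (axis j 1)"

lemma frechet_eqI: "(f has_derivative f') (at x) ==> fd f x v = f' v"
 using frechet_derivative_at[of f f' x] by simp

lemma periodic_frechet:
 assumes "smooth f" "periodic f" shows "periodic (%x. fd f x v)"
 unfolding periodic_def
proof (intro allI)
 fix x :: "real^2" and i
 let ?c = "shift i :: real^2"
 have "((%z. f (z + ?c)) has_derivative fd f (x + ?c)) (at x)"
  by (rule has_derivative_compose[where f = "%z. z + ?c" and f' = "%v. v", OF _ smooth_derivative[OF assms(1)]])
   (auto intro!: derivative_eq_intros)
 moreover have "(%z. f (z + ?c)) = f" using assms(2) by (auto simp: periodic_def)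
 ultimately show "fd f (x + ?c) v = fd f x v"
  using frechet_eqI by metis
qed

lemma vector_3_eq: "(vector [s, t, r] :: real^3) = s *\<^sub>R axis 1 1 + t *\<^sub>R axis 2 1 + r *\<^sub>R axis 3 1"
 by (simp add: vec_eq_iff forall_3 axis_def)

lemma box_integrals:
 fixes f :: "real^3 => real"
 assumes f: "smooth f"
 defines "C == cbox 0 (vector [pi, 2 * pi, 2 * pi])"
 shows "pdm f j integrable_on C"
  "integral C (pdm f 1) = integral square (%p. f (vector [pi, p $ 1, p $ 2]) - f (vector [0, p $ 1, p $ 2]))"
  "(!!y. f (y + shift 2) = f y) ==> integral C (pdm f 2) = 0"
  "(!!y. f (y + shift 3) = f y) ==> integral C (pdm f 3) = 0"
proof -
 let ?u = "vector [pi, 2 * pi, 2 * pi] :: real^3"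
 have c: "continuous_on S f" "continuous_on S (pdm f j)" for S j
  using Ck_on_continuous[OF smooth_on_Ck[OF f]] Ck_on_continuous[OF smooth_on_Ck[OF smooth_pdm[OF f]]] continuous_on_subset by blast+
 have b: "bounded (pdm f j ` box 0 ?u)" for j
  by (rule bounded_subset[OF compact_imp_bounded[OF compact_continuous_image[OF c(2) compact_cbox]] image_mono[OF box_subset_cbox]])
 have u: "(0::real^3) $ i <= ?u $ i" for i using exhaust_3[of i] by auto
 have d: "EX f'. (f has_derivative f') (at y) & f' (axis j 1) = pdm f j y" for y j
  using smooth_derivative[OF f] by (auto simp: pdm_def)
 show "pdm f j integrable_on C" unfolding C_def by (rule integrable_continuous[OF c(2)])
 have z: "vector [0, 0] = (0 :: real^2)" by (simp add: vec_eq_iff forall_2)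
 show "integral C (pdm f 1) = integral square (%p. f (vector [pi, p $ 1, p $ 2]) - f (vector [0, p $ 1, p $ 2]))"
  unfolding C_def using box3_FTC(1)[OF u c(1) c(2) b d] by (simp add: z)
 have s: "(vector [s, 2 * pi, t] :: real^3) = vector [s, 0, t] + shift 2"
  "(vector [s, t, 2 * pi] :: real^3) = vector [s, t, 0] + shift 3" for s t by (simp_all add: vector_3_eq)
 show "integral C (pdm f 2) = 0" if p: "!!y. f (y + shift 2) = f y"
 proof -
  have "f (vector [s, 2 * pi, t]) = f (vector [s, 0, t])" for s t unfolding s by (rule p)
  thus ?thesis unfolding C_def using box3_FTC(2)[OF u c(1) c(2) b d] by simp
 qed
 show "integral C (pdm f 3) = 0" if p: "!!y. f (y + shift 3) = f y"
 proof -
  have "f (vector [s, t, 2 * pi]) = f (vector [s, t, 0])" for s t unfolding s by (rule p)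
  thus ?thesis unfolding C_def using box3_FTC(3)[OF u c(1) c(2) b d] by simp
 qed
qed

text \<open>Deduced from the box by adding a dummy coordinate y1 in [0, pi]: the box integral
  vanishes by periodicity, and y1 times the integrand, as a primitive in y1, shows that it is pi
  times the integral over the square.\<close>

lemma periodic_integral_zero:
 fixes F :: "real^2 => real"
 assumes F: "smooth F" "periodic F" shows "integral square (pd2 F j) = 0"
proof -
 let ?C = "cbox 0 (vector [pi, 2 * pi, 2 * pi]) :: (real^3) set"
 have p: "P2 (y + shift 2) = P2 y + shift 1" "P2 (y + shift 3) = P2 y + shift 2" for y
  by (simp_all add: vec_eq_iff forall_2 axis_def)
 have "integral ?C (pdm (%y. F (P2 y)) 2) = 0" "integral ?C (pdm (%y. F (P2 y)) 3) = 0"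
  by (rule box_integrals(3,4)[OF smooth_P2[OF F(1)]], use F(2) in \<open>simp add: p periodic_def\<close>)+
 then have z: "integral ?C (%y. pd2 F j (P2 y)) = 0"
  using exhaust_2[of j] unfolding pdm_P2[OF F(1), abs_def] by auto
 have s: "smooth (%y. pd2 F j (P2 y))" "smooth (%y::real^3. y $ 1)"
  by (rule smooth_P2[OF smooth_frechet[OF F(1)]], rule smooth_id[OF bounded_linear_vec_nth])
 have "pdm (%y::real^3. y $ 1) 1 y = 1" for y by (simp add: pdm_eqI[OF bounded_linear_imp_has_derivative[OF bounded_linear_vec_nth]])
 then have "pdm (%y. y $ 1 *\<^sub>R pd2 F j (P2 y)) 1 = (%y. pd2 F j (P2 y))"
  by (intro ext) (simp only: pdm_scaleR[OF s(2,1)] pdm_P2(1)[OF smooth_frechet[OF F(1)]] scaleR_zero_right scaleR_one add_0)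
 moreover have "P2 (vector [r, p $ 1, p $ 2]) = p" for r p by (simp add: vec_eq_iff forall_2)
 ultimately have "pi * integral square (pd2 F j) = integral ?C (%y. pd2 F j (P2 y))"
  using box_integrals(2)[OF smooth_scaleR[OF s(2,1)]] by simp
 then show ?thesis by (simp add: z)
qed

text \<open>On su(2) this is -1/8 times the Killing form. Written through the product, its
  invariance under conjugation is cyclicity of the trace.\<close>

definition ip :: "complex^2^2 => complex^2^2 => real" where "ip X Y = - qw (X ** Y)"

lemma qw_cyclic: "X : quats ==> Y : quats ==> qw (X ** Y) = qw (Y ** X)"
 by (simp add: q_mult)

lemma ip_linear: "ip (X + Y) W = ip X W + ip Y W" "ip X (W + Y) = ip X W + ip X Y" "ip (c *\<^sub>R X) W = c * ip X W" "ip X (c *\<^sub>R W) = c * ip X W"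
  "ip (X - Y) W = ip X W - ip Y W" "ip X (W - Y) = ip X W - ip X Y"
 by (simp_all add: ip_def mat_algebra q_defs)

lemma ip_sym: "X : su2 ==> Y : su2 ==> ip X Y = ip Y X"
 by (simp add: ip_def qw_cyclic su2_def)

lemma killing_ip: "X : su2 ==> Y : su2 ==> killing X Y = - 8 * ip X Y"
 by (simp add: killing_su2 ip_def q_mult su2_def)

lemma ip_conj:
 assumes "X : su2" "Y : su2" "q : SU2"
 shows "ip (ct q ** X ** q) (ct q ** Y ** q) = ip X Y"
proof -
 have "ct q ** X ** q ** (ct q ** Y ** q) = ct q ** (X ** (q ** ct q) ** Y) ** q"
  by (simp add: matrix_mul_assoc)
 hence "ip (ct q ** X ** q) (ct q ** Y ** q) = - qw (ct q ** ((X ** Y) ** q))"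
  by (simp add: ip_def conj_transpose_SU2[OF assms(3)] matrix_mul_assoc)
 also have "... = - qw (((X ** Y) ** q) ** ct q)"
  using assms by (subst qw_cyclic) (auto simp: su2_def SU2_quats)
 finally show ?thesis using conj_transpose_SU2[OF assms(3)] by (simp add: ip_def matrix_mul_assoc[symmetric])
qed

lemma su2_linear: "X : su2 ==> Y : su2 ==> X + Y : su2" "X : su2 ==> Y : su2 ==> X - Y : su2" "X : su2 ==> c *\<^sub>R X : su2"
 by (auto simp: su2_def quats_def qw_def)

lemma mc_SU2: "g x : SU2 ==> mc_pullback g x v = ct (g x) ** fd g x v"
 by (simp add: mc_pullback_def matrix_inv_SU2)

lemma mc_su2:
 assumes "smooth g" "range g <= SU2" shows "mc_pullback g x v : su2"
proof -
 have g: "g x : SU2" using assms(2) by blast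
 show ?thesis unfolding mc_SU2[of g, OF g] using tangent_derivative[OF open_UNIV UNIV_I assms(2) smooth_derivative[OF assms(1)], of x v]
  tangent_iff_su2[OF g] by blast
qed

lemma smooth_mult: "smooth f ==> smooth k ==> smooth (%x. f x * (k x :: real))"
 unfolding smooth_on_def by (auto intro: Ck_on_mult)

section \<open>The conformal structure and the energy density\<close>

locale metric_torus =
 fixes h :: "real^2 => real^2^2" assumes h: "torus_metric h"
begin

abbreviation "rt x i j == rotation (h x) $ i $ j"

lemma metric_pos: "h x $ 2 $ 1 = h x $ 1 $ 2" "0 < h x $ 1 $ 1" "0 < det (h x)"
proof -
 have s: "transpose (h x) = h x" and p: "!!v. v ~= 0 ==> 0 < v \<bullet> (h x *v v)" using h by (auto simp: torus_metric_def)
 have "transpose (h x) $ 1 $ 2 = h x $ 1 $ 2" unfolding s ..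
 thus e: "h x $ 2 $ 1 = h x $ 1 $ 2" by (simp add: transpose_def)
 have "axis 1 1 ~= (0::real^2)" by (simp add: axis_eq_0_iff)
 from p[OF this] show a: "0 < h x $ 1 $ 1" by (simp add: inner_vec_def matrix_vector_mult_def sum_2 axis_def)
 let ?v = "vector [- (h x $ 1 $ 2), h x $ 1 $ 1] :: real^2"
 have v0: "?v ~= 0"
 proof
  assume "?v = 0"
  hence "?v $ 2 = 0" by simp
  thus False using a by simp
 qed
 have "?v \<bullet> (h x *v ?v) = h x $ 1 $ 1 * det (h x)"
 proof -
  have "(h x *v ?v) $ 1 = 0" by (simp add: matrix_vector_mult_def sum_2)
  moreover have "(h x *v ?v) $ 2 = det (h x)" by (simp add: matrix_vector_mult_def sum_2 det_2 e)
  ultimately show ?thesis unfolding inner_vec_def sum_2 by (simp only: vector_2 inner_real_def mult_zero_right add_0)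
 qed
 with p[OF v0] have "0 < h x $ 1 $ 1 * det (h x)" by simp
 thus "0 < det (h x)" using a by (simp add: zero_less_mult_iff)
qed

lemma rt: "rt x 1 1 = h x $ 1 $ 2 / sqrt (det (h x))" "rt x 1 2 = h x $ 2 $ 2 / sqrt (det (h x))"
  "rt x 2 1 = - (h x $ 1 $ 1) / sqrt (det (h x))" "rt x 2 2 = - rt x 1 1"
 by (simp_all add: rotation_def)

lemma rt_det: "rt x 1 1 * rt x 2 2 - rt x 1 2 * rt x 2 1 = 1"
proof -
 have "rt x 1 1 * rt x 2 2 - rt x 1 2 * rt x 2 1 = det (h x) / (sqrt (det (h x)) * sqrt (det (h x)))"
  unfolding rt using metric_pos(1)[of x] by (simp add: det_2 diff_divide_distrib)
 thus ?thesis using metric_pos(3)[of x] by simp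
qed

lemma rt_smooth: "smooth (%x. rt x i j)"
proof -
 have hs: "smooth (%x. h x $ i $ j)" for i j
  using h by (intro smooth_linear[OF bounded_linear_compose[OF bounded_linear_vec_nth bounded_linear_vec_nth]]) (simp add: torus_metric_def)
 have "smooth (%x. det (h x))"
  unfolding det_2 by (intro smooth_diff smooth_mult hs)
 moreover have "smooth_on {0<..} (%t::real. t powr (- 1/2))" by (simp add: smooth_on_def Ck_on_powr)
 ultimately have "smooth (%x. det (h x) powr (- 1/2))"
  by (rule smooth_compose) (use metric_pos(3) in auto)
 moreover have "det (h x) powr (- 1/2) = 1 / sqrt (det (h x))" for x
  using metric_pos(3)[of x] by (simp add: powr_minus_divide powr_half_sqrt)
 ultimately have d: "smooth (%x. 1 / sqrt (det (h x)))" by simp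
 have e: "rt x i j = (1 / sqrt (det (h x))) * (if i = 1 then h x $ j $ 2 else - h x $ 1 $ j)" for x
  using exhaust_2[of i] exhaust_2[of j] by (auto simp: rotation_def)
 have "smooth (%x. - h x $ 1 $ j)" by (rule smooth_uminus[OF hs])
 from smooth_mult[OF d this] show ?thesis unfolding e using smooth_mult[OF d hs[of j 2]] by (cases "i = 1") simp_all
qed

lemma rt_periodic: "periodic (%x. rt x i j)"
 using h by (simp add: periodic_def torus_metric_def)

text \<open>This is sqrt(det h) times the sum of h^ij ip(X_i, X_j), expressed by the rotation; so
  only the conformal class enters.\<close>

abbreviation "edens x X Y == rt x 1 2 * ip X X - 2 * rt x 1 1 * ip X Y - rt x 2 1 * ip Y Y"

text \<open>The factor 4 is 1/2 from \<open>energy\<close> times 8 from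
  \<open>killing\<close>.\<close>

lemma energy_formula:
 assumes "torus_map g"
 shows "energy h g = 4 * integral square (%x. edens x (mc_pullback g x (axis 1 1)) (mc_pullback g x (axis 2 1)))"
proof -
 have g: "smooth g" "range g <= SU2" using assms by (auto simp: torus_map_def)
 have sq: "(\<chi> i. 2 * pi) = (vector [2 * pi, 2 * pi] :: real^2)" by (simp add: vec_eq_iff forall_2)
 have "sqrt (det (h x)) * (SUM i:UNIV. SUM j:UNIV. matrix_inv (h x) $ i $ j *
    (- killing (mc_pullback g x (axis i 1)) (mc_pullback g x (axis j 1))))
   = 8 * edens x (mc_pullback g x (axis 1 1)) (mc_pullback g x (axis 2 1))" for x
 proof -
  let ?a = "h x $ 1 $ 1" and ?b = "h x $ 1 $ 2" and ?d = "h x $ 2 $ 2" and ?D = "det (h x)"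
  have D: "?D = ?a * ?d - ?b * ?b" using metric_pos(1)[of x] by (simp add: det_2)
  have "h x ** vector [vector [?d / D, - ?b / D], vector [- ?b / D, ?a / D]] = mat 1" if "?a * ?d = D + ?b * ?b" "D ~= 0" for D
   using that metric_pos(1)[of x] by (simp add: vec2_eq_iff mat2_mult_nth mat2_nth field_simps)
  hence inv: "matrix_inv (h x) = vector [vector [?d / ?D, - ?b / ?D], vector [- ?b / ?D, ?a / ?D]]"
   using D metric_pos(3)[of x] by (intro matrix_inv_unique) simp
  have s: "sqrt ?D * (c / ?D) = c / sqrt ?D" for c using metric_pos(3)[of x] by (simp add: field_simps)
  have e: "sqrt ?D * (?d / ?D * p + - ?b / ?D * q + (- ?b / ?D * q + ?a / ?D * r)) = rt x 1 2 * p - 2 * rt x 1 1 * q - rt x 2 1 * r" for p q r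
  proof -
   have "sqrt ?D * (?d / ?D * p + - ?b / ?D * q + (- ?b / ?D * q + ?a / ?D * r))
    = (sqrt ?D * (?d / ?D)) * p - 2 * (sqrt ?D * (?b / ?D)) * q + (sqrt ?D * (?a / ?D)) * r" by (simp add: algebra_simps)
   thus ?thesis unfolding s rt by simp
  qed
  show ?thesis
   using e[of "8 * ip (mc_pullback g x (axis 1 1)) (mc_pullback g x (axis 1 1))" "8 * ip (mc_pullback g x (axis 1 1)) (mc_pullback g x (axis 2 1))"
     "8 * ip (mc_pullback g x (axis 2 1)) (mc_pullback g x (axis 2 1))"]
   by (simp add: sum_2 inv killing_ip[OF mc_su2[OF g] mc_su2[OF g]] ip_sym[OF mc_su2[OF g] mc_su2[OF g], of x "axis 2 1" x "axis 1 1"])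
 qed
 thus ?thesis unfolding energy_def sq by (simp only: integral_mult_right)
qed

end

lemma su2_eq: assumes "e : su2" shows "e = quat 0 (qx e) (qy e) (qz e)"
proof -
 have 0: "qw e = 0" and q: "e : quats" using assms by (auto simp: su2_def)
 show ?thesis using quats_eq[OF q] unfolding 0 .
qed

text \<open>Composing with the linear projection onto su(2) does not change \<open>f\<close>, and
  the derivative of the composition visibly lies in su(2).\<close>

lemma su2_frechet:
 fixes f :: "'a::real_normed_vector => complex^2^2"
 assumes f: "smooth f" "!!x. f x : su2" shows "fd f x v : su2"
proof -
 define p where "p X = quat 0 (qx X) (qy X) (qz X)" for X
 have "bounded_linear p" unfolding p_def[abs_def]
  by (rule bounded_linearI') (simp_all add: vec2_eq_iff quat_def q_defs complex_eq_iff)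
 from bounded_linear.has_derivative[OF this smooth_derivative[OF f(1), of x]]
 have d: "((%y. p (f y)) has_derivative (%v. p (fd f x v))) (at x)" .
 have "(%y. p (f y)) = f" unfolding p_def using su2_eq[OF f(2)] by (intro ext) (rule sym)
 from frechet_eqI[OF d, of v, unfolded this] have "fd f x v = p (fd f x v)" .
 moreover have "p X : su2" for X by (simp add: su2_def p_def)
 ultimately show ?thesis by (rule ssubst)
qed

lemma periodic_square:
 assumes "periodic f" obtains x' where "x' : square" "f x = f x'"
proof -
 have nat: "f (x + (2 * pi * real k) *\<^sub>R axis i 1) = f x" for x i and k :: nat
 proof (induction k arbitrary: x)
  case (Suc k)
  have "f (x + (2 * pi * real (Suc k)) *\<^sub>R axis i 1) = f ((x + (2 * pi * real k) *\<^sub>R axis i 1) + shift i)"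
   by (simp add: algebra_simps)
  also have "... = f x" using assms Suc.IH by (simp add: periodic_def)
  finally show ?case .
 qed simp
 have int: "f (x + (2 * pi * of_int k) *\<^sub>R axis i 1) = f x" for x i and k :: int
 proof (cases "0 <= k")
  case True
  thus ?thesis using nat[of x "nat k" i] by simp
 next
  case False
  thus ?thesis using nat[of "x + (2 * pi * of_int k) *\<^sub>R axis i 1" "nat (- k)" i]
   by (simp add: algebra_simps)
 qed
 obtain x' where x': "x' : hsquare" "!!i. EX k::int. x $ i - x' $ i = 2 * pi * k" using hsquare_representative by blast
 obtain k l :: int where k: "x $ 1 - x' $ 1 = 2 * pi * k" "x $ 2 - x' $ 2 = 2 * pi * l" using x'(2) by meson
 have "x = (x' + (2 * pi * of_int k) *\<^sub>R axis 1 1) + (2 * pi * of_int l) *\<^sub>R axis 2 1"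
  using k by (simp add: vec_eq_iff forall_2 axis_def algebra_simps)
 hence "f x = f x'" using int by metis
 thus ?thesis using that hsquare_square(1) x'(1) by blast
qed

text \<open>For a unit vector \<open>e\<close> of su(2), which squares to -1, this is exp(s
  e).\<close>

definition gam :: "complex^2^2 => real => complex^2^2" where "gam e s = cos s *\<^sub>R mat 1 + sin s *\<^sub>R e"

lemma unit_square: assumes "e : su2" "ip e e = 1" shows "e ** e = - mat 1"
proof -
 obtain x y z where e: "e = quat 0 x y z" using su2_eq[OF assms(1)] by blast
 have "x * x + y * y + z * z = 1" using assms(2) by (simp add: e ip_def quat_mult)
 thus ?thesis unfolding e quat_mult by (simp add: vec2_eq_iff mat2_nth quat_def complex_eq_iff)
qed

lemma gam:
 assumes e: "e : su2" "ip e e = 1"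
 shows "gam e s : SU2" "e ** gam e s = gam e s ** e" "e ** gam e s = - sin s *\<^sub>R mat 1 + cos s *\<^sub>R e"
  "ct (gam e s) ** e ** gam e s = e"
proof -
 note ee = unit_square[OF e]
 have ct: "ct (gam e s) = cos s *\<^sub>R mat 1 - sin s *\<^sub>R e"
  using bounded_linear.linear[OF bounded_linear_conj_transpose] su2_conj[OF e(1)] by (simp add: gam_def linear_add)
 have cc: "cos s *\<^sub>R (cos s *\<^sub>R X) + sin s *\<^sub>R (sin s *\<^sub>R X) = X" for X :: "complex^2^2"
  by (simp add: scaleR_left_distrib[symmetric] power2_eq_square[symmetric])
 show c: "e ** gam e s = gam e s ** e" "e ** gam e s = - sin s *\<^sub>R mat 1 + cos s *\<^sub>R e"
  by (simp_all add: gam_def mat_algebra ee)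
 have q: "gam e s : quats"
 proof -
  have "mat 1 : quats" using SU2_quats[OF SU2_1] .
  moreover have "c *\<^sub>R X : quats" if "X : quats" for X c using that by (simp add: quats_def)
  ultimately show ?thesis using e(1) by (auto simp: gam_def su2_def intro: quats_linear)
 qed
 have u: "gam e s ** ct (gam e s) = mat 1"
  unfolding ct unfolding gam_def using cc[of "mat 1"] by (simp add: mat_algebra ee algebra_simps)
 thus S: "gam e s : SU2"
 proof -
  have "qw (gam e s ** ct (gam e s)) = 1" unfolding u by (simp add: quat_1)
  thus ?thesis using q by (simp add: SU2_iff q_mult quats_conj q_conj power2_eq_square)
 qed
 have "ct (gam e s) ** e ** gam e s = ct (gam e s) ** gam e s ** e"
  by (simp add: matrix_mul_assoc[symmetric] c(1))
 thus "ct (gam e s) ** e ** gam e s = e" by (simp add: conj_transpose_SU2[OF S])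
qed

lemma smooth_cos: "smooth f ==> smooth (%x. cos (f x :: real))"
 and smooth_sin: "smooth f ==> smooth (%x. sin (f x :: real))"
 using smooth_compose[of f UNIV cos] smooth_compose[of f UNIV sin] Ck_on_sin_cos by (auto simp: smooth_on_def)

lemma smooth_gam: "smooth f ==> smooth (%x. gam e (f x))"
 unfolding gam_def by (intro smooth_add smooth_scaleR smooth_cos smooth_sin smooth_const)

section \<open>First variation and the harmonic map equation\<close>

locale harmonic_torus = metric_torus +
 fixes g assumes g: "harmonic_torus_map h g"
begin

lemma g_torus: "torus_map g" and g_smooth: "smooth g" and g_periodic: "periodic g" and g_SU2: "g x : SU2"
 using g by (auto simp: harmonic_torus_map_def torus_map_def)

definition al :: "2 => real^2 => complex^2^2" where "al j x = ct (g x) ** pd2 g j x"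
text \<open>Components of the Hodge star of the form with components \<open>al\<close>: its value on
  the rotated j-th basis vector.\<close>

definition be :: "2 => real^2 => complex^2^2" where "be j x = rt x 1 j *\<^sub>R al 1 x + rt x 2 j *\<^sub>R al 2 x"

lemma al_smooth: "smooth (al j)" and be_smooth: "smooth (be j)"
proof -
 show a: "smooth (al j)" for j
  unfolding al_def[abs_def] by (intro smooth_mat smooth_conj smooth_frechet g_smooth)
 show "smooth (be j)" unfolding be_def[abs_def] by (intro smooth_add smooth_scaleR rt_smooth a)
qed

lemma al_periodic: "periodic (al j)" and be_periodic: "periodic (be j)"
proof -
 show a: "periodic (al j)" for j
  using g_periodic periodic_frechet[OF g_smooth g_periodic, of "axis j 1"] by (simp add: al_def periodic_def)
 show "periodic (be j)" using a[of 1] a[of 2] rt_periodic[of 1 j] rt_periodic[of 2 j] by (simp add: be_def periodic_def)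
qed

lemma al_mc: "mc_pullback g x (axis j 1) = al j x"
 by (simp add: mc_SU2 g_SU2 al_def)

lemma al_su2: "al j x : su2" and be_su2: "be j x : su2"
proof -
 show a: "al j x : su2" for j x using mc_su2[OF g_smooth, of x "axis j 1"] g_SU2 by (auto simp: al_mc)
 show "be j x : su2" unfolding be_def by (intro su2_linear a)
qed

text \<open>For the variation g exp(t f e), conjugation by exp(t f e) preserves \<open>ip\<close>
  and fixes \<open>e\<close>. Hence the energy is exactly a quadratic polynomial in t, whose linear
  coefficient must vanish.\<close>

lemma first_variation:
 assumes f: "smooth f" "periodic f" and e: "e : su2" "ip e e = 1"
 shows "integral square (%x. pd2 f 1 x * ip (be 2 x) e - pd2 f 2 x * ip (be 1 x) e) = 0"
proof -
 define G where "G t x = g x ** gam e (t * f x)" for t x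
 have tf: "smooth (%x. t * f x)" for t by (intro smooth_mult smooth_const f)
 have Gt: "torus_map (G t)" for t
  unfolding torus_map_def
 proof (intro conjI)
  show "smooth (G t)" unfolding G_def[abs_def] by (intro smooth_mat g_smooth smooth_gam tf)
  show "periodic (G t)" using g_periodic f(2) by (simp add: G_def periodic_def)
  show "range (G t) <= SU2" using SU2_mult[OF g_SU2 gam(1)[OF e]] by (auto simp: G_def)
 qed
 have Gs: "smooth (%(t, x). G t x)"
 proof -
  have "smooth (%p::real \<times> (real^2). g (snd p))" "smooth (%p::real \<times> (real^2). f (snd p))"
   by (rule smooth_compose[OF smooth_id[OF bounded_linear_snd]], use g_smooth f(1) in auto)+
  moreover have "smooth (%p::real \<times> (real^2). fst p)" by (rule smooth_id[OF bounded_linear_fst])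
  ultimately show ?thesis unfolding G_def case_prod_unfold by (intro smooth_mat smooth_gam smooth_mult)
 qed
 have mc: "mc_pullback (G t) x (axis j 1) = ct (gam e (t * f x)) ** al j x ** gam e (t * f x) + (t * pd2 f j x) *\<^sub>R e" for t x j
 proof -
  let ?c = "gam e (t * f x)"
  have f': "((%x. t * f x) has_derivative (%v. t * fd f x v)) (at x)"
   by (rule has_derivative_mult_right[OF smooth_derivative[OF f(1)]])
  have "((%x. gam e (t * f x)) has_derivative (%v. (t * fd f x v) *\<^sub>R (e ** ?c))) (at x)"
   unfolding gam_def gam(3)[OF e, unfolded gam_def]
   by (rule has_derivative_eq_rhs[OF has_derivative_add[OF has_derivative_scaleR[OF has_derivative_cos[OF f'] has_derivative_const]
      has_derivative_scaleR[OF has_derivative_sin[OF f'] has_derivative_const]]])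
    (simp add: fun_eq_iff algebra_simps)
  from has_derivative_mat[OF smooth_derivative[OF g_smooth] this]
  have "pd2 (G t) j x = g x ** ((t * pd2 f j x) *\<^sub>R (e ** ?c)) + pd2 g j x ** ?c"
   unfolding G_def[abs_def] by (rule frechet_eqI)
  moreover have "G t x : SU2" using Gt[of t] by (auto simp: torus_map_def)
  ultimately have "mc_pullback (G t) x (axis j 1) = ct (g x ** ?c) ** (g x ** ((t * pd2 f j x) *\<^sub>R (e ** ?c)) + pd2 g j x ** ?c)"
   by (simp add: mc_SU2) (simp add: G_def)
  also have "... = ct ?c ** (ct (g x) ** g x) ** ((t * pd2 f j x) *\<^sub>R (e ** ?c)) + ct ?c ** al j x ** ?c"
   by (simp add: conj_transpose_mult mat_algebra al_def matrix_mul_assoc)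
  also have "ct ?c ** (ct (g x) ** g x) ** ((t * pd2 f j x) *\<^sub>R (e ** ?c)) = (t * pd2 f j x) *\<^sub>R e"
   using gam(4)[OF e, of "t * f x"] by (simp add: conj_transpose_SU2[OF g_SU2] mat_algebra matrix_mul_assoc)
  finally show ?thesis by simp
 qed
 let ?E0 = "%x. edens x (al 1 x) (al 2 x)"
 let ?E1 = "%x. pd2 f 1 x * ip (be 2 x) e - pd2 f 2 x * ip (be 1 x) e"
 let ?E2 = "%x. rt x 1 2 * (pd2 f 1 x * pd2 f 1 x) - 2 * rt x 1 1 * (pd2 f 1 x * pd2 f 2 x) - rt x 2 1 * (pd2 f 2 x * pd2 f 2 x)"
 have dens: "edens x (mc_pullback (G t) x (axis 1 1)) (mc_pullback (G t) x (axis 2 1)) = ?E0 x + t * (2 * ?E1 x) + t\<^sup>2 * ?E2 x" for t x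
 proof -
  define X where "X j = ct (gam e (t * f x)) ** al j x ** gam e (t * f x)" for j
  have XX: "ip (X i) (X j) = ip (al i x) (al j x)" for i j unfolding X_def by (rule ip_conj[OF al_su2 al_su2 gam(1)[OF e]])
  have Xe: "ip (X j) e = ip (al j x) e" for j
   using ip_conj[OF al_su2 e(1) gam(1)[OF e, of "t * f x"], of j x] unfolding gam(4)[OF e] X_def .
  have eX: "ip e (X j) = ip (al j x) e" for j
   using ip_conj[OF e(1) al_su2 gam(1)[OF e, of "t * f x"], of j x] ip_sym[OF e(1) al_su2] unfolding gam(4)[OF e] X_def by simp
  show ?thesis unfolding mc X_def[symmetric]
   by (simp add: ip_linear XX Xe eX e(2) be_def rt(4) power2_eq_square algebra_simps)
 qed
 have ipc: "continuous_on S (%x. ip (a x) (b x))" if "smooth a" "smooth b" for a b :: "real^2 => complex^2^2" and S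
  unfolding ip_def using that
  by (intro continuous_on_minus bounded_linear.continuous_on[OF bounded_linear_q(1)] continuous_on_subset[OF Ck_on_continuous[OF smooth_on_Ck[OF smooth_mat]]]) auto
 have sc: "continuous_on S u" if "smooth u" for u :: "real^2 => real" and S
  by (rule continuous_on_subset[OF Ck_on_continuous[OF smooth_on_Ck[OF that]]]) simp
 have i: "?E0 integrable_on square" "?E1 integrable_on square" "?E2 integrable_on square"
  by (rule integrable_continuous, intro continuous_intros ipc al_smooth be_smooth smooth_const sc[OF rt_smooth] sc[OF smooth_frechet[OF f(1)]])+
 have "energy h (G t) = 4 * integral square ?E0 + t * (8 * integral square ?E1) + t\<^sup>2 * (4 * integral square ?E2)" for t
 proof -
  have "((%x. ?E0 x + t * (2 * ?E1 x) + t\<^sup>2 * ?E2 x) has_integral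
    integral square ?E0 + t * (2 * integral square ?E1) + t\<^sup>2 * integral square ?E2) square"
   by (intro has_integral_add has_integral_mult_right integrable_integral i)
  thus ?thesis unfolding energy_formula[OF Gt] dens by (simp add: integral_unique)
 qed
 hence "((%t. energy h (G t)) has_real_derivative 8 * integral square ?E1) (at 0)"
  by (auto intro!: derivative_eq_intros)
 moreover have "G 0 = g" by (rule ext) (simp add: G_def gam_def)
 hence "((%t. energy h (G t)) has_real_derivative 0) (at 0)"
  using g Gs Gt unfolding harmonic_torus_map_def by blast
 ultimately have "8 * integral square ?E1 = 0" by (rule DERIV_unique)
 thus ?thesis by simp
qed

text \<open>The equation says that the Hodge star of g^-1 dg is closed. In the direction
  \<open>e\<close> the test function is the e-component of the left minus the right side;
  integration by parts then leaves the integral of its square.\<close>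

lemma harmonic_equation: "pd2 (be 2) 1 x = pd2 (be 1) 2 x"
proof -
 define \<kappa> where "\<kappa> x = pd2 (be 2) 1 x - pd2 (be 1) 2 x" for x
 have \<kappa>: "smooth \<kappa>" "periodic \<kappa>" "!!x. \<kappa> x : su2"
  unfolding \<kappa>_def[abs_def]
  using periodic_frechet[OF be_smooth be_periodic, of 2 "axis 1 1"] periodic_frechet[OF be_smooth be_periodic, of 1 "axis 2 1"]
  by (auto simp: periodic_def intro!: smooth_diff smooth_frechet be_smooth su2_linear su2_frechet be_su2)
 have z: "ip (\<kappa> x) e = 0" if e: "e : su2" "ip e e = 1" for e x
 proof -
  have L: "bounded_linear (%X. ip X e)"
   by (rule bounded_linearI') (simp_all add: ip_linear)
  define f where "f x = ip (\<kappa> x) e" for x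
  have f: "smooth f" "periodic f"
   unfolding f_def using smooth_linear[OF L \<kappa>(1)] \<kappa>(2) by (auto simp: periodic_def)
  have fc: "continuous_on S f" for S using continuous_on_subset[OF Ck_on_continuous[OF smooth_on_Ck[OF f(1)]]] by blast
  have w: "smooth (%x. f x * ip (be j x) e)" "periodic (%x. f x * ip (be j x) e)" for j
   using f(2) be_periodic[of j] by (auto simp: periodic_def intro!: smooth_mult f(1) smooth_linear[OF L be_smooth])
  have d: "pd2 (%x. f x * ip (be j x) e) k x = f x * ip (pd2 (be j) k x) e + pd2 f k x * ip (be j x) e" for j k x
   by (rule frechet_eqI[OF has_derivative_mult[OF smooth_derivative[OF f(1)] bounded_linear.has_derivative[OF L smooth_derivative[OF be_smooth]]]])
  have wi: "pd2 (%x. f x * ip (be j x) e) k integrable_on square" for j k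
   by (rule integrable_continuous, rule continuous_on_subset[OF Ck_on_continuous[OF smooth_on_Ck[OF smooth_frechet[OF w(1)]]]]) simp
  have "0 = integral square (pd2 (%x. f x * ip (be 2 x) e) 1) - integral square (pd2 (%x. f x * ip (be 1 x) e) 2)"
   using periodic_integral_zero[OF w] by simp
  also have "... = integral square (%x. pd2 (%x. f x * ip (be 2 x) e) 1 x - pd2 (%x. f x * ip (be 1 x) e) 2 x)"
   by (rule integral_diff[OF wi wi, symmetric])
  also have "... = integral square (%x. f x * f x + (pd2 f 1 x * ip (be 2 x) e - pd2 f 2 x * ip (be 1 x) e))"
   unfolding d by (simp add: f_def \<kappa>_def ip_linear algebra_simps)
  also have "... = integral square (%x. f x * f x) + integral square (%x. pd2 f 1 x * ip (be 2 x) e - pd2 f 2 x * ip (be 1 x) e)"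
  proof (rule integral_add)
   show "(%x. f x * f x) integrable_on square" by (intro integrable_continuous continuous_on_mult fc)
   show "(%x. pd2 f 1 x * ip (be 2 x) e - pd2 f 2 x * ip (be 1 x) e) integrable_on square"
    by (intro integrable_continuous continuous_intros continuous_on_subset[OF Ck_on_continuous[OF smooth_on_Ck[OF smooth_frechet[OF f(1)]]]]
     continuous_on_subset[OF Ck_on_continuous[OF smooth_on_Ck[OF smooth_linear[OF L be_smooth]]]]) auto
  qed
  finally have "integral square (%x. f x * f x) = 0" using first_variation[OF f e] by simp
  moreover have "box 0 (vector [2 * pi, 2 * pi]) ~= ({} :: (real^2) set)"
  proof -
   have "vector [pi, pi] : (box 0 (vector [2 * pi, 2 * pi]) :: (real^2) set)" by (simp add: mem_box_cart forall_2)
   thus ?thesis by blast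
  qed
  ultimately have "ALL x:square. f x * f x = 0"
   using integral_cbox_eq_0_iff[of 0 "vector [2 * pi, 2 * pi]" "%x. f x * f x"] continuous_on_mult[OF fc fc] by auto
  thus "ip (\<kappa> x) e = 0" using periodic_square[OF f(2), of x] unfolding f_def by auto
 qed
 obtain a b c where k: "\<kappa> x = quat 0 a b c" using su2_eq[OF \<kappa>(3)[of x]] by blast
 have "quat 0 1 0 0 : su2" "quat 0 0 1 0 : su2" "quat 0 0 0 1 : su2" by (simp_all add: su2_def)
 from z[OF this(1), of x] z[OF this(2), of x] z[OF this(3), of x]
 have "a = 0" "b = 0" "c = 0" by (simp_all add: k ip_def quat_mult)
 hence "\<kappa> x = 0" using k by (simp add: quat_def vec2_eq_iff complex_eq_iff)
 thus ?thesis by (simp add: \<kappa>_def)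
qed

end

subsection \<open>The associated family\<close>

lemma pd2_commute:
 fixes f :: "real^2 => 'b::euclidean_space"
 assumes "smooth f" shows "pd2 (pd2 f i) j x = pd2 (pd2 f j) i x"
 by (rule second_derivative_symmetric[OF open_UNIV smooth_on_Ck[OF assms] UNIV_I])

lemma slice_constant:
 assumes f: "smooth f" and z: "!!z. z $ 1 = c ==> pdm f 2 z = 0" "!!z. z $ 1 = c ==> pdm f 3 z = 0"
 shows "f (vector [c, s, t]) = f (vector [c, 0, 0])"
proof -
 have "((%r. f (sc i r y)) has_vector_derivative 0) (at r within {0..1})" if "y $ 1 = c" "i = 2 | i = 3" for i y r
  using has_vector_derivative_at_within[OF line_derivative[OF f, of i y r]] z[of "sc i r y"] that by auto
 from interval_constant[OF this] have "f y = f (sc i 0 y)" if "y $ 1 = c" "i = 2 | i = 3" for i y using that by simp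
 from this[of "vector [c, s, t]" 3] this[of "vector [c, s, 0]" 2]
 have "f (vector [c, s, t]) = f (sc 3 0 (vector [c, s, t]))" "f (vector [c, s, 0]) = f (sc 2 0 (vector [c, s, 0]))" by simp_all
 moreover have "sc 3 0 (vector [c, s, t]) = vector [c, s, 0]" "sc 2 0 (vector [c, s, 0]) = vector [c, 0, 0]"
  by (simp_all add: vec_eq_iff forall_3)
 ultimately show ?thesis by simp
qed

lemma pdm_theta:
 assumes "!!t. (\<phi> has_real_derivative \<phi>' t) (at t)"
 shows "pdm (%y. \<phi> (y $ 1)) j y = (if j = 1 then \<phi>' (y $ 1) else 0)"
proof -
 have "((%y. \<phi> (y $ 1)) has_derivative (%v. \<phi>' (y $ 1) * v $ 1)) (at y)"
  using has_derivative_compose[OF bounded_linear_imp_has_derivative[OF bounded_linear_vec_nth] assms[of "y $ 1", unfolded has_field_derivative_def]] by simp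
 from pdm_eqI[OF this] show ?thesis by (simp add: axis_def)
qed

lemma shift_derivative:
 assumes "smooth f"
 shows "smooth (%y. f (y + c))" "pdm (%y. f (y + c)) j y = pdm f j (y + c)"
proof -
 show "smooth (%y. f (y + c))"
  by (rule smooth_compose[OF smooth_add[OF smooth_id[OF bounded_linear_ident] smooth_const] assms]) simp
 have "((%y. y + c) has_derivative (%v. v)) (at y)" by (auto intro!: derivative_eq_intros)
 from pdm_eqI[OF has_derivative_compose[OF this smooth_derivative[OF assms]]]
 show "pdm (%y. f (y + c)) j y = pdm f j (y + c)" by (simp add: pdm_def)
qed

context harmonic_torus
begin

lemma maurer_cartan: "pd2 (al 2) 1 x - pd2 (al 1) 2 x + (al 1 x ** al 2 x - al 2 x ** al 1 x) = 0"
proof -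
 have c: "ct (pd2 g k x) = - (al k x ** ct (g x))" for k
 proof -
  have "ct (pd2 g k x) ** g x = - al k x"
   using su2_conj[OF al_su2[of k x]] by (simp add: al_def conj_transpose_mult)
  hence "ct (pd2 g k x) ** (g x ** ct (g x)) = - al k x ** ct (g x)"
   by (simp add: matrix_mul_assoc)
  thus ?thesis by (simp add: conj_transpose_SU2[OF g_SU2] mat_minus)
 qed
 have "pd2 (al j) k x = ct (g x) ** pd2 (pd2 g j) k x - al k x ** al j x" for j k
 proof -
  have "pd2 (al j) k x = ct (g x) ** pd2 (pd2 g j) k x + ct (pd2 g k x) ** pd2 g j x"
   unfolding al_def[abs_def]
   by (rule frechet_eqI[OF has_derivative_mat[OF bounded_linear.has_derivative[OF bounded_linear_conj_transpose smooth_derivative[OF g_smooth]]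
      smooth_derivative[OF smooth_frechet[OF g_smooth]]]])
  thus ?thesis unfolding c by (simp add: al_def mat_minus matrix_mul_assoc)
 qed
 thus ?thesis using pd2_commute[OF g_smooth, where i = 1 and j = 2 and x = x] by simp
qed

text \<open>The components of A(e^(i theta)) in real form, with theta as the first coordinate: the
  factors 1 - zeta and 1 - 1/zeta combine to 1 - cos theta on the form and to - sin theta on its
  Hodge star.\<close>

definition AA :: "2 => real^3 => complex^2^2" where
 "AA j y = ((1 - cos (y $ 1)) / 2) *\<^sub>R al j (P2 y) - (sin (y $ 1) / 2) *\<^sub>R be j (P2 y)"

lemma smooth_trig: "smooth (%y::real^3. (1 - cos (y $ 1)) / 2)" "smooth (%y::real^3. sin (y $ 1) / 2)"
proof -
 have "smooth (%y::real^3. (1/2) * (1 - cos (y $ 1)))" "smooth (%y::real^3. (1/2) * sin (y $ 1))"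
  by (intro smooth_mult smooth_diff smooth_const smooth_cos smooth_sin smooth_id bounded_linear_vec_nth)+
 thus "smooth (%y::real^3. (1 - cos (y $ 1)) / 2)" "smooth (%y::real^3. sin (y $ 1) / 2)" by simp_all
qed

lemma AA_smooth: "smooth (AA j)"
 unfolding AA_def[abs_def] by (intro smooth_diff smooth_scaleR smooth_trig smooth_P2 al_smooth be_smooth)

lemma AA_su2: "AA j y : su2"
 unfolding AA_def by (intro su2_linear al_su2 be_su2)

lemma pdm_AA:
 "pdm (AA j) 1 y = (sin (y $ 1) / 2) *\<^sub>R al j (P2 y) - (cos (y $ 1) / 2) *\<^sub>R be j (P2 y)"
 "pdm (AA j) 2 y = ((1 - cos (y $ 1)) / 2) *\<^sub>R pd2 (al j) 1 (P2 y) - (sin (y $ 1) / 2) *\<^sub>R pd2 (be j) 1 (P2 y)"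
 "pdm (AA j) 3 y = ((1 - cos (y $ 1)) / 2) *\<^sub>R pd2 (al j) 2 (P2 y) - (sin (y $ 1) / 2) *\<^sub>R pd2 (be j) 2 (P2 y)"
proof -
 have d: "((%t. (1 - cos t) / 2) has_real_derivative sin t / 2) (at t)" "((%t. sin t / 2) has_real_derivative cos t / 2) (at t)" for t :: real
  by (auto intro!: derivative_eq_intros)
 have e: "pdm (AA j) k y = (((1 - cos (y $ 1)) / 2) *\<^sub>R pdm (%y. al j (P2 y)) k y + (if k = 1 then sin (y $ 1) / 2 else 0) *\<^sub>R al j (P2 y))
   - ((sin (y $ 1) / 2) *\<^sub>R pdm (%y. be j (P2 y)) k y + (if k = 1 then cos (y $ 1) / 2 else 0) *\<^sub>R be j (P2 y))" for k
  unfolding AA_def[abs_def]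
  by (subst pdm_diff, intro smooth_scaleR smooth_trig smooth_P2 al_smooth, intro smooth_scaleR smooth_trig smooth_P2 be_smooth)
   (simp only: pdm_scaleR[OF smooth_trig(1) smooth_P2[OF al_smooth]] pdm_scaleR[OF smooth_trig(2) smooth_P2[OF be_smooth]]
    pdm_theta[OF d(1)] pdm_theta[OF d(2)])
 show "pdm (AA j) 1 y = (sin (y $ 1) / 2) *\<^sub>R al j (P2 y) - (cos (y $ 1) / 2) *\<^sub>R be j (P2 y)"
  "pdm (AA j) 2 y = ((1 - cos (y $ 1)) / 2) *\<^sub>R pd2 (al j) 1 (P2 y) - (sin (y $ 1) / 2) *\<^sub>R pd2 (be j) 1 (P2 y)"
  "pdm (AA j) 3 y = ((1 - cos (y $ 1)) / 2) *\<^sub>R pd2 (al j) 2 (P2 y) - (sin (y $ 1) / 2) *\<^sub>R pd2 (be j) 2 (P2 y)"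
  unfolding e by (simp_all add: pdm_P2[OF al_smooth] pdm_P2[OF be_smooth])
qed

text \<open>With c = (1 - cos theta)/2 and s = (sin theta)/2 one has c^2 + s^2 = c. The rotation has
  trace 0 and determinant 1, so the mixed brackets cancel and the star leaves the bracket of the
  form unchanged; harmonicity removes the derivatives of \<open>be\<close>.\<close>

lemma AA_flat: "pdm (AA 2) 2 y - pdm (AA 1) 3 y + (AA 1 y ** AA 2 y - AA 2 y ** AA 1 y) = 0"
proof -
 define c where "c = (1 - cos (y $ 1)) / 2"
 define s where "s = sin (y $ 1) / 2"
 define a1 a2 where "a1 = al 1 (P2 y)" and "a2 = al 2 (P2 y)"
 define K where "K = a1 ** a2 - a2 ** a1"
 have cs: "c * c + s * s = c"
 proof -
  have "4 * (c * c + s * s) = 1 - 2 * cos (y $ 1) + ((cos (y $ 1))\<^sup>2 + (sin (y $ 1))\<^sup>2)"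
   by (simp add: c_def s_def power2_eq_square field_simps)
  also have "... = 2 - 2 * cos (y $ 1)" by (simp only: sin_cos_squared_add2)
  finally show ?thesis by (simp add: c_def)
 qed
 define p q r where "p = rt (P2 y) 1 1" and "q = rt (P2 y) 1 2" and "r = rt (P2 y) 2 1"
 have be: "be 1 (P2 y) = p *\<^sub>R a1 + r *\<^sub>R a2" "be 2 (P2 y) = q *\<^sub>R a1 - p *\<^sub>R a2"
  by (simp_all add: be_def a1_def a2_def rt(4) p_def q_def r_def)
 have d: "- p * p - q * r = 1" using rt_det[of "P2 y"] unfolding rt(4) by (simp add: p_def q_def r_def)
 have AA12: "AA 1 y = (c - s * p) *\<^sub>R a1 - (s * r) *\<^sub>R a2" "AA 2 y = (c + s * p) *\<^sub>R a2 - (s * q) *\<^sub>R a1"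
  unfolding AA_def c_def[symmetric] s_def[symmetric] be a1_def[symmetric] a2_def[symmetric] by (simp_all add: algebra_simps)
 have "AA 1 y ** AA 2 y - AA 2 y ** AA 1 y = ((c - s * p) * (c + s * p) - s * r * (s * q)) *\<^sub>R K"
  unfolding AA12 K_def by (simp add: mat_algebra algebra_simps)
 also have "(c - s * p) * (c + s * p) - s * r * (s * q) = c * c + s * s * (- p * p - q * r)" by (simp add: algebra_simps)
 finally have "AA 1 y ** AA 2 y - AA 2 y ** AA 1 y = c *\<^sub>R K" unfolding d using cs by simp
 moreover have "pdm (AA 2) 2 y - pdm (AA 1) 3 y = c *\<^sub>R (pd2 (al 2) 1 (P2 y) - pd2 (al 1) 2 (P2 y))"
  unfolding pdm_AA harmonic_equation c_def by (simp add: algebra_simps)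
 moreover have "pd2 (al 2) 1 (P2 y) - pd2 (al 1) 2 (P2 y) = - K"
  using maurer_cartan[of "P2 y"] unfolding K_def a1_def a2_def by (simp add: add_eq_0_iff2 algebra_simps)
 ultimately show ?thesis by simp
qed

lemma assoc_family_AA: "assoc_family h g (cis (y $ 1)) (P2 y) (axis j 1) = AA j y"
proof -
 let ?x = "P2 y" and ?t = "y $ 1"
 have "mc_pullback g ?x (rotation (h ?x) *v axis j 1) = be j ?x"
 proof -
  have "rotation (h ?x) *v axis j 1 = rt ?x 1 j *\<^sub>R axis 1 1 + rt ?x 2 j *\<^sub>R axis 2 1"
   using exhaust_2[of j] by (auto simp: vec_eq_iff forall_2 matrix_vector_mult_def sum_2 axis_def)
  hence "mc_pullback g ?x (rotation (h ?x) *v axis j 1) = ct (g ?x) ** (rt ?x 1 j *\<^sub>R pd2 g 1 ?x + rt ?x 2 j *\<^sub>R pd2 g 2 ?x)"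
   using has_derivative_linear[OF smooth_derivative[OF g_smooth, of ?x]]
   by (simp add: mc_SU2 g_SU2 linear_add linear_scale)
  thus ?thesis by (simp add: be_def al_def mat_algebra)
 qed
 moreover have m: "mat z ** X = (\<chi> i j. z * X $ i $ j)" for z and X :: "complex^2^2"
  by (simp add: vec2_eq_iff mat2_mult_nth mat2_nth)
 ultimately have "assoc_family h g (cis ?t) ?x (axis j 1) = (\<chi> i k. 1/2 * (1 - cis ?t) * (1/2 * (al j ?x $ i $ k - \<i> * be j ?x $ i $ k))
   + 1/2 * (1 - inverse (cis ?t)) * (1/2 * (al j ?x $ i $ k + \<i> * be j ?x $ i $ k)))"
  by (simp add: assoc_family_def alpha10_def alpha01_def hodge_star_def al_mc vec_eq_iff)
 also have "... = AA j y"
 proof -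
  have "1/2 * (1 - Complex p q) * (1/2 * (Complex a b - \<i> * Complex c d)) + 1/2 * (1 - Complex p (- q)) * (1/2 * (Complex a b + \<i> * Complex c d))
   = ((1 - p) / 2) *\<^sub>R Complex a b - (q / 2) *\<^sub>R (- Complex c d * (- 1))" for p q a b c d
   by (simp add: complex_eq_iff field_simps)
  from this[of "cos ?t" "sin ?t" "Re (al j ?x $ i $ k)" "Im (al j ?x $ i $ k)" "Re (be j ?x $ i $ k)" "Im (be j ?x $ i $ k)" for i k]
  moreover have "inverse (cis ?t) = Complex (cos ?t) (- sin ?t)" by (simp add: cis_inverse complex_eq_iff)
  moreover have "cis ?t = Complex (cos ?t) (sin ?t)" by (simp add: complex_eq_iff)
  ultimately show ?thesis by (simp add: AA_def vec_eq_iff)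
 qed
 finally show ?thesis .
qed

lemma AA_periodic:
 assumes "k ~= 1" shows "AA j (y + shift k) = AA j y"
proof -
 have "(y + shift k) $ 1 = y $ 1" using assms by (simp add: axis_def)
 moreover have "P2 (y + shift k) = P2 y + (2 * pi) *\<^sub>R axis (if k = 2 then 1 else 2) 1"
  using assms exhaust_3[of k] by (auto simp: vec_eq_iff forall_2 axis_def)
 ultimately show ?thesis using al_periodic[of j] be_periodic[of j] unfolding AA_def by (simp add: periodic_def)
qed

text \<open>As the connection is periodic, translating a parallel frame by a period changes it by a
  factor depending on theta only, the holonomy. At theta = 0 the connection vanishes and F = 1; at
  theta = pi it is g^-1 dg, so g F is constant.\<close>

theorem frame:
 obtains F where "smooth F" "!!y. F y : SU2" "!!t. F (vector [t, 0, 0]) = mat 1"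
  "!!y. pdm F 2 y = - (AA 1 y ** F y)" "!!y. pdm F 3 y = - (AA 2 y ** F y)"
  "!!y. F (y + shift 2) = F y ** F (vector [y $ 1, 2 * pi, 0])"
  "!!y. F (y + shift 3) = F y ** F (vector [y $ 1, 0, 2 * pi])"
  "!!s t. F (vector [0, s, t]) = mat 1" "!!s t. g (vector [s, t]) ** F (vector [pi, s, t]) = g 0"
  "!!t H. is_holonomy (assoc_family h g (cis t)) 1 H ==> H = F (vector [t, 2 * pi, 0])"
  "!!t H. is_holonomy (assoc_family h g (cis t)) 2 H ==> H = F (vector [t, 0, 2 * pi])"
proof (rule flat_frame[OF AA_smooth AA_smooth AA_su2 AA_su2 AA_flat])
 fix F assume F: "smooth F" "!!y. F y : SU2" "!!y. y $ 2 = 0 ==> y $ 3 = 0 ==> F y = mat 1"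
  "!!y. pdm F 2 y = - (AA 1 y ** F y)" "!!y. pdm F 3 y = - (AA 2 y ** F y)"
 have F1: "F (vector [t, 0, 0]) = mat 1" for t by (rule F(3)) simp_all
 have ct: "ct (AA j y ** X) = - (ct X ** AA j y)" for j y X
  by (simp add: conj_transpose_mult su2_conj[OF AA_su2] mat_minus)
 have per: "F (y + shift k) = F y ** F (y $ 1 *\<^sub>R axis 1 1 + shift k)" if k: "k ~= 1" for y k
 proof -
  let ?c = "shift k :: real^3"
  let ?D = "%y. ct (F y) ** F (y + ?c)"
  have "pdm ?D 2 y = 0" "pdm ?D 3 y = 0" for y
   by (simp_all add: AA_periodic[OF k] pdm_mat pdm_conj smooth_conj F(1) shift_derivative[OF F(1)] F(4,5) ct mat_minus matrix_mul_assoc)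
  from slice_constant[OF smooth_mat[OF smooth_conj[OF F(1)] shift_derivative(1)[OF F(1)]] this, of "y $ 1" "y $ 2" "y $ 3"]
  have "?D (vector [y $ 1, y $ 2, y $ 3]) = ?D (vector [y $ 1, 0, 0])" .
  moreover have "vector [y $ 1, y $ 2, y $ 3] = y" by (simp add: vec_eq_iff forall_3)
  ultimately have "?D y = F (y $ 1 *\<^sub>R axis 1 1 + ?c)" using F1[of "y $ 1"] by (simp add: vector_3_eq)
  hence "F y ** ?D y = F y ** F (y $ 1 *\<^sub>R axis 1 1 + ?c)" by simp
  thus ?thesis by (simp add: matrix_mul_assoc conj_transpose_SU2[OF F(2)])
 qed
 \<comment> \<open>Along the coordinate circle the transport and the frame solve the same equation
   with the same initial value.\<close>
 have hol: "H = F (t *\<^sub>R axis 1 1 + shift k)"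
  if H: "is_holonomy (assoc_family h g (cis t)) j H" and k: "k = (if j = 1 then 2 else 3)" for j t H and k :: 3
 proof -
  obtain \<Phi> where \<Phi>: "\<Phi> 0 = mat 1" "\<Phi> (2 * pi) = H"
   "!!s. s : {0..2 * pi} ==> (\<Phi> has_vector_derivative (- (assoc_family h g (cis t) (s *\<^sub>R axis j 1) (axis j 1) ** \<Phi> s))) (at s within {0..2 * pi})"
   using H unfolding is_holonomy_def by blast
  define y :: "real => real^3" where "y s = t *\<^sub>R axis 1 1 + s *\<^sub>R axis k 1" for s
  have y: "y s $ 1 = t" "P2 (y s) = s *\<^sub>R axis j 1" for s
   using exhaust_2[of j] k by (auto simp: y_def axis_def vec_eq_iff forall_2)
  have "pdm F k z = - (AA j z ** F z)" for z using exhaust_2[of j] k F(4,5) by auto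
  hence d: "((%s. F (y s)) has_vector_derivative - (AA j (y s) ** F (y s))) (at s)" for s
   unfolding y_def using directional_derivative[OF smooth_derivative[OF F(1)], where x = "t *\<^sub>R axis 1 1" and t = s and v = "axis k 1"] by (simp add: pdm_def)
  have A: "assoc_family h g (cis t) (s *\<^sub>R axis j 1) (axis j 1) = AA j (y s)" for s
   using assoc_family_AA[of "y s" j] unfolding y .
  have "((%s. ct (F (y s)) ** \<Phi> s) has_vector_derivative 0) (at s within {0..2 * pi})" if "s : {0..2 * pi}" for s
   using has_vector_derivative_mat[OF bounded_linear.has_vector_derivative[OF bounded_linear_conj_transpose has_vector_derivative_at_within[OF d]] \<Phi>(3)[OF that]]
   by (simp add: A ct mat_minus matrix_mul_assoc)
  then obtain C where C: "!!s. s : {0..2 * pi} ==> ct (F (y s)) ** \<Phi> s = C"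
   using has_vector_derivative_zero_constant[of "{0..2 * pi}"] convex_closed_interval by (metis (no_types, lifting) convex_real_interval(5))
  have "F (y 0) = mat 1" using k exhaust_2[of j] by (intro F(3)) (auto simp: y_def axis_def)
  hence "C = mat 1" using C[of 0] \<Phi>(1) by simp
  hence "F (y (2 * pi)) ** (ct (F (y (2 * pi))) ** H) = F (y (2 * pi))"
   using C[of "2 * pi"] \<Phi>(2) by simp
  thus ?thesis by (simp add: matrix_mul_assoc conj_transpose_SU2[OF F(2)] y_def)
 qed
 have zero: "F (vector [0, s, t]) = mat 1" for s t
  using slice_constant[OF F(1), of 0 s t] F1[of 0] by (simp add: F(4,5) AA_def mat_algebra)
 have gF: "g (vector [s, t]) ** F (vector [pi, s, t]) = g 0" for s t
 proof -
  have gs: "smooth (%y. g (P2 y))" by (rule smooth_P2[OF g_smooth])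
  have ga: "pd2 g j x = g x ** al j x" for j x
   by (simp add: al_def matrix_mul_assoc conj_transpose_SU2[OF g_SU2])
  have "pdm (%y. g (P2 y) ** F y) 2 z = 0" "pdm (%y. g (P2 y) ** F y) 3 z = 0" if "z $ 1 = pi" for z
   by (simp_all add: pdm_mat gs F(1) F(4,5) pdm_P2[OF g_smooth] AA_def that ga mat_minus matrix_mul_assoc)
  from slice_constant[where c = pi and s = s and t = t, OF smooth_mat[OF gs F(1)] this]
  have "g (vector [s, t]) ** F (vector [pi, s, t]) = g (vector [0, 0]) ** F (vector [pi, 0, 0])" by (simp add: P2_def)
  moreover have "(vector [0, 0] :: real^2) = 0" by (simp add: vec_eq_iff forall_2)
  ultimately show ?thesis by (simp add: F1)
 qed
 show ?thesis
 proof (rule that[OF F(1,2) F1 F(4,5) _ _ zero gF])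
  show "F (y + shift 2) = F y ** F (vector [y $ 1, 2 * pi, 0])"
   "F (y + shift 3) = F y ** F (vector [y $ 1, 0, 2 * pi])" for y
   using per[of 2 y] per[of 3 y] by (simp_all add: vector_3_eq)
  show "H = F (vector [t, 2 * pi, 0])" if "is_holonomy (assoc_family h g (cis t)) 1 H" for t H
   using hol[OF that] by (simp add: vector_3_eq)
  show "H = F (vector [t, 0, 2 * pi])" if "is_holonomy (assoc_family h g (cis t)) 2 H" for t H
   using hol[OF that] by (simp add: vector_3_eq)
 qed
qed

end

section \<open>The eigenline bundle over the unit circle\<close>

abbreviation dd :: "(real => 'b::real_normed_vector) => real => 'b" where "dd f t == fd f t 1"

lemma smooth_dd: "smooth f ==> (f has_vector_derivative dd f t) (at t)"
 using directional_derivative[where x = 0 and t = t and v = 1, of f] smooth_derivative[of f t] by simp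

lemma smooth_if_vector_derivative:
 fixes f :: "real => 'b::real_normed_vector"
 assumes "!!t. (L has_vector_derivative f t) (at t)" "smooth f" shows "smooth L"
 unfolding smooth_on_def
proof
 fix k
 have "Ck_on (Suc k) UNIV L"
  by (rule Ck_on_SucI[OF open_UNIV, where f' = "%t v. v *\<^sub>R f t"])
   (use assms in \<open>auto simp: has_vector_derivative_def intro: Ck_on_scaleR smooth_on_Ck\<close>)
 thus "Ck_on k UNIV L" by (rule Ck_on_Suc_imp)
qed

lemma smooth_antiderivative:
 fixes f :: "real => 'b::banach"
 assumes "smooth f"
 shows "EX L. smooth L & L 0 = 0 & (ALL t. (L has_vector_derivative f t) (at t))"
proof -
 let ?L = "%s. s *\<^sub>R integral {0..1} (%r. f (s * r))"
 have d: "(?L has_vector_derivative f t) (at t)" for t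
  by (rule integral_scale[OF Ck_on_continuous[OF smooth_on_Ck[OF assms]]])
 show ?thesis using d smooth_if_vector_derivative[OF d assms] by (intro exI[of _ ?L]) simp
qed

lemma real_constant:
 fixes f :: "real => 'b::real_normed_vector"
 assumes "!!t. (f has_vector_derivative 0) (at t)" shows "f t = f 0"
proof -
 obtain c where "!!x. x : UNIV ==> f x = c"
  using has_vector_derivative_zero_constant[of UNIV f] assms by auto
 thus ?thesis by simp
qed

lemma holomorphic_Ck: "open S ==> f holomorphic_on S ==> Ck_on k S f"
proof (induction k arbitrary: f)
 case 0
 thus ?case by (simp add: holomorphic_on_imp_continuous_on)
next
 case (Suc k)
 show ?case
  by (rule Ck_on_field_derivI[OF Suc.prems(1) holomorphic_derivI[OF Suc.prems(2,1)] Suc.IH[OF Suc.prems(1) holomorphic_deriv[OF Suc.prems(2,1)]]])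
qed

lemma holomorphic_cis_smooth: assumes "f holomorphic_on - {0}" shows "smooth (%t. f (cis t))"
proof -
 have "smooth (%t. complex_of_real (cos t) + \<i> * complex_of_real (sin t))"
  by (intro smooth_add smooth_linear[OF bounded_linear_of_real] smooth_linear[OF bounded_linear_mult_right] smooth_cos smooth_sin
    smooth_id[OF bounded_linear_ident])
 moreover have "(%t. complex_of_real (cos t) + \<i> * complex_of_real (sin t)) = cis" by (auto simp: complex_eq_iff)
 ultimately have "smooth cis" by simp
 thus ?thesis
  by (rule smooth_compose) (use holomorphic_Ck[OF _ assms] in \<open>auto simp: smooth_on_def\<close>)
qed

lemma smooth_inverse:
 assumes "smooth f" "!!t. f t ~= 0" shows "smooth (%t. inverse (f t) :: complex)"
proof (rule smooth_compose[OF assms(1), of "- {0}"])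
 have "inverse holomorphic_on - {0::complex}" by (intro holomorphic_intros) auto
 thus "smooth_on (- {0}) (inverse :: complex => complex)" using holomorphic_Ck[of "- {0}"] by (auto simp: smooth_on_def)
qed (use assms(2) in auto)

lemma smooth_cmult: "smooth f ==> smooth g ==> smooth (%t. f t * g t :: complex)"
 unfolding smooth_on_def by (auto intro: Ck_on_mult)

text \<open>The exponential of half an antiderivative of p'/p, which exists on the whole line as p
  has no zeros.\<close>

lemma smooth_sqrt:
 fixes p :: "real => complex"
 assumes p: "smooth p" "!!t. p t ~= 0" "e0\<^sup>2 = p 0"
 obtains e where "smooth e" "e 0 = e0" "!!t. (e t)\<^sup>2 = p t"
proof -
 obtain L where L: "smooth L" "L 0 = 0" "!!t. (L has_vector_derivative (dd p t * inverse (p t))) (at t)"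
  using smooth_antiderivative[OF smooth_cmult[OF smooth_frechet[OF p(1), of 1] smooth_inverse[OF p(1,2)]]] by blast
 have ed: "((%t. exp (c * L t)) has_vector_derivative (c * (dd p t * inverse (p t)) * exp (c * L t))) (at t)" for c t
  using field_vector_diff_chain_at[OF bounded_linear.has_vector_derivative[OF bounded_linear_mult_right L(3)] DERIV_exp, of c t]
  by (simp add: comp_def)
 have "((%t. p t * exp (- 1 * L t)) has_vector_derivative 0) (at t)" for t
 proof -
  have "p t * (- 1 * (dd p t * inverse (p t)) * exp (- 1 * L t)) + dd p t * exp (- 1 * L t) = 0"
   using p(2)[of t] by (simp add: field_simps)
  with has_vector_derivative_mult[OF smooth_dd[OF p(1)] ed[of "-1"], of t] show ?thesis by (simp only:)
 qed
 from real_constant[OF this] have "p t * exp (- L t) = p 0" for t using L(2) by simp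
 hence pe: "p t = p 0 * exp (L t)" for t by (metis exp_minus_inverse mult.assoc mult.commute mult.right_neutral)
 show thesis
 proof
  let ?e = "%t. e0 * exp ((1/2) * L t)"
  have "smooth (exp :: complex => complex)" by (simp add: smooth_on_def Ck_on_exp)
  hence "smooth (%t. exp ((1/2) * L t))"
   by (rule smooth_compose[OF smooth_linear[OF bounded_linear_mult_right L(1)]]) simp
  thus "smooth ?e" by (rule smooth_linear[OF bounded_linear_mult_right])
  show "?e 0 = e0" using L(2) by simp
  have "(exp ((1/2) * L t))\<^sup>2 = exp (L t)" for t using exp_double[of "(1/2) * L t"] by simp
  thus "(?e t)\<^sup>2 = p t" for t by (simp add: power_mult_distrib p(3) pe[of t])
 qed
qed

text \<open>The angle is the antiderivative of w s' - s w'; this stays smooth where arccos would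
  not.\<close>

lemma smooth_angle:
 fixes w s :: "real => real"
 assumes ws: "smooth w" "smooth s" "!!t. w t * w t + s t * s t = 1" "w 0 = 1"
 obtains L where "smooth L" "L 0 = 0" "!!t. w t = cos (L t)" "!!t. s t = sin (L t)"
proof -
 let ?d = "%t. w t * dd s t - s t * dd w t"
 have "smooth ?d" by (intro smooth_diff smooth_mult ws smooth_frechet)
 from smooth_antiderivative[OF this]
 obtain L where L: "smooth L" "L 0 = 0" "!!t. (L has_vector_derivative ?d t) (at t)" by blast
 note D = smooth_dd[OF ws(1), folded has_real_derivative_iff_has_vector_derivative] smooth_dd[OF ws(2), folded has_real_derivative_iff_has_vector_derivative]
  L(3)[folded has_real_derivative_iff_has_vector_derivative]
 have z: "w t * dd w t + s t * dd s t = 0" for t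
 proof -
  have "((%t. w t * w t + s t * s t) has_real_derivative 2 * (w t * dd w t + s t * dd s t)) (at t)"
   using D by (auto intro!: derivative_eq_intros simp: algebra_simps)
  hence "((%t::real. 1::real) has_real_derivative 2 * (w t * dd w t + s t * dd s t)) (at t)" by (simp only: ws(3))
  from DERIV_unique[OF this DERIV_const] show ?thesis by simp
 qed
 have k: "dd w t + s t * ?d t = 0" "dd s t - w t * ?d t = 0" for t
 proof -
  have "dd w t + s t * ?d t = (1 - (w t * w t + s t * s t)) * dd w t + w t * (w t * dd w t + s t * dd s t)" by (simp add: algebra_simps)
  thus "dd w t + s t * ?d t = 0" unfolding z ws(3) by simp
  have "dd s t - w t * ?d t = (1 - (w t * w t + s t * s t)) * dd s t + s t * (w t * dd w t + s t * dd s t)" by (simp add: algebra_simps)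
  thus "dd s t - w t * ?d t = 0" unfolding z ws(3) by simp
 qed
 have "((%t. w t * cos (L t) + s t * sin (L t)) has_real_derivative (dd w t + s t * ?d t) * cos (L t) + (dd s t - w t * ?d t) * sin (L t)) (at t)"
  "((%t. s t * cos (L t) - w t * sin (L t)) has_real_derivative (dd s t - w t * ?d t) * cos (L t) - (dd w t + s t * ?d t) * sin (L t)) (at t)" for t
  using D by (auto intro!: derivative_eq_intros simp: algebra_simps)
 hence "((%t. w t * cos (L t) + s t * sin (L t)) has_vector_derivative 0) (at t)" "((%t. s t * cos (L t) - w t * sin (L t)) has_vector_derivative 0) (at t)" for t
  unfolding k has_real_derivative_iff_has_vector_derivative by simp_all
 from real_constant[OF this(1)] real_constant[OF this(2)]
 have AB: "w t * cos (L t) + s t * sin (L t) = 1" "s t * cos (L t) - w t * sin (L t) = 0" for t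
  using ws(4) ws(3)[of 0] L(2) by simp_all
 have "cos (L t) = w t" "sin (L t) = s t" for t
 proof -
  have "(w t * cos (L t) + s t * sin (L t)) * w t - (s t * cos (L t) - w t * sin (L t)) * (- s t) = (w t * w t + s t * s t) * cos (L t)"
   by (simp add: algebra_simps)
  thus "cos (L t) = w t" unfolding AB ws(3) by simp
  have "(w t * cos (L t) + s t * sin (L t)) * s t - (s t * cos (L t) - w t * sin (L t)) * w t = (w t * w t + s t * s t) * sin (L t)"
   by (simp add: algebra_simps)
  thus "sin (L t) = s t" unfolding AB ws(3) by simp
 qed
 thus ?thesis using that L(1,2) by metis
qed

text \<open>The difference of two logarithms takes values in the discrete set of multiples of 2 pi
  i.\<close>

lemma continuous_log_unique:
 assumes ab: "continuous_on {0..pi} a" "continuous_on {0..pi} b" "!!t. t : {0..pi} ==> exp (a t) = exp (b t :: complex)" "a 0 = b 0"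
  and t: "t : {0..pi}"
 shows "a t = b t"
proof -
 have "(%t. a t - b t) constant_on {0..pi}"
 proof (rule continuous_discrete_range_constant)
  show "EX e>0. ALL y. y : {0..pi} & a y - b y ~= a x - b x --> e <= norm (a y - b y - (a x - b x))" if x: "x : {0..pi}" for x
  proof (intro exI[of _ "2 * pi"] conjI allI impI)
   fix y assume y: "y : {0..pi} & a y - b y ~= a x - b x"
   have "exp (a y - b y - (a x - b x)) = 1" using ab(3)[of y] ab(3)[OF x] y by (simp add: exp_diff)
   then obtain k :: int where k: "Re (a y - b y - (a x - b x)) = 0" "Im (a y - b y - (a x - b x)) = of_int (2 * k) * pi"
    unfolding exp_eq_1 by auto
   hence "k ~= 0" using y by (auto simp: complex_eq_iff)
   hence "1 <= \<bar>real_of_int k\<bar>" by linarith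
   hence "2 * pi * 1 <= 2 * pi * \<bar>real_of_int k\<bar>" by (intro mult_left_mono) auto
   also have "... = \<bar>Im (a y - b y - (a x - b x))\<bar>" unfolding k(2) by (simp add: abs_mult)
   also have "... <= norm (a y - b y - (a x - b x))" by (rule abs_Im_le_cmod)
   finally show "2 * pi <= norm (a y - b y - (a x - b x))" by simp
  qed simp
 qed (auto intro!: continuous_on_diff ab)
 then obtain c where c: "!!t. t : {0..pi} ==> a t - b t = c" by (auto simp: constant_on_def)
 from c[of 0] ab(4) have "c = 0" by simp
 thus ?thesis using c[OF t] by simp
qed

text \<open>The centralizer of a unit imaginary quaternion is the plane spanned by it and 1.\<close>

lemma quat_commute:
 assumes K: "K : quats" and n: "n : su2" "ip n n = 1" and c: "K ** n = n ** K"
 shows "K = qw K *\<^sub>R mat 1 + ip K n *\<^sub>R n"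
proof -
 obtain w a b d where K: "K = quat w a b d" using quats_eq[OF K] by blast
 obtain x y z where n': "n = quat 0 x y z" using su2_eq[OF n(1)] by blast
 have u: "x * x + y * y + z * z = 1" using n(2) unfolding n' ip_def quat_mult by simp
 have "qx (K ** n) = qx (n ** K)" "qy (K ** n) = qy (n ** K)" "qz (K ** n) = qz (n ** K)" unfolding c by simp_all
 hence p: "b * z = d * y" "d * x = a * z" "a * y = b * x" unfolding K n' quat_mult by (simp_all add: algebra_simps)
 have "a = a * (x * x + y * y + z * z)" "b = b * (x * x + y * y + z * z)" "d = d * (x * x + y * y + z * z)" by (simp_all add: u)
 hence m: "(a * x + b * y + d * z) * x = a" "(a * x + b * y + d * z) * y = b" "(a * x + b * y + d * z) * z = d"
  using p by algebra+
 have i: "ip K n = a * x + b * y + d * z" unfolding K n' ip_def quat_mult by simp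
 show ?thesis unfolding i unfolding K n' by (simp add: quat_def vec2_eq_iff mat2_nth complex_eq_iff m qw_def)
qed

text \<open>Commuting with K means commuting with its imaginary part X, which is not 0; the
  trace-free matrices commuting with X form its complex line.\<close>

lemma commuting_traceless:
 fixes q :: "complex^2^2"
 assumes K: "K : SU2" "K ~= mat 1" "K ~= - mat 1" and q: "q $ 1 $ 1 + q $ 2 $ 2 = 0" "q ** K = K ** q"
 shows "EX c. EX X:su2. ALL i j. q $ i $ j = c * X $ i $ j"
proof -
 define X where "X = quat 0 (qx K) (qy K) (qz K)"
 have Kq: "K = quat (qw K) (qx K) (qy K) (qz K)" by (rule quats_eq[OF SU2_quats[OF K(1)]])
 have KX: "K = qw K *\<^sub>R mat 1 + X"
  by (subst Kq) (simp add: X_def quat_def vec2_eq_iff mat2_nth complex_eq_iff)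
 have "qx K ~= 0 | qy K ~= 0 | qz K ~= 0"
 proof (rule ccontr)
  assume "~ ?thesis"
  hence z: "qx K = 0" "qy K = 0" "qz K = 0" by auto
  hence "(qw K)\<^sup>2 = 1" using K(1) by (simp add: SU2_iff)
  hence "qw K = 1 | qw K = -1" by (simp add: power2_eq_1_iff)
  thus False using K(2,3) Kq z by (auto simp: quat_def vec2_eq_iff mat2_nth complex_eq_iff)
 qed
 hence X0: "X $ 1 $ 1 ~= 0 | X $ 1 $ 2 ~= 0" by (auto simp: X_def quat_def complex_eq_iff)
 have Xe: "X $ 2 $ 2 = - X $ 1 $ 1" "X $ 2 $ 1 = - cnj (X $ 1 $ 2)" by (simp_all add: X_def quat_def complex_eq_iff)
 have qe: "q $ 2 $ 2 = - q $ 1 $ 1" using q(1) by (simp add: add_eq_0_iff)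
 have "q ** (qw K *\<^sub>R mat 1 + X) = (qw K *\<^sub>R mat 1 + X) ** q" unfolding KX[symmetric] by (rule q(2))
 hence "q ** X = X ** q" by (simp add: mat_algebra)
 hence ent: "(q ** X) $ i $ j = (X ** q) $ i $ j" for i j by simp
 note e = ent[of 1 1, unfolded mat2_mult_nth] ent[of 1 2, unfolded mat2_mult_nth Xe(1) qe] ent[of 2 1, unfolded mat2_mult_nth Xe(1) qe]
 have "EX c. a = c * x & b = c * y & d = c * z"
  if "a * x + b * z = x * a + y * d" "a * y + b * - x = x * b + y * - a" "d * x + - a * z = z * a + - x * d" "x ~= 0 | y ~= 0"
  for a b d x y z :: complex
 proof -
  have lin: "A + - B = B + - A ==> A = B" for A B :: complex by (simp add: complex_eq_iff)
  have h1: "b * z = y * d" using that(1) by (simp add: mult.commute[of x a])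
  have h2: "a * y = b * x" by (rule lin) (use that(2) in \<open>simp add: mult.commute[of x b] mult.commute[of y a]\<close>)
  have h3: "d * x = a * z" by (rule lin) (use that(3) in \<open>simp add: mult.commute[of x d] mult.commute[of z a]\<close>)
  show ?thesis
  proof (cases "x = 0")
   case True
   hence "y ~= 0" using that(4) by simp
   hence "a = b / y * x" "b = b / y * y" "d = b / y * z" using True h1 h2 by (simp_all add: eq_divide_eq mult.commute)
   thus ?thesis by blast
  next
   case False
   hence "a = a / x * x" "b = a / x * y" "d = a / x * z" using h2 h3 by (simp_all add: eq_divide_eq mult.commute)
   thus ?thesis by blast
  qed
 qed
 from this[OF e X0] obtain c where "q $ 1 $ 1 = c * X $ 1 $ 1 & q $ 1 $ 2 = c * X $ 1 $ 2 & q $ 2 $ 1 = c * X $ 2 $ 1" by blast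
 hence "q $ i $ j = c * X $ i $ j" for i j using exhaust_2[of i] exhaust_2[of j] Xe(1) qe by auto
 moreover have "X : su2" by (simp add: X_def su2_def)
 ultimately show ?thesis by blast
qed

text \<open>Schwarz reflection in the unit circle: on the circle this holomorphic function is the
  conjugate of \<open>f\<close>.\<close>

lemma reflected_holomorphic:
 assumes "f holomorphic_on - {0}" shows "(%\<zeta>. cnj (f (inverse (cnj \<zeta>)))) holomorphic_on - {0}"
proof -
 have "z : cnj ` (- {0})" if "z ~= 0" for z
  by (rule rev_image_eqI[of "cnj z"]) (use that in auto)
 hence "cnj ` (- {0}) = - {0}" by auto
 hence 1: "cnj o f o cnj holomorphic_on - {0}" using assms by (intro holomorphic_on_compose_cnj_cnj) auto
 have 2: "inverse holomorphic_on - {0::complex}" by (intro holomorphic_intros) auto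
 have "inverse ` (- {0}) <= - {0::complex}" by auto
 from holomorphic_on_compose_gen[OF 2 1 this] have "(cnj o f o cnj) o inverse holomorphic_on - {0}" .
 thus ?thesis by (simp add: comp_def)
qed

lemma inverse_cnj_cis: "inverse (cnj (cis t)) = cis t"
 by (simp add: cis_cnj cis_inverse)

text \<open>The identity theorem on the connected punctured plane: the zeros accumulate at
  \<open>cis t0\<close>.\<close>

lemma vanishing_on_circle:
 assumes f: "f holomorphic_on - {0}" and E: "open E" "t0 : E" "!!t. t : E ==> f (cis t) = 0"
 shows "f (cis t) = 0"
proof -
 have lim: "cis t0 islimpt cis ` E"
  unfolding islimpt_approachable
 proof (intro allI impI)
  fix e :: real assume e: "0 < e"
  have "isCont cis t0" unfolding cis_conv_exp[abs_def] by (intro continuous_intros)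
  then obtain d where d: "0 < d" "!!t. dist t t0 < d ==> dist (cis t) (cis t0) < e"
   using e unfolding continuous_at_eps_delta dist_norm by blast
  obtain d' where d': "0 < d'" "ball t0 d' <= E" using E(1,2) open_contains_ball by blast
  define r where "r = min 1 (min d d') / 2"
  have r: "0 < r" "r < d" "r < d'" "r < 1" using d(1) d'(1) by (auto simp: r_def)
  have "t0 + r : E" using d'(2) r by (auto simp: dist_norm subset_iff)
  moreover have "cis (t0 + r) ~= cis t0"
  proof
   assume "cis (t0 + r) = cis t0"
   hence "cis t0 * cis r = cis t0 * 1" by (simp add: cis_mult)
   hence "cis r = 1" by simp
   hence "sin r = 0" by (simp add: complex_eq_iff)
   thus False using sin_gt_zero[of r] r pi_gt3 by simp
  qed
  moreover have "dist (cis (t0 + r)) (cis t0) < e" using d(2) r by (simp add: dist_norm)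
  ultimately show "EX x':cis ` E. x' ~= cis t0 & dist x' (cis t0) < e" by blast
 qed
 have "connected (- {0::complex})" by (rule connected_punctured_universe) simp
 thus ?thesis
  by (rule analytic_continuation[OF f _ _ _ _ lim, rotated]) (use E(3) in \<open>auto simp: open_Compl\<close>)
qed

text \<open>Where one of the holonomies is not \<open>\<plusminus>1\<close>, its normalized trace-free part shows that
 \<open>Q/\<eta>\<close> is Hermitian. The corresponding identity for \<open>Q \<otimes> Q\<close> is holomorphic and so holds
 on the whole circle; it gives \<open>N\<^sup>* = \<plusminus> N\<close>, and \<open>N\<^sup>* = - N\<close> contradicts \<open>N\<^sup>2 = 1\<close>.\<close>

lemma eigenline_reality:
 fixes Q :: "complex => complex^2^2"
 assumes Q: "!!i j. (%\<zeta>. Q \<zeta> $ i $ j) holomorphic_on - {0}" "!!\<zeta>. \<zeta> ~= 0 ==> Q \<zeta> ** Q \<zeta> = mat (poly P \<zeta>)"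
  and E: "open E" "t0 : E" "!!t. t : E ==> EX c. EX X:su2. ALL i j. Q (cis t) $ i $ j = c * X $ i $ j"
  and e: "e\<^sup>2 = poly P (cis t)" "e ~= 0"
 defines "N == mat (inverse e) ** Q (cis t)"
 shows "ct N = N"
proof -
 let ?p = "%t. poly P (cis t)"
 have "Q (cis t) $ i $ j * Q (cis t) $ k $ l * cnj (?p t) - cnj (Q (cis t) $ j $ i) * cnj (Q (cis t) $ l $ k) * ?p t = 0" for i j k l
 proof -
  \<comment> \<open>On the circle the reflected factors are plain conjugates, so this vanishes
    wherever Q is a complex multiple of an element of su(2). Products of two entries avoid the
    square root of P, which need not be single-valued on the punctured plane.\<close>
  let ?f = "%\<zeta>. Q \<zeta> $ i $ j * Q \<zeta> $ k $ l * cnj (poly P (inverse (cnj \<zeta>)))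
    - cnj (Q (inverse (cnj \<zeta>)) $ j $ i) * cnj (Q (inverse (cnj \<zeta>)) $ l $ k) * poly P \<zeta>"
  have "(%\<zeta>. poly P \<zeta>) holomorphic_on - {0}" by (intro holomorphic_intros)
  hence "?f holomorphic_on - {0}"
   by (intro holomorphic_on_diff holomorphic_on_mult Q(1) reflected_holomorphic)
  moreover have "?f (cis t) = 0" if t: "t : E" for t
  proof -
   obtain c X where X: "X : su2" "!!i j. Q (cis t) $ i $ j = c * X $ i $ j" using E(3)[OF t] by blast
   obtain x y z where xyz: "X = quat 0 x y z" using su2_eq[OF X(1)] by blast
   have "?p t = (Q (cis t) ** Q (cis t)) $ 1 $ 1" using Q(2)[of "cis t"] by (simp add: mat2_nth)
   also have "... = c\<^sup>2 * (X ** X) $ 1 $ 1" by (simp add: mat2_mult_nth X(2) power2_eq_square algebra_simps)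
   also have "(X ** X) $ 1 $ 1 = of_real (- (x * x) - y * y - z * z)"
    unfolding xyz quat_mult by (simp add: quat_def complex_eq_iff)
   finally have p: "?p t = c\<^sup>2 * of_real (- (x * x) - y * y - z * z)" .
   have "ct X $ i $ j = (- X) $ i $ j" for i j using su2_conj[OF X(1)] by simp
   hence "cnj (X $ j $ i) = - X $ i $ j" for i j by (simp add: conj_transpose_def)
   thus ?thesis unfolding inverse_cnj_cis p X(2) by (simp add: power2_eq_square algebra_simps)
  qed
  ultimately have "?f (cis t) = 0" by (rule vanishing_on_circle[OF _ E(1,2)])
  thus ?thesis unfolding inverse_cnj_cis .
 qed
 hence QQ: "Q (cis t) $ i $ j * Q (cis t) $ k $ l * (cnj e)\<^sup>2 = cnj (Q (cis t) $ j $ i) * cnj (Q (cis t) $ l $ k) * e\<^sup>2" for i j k l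
  unfolding e(1) complex_cnj_power[symmetric] by simp
 have Nij: "N $ i $ j = inverse e * Q (cis t) $ i $ j" for i j
  using exhaust_2[of i] by (auto simp: N_def mat2_mult_nth mat2_nth)
 have NN: "N $ i $ j * N $ k $ l = cnj (N $ j $ i) * cnj (N $ l $ k)" for i j k l
 proof -
  have "N $ i $ j * N $ k $ l = (Q (cis t) $ i $ j * Q (cis t) $ k $ l * (cnj e)\<^sup>2) / (e\<^sup>2 * (cnj e)\<^sup>2)"
   using e(2) by (simp add: Nij field_simps power2_eq_square)
  also have "... = cnj (N $ j $ i) * cnj (N $ l $ k)"
   unfolding QQ using e(2) by (simp add: Nij field_simps power2_eq_square)
  finally show ?thesis .
 qed
 have N2: "N ** N = mat 1"
 proof -
  have "N ** N = mat (inverse e * inverse e * e\<^sup>2)"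
  proof -
   have "(N ** N) $ i $ j = inverse e * inverse e * (Q (cis t) ** Q (cis t)) $ i $ j" for i j
    by (simp add: mat2_mult_nth Nij algebra_simps)
   thus ?thesis using Q(2)[of "cis t"] e(1) by (simp add: vec2_eq_iff mat2_nth)
  qed
  thus ?thesis using e(2) by (simp add: power2_eq_square field_simps)
 qed
 have "EX i j. N $ i $ j ~= 0"
 proof (rule ccontr)
  assume "~ ?thesis"
  hence "(N ** N) $ 1 $ 1 = 0" by (simp add: mat2_mult_nth)
  thus False by (simp add: N2 mat2_nth)
 qed
 then obtain i j where ij: "N $ i $ j ~= 0" by blast
 have "N $ i $ j * N $ i $ j = cnj (N $ j $ i) * cnj (N $ j $ i)" by (rule NN)
 hence "cnj (N $ j $ i) = N $ i $ j | cnj (N $ j $ i) = - N $ i $ j"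
  by (metis power2_eq_iff power2_eq_square)
 thus "ct N = N"
 proof
  assume "cnj (N $ j $ i) = N $ i $ j"
  hence "cnj (N $ l $ k) = N $ k $ l" for k l using NN[of i j k l] ij by simp
  thus ?thesis by (simp add: vec_eq_iff conj_transpose_def)
 next
  assume "cnj (N $ j $ i) = - N $ i $ j"
  hence "N $ i $ j * (N $ k $ l) = N $ i $ j * (- cnj (N $ l $ k))" for k l using NN[of i j k l] by simp
  hence "N $ k $ l = - cnj (N $ l $ k)" for k l using ij mult_left_cancel by blast
  from this[of 1 1] this[of 2 1] have c: "- cnj (N $ 1 $ 1) = N $ 1 $ 1" "- cnj (N $ 1 $ 2) = N $ 2 $ 1" by simp_all
  have "N $ 1 $ 1 * - cnj (N $ 1 $ 1) + N $ 1 $ 2 * - cnj (N $ 1 $ 2) = (N ** N) $ 1 $ 1" unfolding c mat2_mult_nth ..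
  hence "Re (N $ 1 $ 1 * - cnj (N $ 1 $ 1) + N $ 1 $ 2 * - cnj (N $ 1 $ 2)) = 1" by (simp add: N2 mat2_nth)
  hence "- (Re (N $ 1 $ 1))\<^sup>2 - (Im (N $ 1 $ 1))\<^sup>2 - (Re (N $ 1 $ 2))\<^sup>2 - (Im (N $ 1 $ 2))\<^sup>2 = 1"
   by (simp add: power2_eq_square)
  thus ?thesis by (smt (verit) zero_le_power2)
 qed
qed

lemma bounded_linear_mat_scalar: "bounded_linear (mat :: complex => complex^2^2)"
 by (rule bounded_linearI') (simp_all add: vec2_eq_iff mat2_nth)

lemma scalar_quats_constant:
 assumes K: "smooth K" "!!t. K t = mat 1 | K t = - mat 1" "K 0 = mat 1" shows "K (t::real) = (mat 1 :: complex^2^2)"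
proof -
 have c: "continuous_on UNIV (%t. qw (K t))"
  by (rule Ck_on_continuous[OF smooth_on_Ck[OF smooth_linear[OF bounded_linear_q(1) K(1)]]])
 have q: "qw (K t) = 1 | qw (K t) = - 1" for t using K(2)[of t] by (auto simp: qw_def mat2_nth)
 have "finite (range (%t. qw (K t)))" by (rule finite_subset[of _ "{1, -1}"]) (use q in auto)
 hence "(%t. qw (K t)) constant_on UNIV" by (rule continuous_finite_range_constant[OF connected_UNIV c])
 then obtain a where "!!t. qw (K t) = a" by (auto simp: constant_on_def)
 from this[of t] this[of 0] have "qw (K t) = 1" by (simp add: K(3) qw_def mat2_nth)
 thus ?thesis using K(2)[of t] by (auto simp: qw_def mat2_nth)
qed

text \<open>As K commutes with n, it lies on the circle exp(R n), and its two coordinates there are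
  smooth.\<close>

lemma holonomy_angle:
 fixes K :: "real => complex^2^2"
 assumes K: "smooth K" "!!t. K t : SU2" "K 0 = mat 1"
  and n: "smooth n" "!!t. n t : su2" "!!t. ip (n t) (n t) = 1" "!!t. K t ** n t = n t ** K t"
 obtains L where "smooth L" "L 0 = 0" "!!t. K t = gam (n t) (L t)"
proof -
 let ?w = "%t. qw (K t)" and ?s = "%t. ip (K t) (n t)"
 have e: "K t = ?w t *\<^sub>R mat 1 + ?s t *\<^sub>R n t" for t by (rule quat_commute[OF SU2_quats[OF K(2)] n(2,3,4)])
 have s: "smooth ?w" "smooth ?s" unfolding ip_def
  by (intro smooth_uminus smooth_linear[OF bounded_linear_q(1)] K(1) smooth_mat n(1))+
 have u: "?w t * ?w t + ?s t * ?s t = 1" for t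
 proof -
  obtain x y z where n': "n t = quat 0 x y z" using su2_eq[OF n(2)] by blast
  have i: "x * x + y * y + z * z = 1" using n(3)[of t] unfolding n' ip_def quat_mult by simp
  have "(qw (K t))\<^sup>2 + (qx (K t))\<^sup>2 + (qy (K t))\<^sup>2 + (qz (K t))\<^sup>2 = 1" using K(2)[of t] by (simp add: SU2_iff)
  moreover have "qx (K t) = ?s t * x" "qy (K t) = ?s t * y" "qz (K t) = ?s t * z"
   by (subst e, simp add: n' q_linear q_defs quat_def mat2_nth)+
  ultimately have "?w t * ?w t + ?s t * ?s t * (x * x + y * y + z * z) = 1" by (simp add: power2_eq_square algebra_simps)
  thus ?thesis unfolding i by simp
 qed
 have w0: "?w 0 = 1" by (simp add: K(3) qw_def mat2_nth)
 obtain L where "smooth L" "L 0 = 0" "!!t. ?w t = cos (L t)" "!!t. ?s t = sin (L t)"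
  using smooth_angle[OF s u w0] by metis
 thus ?thesis using that e by (simp add: gam_def)
qed

text \<open>A nonzero column of q + e works because (q - e)(q + e) = 0; the trace rules out q =
  -e.\<close>

lemma eigenvector:
 fixes q :: "complex^2^2"
 assumes "q $ 1 $ 1 + q $ 2 $ 2 = 0" "q ** q = mat (e\<^sup>2)" "e ~= 0"
 obtains v where "v ~= 0" "q *v v = e *s v"
proof -
 have "EX j. (\<chi> i. (q + mat e) $ i $ j) ~= 0"
 proof (rule ccontr)
  assume "~ ?thesis"
  hence "(q + mat e) $ i $ j = 0" for i j by (auto simp: vec_eq_iff)
  from this[of 1 1] this[of 2 2] have "q $ 1 $ 1 + q $ 2 $ 2 + 2 * e = 0" by (simp add: mat2_nth algebra_simps add_eq_0_iff)
  thus False using assms(1,3) by simp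
 qed
 then obtain j where j: "(\<chi> i. (q + mat e) $ i $ j) ~= 0" by blast
 have "q ** (q + mat e) = mat e ** (q + mat e)"
  by (simp add: mat_algebra assms(2)) (simp add: vec2_eq_iff mat2_mult_nth mat2_nth power2_eq_square)
 hence "(q ** (q + mat e)) $ i $ j = e * (q + mat e) $ i $ j" for i
  using exhaust_2[of i] by (auto simp: mat2_mult_nth mat2_nth)
 hence "q *v (\<chi> i. (q + mat e) $ i $ j) = e *s (\<chi> i. (q + mat e) $ i $ j)"
  by (simp add: vec_eq_iff matrix_vector_mult_def matrix_matrix_mult_def)
 thus ?thesis using that j by blast
qed

text \<open>In the generic case n is i Q / e, where e is the smooth root of P continuing the given
  lift. It has eigenvalue i on the common eigenline, so exp(L n) has eigenvalue exp(i L) there,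
  which identifies the given logarithms with i L.\<close>

theorem spectral_frame:
 fixes K1 K2 :: "real => complex^2^2"
 assumes K1: "smooth K1" "!!t. K1 t : SU2" "K1 0 = mat 1"
  and K2: "smooth K2" "!!t. K2 t : SU2" "K2 0 = mat 1"
  and H: "!!t. H1 (cis t) = K1 t" "!!t. H2 (cis t) = K2 t"
  and sc: "spectral_curve H1 H2 P Q"
  and ev: "eigenvalue_function P Q H1 \<mu>1" "eigenvalue_function P Q H2 \<mu>2"
  and \<eta>: "continuous_on {0..pi} \<eta>" "!!\<theta>. \<theta> : {0..pi} ==> (cis \<theta>, \<eta> \<theta>) : curve_points P"
  and l: "log_along_lift \<mu>1 \<eta> l1" "log_along_lift \<mu>2 \<eta> l2"
 obtains n L1 L2 where "smooth n" "!!t. n t : su2" "!!t. ip (n t) (n t) = 1"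
  "smooth L1" "L1 0 = 0" "!!t. K1 t = gam (n t) (L1 t)"
  "smooth L2" "L2 0 = 0" "!!t. K2 t = gam (n t) (L2 t)"
  "!!\<theta>. \<theta> : {0..pi} ==> l1 \<theta> = \<i> * of_real (L1 \<theta>)" "!!\<theta>. \<theta> : {0..pi} ==> l2 \<theta> = \<i> * of_real (L2 \<theta>)"
proof -
 define p q where "p t = poly P (cis t)" and "q t = Q (cis t)" for t
 have Qh: "!!i j. (%\<zeta>. Q \<zeta> $ i $ j) holomorphic_on - {0}"
  and Q2: "!!\<zeta>. \<zeta> ~= 0 ==> Q \<zeta> ** Q \<zeta> = mat (poly P \<zeta>)"
  and tr: "!!t. q t $ 1 $ 1 + q t $ 2 $ 2 = 0" and qK: "!!t. q t ** K1 t = K1 t ** q t" "!!t. q t ** K2 t = K2 t ** q t"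
  using sc by (auto simp: spectral_curve_def q_def H[symmetric] trace_def sum_2)
 have p0: "p t ~= 0" for t using sc by (auto simp: spectral_curve_def spectral_polynomial_def p_def)
 have ps: "smooth p" unfolding p_def[abs_def] by (rule holomorphic_cis_smooth) (intro holomorphic_intros)
 have \<eta>2: "(\<eta> t)\<^sup>2 = p t" if "t : {0..pi}" for t using \<eta>(2)[OF that] by (simp add: curve_points_def p_def)
 obtain e where e: "smooth e" "e 0 = \<eta> 0" "!!t. (e t)\<^sup>2 = p t"
  using smooth_sqrt[OF ps p0 \<eta>2] by auto
 have e0: "e t ~= 0" for t using e(3)[of t] p0[of t] by auto
 \<comment> \<open>The ratio of the two roots is continuous with values 1 and -1, and it is 1 at the
   start.\<close>
 have \<eta>e: "\<eta> t = e t" if t: "t : {0..pi}" for t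
 proof -
  have "continuous_on {0..pi} (%t. \<eta> t / e t)"
   by (intro continuous_on_divide \<eta>(1) continuous_on_subset[OF Ck_on_continuous[OF smooth_on_Ck[OF e(1)]]]) (use e0 in auto)
  moreover have r: "\<eta> t / e t = 1 | \<eta> t / e t = -1" if "t : {0..pi}" for t
  proof -
   have "(\<eta> t / e t)\<^sup>2 = 1" using \<eta>2[OF that] e(3)[of t] p0[of t] by (simp add: power_divide)
   thus ?thesis by (simp add: power2_eq_1_iff)
  qed
  have "(%t. \<eta> t / e t) ` {0..pi} <= {1, -1}" using r by blast
  hence "finite ((%t. \<eta> t / e t) ` {0..pi})" by (rule finite_subset) simp
  ultimately have "(%t. \<eta> t / e t) constant_on {0..pi}" by (rule_tac continuous_finite_range_constant) auto
  then obtain a where a: "!!t. t : {0..pi} ==> \<eta> t / e t = a" by (auto simp: constant_on_def)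
  have "\<eta> t / e t = 1" using a[OF t] a[of 0] e(2) e0[of 0] by simp
  thus ?thesis using e0 by simp
 qed
 have q2: "q t ** q t = mat ((e t)\<^sup>2)" for t using Q2[of "cis t"] by (simp add: q_def e(3) p_def)
 define N where "N t = mat (inverse (e t)) ** q t" for t
 have qs: "smooth q"
  unfolding smooth_on_def
 proof
  fix k show "Ck_on k UNIV q"
   by (intro Ck_on_vec open_UNIV) (use holomorphic_cis_smooth[OF Qh] in \<open>simp add: q_def smooth_on_def\<close>)
 qed
 have Ns: "smooth (%t. mat \<i> ** N t)" unfolding N_def
  by (intro smooth_mat smooth_const smooth_linear[OF bounded_linear_mat_scalar smooth_inverse[OF e(1) e0]] qs)
 have scal: "X ** (mat c ** Y) = mat c ** (X ** Y)" for c and X Y :: "complex^2^2"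
  by (simp add: vec2_eq_iff mat2_mult_nth mat2_nth algebra_simps)
 define triv where "triv K t \<longleftrightarrow> K t = mat 1 | K t = - mat 1" for K :: "real => complex^2^2" and t :: real
 have "EX n. smooth n & (ALL t. n t : su2 & ip (n t) (n t) = 1 & K1 t ** n t = n t ** K1 t & K2 t ** n t = n t ** K2 t) &
   ((ALL t v. q t *v v = e t *s v --> n t *v v = \<i> *s v) | (ALL t. K1 t = mat 1 & K2 t = mat 1))"
 \<comment> \<open>If both holonomies are 1 or -1 throughout, they are 1 by continuity and every
   vector is an eigenvector; a constant n serves.\<close>
 proof (cases "ALL t. triv K1 t & triv K2 t")
  case True
  hence T: "K1 t = mat 1 | K1 t = - mat 1" "K2 t = mat 1 | K2 t = - mat 1" for t unfolding triv_def by blast+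
  have K: "K1 t = mat 1" "K2 t = mat 1" for t
   by (rule scalar_quats_constant[OF K1(1) T(1) K1(3)], rule scalar_quats_constant[OF K2(1) T(2) K2(3)])
  have "ip (quat 0 1 0 0) (quat 0 1 0 0) = 1" "quat 0 1 0 0 : su2" by (simp_all add: ip_def quat_mult su2_def)
  thus ?thesis
   by (intro exI[of _ "%_. quat 0 1 0 0"]) (simp add: smooth_const K)
 next
  case False
  then obtain K t0 where K: "K = K1 | K = K2" "~ triv K t0" by blast
  have Kc: "continuous_on UNIV K"
   using K(1) Ck_on_continuous[OF smooth_on_Ck[OF K1(1)]] Ck_on_continuous[OF smooth_on_Ck[OF K2(1)]] by auto
  have "open (UNIV Int K -` (- {mat 1, - mat 1}))"
   by (rule continuous_open_preimage[OF Kc open_UNIV]) (intro open_Compl finite_imp_closed, simp)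
  moreover have "UNIV Int K -` (- {mat 1, - mat 1}) = {t. ~ triv K t}" by (auto simp: triv_def)
  ultimately have E: "open {t. ~ triv K t}" "t0 : {t. ~ triv K t}" using K(2) by simp_all
  have E3: "EX c. EX X:su2. ALL i j. Q (cis t) $ i $ j = c * X $ i $ j" if t: "t : {t. ~ triv K t}" for t
  proof -
   have "K t : SU2" "q t ** K t = K t ** q t" using K(1) K1(2) K2(2) qK by auto
   thus ?thesis
    using commuting_traceless[of "K t" "q t"] t tr[of t] unfolding triv_def q_def by simp
  qed
  have herm: "ct (N t) = N t" for t
   unfolding N_def q_def
   by (rule eigenline_reality[OF Qh Q2 E E3 e(3)[unfolded p_def] e0])
  let ?n = "%t. mat \<i> ** N t"
  have Nt: "N t $ 2 $ 2 = - N t $ 1 $ 1" for t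
   using tr[of t] by (simp add: N_def mat2_mult_nth mat2_nth add_eq_0_iff)
  have nsu: "?n t : su2" for t
  proof -
   have h: "cnj (N t $ 1 $ 1) = N t $ 1 $ 1" "cnj (N t $ 1 $ 2) = N t $ 2 $ 1"
    using arg_cong[OF herm[of t], of "%X. X $ 1 $ 1"] arg_cong[OF herm[of t], of "%X. X $ 2 $ 1"] by (simp_all add: conj_transpose_def)
   hence "Im (N t $ 1 $ 1) = 0" by (simp add: complex_eq_iff)
   thus ?thesis using h by (simp add: su2_def quats_def qw_def mat2_mult_nth mat2_nth Nt)
  qed
  have N2: "N t ** N t = mat 1" for t
  proof -
   have eq: "N t ** N t = mat (inverse (e t)) ** (mat (inverse (e t)) ** (q t ** q t))"
    unfolding N_def by (simp only: matrix_mul_assoc[symmetric] scal[of "q t"])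
   have "inverse (e t) * (inverse (e t) * (e t)\<^sup>2) = 1" using e0[of t] by (simp add: field_simps power2_eq_square)
   hence "mat (inverse (e t)) ** (mat (inverse (e t)) ** (q t ** q t)) = mat 1"
    unfolding q2 by (simp add: vec2_eq_iff mat2_mult_nth mat2_nth)
   with eq show ?thesis by simp
  qed
  have "?n t ** ?n t = - mat 1" for t
  proof -
   have "?n t ** ?n t = mat \<i> ** (mat \<i> ** (N t ** N t))" by (simp only: matrix_mul_assoc[symmetric] scal[of "N t"])
   thus ?thesis unfolding N2 by (simp add: vec2_eq_iff mat2_mult_nth mat2_nth)
  qed
  hence nn: "ip (?n t) (?n t) = 1" for t by (simp add: ip_def qw_def mat2_nth)
  have "K' t ** ?n t = ?n t ** K' t" if "q t ** K' t = K' t ** q t" for K' t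
   unfolding N_def by (simp only: matrix_mul_assoc[symmetric] scal[of "K' t"] that)
  hence nK: "K1 t ** ?n t = ?n t ** K1 t" "K2 t ** ?n t = ?n t ** K2 t" for t using qK by blast+
  have nv: "?n t *v v = \<i> *s v" if v: "q t *v v = e t *s v" for t v
  proof -
   have mv: "mat c *v w = c *s w" for c and w :: "complex^2"
    by (simp add: vec_eq_iff forall_2 matrix_vector_mult_def sum_2 mat2_nth)
   have "?n t *v v = mat \<i> *v (mat (inverse (e t)) *v (q t *v v))" by (simp add: N_def matrix_vector_mul_assoc)
   thus ?thesis unfolding v mv using e0[of t] by (simp add: vec_eq_iff)
  qed
  show ?thesis using Ns nsu nn nK nv by (intro exI[of _ ?n]) blast
 qed
 then obtain n where n: "smooth n" "!!t. n t : su2" "!!t. ip (n t) (n t) = 1" "!!t. K1 t ** n t = n t ** K1 t" "!!t. K2 t ** n t = n t ** K2 t"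
  and nv: "(ALL t v. q t *v v = e t *s v --> n t *v v = \<i> *s v) | (ALL t. K1 t = mat 1 & K2 t = mat 1)" by blast
 obtain L1 where L1: "smooth L1" "L1 0 = 0" "!!t. K1 t = gam (n t) (L1 t)" using holonomy_angle[OF K1 n(1-3,4)] by metis
 obtain L2 where L2: "smooth L2" "L2 0 = 0" "!!t. K2 t = gam (n t) (L2 t)" using holonomy_angle[OF K2 n(1-3,5)] by metis
 have log: "l t = \<i> * of_real (L t)"
  if l: "log_along_lift \<mu> \<eta> l" and ev: "eigenvalue_function P Q H \<mu>" and H: "!!t. H (cis t) = K t" and L: "smooth L" "L 0 = 0" "!!t. K t = gam (n t) (L t)"
   and kv: "(ALL t v. q t *v v = e t *s v --> n t *v v = \<i> *s v) | (ALL t. K t = mat 1)" and t: "t : {0..pi}" for l \<mu> H K L t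
 proof (rule continuous_log_unique[OF _ _ _ _ t])
  show "continuous_on {0..pi} l" "l 0 = \<i> * of_real (L 0)" using l L(2) by (simp_all add: log_along_lift_def)
  show "continuous_on {0..pi} (%t. \<i> * of_real (L t))"
   by (intro continuous_intros continuous_on_subset[OF Ck_on_continuous[OF smooth_on_Ck[OF L(1)]]]) auto
  fix t assume t: "t : {0..pi}"
  obtain v where v: "v ~= 0" "q t *v v = e t *s v" using eigenvector[OF tr q2 e0] by metis
  have "Q (cis t) *v v = \<eta> t *s v" using v(2) \<eta>e[OF t] by (simp add: q_def)
  hence "K t *v v = \<mu> (cis t, \<eta> t) *s v"
   using ev \<eta>(2)[OF t] unfolding eigenvalue_function_def H[symmetric] by blast
  also have "\<mu> (cis t, \<eta> t) = exp (l t)" using l t by (simp add: log_along_lift_def)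
  finally have 1: "K t *v v = exp (l t) *s v" .
  have "K t *v v = exp (\<i> * of_real (L t)) *s v"
   using kv
  proof
   assume "ALL t v. q t *v v = e t *s v --> n t *v v = \<i> *s v"
   hence nv: "n t *v v = \<i> *s v" using v(2) by blast
   have "gam (n t) (L t) *v v = cos (L t) *\<^sub>R v + sin (L t) *\<^sub>R (n t *v v)"
    by (simp add: gam_def vec_eq_iff forall_2 matrix_vector_mult_def sum_2 mat2_nth algebra_simps)
   also have "... = exp (\<i> * of_real (L t)) *s v"
    unfolding nv cis_conv_exp[symmetric] by (simp add: vec_eq_iff complex_eq_iff)
   finally show ?thesis using L(3) by simp
  next
   assume K1: "ALL t. K t = mat 1"
   have "qw (gam (n t) (L t)) = cos (L t)" using n(2)[of t] by (simp add: gam_def su2_def qw_def mat2_nth)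
   moreover have "gam (n t) (L t) = mat 1" using K1 L(3)[of t] by metis
   ultimately have c: "cos (L t) = 1" by (simp add: qw_def mat2_nth)
   hence "sin (L t) = 0" using sin_cos_squared_add[of "L t"] by simp
   hence "exp (\<i> * of_real (L t)) = 1" using c unfolding cis_conv_exp[symmetric] by (simp add: complex_eq_iff)
   thus ?thesis using K1 by simp
  qed
  from trans[OF 1[symmetric] this] have "v = 0 | exp (l t) = exp (\<i> * of_real (L t))"
   by (auto simp: vec_eq_iff forall_2)
  thus "exp (l t) = exp (\<i> * of_real (L t))" using v(1) by simp
 qed
 show ?thesis
  by (rule that[OF n(1-3) L1 L2 log[OF l(1) ev(1) H(1) L1] log[OF l(2) ev(2) H(2) L2]]) (use nv in auto)
qed

section \<open>The Wess-Zumino term\<close>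

lemma pdm_first:
 assumes "smooth f"
 shows "smooth (%y::real^3. f (y $ 1))" "pdm (%y. f (y $ 1)) j y = (if j = 1 then dd f (y $ 1) else 0)"
proof -
 show "smooth (%y::real^3. f (y $ 1))"
  by (rule smooth_compose[OF smooth_id[OF bounded_linear_vec_nth] assms]) simp
 have "((%y. f (y $ 1)) has_derivative (%v. fd f (y $ 1) (v $ 1))) (at y)"
  by (rule has_derivative_compose[OF bounded_linear_imp_has_derivative[OF bounded_linear_vec_nth] smooth_derivative[OF assms]])
 from pdm_eqI[OF this] show "pdm (%y. f (y $ 1)) j y = (if j = 1 then dd f (y $ 1) else 0)"
  using linear_0[OF has_derivative_linear[OF smooth_derivative[OF assms]]] by (simp add: axis_def)
qed

lemma bounded_linear_ip: "bounded_linear (%X. - qw X)"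
 by (rule bounded_linear_minus[OF bounded_linear_q(1)])

lemma pdm_ip:
 assumes "smooth X" "smooth Y"
 shows "pdm (%y. ip (X y) (Y y)) j y = ip (X y) (pdm Y j y) + ip (pdm X j y) (Y y)"
 unfolding ip_def using pdm_linear[OF bounded_linear_ip smooth_mat[OF assms], of j y]
 by (simp add: pdm_mat[OF assms] q_defs)

lemma smooth_ip: "smooth X ==> smooth Y ==> smooth (%y. ip (X y) (Y y))"
 unfolding ip_def by (rule smooth_linear[OF bounded_linear_ip smooth_mat])

lemma ip_commutator:
 assumes "X : su2" "Y : su2" "Z : su2"
 shows "ip X (commutator Y Z) = ip (commutator X Y) Z"
 using assms by (auto simp: ip_def commutator_def mat_algebra q_mult su2_def quats_mult q_linear quats_linear algebra_simps)

lemma commutator_su2: "X : su2 ==> Y : su2 ==> commutator X Y : su2"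
 by (auto simp: commutator_def su2_def quats_mult quats_linear q_linear q_mult)

lemma Omega_ip:
 assumes "q : SU2" "ct q ** u : su2" "ct q ** v : su2" "ct q ** w : su2"
 shows "Omega q u v w = ip (ct q ** u) (commutator (ct q ** v) (ct q ** w)) / (2 * pi)"
 unfolding Omega_su2[OF assms] using assms(2-4)
 by (simp add: det3_def ip_def commutator_def mat_algebra q_mult su2_def quats_mult q_linear quats_linear field_simps)

lemma log_derivative_su2:
 assumes U: "smooth U" "!!y. U y : SU2"
 shows "ct (U y) ** pdm U k y : su2"
 unfolding pdm_def using tangent_derivative[OF open_UNIV UNIV_I _ smooth_derivative[OF U(1)], of y "axis k 1"] U(2) tangent_iff_su2[OF U(2)] by blast

lemma su2_SU2_conj: "X : su2 ==> U : SU2 ==> ct U ** X ** U : su2"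
 by (auto simp: su2_def quats_mult quats_conj SU2_quats q_mult q_conj algebra_simps)

lemma pdm_gauge:
 assumes U: "smooth U" "!!y. U y : SU2" and X: "smooth X"
 shows "pdm (%y. ct (U y) ** X y ** U y) k y = ct (U y) ** pdm X k y ** U y +
  commutator (ct (U y) ** X y ** U y) (ct (U y) ** pdm U k y)"
proof -
 define p where "p = ct (U y) ** pdm U k y"
 have p: "p : su2" unfolding p_def by (rule log_derivative_su2[OF U])
 have d: "pdm U k y = U y ** p" by (simp add: p_def matrix_mul_assoc conj_transpose_SU2[OF U(2)])
 show ?thesis unfolding p_def[symmetric]
  by (simp add: pdm_mat smooth_mat smooth_conj U(1) X pdm_conj d conj_transpose_mult su2_conj[OF p] mat_minus mat_algebra
    commutator_def matrix_mul_assoc)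
qed

text \<open>The bracket of w2 and w3 is the curl of the conjugated connection. Moving its
  derivatives onto w1 and using that derivatives of U commute, the triple product becomes a
  divergence plus two terms free of U: one from the theta-derivative of A, one from that of phi.
  Over the cylinder the divergence disappears by periodicity and by its values at the ends.\<close>

lemma transgression:
 fixes \<phi>1 \<phi>2 :: "real^3 => real"
 assumes U: "smooth U" "!!y. U y : SU2"
  and A: "smooth A1" "smooth A2" "!!y. A1 y : su2" "!!y. A2 y : su2"
  and flat: "!!y. pdm A2 2 y - pdm A1 3 y + (A1 y ** A2 y - A2 y ** A1 y) = 0"
  and e: "e : su2" "ip e e = 1"
  and \<phi>: "smooth \<phi>1" "smooth \<phi>2" "!!y. pdm \<phi>1 3 y = 0" "!!y. pdm \<phi>2 2 y = 0"
  and Ud: "!!y. pdm U 2 y = - (A1 y ** U y + \<phi>1 y *\<^sub>R (U y ** e))" "!!y. pdm U 3 y = - (A2 y ** U y + \<phi>2 y *\<^sub>R (U y ** e))"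
 defines "c X y == ct (U y) ** X y ** U y" and "w k y == ct (U y) ** pdm U k y"
 shows "ip (w 1 y) (commutator (w 2 y) (w 3 y)) =
  pdm (%y. ip (c A2 y) (w 1 y) - \<phi>2 y * ip e (w 1 y)) 2 y - pdm (%y. ip (c A1 y) (w 1 y) - \<phi>1 y * ip e (w 1 y)) 3 y
  + pdm (%y. \<phi>1 y * ip (c A2 y) e - \<phi>2 y * ip (c A1 y) e) 1 y
  + (ip (A2 y) (pdm A1 1 y) - ip (A1 y) (pdm A2 1 y)) + (\<phi>1 y * pdm \<phi>2 1 y - \<phi>2 y * pdm \<phi>1 1 y)"
proof -
 have cs: "smooth (c X)" if "smooth X" for X
  unfolding c_def[abs_def] by (intro smooth_mat smooth_conj U(1) that)
 have ws: "smooth (w k)" for k unfolding w_def[abs_def] by (intro smooth_mat smooth_conj smooth_pdm U(1))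
 have w: "w k y : su2" for k y unfolding w_def by (rule log_derivative_su2[OF U])
 have Uw: "pdm U k y = U y ** w k y" for k y by (simp add: w_def matrix_mul_assoc conj_transpose_SU2[OF U(2)])
 have cw: "c A1 y : su2" "c A2 y : su2" for y unfolding c_def by (rule su2_SU2_conj[OF _ U(2)], rule A)+
 have UU: "ct (U y) ** (U y ** X) = X" for y X by (simp add: matrix_mul_assoc conj_transpose_SU2[OF U(2)])
 have w2: "w 2 y = - (c A1 y + \<phi>1 y *\<^sub>R e)" and w3: "w 3 y = - (c A2 y + \<phi>2 y *\<^sub>R e)" for y
  unfolding w_def Ud c_def by (simp_all add: mat_algebra mat_minus UU matrix_mul_assoc[symmetric])
 have sc: "smooth (%y. \<phi> y *\<^sub>R (U y ** e))" if "smooth \<phi>" for \<phi> by (intro smooth_scaleR smooth_mat smooth_const U(1) that)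
 have dw: "pdm (w 1) k y = - c (pdm A 1) y - pdm \<phi> 1 y *\<^sub>R e - \<phi> y *\<^sub>R commutator (w 1 y) e"
  if Uk: "!!y. pdm U k y = - (A y ** U y + \<phi> y *\<^sub>R (U y ** e))" and As: "smooth A" "!!y. A y : su2" and ph: "smooth \<phi>" for k A \<phi>
 proof -
  have "pdm (pdm U k) 1 y = - (pdm (%y. A y ** U y + \<phi> y *\<^sub>R (U y ** e)) 1 y)"
   unfolding Uk[abs_def] by (rule pdm_uminus[OF smooth_add[OF smooth_mat[OF As(1) U(1)] sc[OF ph]]])
  also have "... = - (A y ** (U y ** w 1 y) + pdm A 1 y ** U y + \<phi> y *\<^sub>R ((U y ** w 1 y) ** e) + pdm \<phi> 1 y *\<^sub>R (U y ** e))"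
   by (simp add: pdm_add[OF smooth_mat[OF As(1) U(1)] sc[OF ph]] pdm_mat[OF As(1) U(1)] pdm_scaleR[OF ph smooth_mat[OF U(1) smooth_const]]
     pdm_mat[OF U(1) smooth_const] pdm_const Uw mat_algebra)
  finally have 1: "ct (U y) ** pdm (pdm U k) 1 y =
    - (ct (U y) ** (A y ** (U y ** w 1 y)) + c (pdm A 1) y + \<phi> y *\<^sub>R (w 1 y ** e) + pdm \<phi> 1 y *\<^sub>R e)"
   by (simp add: mat_algebra mat_minus UU c_def matrix_mul_assoc[symmetric])
  have "ct (pdm U k y) = ct (U y) ** A y + \<phi> y *\<^sub>R (e ** ct (U y))"
   unfolding Uk using bounded_linear.linear[OF bounded_linear_conj_transpose]
   by (simp add: linear_add linear_diff linear_cmul linear_neg conj_transpose_mult su2_conj[OF e(1)] su2_conj[OF As(2)] mat_minus)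
  hence "ct (pdm U k y) ** pdm U 1 y = ct (U y) ** (A y ** (U y ** w 1 y)) + \<phi> y *\<^sub>R (e ** w 1 y)"
   by (simp add: Uw[of 1] mat_algebra UU matrix_mul_assoc[symmetric])
  moreover have "pdm (w 1) k y = ct (U y) ** pdm (pdm U k) 1 y + ct (pdm U k y) ** pdm U 1 y"
   unfolding w_def[of 1, abs_def]
   by (simp add: pdm_mat[OF smooth_conj[OF U(1)] smooth_pdm[OF U(1)]] pdm_conj[OF U(1)] pdm_commute[OF U(1), of 1 k])
  ultimately show ?thesis using 1 by (simp add: commutator_def algebra_simps)
 qed
 note dw1 = dw[OF Ud(1) A(1,3) \<phi>(1)] and dw2 = dw[OF Ud(2) A(2,4) \<phi>(2)]
 have dc: "pdm (c X) k y = c (pdm X k) y + commutator (c X y) (w k y)" if "smooth X" for X k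
  unfolding c_def[abs_def] w_def by (rule pdm_gauge[OF U that])
 \<comment> \<open>Flatness gives minus the bracket of the conjugated components; differentiating
   the conjugation adds this bracket twice, together with the terms in phi.\<close>
 have curl: "pdm (c A2) 2 y - pdm (c A1) 3 y = commutator (w 2 y) (w 3 y)"
 proof -
  have "c (pdm A2 2) y - c (pdm A1 3) y = ct (U y) ** (pdm A2 2 y - pdm A1 3 y) ** U y"
   by (simp add: c_def mat_algebra)
  also have "pdm A2 2 y - pdm A1 3 y = - commutator (A1 y) (A2 y)"
   unfolding eq_neg_iff_add_eq_0 commutator_def by (rule flat)
  also have "ct (U y) ** - commutator (A1 y) (A2 y) ** U y = - commutator (c A1 y) (c A2 y)"
  proof -
   have "U y ** (ct (U y) ** Z) = Z" for Z :: "complex^2^2" by (simp add: matrix_mul_assoc conj_transpose_SU2[OF U(2)])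
   thus ?thesis by (simp add: commutator_def c_def mat_algebra mat_minus matrix_mul_assoc[symmetric])
  qed
  finally show ?thesis
   by (simp add: dc A w2 w3 commutator_def mat_algebra mat_minus algebra_simps)
 qed
 have ipc: "ip (c A1 y) (c X y) = ip (A1 y) (X y)" "ip (c A2 y) (c X y) = ip (A2 y) (X y)" if "X y : su2" for X
  unfolding c_def by (rule ip_conj[OF _ that U(2)], rule A)+
 have A': "pdm A1 1 y : su2" "pdm A2 1 y : su2" unfolding pdm_def by (rule su2_frechet, use A in auto)+
 have comm: "commutator X X = 0" "ip X 0 = 0" "ip 0 X = 0" for X by (simp_all add: commutator_def ip_def q_defs mat_algebra)
 have z: "ip e (commutator (w 1 y) e) = 0"
  using ip_commutator[OF e(1) e(1) w, of 1 y] comm[of e] by (simp add: commutator_def ip_def q_defs mat_algebra)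
 have t: "ip (c A1 y) (commutator (w 1 y) e) = ip (commutator (c A1 y) (w 1 y)) e" "ip (c A2 y) (commutator (w 1 y) e) = ip (commutator (c A2 y) (w 1 y)) e"
  by (rule ip_commutator[OF cw(1) w e(1)] ip_commutator[OF cw(2) w e(1)])+
 have smult: "pdm (%y. \<phi> y * k y) j y = \<phi> y * pdm k j y + pdm \<phi> j y * k y" if "smooth \<phi>" "smooth k" for \<phi> k :: "real^3 => real" and j y
  using pdm_scaleR[OF that] by simp
 note sm = smooth_ip[OF cs[OF A(1)]] smooth_ip[OF cs[OF A(2)]] ws smooth_const smooth_ip[OF smooth_const ws] smooth_mult \<phi>(1,2)
 have E1: "pdm (%y. ip (c A2 y) (w 1 y) - \<phi>2 y * ip e (w 1 y)) 2 y =
   ip (c A2 y) (pdm (w 1) 2 y) + ip (pdm (c A2) 2 y) (w 1 y) - \<phi>2 y * ip e (pdm (w 1) 2 y)"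
  and E2: "pdm (%y. ip (c A1 y) (w 1 y) - \<phi>1 y * ip e (w 1 y)) 3 y =
   ip (c A1 y) (pdm (w 1) 3 y) + ip (pdm (c A1) 3 y) (w 1 y) - \<phi>1 y * ip e (pdm (w 1) 3 y)"
  and E3: "pdm (%y. \<phi>1 y * ip (c A2 y) e - \<phi>2 y * ip (c A1 y) e) 1 y =
   \<phi>1 y * ip (pdm (c A2) 1 y) e + pdm \<phi>1 1 y * ip (c A2 y) e - (\<phi>2 y * ip (pdm (c A1) 1 y) e + pdm \<phi>2 1 y * ip (c A1 y) e)"
  by (simp_all add: pdm_diff smult sm \<phi>(3,4) pdm_ip cs A(1,2) pdm_const comm)
 have "ip (w 1 y) (commutator (w 2 y) (w 3 y)) = ip (pdm (c A2) 2 y) (w 1 y) - ip (pdm (c A1) 3 y) (w 1 y)"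
  unfolding ip_sym[OF w commutator_su2[OF w w]] unfolding curl[symmetric] by (simp add: ip_linear)
 moreover have n: "ip X (- Y) = - ip X Y" for X Y by (simp add: ip_def mat_minus q_defs)
 have "ip (pdm (c A2) 1 y) e = ip (c (pdm A2 1) y) e + ip (c A2 y) (commutator (w 1 y) e)"
  "ip (pdm (c A1) 1 y) e = ip (c (pdm A1 1) y) e + ip (c A1 y) (commutator (w 1 y) e)"
  unfolding t by (simp_all add: dc A ip_linear)
 moreover have "ip e (c (pdm A2 1) y) = ip (c (pdm A2 1) y) e" "ip e (c (pdm A1 1) y) = ip (c (pdm A1 1) y) e"
  unfolding c_def by (rule ip_sym[OF e(1) su2_SU2_conj[OF _ U(2)]], rule A')+
 ultimately show ?thesis
  unfolding E1 E2 E3 dw1 dw2 ip_linear n ipc(2)[of "pdm A1 1", OF A'(1)] ipc(1)[of "pdm A2 1", OF A'(2)] z e(2) by (simp add: algebra_simps)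
qed

text \<open>Conjugation by v turns the moving axis n(t) into the fixed axis n(0), so that the
  holonomies can be undone inside a single circle subgroup.\<close>

lemma parallel_frame:
 assumes n: "smooth n" "!!t. n t : su2" "!!t. ip (n t) (n t) = 1"
 obtains v :: "real => complex^2^2" where "smooth v" "!!t. v t : SU2" "v 0 = mat 1" "!!t. ct (v t) ** n t ** v t = n 0"
proof -
 define n' where "n' t = dd n t" for t
 have n'd: "(n has_vector_derivative n' t) (at t)" for t unfolding n'_def by (rule smooth_dd[OF n(1)])
 have n's: "smooth n'" unfolding n'_def[abs_def] by (rule smooth_frechet[OF n(1)])
 have n'su: "n' t : su2" for t unfolding n'_def by (rule su2_frechet[OF n(1,2)])
 have nn: "n t ** n t = - mat 1" for t by (rule unit_square[OF n(2,3)])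
 have anti: "n t ** n' t = - (n' t ** n t)" for t
 proof -
  have "((%t. n t ** n t) has_vector_derivative n t ** n' t + n' t ** n t) (at t)" by (rule has_vector_derivative_mat[OF n'd n'd])
  hence "n t ** n' t + n' t ** n t = 0" unfolding nn by (rule vector_derivative_unique_at[OF _ has_vector_derivative_const])
  thus ?thesis by (simp add: eq_neg_iff_add_eq_0)
 qed
 \<comment> \<open>The element n n'/2 generates the rotation of n without spin about n, in the sense
   that n W - W n = - n'.\<close>
 define W where "W t = (1/2) *\<^sub>R (n t ** n' t)" for t
 have Wsu: "W t : su2" for t
 proof -
  have "qw (n t ** n' t) = qw (n' t ** n t)" using n(2)[of t] n'su[of t] by (simp add: qw_cyclic su2_def)
  moreover have "qw (n t ** n' t) = - qw (n' t ** n t)" unfolding anti by (simp add: qw_def)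
  ultimately have "qw (n t ** n' t) = 0" by simp
  moreover have "n t ** n' t : quats" using n(2)[of t] n'su[of t] by (auto simp: su2_def)
  ultimately have "n t ** n' t : su2" by (simp add: su2_def)
  thus ?thesis unfolding W_def by (rule su2_linear)
 qed
 have nW: "n t ** W t - W t ** n t = - n' t" for t
 proof -
  have "n t ** (n t ** n' t) = - n' t" "n t ** n' t ** n t = n' t"
   unfolding matrix_mul_assoc nn unfolding anti by (simp_all add: mat_minus matrix_mul_assoc[symmetric] nn)
  moreover have "(1/2) *\<^sub>R - X - (1/2) *\<^sub>R X = - X" for X :: "complex^2^2" by (simp add: vec_eq_iff complex_eq_iff)
  ultimately show ?thesis by (simp add: W_def mat_algebra)
 qed
 have "smooth (%t. n t ** n' t)" by (rule smooth_mat[OF n(1) n's])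
 hence Ws: "smooth W" unfolding W_def[abs_def] by (intro smooth_scaleR smooth_const)
 obtain Y where Y: "smooth Y" "!!y. Y y : SU2" "!!y. y $ 1 = 0 ==> Y y = mat 1" "!!y. pdm Y 1 y = W (y $ 1) ** Y y"
  using transport_smooth[OF pdm_first(1)[OF Ws] Wsu, where i = 1] by metis
 define v where "v t = Y (t *\<^sub>R axis 1 1)" for t
 have vs: "smooth v" unfolding v_def[abs_def] by (rule smooth_compose[OF smooth_id[OF bounded_linear_scaleR_left] Y(1)]) simp
 have vd: "(v has_vector_derivative W t ** v t) (at t)" for t
 proof -
  have "((%t. Y (0 + t *\<^sub>R axis 1 1)) has_vector_derivative pdm Y 1 (0 + t *\<^sub>R axis 1 1)) (at t)"
   unfolding pdm_def by (rule directional_derivative[OF smooth_derivative[OF Y(1)]])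
  thus ?thesis by (simp add: v_def[abs_def] Y(4))
 qed
 have "((%t. ct (v t) ** n t ** v t) has_vector_derivative 0) (at t)" for t
 proof -
  have ct: "((%t. ct (v t)) has_vector_derivative - (ct (v t) ** W t)) (at t)"
   using bounded_linear.has_vector_derivative[OF bounded_linear_conj_transpose vd]
   by (simp add: conj_transpose_mult su2_conj[OF Wsu] mat_minus)
  have "ct (v t) ** n t ** (W t ** v t) + (ct (v t) ** n' t + - (ct (v t) ** W t) ** n t) ** v t
   = ct (v t) ** ((n t ** W t - W t ** n t) + n' t) ** v t"
   by (simp add: mat_algebra mat_minus matrix_mul_assoc)
  also have "... = 0" unfolding nW by (simp add: mat_algebra)
  finally show ?thesis using has_vector_derivative_mat[OF has_vector_derivative_mat[OF ct n'd] vd] by simp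
 qed
 from real_constant[OF this] have "ct (v t) ** n t ** v t = ct (v 0) ** n 0 ** v 0" for t .
 moreover have v0: "v 0 = mat 1" unfolding v_def by (rule Y(3)) simp
 ultimately show ?thesis using that[OF vs _ v0] Y(2) by (simp add: v_def)
qed

lemma pdm_gam:
 assumes e: "e : su2" "ip e e = 1" and f: "smooth f"
 shows "pdm (%y. gam e (f y)) j y = pdm f j y *\<^sub>R (gam e (f y) ** e)"
proof -
 have "((%y. gam e (f y)) has_derivative (%u. fd f y u *\<^sub>R (- sin (f y) *\<^sub>R mat 1 + cos (f y) *\<^sub>R e))) (at y)"
  unfolding gam_def by (auto intro!: derivative_eq_intros smooth_derivative[OF f] simp: algebra_simps)
 from pdm_eqI[OF this] show ?thesis unfolding gam(2)[OF e, symmetric] gam(3)[OF e] by (simp add: pdm_def)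
qed

lemma gam_add:
 assumes "e : su2" "ip e e = 1" shows "gam e (s + t) = gam e s ** gam e t"
 using unit_square[OF assms] by (simp add: gam_def mat_algebra cos_add sin_add algebra_simps)

lemma gam_eq_1:
 assumes "e : su2" shows "gam e s = mat 1 \<longleftrightarrow> (EX m::int. s = 2 * pi * m)"
proof
 assume 1: "gam e s = mat 1"
 have "qw (gam e s) = cos s" using assms by (simp add: gam_def su2_def qw_def mat2_nth)
 hence "cos s = 1" unfolding 1 by (simp add: quat_1)
 thus "EX m::int. s = 2 * pi * m" by (auto simp: cos_one_2pi_int)
next
 assume "EX m::int. s = 2 * pi * m"
 hence "cos s = 1" by (auto simp: cos_one_2pi_int)
 moreover have "sin s = 0" using sin_cos_squared_add[of s] \<open>cos s = 1\<close> by simp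
 ultimately show "gam e s = mat 1" by (simp add: gam_def)
qed

text \<open>Where a map takes values in a circle its derivatives are parallel, so the end theta = 0
  will contribute nothing.\<close>

lemma beta_parallel: "beta q (p ** (s *\<^sub>R (X :: complex^2^2))) (p ** (t *\<^sub>R X)) = 0"
 by (simp add: beta_def mat_algebra q_defs algebra_simps)

lemma integral_square_const: "integral square (%p. c :: real) = 4 * pi\<^sup>2 * c"
proof -
 have "(0 :: real^2) : square" by (simp add: mem_box_cart forall_2)
 hence "square ~= {}" by blast
 thus ?thesis by (simp add: content_cbox_cart UNIV_2 power2_eq_square)
qed

section \<open>The energy term and the interpolating map\<close>

context harmonic_torus
begin

abbreviation "edg x == edens x (al 1 x) (al 2 x)"

lemma energy_edg: "energy h g = 4 * integral square edg"
 unfolding energy_formula[OF g_torus] al_mc ..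

lemma smooth_edg: "smooth edg"
 by (intro smooth_diff smooth_mult smooth_ip rt_smooth al_smooth smooth_const)

text \<open>The terms pairing the form with itself, or its star with itself, cancel by symmetry. The
  mixed ones carry the factor cos - cos^2 - sin^2 = cos - 1, the derivative of sin theta -
  theta.\<close>

lemma pdm_energy: "ip (AA 2 y) (pdm (AA 1) 1 y) - ip (AA 1 y) (pdm (AA 2) 1 y) = pdm (%y. ((sin (y $ 1) - y $ 1) / 4) * edg (P2 y)) 1 y"
proof -
 let ?x = "P2 y" and ?t = "y $ 1"
 have d: "((%t. (sin t - t) / 4) has_real_derivative (cos t - 1) / 4) (at t)" for t by (auto intro!: derivative_eq_intros)
 have s: "smooth (%t::real. (sin t - t) / 4)"
  using smooth_diff[OF smooth_sin[OF smooth_id[OF bounded_linear_ident]] smooth_id[OF bounded_linear_ident]]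
   smooth_linear[OF bounded_linear_mult_left[of "1/4 :: real"]] by fastforce
 have "pdm (%y. ((sin (y $ 1) - y $ 1) / 4) *\<^sub>R edg (P2 y)) 1 y = ((cos ?t - 1) / 4) * edg ?x"
  unfolding pdm_scaleR[OF pdm_first(1)[OF s] smooth_P2[OF smooth_edg]] pdm_theta[OF d] pdm_P2(1)[OF smooth_edg] by simp
 moreover have "ip (AA 2 y) (pdm (AA 1) 1 y) - ip (AA 1 y) (pdm (AA 2) 1 y) = ((cos ?t - 1) / 4) * edg ?x"
 proof -
  define c s where "c = cos ?t" and "s = sin ?t"
  have r: "rt ?x 2 2 = - rt ?x 1 1" by (simp add: rt)
  have c2: "sin ?t * sin ?t = 1 - cos ?t * cos ?t" using sin_cos_squared_add[of ?t] by (simp add: power2_eq_square)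
  have sy: "ip (al 2 ?x) (al 1 ?x) = ip (al 1 ?x) (al 2 ?x)" by (rule ip_sym[OF al_su2 al_su2])
  have "ip (AA 2 y) (pdm (AA 1) 1 y) - ip (AA 1 y) (pdm (AA 2) 1 y) = ((cos ?t - cos ?t * cos ?t - sin ?t * sin ?t) / 4) * edg ?x"
   unfolding AA_def pdm_AA be_def ip_linear sy r
   unfolding c_def[symmetric] s_def[symmetric] by (simp add: field_simps)
  thus ?thesis unfolding c2 by simp
 qed
 ultimately show ?thesis by simp
qed

end

context harmonic_torus
begin

text \<open>In U = F v exp(psi e) a period multiplies F by exp(L_j n), which v moves to exp(L_j e),
  while psi decreases by L_j up to the multiple 2 pi m_j. Hence U is periodic, and
  \<open>transgression\<close> evaluates the integral of the map G built from its inverse.\<close>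

theorem cylinder:
 assumes F: "smooth F" "!!y. F y : SU2"
   "!!y. pdm F 2 y = - (AA 1 y ** F y)" "!!y. pdm F 3 y = - (AA 2 y ** F y)"
   "!!y. F (y + shift 2) = F y ** F (vector [y $ 1, 2 * pi, 0])"
   "!!y. F (y + shift 3) = F y ** F (vector [y $ 1, 0, 2 * pi])"
   "!!s t. F (vector [0, s, t]) = mat 1" "!!s t. g (vector [s, t]) ** F (vector [pi, s, t]) = g 0"
  and n: "smooth n" "!!t. n t : su2" "!!t. ip (n t) (n t) = 1"
  and L: "smooth L1" "smooth L2" "L1 0 = 0" "L2 0 = 0"
  and FL: "!!t. F (vector [t, 2 * pi, 0]) = gam (n t) (L1 t)" "!!t. F (vector [t, 0, 2 * pi]) = gam (n t) (L2 t)"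
 obtains G and k :: int where "smooth G" "range G <= SU2"
  "!!y. G (y + shift 2) = G y" "!!y. G (y + shift 3) = G y"
  "!!s t. G (vector [pi, s, t]) = g (vector [s, t])"
  "!!q s t. beta (q ** G (vector [0, s, t])) (q ** D3 G (vector [0, s, t]) 2) (q ** D3 G (vector [0, s, t]) 3) = 0"
  "integral (cbox 0 (vector [pi, 2 * pi, 2 * pi])) (Omega3 G) =
   energy h g / 32 - integral {0..pi} (%t. L1 t * dd L2 t) / pi + 2 * pi * k"
proof -
 obtain v where v: "smooth v" "!!t. v t : SU2" "v 0 = mat 1" "!!t. ct (v t) ** n t ** v t = n 0"
  using parallel_frame[OF n] by metis
 define e where "e = n 0"
 have e: "e : su2" "ip e e = 1" using n by (simp_all add: e_def)
 have g2: "g (vector [2 * pi, 0]) = g 0" "g (vector [0, 2 * pi]) = g 0"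
 proof -
  have "g (0 + shift i) = g 0" for i using g_periodic unfolding periodic_def by blast
  moreover have "vector [2 * pi, 0] = 0 + (2 * pi) *\<^sub>R (axis 1 1 :: real^2)" "vector [0, 2 * pi] = 0 + (2 * pi) *\<^sub>R (axis 2 1 :: real^2)"
   by (simp_all add: vec_eq_iff forall_2 axis_def)
  ultimately show "g (vector [2 * pi, 0]) = g 0" "g (vector [0, 2 * pi]) = g 0" by metis+
 qed
 have gcancel: "X = mat 1" if "g 0 ** X = g 0" for X
 proof -
  have "ct (g 0) ** (g 0 ** X) = mat 1" unfolding that by (rule conj_transpose_SU2[OF g_SU2])
  thus ?thesis by (simp add: matrix_mul_assoc conj_transpose_SU2[OF g_SU2])
 qed
 \<comment> \<open>At theta = pi the frame is g^-1 g(0), which is periodic. So both holonomies are 1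
   there and both angles are multiples of 2 pi.\<close>
 have "gam (n pi) (L1 pi) = mat 1" "gam (n pi) (L2 pi) = mat 1"
  using gcancel F(8)[of "2 * pi" 0] F(8)[of 0 "2 * pi"] unfolding g2 FL by blast+
 then obtain m1 m2 :: int where m: "L1 pi = 2 * pi * m1" "L2 pi = 2 * pi * m2"
  unfolding gam_eq_1[OF n(2)] by metis
 define f1 f2 where "f1 t = L1 t / (2 * pi) - m1" and "f2 t = L2 t / (2 * pi) - m2" for t
 have fp: "f1 pi = 0" "f2 pi = 0" by (simp_all add: f1_def f2_def m)
 have Ld: "(L1 has_real_derivative dd L1 t) (at t)" "(L2 has_real_derivative dd L2 t) (at t)" for t
  unfolding has_real_derivative_iff_has_vector_derivative by (rule smooth_dd, rule L)+
 have fd: "(f1 has_real_derivative dd L1 t / (2 * pi)) (at t)" "(f2 has_real_derivative dd L2 t / (2 * pi)) (at t)" for t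
  unfolding f1_def f2_def by (rule derivative_eq_intros Ld refl | simp)+
 have fs: "smooth f1" "smooth f2"
  unfolding f1_def f2_def by (intro smooth_diff smooth_const smooth_linear[OF bounded_linear_divide] L)+
 define \<phi>1 \<phi>2 :: "real^3 => real" where "\<phi>1 y = f1 (y $ 1)" and "\<phi>2 y = f2 (y $ 1)" for y
 have \<phi>s: "smooth \<phi>1" "smooth \<phi>2" unfolding \<phi>1_def[abs_def] \<phi>2_def[abs_def] by (rule pdm_first(1), rule fs)+
 have \<phi>d: "pdm \<phi>1 j y = (if j = 1 then dd L1 (y $ 1) / (2 * pi) else 0)" "pdm \<phi>2 j y = (if j = 1 then dd L2 (y $ 1) / (2 * pi) else 0)" for j y
  unfolding \<phi>1_def[abs_def] \<phi>2_def[abs_def] by (rule pdm_theta[OF fd(1)] pdm_theta[OF fd(2)])+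
 define \<psi> where "\<psi> y = - (\<phi>1 y * y $ 2 + \<phi>2 y * y $ 3)" for y
 note ls = smooth_id[OF bounded_linear_vec_nth]
 have \<psi>s: "smooth \<psi>" unfolding \<psi>_def[abs_def] by (intro smooth_uminus smooth_add smooth_mult \<phi>s ls)
 have \<psi>d: "pdm \<psi> 2 y = - \<phi>1 y" "pdm \<psi> 3 y = - \<phi>2 y" for y
 proof -
  have l: "pdm (%y. y $ i) j y = (if i = j then 1 else 0)" for i j and y :: "real^3"
   using pdm_eqI[OF bounded_linear_imp_has_derivative[OF bounded_linear_vec_nth]] by (simp add: axis_def)
  have "pdm \<psi> j y = - (\<phi>1 y * pdm (%y. y $ 2) j y + pdm \<phi>1 j y * y $ 2 + (\<phi>2 y * pdm (%y. y $ 3) j y + pdm \<phi>2 j y * y $ 3))" for j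
   unfolding \<psi>_def[abs_def] pdm_uminus[OF smooth_add[OF smooth_mult[OF \<phi>s(1) ls] smooth_mult[OF \<phi>s(2) ls]]]
    pdm_add[OF smooth_mult[OF \<phi>s(1) ls] smooth_mult[OF \<phi>s(2) ls]]
   using pdm_scaleR[OF \<phi>s(1) ls] pdm_scaleR[OF \<phi>s(2) ls] by simp
  thus "pdm \<psi> 2 y = - \<phi>1 y" "pdm \<psi> 3 y = - \<phi>2 y" by (simp_all add: \<phi>d l)
 qed
 define U where "U y = F y ** v (y $ 1) ** gam e (\<psi> y)" for y
 have vs: "smooth (%y::real^3. v (y $ 1))" by (rule pdm_first(1)[OF v(1)])
 note Fv = smooth_mat[OF F(1) vs] and gs = smooth_gam[OF \<psi>s, of e]
 have Us: "smooth U" unfolding U_def[abs_def] by (rule smooth_mat[OF Fv gs])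
 have USU: "U y : SU2" for y unfolding U_def by (intro SU2_mult F(2) v(2) gam(1)[OF e])
 have Ud: "pdm U 2 y = - (AA 1 y ** U y + \<phi>1 y *\<^sub>R (U y ** e))" "pdm U 3 y = - (AA 2 y ** U y + \<phi>2 y *\<^sub>R (U y ** e))" for y
  unfolding U_def[abs_def]
  by (simp_all add: pdm_mat[OF Fv gs] pdm_mat[OF F(1) vs] pdm_gam[OF e \<psi>s] \<psi>d pdm_first(2)[OF v(1)] F(3,4) mat_algebra mat_minus matrix_mul_assoc)
 have vg: "gam (n t) s ** v t = v t ** gam e s" for t s
 proof -
  have "v t ** (ct (v t) ** n t ** v t) = v t ** e" unfolding v(4) e_def ..
  hence "n t ** v t = v t ** e" by (simp add: matrix_mul_assoc conj_transpose_SU2[OF v(2)])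
  thus ?thesis by (simp add: gam_def mat_algebra)
 qed
 have Up: "U (y + shift k) = U y" if k: "k ~= 1" and Fk: "F (y + shift k) = F y ** gam (n (y $ 1)) l"
   and \<psi>k: "\<psi> (y + shift k) = \<psi> y + (2 * pi * of_int m - l)" for k y l and m :: int
 proof -
  have "gam e (2 * pi * of_int m) = mat 1" using gam_eq_1[OF e(1)] by blast
  hence "gam e (\<psi> (y + shift k)) = gam e (- l) ** gam e (\<psi> y)"
   unfolding \<psi>k diff_conv_add_uminus gam_add[OF e] by (simp flip: gam_add[OF e] add: add.commute)
  moreover have "gam e l ** (gam e (- l) ** X) = X" for X :: "complex^2^2"
   unfolding matrix_mul_assoc gam_add[OF e, symmetric] by (simp add: gam_def)
  moreover have "gam (n (y $ 1)) l ** (v (y $ 1) ** X) = v (y $ 1) ** (gam e l ** X)" for X :: "complex^2^2"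
   by (simp add: matrix_mul_assoc vg)
  moreover have "(y + shift k) $ 1 = y $ 1" using k by (simp add: axis_def)
  ultimately show ?thesis unfolding U_def Fk by (simp add: matrix_mul_assoc[symmetric])
 qed
 have Uper: "U (y + shift 2) = U y" "U (y + shift 3) = U y" for y
 proof -
  have "\<psi> (y + shift 2) = \<psi> y + (2 * pi * of_int m1 - L1 (y $ 1))"
   "\<psi> (y + shift 3) = \<psi> y + (2 * pi * of_int m2 - L2 (y $ 1))"
   by (simp_all add: \<psi>_def \<phi>1_def \<phi>2_def f1_def f2_def axis_def field_simps)
  thus "U (y + shift 2) = U y" "U (y + shift 3) = U y"
   using Up[of 2 y "L1 (y $ 1)" m1] Up[of 3 y "L2 (y $ 1)" m2] F(5,6)[of y] FL by simp_all
 qed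
 \<comment> \<open>Chosen so that c U^-1 equals g at theta = pi, where U is g^-1 g(0) v(pi).\<close>
 define c where "c = g 0 ** v pi"
 have c: "c : SU2" unfolding c_def by (rule SU2_mult[OF g_SU2 v(2)])
 define G where "G y = c ** ct (U y)" for y
 have Gs: "smooth G" unfolding G_def[abs_def] by (intro smooth_mat smooth_const smooth_conj Us)
 have GSU: "G y : SU2" for y unfolding G_def by (rule SU2_mult[OF c SU2_conj[OF USU]])
 have Gd: "D3 G y k = c ** ct (pdm U k y)" for y k
 proof -
  have "pdm G k y = c ** ct (pdm U k y)"
   unfolding G_def[abs_def] pdm_mat[OF smooth_const smooth_conj[OF Us]] pdm_const pdm_conj[OF Us] by (simp add: mat_algebra)
  thus ?thesis unfolding pdm_def[of G] .
 qed
 define w a1 a2 where "w y = ct (U y) ** pdm U 1 y" and "a1 y = ct (U y) ** AA 1 y ** U y"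
  and "a2 y = ct (U y) ** AA 2 y ** U y" for y
 have as: "smooth a1" "smooth a2" "smooth w"
  unfolding a1_def[abs_def] a2_def[abs_def] w_def[abs_def] by (intro smooth_mat smooth_conj Us AA_smooth smooth_pdm)+
 have aper: "a1 (y + shift k) = a1 y" "a2 (y + shift k) = a2 y" "w (y + shift k) = w y"
  if k: "k = 2 | k = 3" for k y
 proof -
  have u: "U (y + shift k) = U y" for y using k Uper by auto
  have "pdm U 1 (y + shift k) = pdm U 1 y"
   using shift_derivative(2)[OF Us, of "shift k" 1 y] unfolding u by simp
  moreover have "k ~= 1" using k by auto
  ultimately show "a1 (y + shift k) = a1 y" "a2 (y + shift k) = a2 y" "w (y + shift k) = w y"
   by (simp_all add: a1_def a2_def w_def u AA_periodic)
 qed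
 have \<phi>per: "\<phi>1 (y + shift 3) = \<phi>1 y" "\<phi>2 (y + shift 2) = \<phi>2 y" for y
  by (simp_all add: \<phi>1_def \<phi>2_def axis_def)
 obtain J where J: "smooth J" "J 0 = 0" "!!t. (J has_vector_derivative L1 t * dd L2 t) (at t)"
  using smooth_antiderivative[OF smooth_mult[OF L(1) smooth_frechet[OF L(2)]]] by blast
 have JI: "integral {0..pi} (%t. L1 t * dd L2 t) = J pi"
  using fundamental_theorem_of_calculus[of 0 pi J "%t. L1 t * dd L2 t"] has_vector_derivative_at_within[OF J(3)] J(2)
  by (simp add: integral_unique)
 \<comment> \<open>A primitive of f1 f2' - f2 f1': subtracting L1 L2 from 2 J antisymmetrizes L1
   L2', and the linear terms come from the integers m1, m2.\<close>
 define q where "q t = (2 * J t - L1 t * L2 t) / (4 * pi\<^sup>2) - (m1 * L2 t - m2 * L1 t) / (2 * pi)" for t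
 have qd: "(q has_real_derivative f1 t * (dd L2 t / (2 * pi)) - f2 t * (dd L1 t / (2 * pi))) (at t)" for t
  unfolding q_def f1_def f2_def
  by (rule derivative_eq_intros J(3)[folded has_real_derivative_iff_has_vector_derivative] Ld refl | simp)+ (simp add: field_simps power2_eq_square power4_eq_xxxx)
 have qs: "smooth q"
  unfolding q_def by (intro smooth_diff smooth_mult smooth_const smooth_linear[OF bounded_linear_divide] J L)
 have qp: "q pi = J pi / (2 * pi\<^sup>2) - m1 * m2" "q 0 = 0"
  by (simp_all add: q_def m J L power2_eq_square field_simps)
 define X Y S :: "real^3 => real" where "X y = ip (a2 y) (w y) - \<phi>2 y * ip e (w y)" and "Y y = ip (a1 y) (w y) - \<phi>1 y * ip e (w y)"
  and "S y = \<phi>1 y * ip (a2 y) e - \<phi>2 y * ip (a1 y) e" for y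
 define K :: "real^3 => real" where "K y = ((sin (y $ 1) - y $ 1) / 4) * edg (P2 y)" for y
 define Z where "Z y = S y + K y + q (y $ 1)" for y
 have XYs: "smooth X" "smooth Y" "smooth S"
  unfolding X_def[abs_def] Y_def[abs_def] S_def[abs_def] by (intro smooth_diff smooth_mult smooth_ip as \<phi>s smooth_const)+
 have Ks: "smooth K"
  unfolding K_def[abs_def] by (intro smooth_mult smooth_linear[OF bounded_linear_divide] smooth_diff smooth_sin ls smooth_P2 smooth_edg)
 have Zs: "smooth Z" unfolding Z_def[abs_def] by (intro smooth_add XYs Ks pdm_first(1) qs)
 have Zd: "pdm Z 1 y = pdm S 1 y + pdm K 1 y + (\<phi>1 y * pdm \<phi>2 1 y - \<phi>2 y * pdm \<phi>1 1 y)" for y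
  unfolding Z_def[abs_def] pdm_add[OF smooth_add[OF XYs(3) Ks] pdm_first(1)[OF qs]] pdm_add[OF XYs(3) Ks] pdm_theta[OF qd] \<phi>d
  by (simp add: \<phi>1_def \<phi>2_def)
 \<comment> \<open>Passing from U to its inverse changes the sign of a cubic expression, whence the
   minus; the factor 2 pi is the normalization in \<open>Omega_ip\<close>.\<close>
 have Om: "Omega3 G y = - (pdm X 2 y - pdm Y 3 y + pdm Z 1 y) / (2 * pi)" for y
 proof -
  let ?w = "%k. ct (U y) ** pdm U k y"
  let ?V = "ct (U y)"
  have V: "?V : SU2" by (rule SU2_conj[OF USU])
  have wsu: "?w k : su2" for k by (rule log_derivative_su2[OF Us USU])
  have GG: "ct (G y) ** D3 G y k = - (ct ?V ** ?w k ** ?V)" for k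
  proof -
   have "ct (?w k) = - ?w k" by (rule su2_conj[OF wsu])
   hence "ct (pdm U k y) ** U y = - ?w k" by (simp add: conj_transpose_mult)
   hence "U y ** (ct (pdm U k y) ** U y) ** ?V = - (U y ** ?w k ** ?V)" by (simp add: mat_minus)
   hence "U y ** ct (pdm U k y) = - (U y ** ?w k ** ?V)"
    by (simp add: matrix_mul_assoc[symmetric] conj_transpose_SU2[OF USU])
   moreover have "ct (G y) ** D3 G y k = U y ** (ct c ** c) ** ct (pdm U k y)"
    unfolding Gd by (simp add: G_def conj_transpose_mult matrix_mul_assoc)
   ultimately show ?thesis by (simp add: conj_transpose_SU2[OF c])
  qed
  have cj: "ct ?V ** A ** ?V : su2" if "A : su2" for A by (rule su2_SU2_conj[OF that V])
  have cm: "commutator (- (ct ?V ** A ** ?V)) (- (ct ?V ** B ** ?V)) = ct ?V ** commutator A B ** ?V" for A B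
  proof -
   have "?V ** (U y ** D) = D" for D :: "complex^2^2" by (simp add: matrix_mul_assoc conj_transpose_SU2[OF USU])
   thus ?thesis by (simp add: commutator_def mat_minus mat_algebra matrix_mul_assoc[symmetric])
  qed
  have n: "ip (- A) B = - ip A B" for A B by (simp add: ip_def mat_minus q_defs)
  have "Omega3 G y = - ip (?w 1) (commutator (?w 2) (?w 3)) / (2 * pi)"
   unfolding Omega_ip[OF GSU su2_uminus[OF cj[OF wsu], folded GG] su2_uminus[OF cj[OF wsu], folded GG] su2_uminus[OF cj[OF wsu], folded GG]]
    GG cm n ip_conj[OF wsu commutator_su2[OF wsu wsu] V] ..
  also have "ip (?w 1) (commutator (?w 2) (?w 3)) = pdm X 2 y - pdm Y 3 y + pdm S 1 y + pdm K 1 y + (\<phi>1 y * pdm \<phi>2 1 y - \<phi>2 y * pdm \<phi>1 1 y)"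
   unfolding X_def[abs_def] Y_def[abs_def] S_def[abs_def] K_def[abs_def] pdm_energy[symmetric] w_def a1_def a2_def
   by (rule transgression[OF Us USU AA_smooth AA_smooth AA_su2 AA_su2 AA_flat e \<phi>s _ _ Ud]) (simp_all add: \<phi>d)
  finally show ?thesis unfolding Zd by (simp add: algebra_simps)
 qed
 let ?C = "cbox 0 (vector [pi, 2 * pi, 2 * pi]) :: (real^3) set"
 have "integral ?C (Omega3 G) = - (integral ?C (%y. pdm X 2 y - pdm Y 3 y + pdm Z 1 y)) / (2 * pi)"
  by (simp only: Om integral_divide integral_neg)
 also have "integral ?C (%y. pdm X 2 y - pdm Y 3 y + pdm Z 1 y) = integral ?C (pdm X 2) - integral ?C (pdm Y 3) + integral ?C (pdm Z 1)"
  by (simp add: integral_add integral_diff integrable_diff box_integrals(1)[OF XYs(1)] box_integrals(1)[OF XYs(2)] box_integrals(1)[OF Zs])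
 also have "integral ?C (pdm X 2) = 0"
  by (rule box_integrals(3)[OF XYs(1)]) (simp add: X_def aper \<phi>per)
 also have "integral ?C (pdm Y 3) = 0"
  by (rule box_integrals(4)[OF XYs(2)]) (simp add: Y_def aper \<phi>per)
 \<comment> \<open>At theta = pi the functions phi vanish, at theta = 0 the connection does; so S
   contributes at neither end.\<close>
 also have "integral ?C (pdm Z 1) = integral square (%p. q pi - (pi / 4) * edg p)"
 proof -
  have "P2 (vector [s, p $ 1, p $ 2]) = p" for s p by (simp add: vec_eq_iff forall_2)
  moreover have "a1 (vector [0, s, t]) = 0" "a2 (vector [0, s, t]) = 0" for s t by (simp_all add: a1_def a2_def AA_def mat_algebra)
  ultimately show ?thesis unfolding box_integrals(2)[OF Zs]
   by (simp add: Z_def S_def K_def \<phi>1_def \<phi>2_def fp qp ip_def mat_algebra q_defs)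
 qed
 also have "... = 4 * pi\<^sup>2 * q pi - (pi / 4) * integral square edg"
 proof -
  have "continuous_on square edg" by (rule continuous_on_subset[OF Ck_on_continuous[OF smooth_on_Ck[OF smooth_edg]]]) simp
  from integrable_continuous[OF this] show ?thesis
   by (subst integral_diff) (simp_all only: integrable_const integrable_on_mult_right integral_mult_right integral_square_const)
 qed
 also have "integral square edg = energy h g / 4" unfolding energy_edg by simp
 also have "- (0 - 0 + (4 * pi\<^sup>2 * q pi - pi / 4 * (energy h g / 4))) / (2 * pi)
   = energy h g / 32 - integral {0..pi} (%t. L1 t * dd L2 t) / pi + 2 * pi * of_int (m1 * m2)"
  unfolding qp JI by (simp add: field_simps power2_eq_square)
 finally have I: "integral ?C (Omega3 G) = energy h g / 32 - integral {0..pi} (%t. L1 t * dd L2 t) / pi + 2 * pi * of_int (m1 * m2)" .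
 show ?thesis
 proof (rule that[OF Gs _ _ _ _ _ I])
  show "range G <= SU2" using GSU by blast
  show "G (y + shift 2) = G y" "G (y + shift 3) = G y" for y by (simp_all add: G_def Uper)
  show "G (vector [pi, s, t]) = g (vector [s, t])" for s t
  proof -
   have "U (vector [pi, s, t]) = F (vector [pi, s, t]) ** v pi" by (simp add: U_def \<psi>_def \<phi>1_def \<phi>2_def fp gam_def)
   hence "G (vector [pi, s, t]) = g 0 ** (v pi ** ct (v pi)) ** ct (F (vector [pi, s, t]))"
    by (simp add: G_def c_def conj_transpose_mult matrix_mul_assoc)
   also have "... = g (vector [s, t]) ** (F (vector [pi, s, t]) ** ct (F (vector [pi, s, t])))"
    unfolding F(8)[of s t, symmetric] by (simp add: conj_transpose_SU2[OF v(2)] matrix_mul_assoc)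
   finally show ?thesis by (simp add: conj_transpose_SU2[OF F(2)])
  qed
  show "beta (p ** G (vector [0, s, t])) (p ** D3 G (vector [0, s, t]) 2) (p ** D3 G (vector [0, s, t]) 3) = 0" for p s t
  proof -
   let ?z = "vector [0, s, t] :: real^3"
   have A0: "AA j ?z = 0" for j by (simp add: AA_def)
   have "D3 G ?z 2 = \<phi>1 ?z *\<^sub>R (c ** (e ** ct (U ?z)))" "D3 G ?z 3 = \<phi>2 ?z *\<^sub>R (c ** (e ** ct (U ?z)))"
    unfolding Gd Ud A0 using bounded_linear.linear[OF bounded_linear_conj_transpose]
    by (simp_all add: mat_algebra linear_neg linear_cmul conj_transpose_mult su2_conj[OF e(1)] mat_minus)
   thus ?thesis by (simp add: beta_parallel)
  qed
 qed
qed

end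

section \<open>Comparison of the integrals over the manifold and over the cylinder\<close>

theorem mainTheorem3:
  fixes h :: "real^2 \<Rightarrow> real^2^2" and g :: "real^2 \<Rightarrow> complex^2^2"
    and H1 H2 Q :: "complex \<Rightarrow> complex^2^2" and P :: "complex poly"
    and \<mu>1 \<mu>2 :: "complex \<times> complex \<Rightarrow> complex"
    and \<eta> l1 l2 :: "real \<Rightarrow> complex"
    and M :: "'m::t2_space set" and cs :: "'m chart list"
    and \<iota> :: "real^2 \<Rightarrow> 'm" and gt :: "'m \<Rightarrow> complex^2^2"
  assumes "torus_metric h"
    and "harmonic_torus_map h g"
    and "\<not> (\<exists>c\<in>SU2. pm_holomorphic_to_equator h g c)"
    and "\<And>\<zeta>. \<zeta> \<noteq> 0 \<Longrightarrow> is_holonomy (assoc_family h g \<zeta>) 1 (H1 \<zeta>)"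
    and "\<And>\<zeta>. \<zeta> \<noteq> 0 \<Longrightarrow> is_holonomy (assoc_family h g \<zeta>) 2 (H2 \<zeta>)"
    and "spectral_curve H1 H2 P Q"
    and "eigenvalue_function P Q H1 \<mu>1"
    and "eigenvalue_function P Q H2 \<mu>2"
    and "continuous_on {0..pi} \<eta>"
    and "\<And>\<theta>. \<theta> \<in> {0..pi} \<Longrightarrow> (cis \<theta>, \<eta> \<theta>) \<in> curve_points P"
    and "log_along_lift \<mu>1 \<eta> l1"
    and "log_along_lift \<mu>2 \<eta> l2"
    and "compact_oriented_3manifold M cs"
    and "boundary_torus cs \<iota>"
    and "smooth_extension M cs \<iota> g gt"
  shows "\<exists>k::int. complex_of_real (wess_zumino_integral cs gt) =
      - (1 / pi) * integral {0..pi} (\<lambda>\<theta>. l1 \<theta> * vector_derivative l2 (at \<theta> within {0..pi}))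
      - 1 / 32 * energy h g + 2 * pi * k"
proof -
 interpret harmonic_torus h g using assms(1,2) by unfold_locales
 interpret mfd_boundary M cs \<iota> using assms(13,14) by unfold_locales
 obtain F where F: "smooth F" "!!y. F y : SU2"
   "!!y. pdm F 2 y = - (AA 1 y ** F y)" "!!y. pdm F 3 y = - (AA 2 y ** F y)"
   "!!y. F (y + shift 2) = F y ** F (vector [y $ 1, 2 * pi, 0])"
   "!!y. F (y + shift 3) = F y ** F (vector [y $ 1, 0, 2 * pi])"
   "!!s t. F (vector [0, s, t]) = mat 1" "!!s t. g (vector [s, t]) ** F (vector [pi, s, t]) = g 0"
   "!!t H. is_holonomy (assoc_family h g (cis t)) 1 H ==> H = F (vector [t, 2 * pi, 0])"
   "!!t H. is_holonomy (assoc_family h g (cis t)) 2 H ==> H = F (vector [t, 0, 2 * pi])"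
 proof (rule frame, goal_cases)
  case (1 F)
  show ?case by (rule that[OF 1(2,3,5-12)])
 qed
 have Ks: "smooth (%t. F (vector [t, r, s]))" for r s
  unfolding vector_3_eq add.assoc
  by (rule smooth_compose[OF smooth_add[OF smooth_id[OF bounded_linear_scaleR_left] smooth_const] F(1)]) simp
 obtain n L1 L2 where n: "smooth n" "!!t. n t : su2" "!!t. ip (n t) (n t) = 1"
  and L1: "smooth L1" "L1 0 = 0" "!!t. F (vector [t, 2 * pi, 0]) = gam (n t) (L1 t)"
  and L2: "smooth L2" "L2 0 = 0" "!!t. F (vector [t, 0, 2 * pi]) = gam (n t) (L2 t)"
  and l: "!!\<theta>. \<theta> : {0..pi} ==> l1 \<theta> = \<i> * of_real (L1 \<theta>)" "!!\<theta>. \<theta> : {0..pi} ==> l2 \<theta> = \<i> * of_real (L2 \<theta>)"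
 proof (rule spectral_frame[where ?K1.0 = "%t. F (vector [t, 2 * pi, 0])" and ?K2.0 = "%t. F (vector [t, 0, 2 * pi])",
    OF Ks F(2) F(7) Ks F(2) F(7) F(9)[OF assms(4)[OF cis_neq_zero]] F(10)[OF assms(5)[OF cis_neq_zero]] assms(6-9) _ assms(11,12)], goal_cases)
  case (1 \<theta>)
  show ?case by (rule assms(10)[OF 1(2)])
 next
  case (2 n L1 L2)
  show ?case by (rule that[OF 2(2-12)])
 qed
 obtain G k0 where G: "smooth G" "range G <= SU2"
   "!!y. G (y + shift 2) = G y" "!!y. G (y + shift 3) = G y"
   "!!s t. G (vector [pi, s, t]) = g (vector [s, t])"
   "!!q s t. beta (q ** G (vector [0, s, t])) (q ** D3 G (vector [0, s, t]) 2) (q ** D3 G (vector [0, s, t]) 3) = 0"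
  and k0: "integral (cbox 0 (vector [pi, 2 * pi, 2 * pi])) (Omega3 G) =
   energy h g / 32 - integral {0..pi} (%t. L1 t * dd L2 t) / pi + 2 * pi * of_int k0"
 proof (rule cylinder[OF F(1-8) n L1(1) L2(1) L1(2) L2(2) L1(3) L2(3)], goal_cases)
  case (1 G k0)
  show ?case by (rule that[OF 1(2-)])
 qed
 obtain N1 where N1: "negligible N1" "!!v. v ~: N1 ==> norm v < 1 ==> EX k::int. wess_zumino_integral cs gt =
   - integral square (%x. beta (cen v ** g x) (cen v ** D2 g x 1) (cen v ** D2 g x 2)) + 2 * pi * k"
 proof (rule wess_zumino_boundary[OF assms(15) g_smooth], goal_cases)
  case (1 N1)
  show ?case by (rule that[OF 1(2-)])
 qed
 obtain N2 where N2: "negligible N2" "!!v. v ~: N2 ==> norm v < 1 ==> EX k::int.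
   integral (cbox 0 (vector [pi, 2 * pi, 2 * pi])) (Omega3 G) = integral square (%p.
    beta (cen v ** G (vector [pi, p $ 1, p $ 2])) (cen v ** D3 G (vector [pi, p $ 1, p $ 2]) 2) (cen v ** D3 G (vector [pi, p $ 1, p $ 2]) 3) -
    beta (cen v ** G (vector [0, p $ 1, p $ 2])) (cen v ** D3 G (vector [0, p $ 1, p $ 2]) 2) (cen v ** D3 G (vector [0, p $ 1, p $ 2]) 3))
   + 2 * pi * k"
 proof (rule cylinder_integrality[OF smooth_on_Ck[OF G(1)] G(2-4)], goal_cases)
  case (1 N2)
  show ?case by (rule that[OF 1(2-)])
 qed
 \<comment> \<open>Since a ball is not null, one translate is admissible for both integrals.\<close>
 have "~ ball 0 1 <= N1 Un N2"
  using negligible_subset[OF negligible_Un[OF N1(1) N2(1)], of "ball 0 1"] open_not_negligible[of "ball (0::real^3) 1"] by auto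
 then obtain v where v: "v ~: N1" "v ~: N2" "norm v < 1" by (auto simp: subset_iff)
 have slice: "D3 G (vector [pi, p $ 1, p $ 2]) 2 = D2 g p 1" "D3 G (vector [pi, p $ 1, p $ 2]) 3 = D2 g p 2" "G (vector [pi, p $ 1, p $ 2]) = g p" for p
 proof -
  have vp: "vector [p $ 1, p $ 2] = p" for p :: "real^2" by (simp add: vec_eq_iff forall_2)
  show "G (vector [pi, p $ 1, p $ 2]) = g p" unfolding G(5) vp ..
  define T :: "real^2 => real^3" where "T x = x $ 1 *\<^sub>R axis 2 1 + x $ 2 *\<^sub>R axis 3 1" for x
  have T: "vector [pi, x $ 1, x $ 2] = pi *\<^sub>R axis 1 1 + T x" for x unfolding T_def vector_3_eq by simp
  have "bounded_linear T"
   by (rule bounded_linearI') (simp_all add: T_def algebra_simps)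
  hence "(T has_derivative T) (at p)" by (rule bounded_linear_imp_has_derivative)
  hence "((%x. pi *\<^sub>R axis 1 1 + T x) has_derivative T) (at p)" by (auto intro!: derivative_eq_intros)
  from has_derivative_compose[OF this smooth_derivative[OF G(1)]]
  have "(g has_derivative (%u. fd G (vector [pi, p $ 1, p $ 2]) (T u))) (at p)"
   unfolding T[symmetric] G(5) vp .
  from frechet_eqI[OF this] show "D3 G (vector [pi, p $ 1, p $ 2]) 2 = D2 g p 1" "D3 G (vector [pi, p $ 1, p $ 2]) 3 = D2 g p 2"
   by (simp_all add: T_def axis_def)
 qed
 obtain k1 k2 :: int where k: "wess_zumino_integral cs gt =
   - integral square (%x. beta (cen v ** g x) (cen v ** D2 g x 1) (cen v ** D2 g x 2)) + 2 * pi * k1"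
  "integral (cbox 0 (vector [pi, 2 * pi, 2 * pi])) (Omega3 G) =
   integral square (%x. beta (cen v ** g x) (cen v ** D2 g x 1) (cen v ** D2 g x 2)) + 2 * pi * k2"
  using N1(2)[OF v(1,3)] N2(2)[OF v(2,3)] unfolding G(6) slice by auto
 \<comment> \<open>Both integrals reduce to the integral of \<open>beta\<close> along g, with
   opposite signs because the orientations of the torus differ; the end theta = 0 drops out by
   \<open>G(6)\<close>. So the Wess-Zumino integral is minus the cylinder integral modulo 2
   pi.\<close>
 have W: "wess_zumino_integral cs gt =
   integral {0..pi} (%t. L1 t * dd L2 t) / pi - energy h g / 32 + 2 * pi * of_int (k1 + k2 - k0)"
  using k k0 by (simp add: algebra_simps)
 have I: "integral {0..pi} (%\<theta>. l1 \<theta> * vector_derivative l2 (at \<theta> within {0..pi})) =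
   of_real (- integral {0..pi} (%t. L1 t * dd L2 t))"
 proof -
  \<comment> \<open>Both logarithms are imaginary on the unit circle, and the two factors i account
    for the sign.\<close>
  have "l1 \<theta> * vector_derivative l2 (at \<theta> within {0..pi}) = of_real (- (L1 \<theta> * dd L2 \<theta>))" if \<theta>: "\<theta> : {0..pi}" for \<theta>
  proof -
   have d: "((%\<theta>. \<i> * complex_of_real (L2 \<theta>)) has_vector_derivative \<i> * of_real (dd L2 \<theta>)) (at \<theta> within {0..pi})"
    by (intro has_vector_derivative_mult_right has_vector_derivative_of_real has_vector_derivative_at_within[THEN has_real_derivative_iff_has_vector_derivative[THEN iffD2], OF smooth_dd[OF L2(1)]])
   have "(l2 has_vector_derivative \<i> * of_real (dd L2 \<theta>)) (at \<theta> within {0..pi})"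
    by (rule has_vector_derivative_transform[OF \<theta> _ d]) (rule l(2))
   hence "vector_derivative l2 (at \<theta> within {0..pi}) = \<i> * of_real (dd L2 \<theta>)"
    by (intro vector_derivative_within_closed_interval pi_gt_zero) (use \<theta> in auto)
   thus ?thesis by (simp add: l(1)[OF \<theta>] complex_eq_iff)
  qed
  hence "integral {0..pi} (%\<theta>. l1 \<theta> * vector_derivative l2 (at \<theta> within {0..pi})) =
   integral {0..pi} (%\<theta>. complex_of_real (- (L1 \<theta> * dd L2 \<theta>)))" by (rule integral_cong)
  also have "... = of_real (integral {0..pi} (%\<theta>. - (L1 \<theta> * dd L2 \<theta>)))"
  proof (rule integral_linear[OF _ bounded_linear_of_real, unfolded o_def])
   have "continuous_on {0..pi} (%\<theta>. L1 \<theta> * dd L2 \<theta>)"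
    by (rule continuous_on_subset[OF Ck_on_continuous[OF smooth_on_Ck[OF smooth_mult[OF L1(1) smooth_frechet[OF L2(1)]]]]]) simp
   thus "(%\<theta>. - (L1 \<theta> * dd L2 \<theta>)) integrable_on {0..pi}" by (intro integrable_neg integrable_continuous_interval)
  qed
  finally show ?thesis by simp
 qed
 show ?thesis unfolding I by (rule exI[of _ "k1 + k2 - k0"]) (simp add: W)
qed

end
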